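(* Let $0<2\alpha<\pi$ and let $S$, $J_h$ and $\mathcal A$ (all depending on $\alpha$) be as defined in the context. There exist numerical constants $h_0,C>0$ such that for every $h\in(0,h_0)$, $$2\alpha \log \frac{1}{h}-C\log\log\frac{1}{h}\;\leq\; \inf_{v\in \mathcal A} J_h(v)\;\leq\; 2\alpha \log\frac{1}{h}+C .$$
   Context: Let $2\alpha\in(0,\pi)$ and let $S=\{r(\cos\varphi,\sin\varphi):0\le r<1,\ -\alpha<\varphi<\alpha\}\subset\mathbb R^2$ be the sector of the unit disc with opening angle $2\alpha$. Let $\Gamma=\{x\in\partial S:|x|=1\}$ be the curved part of its boundary and $2S=\{2x:x\in S\}$. Boundary conditions: a function $v\in W^{2,2}(S)$ is said to satisfy the boundary conditions if $v(x)=1$ and $\nabla v(x)=x$ for $x\in\Gamma$ (in the sense of traces). The admissible class is $$\mathcal A=\{v\in W^{2,2}(S): v\text{ is convex and satisfies the boundary conditions on }\Gamma\}.$$ For $v\in W^{2,2}(S)$ satisfying the boundary conditions, the extension $Ev\in W^{2,2}_{\mathrm{}}(2S)$ is defined by $Ev(x)=v(x)$ if $x\in S$ and $Ev(x)=|x|$ if $x\in 2S\setminus S$. $W^{2,2}_0(2S)$ is the closure of $C_c^\infty(2S)$ with respect to the norm $\|\varphi\|_{W^{2,2}_0(2S)}=\left(\int_{2S}|\nabla^2\varphi|^2\,dx\right)^{1/2}$, and $$\|f\|_{W^{-2,2}(2S)}=\sup\left\{\int_{2S}\varphi f\,dx:\ \varphi\in W^{2,2}_0(2S),\ \|\varphi\|_{W^{2,2}_0(2S)}\le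 1\right\}.$$ For $h>0$ the functional is $$J_h(v)=h^{-2}\|\det\nabla^2(Ev)\|_{W^{-2,2}(2S)}^2+\|\nabla^2 v\|_{L^2(S)}^2 .$$ Here $|\cdot|$ of a matrix is the Frobenius norm. *)

theory Defs
  imports "HOL-Analysis.Analysis"
begin

section \<open>Smooth functions and test functions\<close>

definition pderiv_dir :: "2 \<Rightarrow> (real^2 \<Rightarrow> real) \<Rightarrow> real^2 \<Rightarrow> real" where
  "pderiv_dir i f x = frechet_derivative f (at x) (axis i 1)"

definition smooth :: "(real^2 \<Rightarrow> real) \<Rightarrow> bool" where
  "smooth f \<longleftrightarrow> (\<forall>is. foldr pderiv_dir is f differentiable_on UNIV)"

text \<open>
  The sector below contains its vertex and is hence not open; function spaces on \<open>\<Omega>\<close> are those of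
  the domain \<open>interior \<Omega>\<close>, which differs from \<open>\<Omega>\<close> by a single point in the cases considered.
  Elements of \<open>C\<^sub>c\<^sup>\<infinity>\<close> are identified with their extension by zero to the plane.
\<close>

definition test_functions :: "(real^2) set \<Rightarrow> (real^2 \<Rightarrow> real) set" where
  "test_functions \<Omega> =
     {\<phi>. smooth \<phi> \<and> (\<exists>K. compact K \<and> K \<subseteq> interior \<Omega> \<and> (\<forall>x. x \<notin> K \<longrightarrow> \<phi> x = 0))}"

section \<open>Lebesgue and Sobolev spaces\<close>

definition L2 :: "(real^2) set \<Rightarrow> (real^2 \<Rightarrow> 'b::euclidean_space) set" where
  "L2 \<Omega> = {f. f \<in> borel_measurable (lebesgue_on \<Omega>) \<and>
               integrable (lebesgue_on \<Omega>) (\<lambda>x. (norm (f x))\<^sup>2)}"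

definition L2_norm :: "(real^2) set \<Rightarrow> (real^2 \<Rightarrow> 'b::euclidean_space) \<Rightarrow> real" where
  "L2_norm \<Omega> f = sqrt (LINT x|lebesgue_on \<Omega>. (norm (f x))\<^sup>2)"

definition locally_integrable :: "(real^2) set \<Rightarrow> (real^2 \<Rightarrow> real) \<Rightarrow> bool" where
  "locally_integrable \<Omega> f \<longleftrightarrow>
     (\<forall>K. compact K \<and> K \<subseteq> interior \<Omega> \<longrightarrow> integrable (lebesgue_on K) f)"

definition has_weak_pderiv ::
    "(real^2) set \<Rightarrow> 2 \<Rightarrow> (real^2 \<Rightarrow> real) \<Rightarrow> (real^2 \<Rightarrow> real) \<Rightarrow> bool" where
  "has_weak_pderiv \<Omega> i f g \<longleftrightarrow>
     locally_integrable \<Omega> f \<and> locally_integrable \<Omega> g \<and>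
     (\<forall>\<phi>\<in>test_functions \<Omega>.
        (LINT x|lebesgue_on \<Omega>. f x * pderiv_dir i \<phi> x) = - (LINT x|lebesgue_on \<Omega>. g x * \<phi> x))"

text \<open>
  Weak derivatives are unique only almost everywhere, so \<open>SOME\<close> picks a representative. It is
  used only under integrals and in membership conditions invariant under a.e. modification.
\<close>

definition weak_pderiv :: "(real^2) set \<Rightarrow> 2 \<Rightarrow> (real^2 \<Rightarrow> real) \<Rightarrow> real^2 \<Rightarrow> real" where
  "weak_pderiv \<Omega> i f = (SOME g. has_weak_pderiv \<Omega> i f g)"

definition W12 :: "(real^2) set \<Rightarrow> (real^2 \<Rightarrow> real) set" where
  "W12 \<Omega> = {f \<in> L2 \<Omega>. \<forall>i. \<exists>g\<in>L2 \<Omega>. has_weak_pderiv \<Omega> i f g}"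

definition W22 :: "(real^2) set \<Rightarrow> (real^2 \<Rightarrow> real) set" where
  "W22 \<Omega> = {f \<in> W12 \<Omega>. \<forall>i. weak_pderiv \<Omega> i f \<in> W12 \<Omega>}"

text \<open>The norm on \<^typ>\<open>real^2^2\<close> is the Frobenius norm.\<close>

definition weak_hessian :: "(real^2) set \<Rightarrow> (real^2 \<Rightarrow> real) \<Rightarrow> real^2 \<Rightarrow> real^2^2" where
  "weak_hessian \<Omega> f x = (\<chi> i j. weak_pderiv \<Omega> j (weak_pderiv \<Omega> i f) x)"

definition W22_0_norm :: "(real^2) set \<Rightarrow> (real^2 \<Rightarrow> real) \<Rightarrow> real" where
  "W22_0_norm \<Omega> \<phi> = L2_norm \<Omega> (weak_hessian \<Omega> \<phi>)"

text \<open>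
  The closure of the test functions with respect to \<^const>\<open>W22_0_norm\<close>, realised as a space of
  functions. The \<open>L2\<close> convergence is there to identify the limit, since \<^const>\<open>W22_0_norm\<close> vanishes
  on affine functions; on bounded \<open>\<Omega>\<close> every sequence of test functions that is Cauchy for
  \<^const>\<open>W22_0_norm\<close> converges in \<open>L2\<close> by the Poincare inequality.
\<close>

definition W22_0 :: "(real^2) set \<Rightarrow> (real^2 \<Rightarrow> real) set" where
  "W22_0 \<Omega> =
     {\<phi> \<in> W22 \<Omega>. \<exists>\<Phi>. (\<forall>n. \<Phi> n \<in> test_functions \<Omega>) \<and>
        (\<lambda>n::nat. L2_norm \<Omega> (\<lambda>x. \<Phi> n x - \<phi> x)) \<longlonglongrightarrow> 0 \<and>
        (\<lambda>n::nat. W22_0_norm \<Omega> (\<lambda>x. \<Phi> n x - \<phi> x)) \<longlonglongrightarrow> 0}"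

definition W22_dual_norm :: "(real^2) set \<Rightarrow> (real^2 \<Rightarrow> real) \<Rightarrow> ereal" where
  "W22_dual_norm \<Omega> f =
     (SUP \<phi>\<in>{\<phi> \<in> W22_0 \<Omega>. W22_0_norm \<Omega> \<phi> \<le> 1}. ereal (LINT x|lebesgue_on \<Omega>. \<phi> x * f x))"

section \<open>The sector and the boundary conditions\<close>

definition sector :: "real \<Rightarrow> (real^2) set" where
  "sector \<alpha> =
     {r *\<^sub>R vector [cos \<phi>, sin \<phi>] | r \<phi>. 0 \<le> r \<and> r < 1 \<and> - \<alpha> < \<phi> \<and> \<phi> < \<alpha>}"

definition double_sector :: "real \<Rightarrow> (real^2) set" where
  "double_sector \<alpha> = (\<lambda>x. 2 *\<^sub>R x) ` sector \<alpha>"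

definition curved_boundary :: "real \<Rightarrow> (real^2) set" where
  "curved_boundary \<alpha> = {x \<in> frontier (sector \<alpha>). norm x = 1}"

definition circle_arc_length :: "(real^2) measure" where
  "circle_arc_length = distr (lebesgue_on {-pi<..pi}) borel (\<lambda>\<theta>. vector [cos \<theta>, sin \<theta>])"

text \<open>
  \<open>g\<close> is the trace of \<open>f \<in> W\<^sup>1\<^sup>,\<^sup>2(\<Omega>)\<close> on the part \<open>\<Gamma>\<close> of the boundary, where \<open>\<Gamma>\<close> lies on the unit
  circle: the trace operator is the continuous extension to \<open>W\<^sup>1\<^sup>,\<^sup>2(\<Omega>)\<close>, with values in \<open>L\<^sup>2(\<Gamma>)\<close>, of
  the restriction map on functions smooth up to the boundary.
\<close>

definition has_trace_on ::
    "(real^2) set \<Rightarrow> (real^2) set \<Rightarrow> (real^2 \<Rightarrow> real) \<Rightarrow> (real^2 \<Rightarrow> real) \<Rightarrow> bool" where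
  "has_trace_on \<Omega> \<Gamma> f g \<longleftrightarrow> f \<in> W12 \<Omega> \<and>
     (\<exists>F. (\<forall>n. smooth (F n)) \<and>
        (\<lambda>n::nat. L2_norm \<Omega> (\<lambda>x. F n x - f x)) \<longlonglongrightarrow> 0 \<and>
        (\<forall>i. (\<lambda>n. L2_norm \<Omega> (\<lambda>x. pderiv_dir i (F n) x - weak_pderiv \<Omega> i f x)) \<longlonglongrightarrow> 0) \<and>
        (\<lambda>n. LINT x:\<Gamma>|circle_arc_length. (F n x - g x)\<^sup>2) \<longlonglongrightarrow> 0)"

definition boundary_conditions :: "real \<Rightarrow> (real^2 \<Rightarrow> real) \<Rightarrow> bool" where
  "boundary_conditions \<alpha> v \<longleftrightarrow>
     has_trace_on (sector \<alpha>) (curved_boundary \<alpha>) v (\<lambda>x. 1) \<and>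
     (\<forall>i. has_trace_on (sector \<alpha>) (curved_boundary \<alpha>) (weak_pderiv (sector \<alpha>) i v) (\<lambda>x. x $ i))"

section \<open>The functional\<close>

text \<open>Convexity is required of the representative \<open>v\<close> itself, which is then continuous on the
  interior of the sector.\<close>

definition admissible :: "real \<Rightarrow> (real^2 \<Rightarrow> real) set" where
  "admissible \<alpha> =
     {v \<in> W22 (sector \<alpha>). convex_on (sector \<alpha>) v \<and> boundary_conditions \<alpha> v}"

definition extension :: "real \<Rightarrow> (real^2 \<Rightarrow> real) \<Rightarrow> real^2 \<Rightarrow> real" where
  "extension \<alpha> v x = (if x \<in> sector \<alpha> then v x else norm x)"

definition energy :: "real \<Rightarrow> real \<Rightarrow> (real^2 \<Rightarrow> real) \<Rightarrow> ereal" where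
  "energy \<alpha> h v =
     (W22_dual_norm (double_sector \<alpha>)
        (\<lambda>x. det (weak_hessian (double_sector \<alpha>) (extension \<alpha> v) x)))\<^sup>2 / ereal (h\<^sup>2)
     + ereal ((L2_norm (sector \<alpha>) (weak_hessian (sector \<alpha>) v))\<^sup>2)"

end

theory Submission
 imports Defs
begin

text \<open>
Upper bound: smooth the cone \<open>|x|\<close> on the scale \<open>h\<close>. The determinant of the Hessian is then at most \<open>C / h\<^sup>2\<close> and lives in \<open>|x| < h\<close>,
where a test function, vanishing outside the sector, is controlled by \<open>h\<^sup>3\<close> times its second derivatives.

Lower bound: the boundary conditions give the extension \<open>u\<close> of \<open>v\<close> weak second derivatives across the arc, hence \<open>u\<close> is convex
on \<open>2S\<close> and \<open>u >= |x|\<close>. If \<open>u\<close> were at least \<open>M\<close> near the vertex, then the gradients of \<open>u\<close> on dyadic boxes in a narrow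
cone would cover an area of order \<open>M\<close> in slope space, just inside the unit circle. That area is bounded by the integral of the
determinant against cut-off functions of the boxes, i.e. by its dual norm. So \<open>u\<close> takes a value of order \<open>h\<close> (up to powers
of \<open>L = ln (1 / h)\<close>) near the vertex. Convexity along rays then gives \<open>|x| <= u <= |x| + 3 * r0\<close> away from the sides, with \<open>r0\<close> of the same
order, and the angular second derivative of \<open>u\<close> is close to \<open>1 / |x|\<close> in the mean, whence \<open>2 * \<alpha> * ln (1 / \<rho>)\<close> with \<open>\<rho> = 8 * r0 * L\<close>.
All this is done for the mollifications of \<open>u\<close>. For \<open>\<alpha> < 16 / L\<close> the claim is trivial, so that constants may depend on powers of \<open>1 / \<alpha>\<close>.
\<close>

text \<open>The vertex is a boundary point of 2S, so no test function sees it directly. A cut-off of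
  a box of size l costs a Hessian norm of order 1 / l, but the slope argument weights the gradient
  image of that box by l. The two powers cancel: every scale costs the same multiple of the dual
  norm, and only the number of scales, of order L, is lost. The exponents of L: an energy below
  \<open>2 * \<alpha> * L\<close> forces a dual norm of at most \<open>2 * h * L\<close>; the number
  of scales gives one more L, and trading \<open>1 / \<alpha>^5\<close> for \<open>L^5\<close> gives
  the \<open>L^7\<close> in the value near the vertex. The further factor L in \<rho> makes an
  angular margin \<open>1 / L\<close> admissible, whose cost \<open>3 * \<delta> * L\<close> is
  bounded. So \<open>ln (1 / \<rho>)\<close> is L minus \<open>8 * ln L\<close> and a constant, and
  this is where the double logarithm comes from. Mollification is forced because v has only
  square-integrable second derivatives, while areas of gradient images and derivatives along arcs
  are computed for smooth functions; products of two L2 functions pass to the limit.\<close>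

abbreviation pd :: "2 => (real^2 => real) => real^2 => real" where "pd == pderiv_dir"
lemmas lint_cong = Bochner_Integration.integral_cong[OF refl]
lemmas lint_nonneg = Bochner_Integration.integral_nonneg
lemmas lint_bound = Bochner_Integration.integrable_bound
lemmas lint_add = Bochner_Integration.integral_add
lemmas lint_diff = Bochner_Integration.integral_diff
lemmas lint_add_int = Bochner_Integration.integrable_add
lemmas lint_diff_int = Bochner_Integration.integrable_diff
abbreviation ind :: "'a set => 'a => 'b::zero_neq_one" where "ind == indicator"

section \<open>Lebesgue measure on the plane as a product measure\<close>

lemma measurable_vector2 [measurable]:
 "(%p. vector [fst p, snd p] :: real^2) \<in> borel \<rightarrow>\<^sub>M borel"
proof (rule borel_measurable_continuous_onI)
 have "continuous_on UNIV (%p::real\<times>real. (\<chi> i. if i = 1 then fst p else snd p) :: real^2)"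
 proof (intro continuous_on_vec_lambda)
  fix i :: 2
  show "continuous_on UNIV (%x::real\<times>real. if i = 1 then fst x else snd x)" by (cases "i = 1") (auto intro!: continuous_intros)
 qed
 moreover have "(vector [fst p, snd p] :: real^2) = (\<chi> i. if i = 1 then fst p else snd p)" for p by (auto simp: vec_eq_iff forall_2)
 ultimately show "continuous_on UNIV (%p::real\<times>real. vector [fst p, snd p] :: real^2)" by (simp only:)
qed

lemma vector2_eta [simp]: "vector [x $ 1, x $ 2] = (x :: real^2)" by (simp add: vec_eq_iff forall_2)

text \<open>A measure that gives boxes their volume is Lebesgue measure, so only the preimage of a
  box has to be computed. This carries Fubini and Tonelli from pairs over to
  \<open>real^2\<close>.\<close>

lemma lborel_plane:
 "(lborel :: (real^2) measure) = distr (lborel \<Otimes>\<^sub>M lborel) borel (%p. vector [fst p, snd p])"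
proof (rule lborel_eqI)
 fix l u :: "real^2" assume le: "\<And>b. b \<in> Basis ==> l \<bullet> b <= u \<bullet> b"
 have le': "l $ i <= u $ i" for i using le[of "axis i 1"] by (auto simp: inner_axis Basis_vec_def)
 have pre: "(%p. vector [fst p, snd p]) -` box l u = {l$1<..<u$1} \<times> {l$2<..<u$2}" by (auto simp: mem_box_cart forall_2)
 have "emeasure (distr (lborel \<Otimes>\<^sub>M lborel) borel (%p. vector [fst p, snd p])) (box l u)
   = emeasure (lborel \<Otimes>\<^sub>M lborel) ({l$1<..<u$1} \<times> {l$2<..<u$2})"
  by (subst emeasure_distr) (auto simp: pre lborel_prod space_pair_measure)
 also have "\<dots> = ennreal (u$1 - l$1) * ennreal (u$2 - l$2)" using le'[of 1] le'[of 2] by (subst lborel.emeasure_pair_measure_Times) auto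
 also have "\<dots> = ennreal ((u$1 - l$1) * (u$2 - l$2))" using le'[of 1] le'[of 2] by (simp add: ennreal_mult)
 also have "(u$1 - l$1) * (u$2 - l$2) = (\<Prod>i\<in>UNIV. (u - l) \<bullet> axis i 1)" by (simp add: inner_axis UNIV_2)
 also have "\<dots> = (\<Prod>b\<in>Basis. (u - l) \<bullet> b)"
 proof -
  have B: "(Basis::(real^2) set) = (%i. axis i 1) ` UNIV" by (auto simp: Basis_vec_def)
  have "inj (%i::2. axis i (1::real))" by (auto simp: inj_on_def axis_eq_axis)
  thus ?thesis unfolding B by (subst prod.reindex) auto
 qed
 finally show "emeasure (distr (lborel \<Otimes>\<^sub>M lborel) borel (%p. vector [fst p, snd p])) (box l u) = (\<Prod>b\<in>Basis. (u - l) \<bullet> b)" .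
qed simp

lemma nn_integral_plane:
 fixes f :: "real^2 => ennreal"
 assumes [measurable]: "f \<in> borel_measurable borel"
 shows "(\<integral>\<^sup>+x. f x \<partial>lborel) = (\<integral>\<^sup>+a. \<integral>\<^sup>+b. f (vector [a, b]) \<partial>lborel \<partial>lborel)"
  and "(\<integral>\<^sup>+x. f x \<partial>lborel) = (\<integral>\<^sup>+b. \<integral>\<^sup>+a. f (vector [a, b]) \<partial>lborel \<partial>lborel)"
proof -
 have m: "(%p. vector [fst p, snd p] :: real^2) \<in> lborel \<Otimes>\<^sub>M lborel \<rightarrow>\<^sub>M borel" by (simp add: lborel_prod)
 have m': "(%p. f (vector [fst p, snd p])) \<in> borel_measurable (lborel \<Otimes>\<^sub>M lborel)" using m by measurable
 have e: "(\<integral>\<^sup>+x. f x \<partial>lborel) = (\<integral>\<^sup>+p. f (vector [fst p, snd p]) \<partial>(lborel \<Otimes>\<^sub>M lborel))"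
  by (subst lborel_plane, subst nn_integral_distr[OF m]) auto
 show "(\<integral>\<^sup>+x. f x \<partial>lborel) = (\<integral>\<^sup>+a. \<integral>\<^sup>+b. f (vector [a, b]) \<partial>lborel \<partial>lborel)"
  unfolding e using m' by (subst lborel.nn_integral_fst[symmetric]) auto
 show "(\<integral>\<^sup>+x. f x \<partial>lborel) = (\<integral>\<^sup>+b. \<integral>\<^sup>+a. f (vector [a, b]) \<partial>lborel \<partial>lborel)"
  unfolding e using m' by (subst lborel_pair.nn_integral_snd[symmetric]) (auto simp: case_prod_unfold)
qed

lemma integral_plane:
 fixes f :: "real^2 => real"
 assumes "integrable lborel f"
 shows "(LINT x|lborel. f x) = (LINT a|lborel. LINT b|lborel. f (vector [a, b]))"
  and "(LINT x|lborel. f x) = (LINT b|lborel. LINT a|lborel. f (vector [a, b]))"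
proof -
 have [measurable]: "f \<in> borel_measurable borel" using assms by simp
 have m: "(%p. vector [fst p, snd p] :: real^2) \<in> lborel \<Otimes>\<^sub>M lborel \<rightarrow>\<^sub>M borel" by (simp add: lborel_prod)
 have i: "integrable (lborel \<Otimes>\<^sub>M lborel) (%p. f (vector [fst p, snd p]))"
  using assms by (subst (asm) lborel_plane) (subst (asm) integrable_distr_eq[OF m], auto)
 have e: "(LINT x|lborel. f x) = (LINT p|(lborel \<Otimes>\<^sub>M lborel). f (vector [fst p, snd p]))"
  by (subst lborel_plane, subst integral_distr[OF m]) auto
 have i': "integrable (lborel \<Otimes>\<^sub>M lborel) (%(a,b). f (vector [a, b]))" using i by (simp add: case_prod_unfold)
 show "(LINT x|lborel. f x) = (LINT a|lborel. LINT b|lborel. f (vector [a, b]))"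
  unfolding e using lborel_pair.integral_fst[OF i'] by (simp add: case_prod_unfold)
 show "(LINT x|lborel. f x) = (LINT b|lborel. LINT a|lborel. f (vector [a, b]))"
  unfolding e using lborel_pair.integral_snd[OF i'] by (simp add: case_prod_unfold)
qed

section \<open>Smooth functions\<close>

text \<open>Each level asks only for some derivative function that is regular to one order less.
  Unlike the iterated partial derivatives in \<open>smooth\<close>, this form is closed under
  products and compositions by a plain induction on k; demanding it for every k restores
  smoothness.\<close>

fun Ck1 :: "nat => real set => (real => real) => bool" where
 "Ck1 0 S f \<longleftrightarrow> True"
| "Ck1 (Suc k) S f \<longleftrightarrow> (\<exists>g. (\<forall>t\<in>S. (f has_real_derivative g t) (at t)) \<and> Ck1 k S g)"

fun Ck :: "nat => (real^2) set => (real^2 => real) => bool" where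
 "Ck 0 S f \<longleftrightarrow> True"
| "Ck (Suc k) S f \<longleftrightarrow>
   (\<exists>g. (\<forall>x\<in>S. (f has_derivative (%h. \<Sum>i\<in>UNIV. g i x * h $ i)) (at x)) \<and> (\<forall>i. Ck k S (g i)))"

lemma Ck1_Suc_D: "Ck1 (Suc k) S f ==> Ck1 k S f"
proof (induction k arbitrary: f)
 case (Suc k)
 from Suc.prems[unfolded Ck1.simps(2)[of "Suc k"]]
 obtain g where "\<forall>t\<in>S. (f has_real_derivative g t) (at t)" "Ck1 (Suc k) S g" by blast
 moreover have "Ck1 k S g" using Suc.IH[OF calculation(2)] .
 ultimately show ?case unfolding Ck1.simps(2)[of k] by (intro exI[of _ g] conjI)
qed simp

lemma Ck_Suc_D: "Ck (Suc k) S f ==> Ck k S f"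
proof (induction k arbitrary: f)
 case (Suc k)
 from Suc.prems[unfolded Ck.simps(2)[of "Suc k"]]
 obtain g where "\<forall>x\<in>S. (f has_derivative (%h. \<Sum>i\<in>UNIV. g i x * h $ i)) (at x)" "\<forall>i. Ck (Suc k) S (g i)" by blast
 moreover have "\<forall>i. Ck k S (g i)" using Suc.IH calculation(2) by blast
 ultimately show ?case unfolding Ck.simps(2)[of k] by (intro exI[of _ g] conjI)
qed simp

lemma Ck1_const [simp]: "Ck1 k S (%t. c)"
proof (induction k arbitrary: c)
 case (Suc k) thus ?case by (auto intro!: exI[of _ "%t. 0"])
qed simp

lemma Ck1_id [simp]: "Ck1 k S (%t. t)" by (cases k) (auto intro!: exI[of _ "%t. 1"])

lemma Ck_const [simp]: "Ck k S (%x. c)"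
proof (induction k arbitrary: c)
 case (Suc k) thus ?case by (auto intro!: exI[of _ "%i x. 0"])
qed simp

lemma Ck_nth [simp]: "Ck k S (%x. x $ i)"
proof (cases k)
 case (Suc l)
 have "((%x::real^2. x $ i) has_derivative (%h. \<Sum>j\<in>UNIV. (if i = j then 1 else 0) * h $ j)) (at x)" for x
  by (rule has_derivative_eq_rhs[OF bounded_linear_imp_has_derivative[OF bounded_linear_vec_nth]])
   (auto simp: if_distrib[of "%x. x * _"] cong: if_cong)
 thus ?thesis using Suc by (auto intro!: exI[of _ "%j x. if i = j then 1 else 0"])
qed simp

lemma Ck1_add: "Ck1 k S f ==> Ck1 k S g ==> Ck1 k S (%t. f t + g t)"
proof (induction k arbitrary: f g)
 case (Suc k)
 then obtain f' g' where "\<forall>t\<in>S. (f has_real_derivative f' t) (at t)" "Ck1 k S f'"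
  "\<forall>t\<in>S. (g has_real_derivative g' t) (at t)" "Ck1 k S g'" by auto
 thus ?case using Suc.IH[of f' g'] by (auto intro!: exI[of _ "%t. f' t + g' t"] DERIV_add)
qed simp

lemma Ck1_mult: "Ck1 k S f ==> Ck1 k S g ==> Ck1 k S (%t. f t * g t)"
proof (induction k arbitrary: f g)
 case (Suc k)
 then obtain f' g' where *: "\<forall>t\<in>S. (f has_real_derivative f' t) (at t)" "Ck1 k S f'"
  "\<forall>t\<in>S. (g has_real_derivative g' t) (at t)" "Ck1 k S g'" by auto
 note ** = Suc.prems[THEN Ck1_Suc_D]
 have "Ck1 k S (%t. f' t * g t + g' t * f t)" by (intro Ck1_add Suc.IH * **)
 thus ?case using * by (auto intro!: exI[of _ "%t. f' t * g t + g' t * f t"] DERIV_mult)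
qed simp

lemma Ck_add: "Ck k S f ==> Ck k S g ==> Ck k S (%x. f x + g x)"
proof (induction k arbitrary: f g)
 case (Suc k)
 then obtain f' g' where *: "\<forall>x\<in>S. (f has_derivative (%h. \<Sum>i\<in>UNIV. f' i x * h $ i)) (at x)" "\<And>i. Ck k S (f' i)"
  "\<forall>x\<in>S. (g has_derivative (%h. \<Sum>i\<in>UNIV. g' i x * h $ i)) (at x)" "\<And>i. Ck k S (g' i)" by auto
 have "((%x. f x + g x) has_derivative (%h. \<Sum>i\<in>UNIV. (f' i x + g' i x) * h $ i)) (at x)" if "x \<in> S" for x
  by (rule has_derivative_eq_rhs[OF has_derivative_add[OF *(1)[rule_format, OF that] *(3)[rule_format, OF that]]])
    (auto simp: sum_2 algebra_simps)
 thus ?case using Suc.IH[OF *(2) *(4)] by (auto intro!: exI[of _ "%i x. f' i x + g' i x"])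
qed simp

lemma Ck_mult: "Ck k S f ==> Ck k S g ==> Ck k S (%x. f x * g x)"
proof (induction k arbitrary: f g)
 case (Suc k)
 then obtain f' g' where *: "\<forall>x\<in>S. (f has_derivative (%h. \<Sum>i\<in>UNIV. f' i x * h $ i)) (at x)" "\<And>i. Ck k S (f' i)"
  "\<forall>x\<in>S. (g has_derivative (%h. \<Sum>i\<in>UNIV. g' i x * h $ i)) (at x)" "\<And>i. Ck k S (g' i)" by auto
 note ** = Suc.prems[THEN Ck_Suc_D]
 have "Ck k S (%x. f' i x * g x + f x * g' i x)" for i by (intro Ck_add Suc.IH * **)
 moreover have "((%x. f x * g x) has_derivative (%h. \<Sum>i\<in>UNIV. (f' i x * g x + f x * g' i x) * h $ i)) (at x)" if "x \<in> S" for x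
  by (rule has_derivative_eq_rhs[OF has_derivative_mult[OF *(1)[rule_format, OF that] *(3)[rule_format, OF that]]])
    (auto simp: sum_2 algebra_simps)
 ultimately show ?case by (auto intro!: exI[of _ "%i x. f' i x * g x + f x * g' i x"])
qed simp

lemma Ck_comp: "Ck1 k T f ==> Ck k S g ==> g ` S \<subseteq> T ==> Ck k S (%x. f (g x))"
proof (induction k arbitrary: f)
 case (Suc k)
 then obtain f' g' where *: "\<forall>t\<in>T. (f has_real_derivative f' t) (at t)" "Ck1 k T f'"
  "\<forall>x\<in>S. (g has_derivative (%h. \<Sum>i\<in>UNIV. g' i x * h $ i)) (at x)" "\<And>i. Ck k S (g' i)" by auto
 have "Ck k S (%x. f' (g x) * g' i x)" for i by (rule Ck_mult[OF Suc.IH[OF *(2) Ck_Suc_D[OF Suc.prems(2)] Suc.prems(3)] *(4)])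
 moreover have "((%x. f (g x)) has_derivative (%h. \<Sum>i\<in>UNIV. (f' (g x) * g' i x) * h $ i)) (at x)" if "x \<in> S" for x
 proof -
  have "(f has_derivative (%h. f' (g x) * h)) (at (g x))" using *(1) Suc.prems(3) that by (auto simp: has_field_derivative_def)
  from has_derivative_compose[OF *(3)[rule_format, OF that] this]
  show ?thesis by (rule has_derivative_eq_rhs) (auto simp: sum_2 algebra_simps)
 qed
 ultimately show ?case by (auto intro!: exI[of _ "%i x. f' (g x) * g' i x"])
qed simp

lemma Ck1_comp: "Ck1 k T f ==> Ck1 k S g ==> g ` S \<subseteq> T ==> Ck1 k S (%x. f (g x))"
proof (induction k arbitrary: f)
 case (Suc k)
 then obtain f' g' where *: "\<forall>t\<in>T. (f has_real_derivative f' t) (at t)" "Ck1 k T f'"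
  "\<forall>t\<in>S. (g has_real_derivative g' t) (at t)" "Ck1 k S g'" by auto
 have "Ck1 k S (%x. f' (g x) * g' x)" by (rule Ck1_mult[OF Suc.IH[OF *(2) Ck1_Suc_D[OF Suc.prems(2)] Suc.prems(3)] *(4)])
 moreover have "((%x. f (g x)) has_real_derivative f' (g x) * g' x) (at x)" if "x \<in> S" for x
  using *(1,3) Suc.prems(3) that by (intro DERIV_chain2) auto
 ultimately show ?case by (auto intro!: exI[of _ "%x. f' (g x) * g' x"])
qed simp

lemma Ck1_cong: "open S ==> (\<And>t. t \<in> S ==> f t = g t) ==> Ck1 k S f ==> Ck1 k S g"
 by (cases k) (auto intro: has_field_derivative_transform_within_open)

lemma Ck_cong: "open S ==> (\<And>t. t \<in> S ==> f t = g t) ==> Ck k S f ==> Ck k S g"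
proof (cases k)
 case (Suc l)
 assume a: "open S" "\<And>t. t \<in> S ==> f t = g t" "Ck k S f"
 then obtain f' where "\<forall>x\<in>S. (f has_derivative (%h. \<Sum>i\<in>UNIV. f' i x * h $ i)) (at x)" "\<And>i. Ck l S (f' i)" using Suc by auto
 thus ?thesis using a(1,2) Suc by (auto intro!: exI[of _ f'] intro: has_derivative_transform_within_open)
qed simp

lemma Ck1_mono: "Ck1 k S f ==> T \<subseteq> S ==> Ck1 k T f"
proof (induction k arbitrary: f)
 case (Suc k)
 then obtain f' where "\<forall>x\<in>S. (f has_real_derivative f' x) (at x)" "Ck1 k S f'" by auto
 thus ?case using Suc.IH Suc.prems(2) by (auto intro!: exI[of _ f'])
qed simp

section \<open>Partial derivatives and the two forms of smoothness\<close>

lemma has_derivative_pderiv_dir: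
 assumes "(f has_derivative (%h. \<Sum>i\<in>UNIV. g i * h $ i)) (at x)"
 shows "pd i f x = g i"
proof -
 have "frechet_derivative f (at x) = (%h. \<Sum>i\<in>UNIV. g i * h $ i)" using frechet_derivative_at[OF assms] by simp
 thus ?thesis unfolding pderiv_dir_def by (simp add: axis_def if_distrib[of "%x. _ * x"] cong: if_cong)
qed

lemma has_derivative_pderiv_dirI:
 assumes "f differentiable (at x)"
 shows "(f has_derivative (%h. \<Sum>i\<in>UNIV. pd i f x * h $ i)) (at x)"
proof -
 have d: "(f has_derivative frechet_derivative f (at x)) (at x)" using assms frechet_derivative_works by blast
 then interpret bounded_linear "frechet_derivative f (at x)" by (rule has_derivative_bounded_linear)
 have "frechet_derivative f (at x) h = (\<Sum>i\<in>UNIV. pd i f x * h $ i)" for h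
 proof -
  have "h = h $ 1 *\<^sub>R axis 1 1 + h $ 2 *\<^sub>R axis 2 1" by (simp add: vec_eq_iff forall_2 axis_def)
  hence "frechet_derivative f (at x) h = frechet_derivative f (at x) (h $ 1 *\<^sub>R axis 1 1 + h $ 2 *\<^sub>R axis 2 1)" by simp
  also have "\<dots> = (\<Sum>i\<in>UNIV. pd i f x * h $ i)" unfolding add scaleR pderiv_dir_def by (simp add: sum_2)
  finally show ?thesis .
 qed
 hence "frechet_derivative f (at x) = (%h. \<Sum>i\<in>UNIV. pd i f x * h $ i)" by blast
 thus ?thesis using d by simp
qed

lemma Ck_Suc_pderiv:
 assumes "open S" "Ck (Suc k) S f"
 shows "x \<in> S ==> (f has_derivative (%h. \<Sum>i\<in>UNIV. pd i f x * h $ i)) (at x)" "Ck k S (pd i f)"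
proof -
 obtain g where g: "\<And>x. x \<in> S ==> (f has_derivative (%h. \<Sum>i\<in>UNIV. g i x * h $ i)) (at x)" "\<And>i. Ck k S (g i)"
  using assms(2) by auto
 have e: "pd i f x = g i x" if "x \<in> S" for i x using has_derivative_pderiv_dir[OF g(1)[OF that]] .
 show "x \<in> S ==> (f has_derivative (%h. \<Sum>i\<in>UNIV. pd i f x * h $ i)) (at x)" using g(1)[of x] e by simp
 show "Ck k S (pd i f)" by (rule Ck_cong[OF assms(1) _ g(2)[of i]]) (simp add: e)
qed

lemma smooth_differentiable: "smooth f ==> f differentiable (at x)" unfolding smooth_def differentiable_on_def by (drule spec[of _ "[]"]) simp

lemma smooth_pderiv: "smooth f ==> smooth (pd i f)" unfolding smooth_def
proof
 fix "is" assume "\<forall>is. foldr pd is f differentiable_on UNIV"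
 from this[rule_format, of "is @ [i]"] show "foldr pd is (pd i f) differentiable_on UNIV" by simp
qed

text \<open>In \<open>foldr\<close> the derivative applied first is the last entry of the list, so
  the induction for the converse runs over the list from the right.\<close>

lemma smooth_iff_Ck: "smooth f \<longleftrightarrow> (\<forall>k. Ck k UNIV f)"
proof safe
 fix k assume "smooth f" thus "Ck k UNIV f"
 proof (induction k arbitrary: f)
  case (Suc k)
  thus ?case by (auto intro!: exI[of _ "%i. pd i f"] has_derivative_pderiv_dirI smooth_differentiable smooth_pderiv)
 qed simp
next
 assume a: "\<forall>k. Ck k UNIV f"
 have "foldr pd is f differentiable_on UNIV" for "is" using a
 proof (induction "is" arbitrary: f rule: rev_induct)
  case Nil
  hence "Ck (Suc 0) UNIV f" by blast
  hence "f differentiable (at x)" for x unfolding differentiable_def using Ck_Suc_pderiv(1)[OF open_UNIV, of 0 f x] by blast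
  thus ?case by (simp add: differentiable_on_def)
 next
  case (snoc i "is")
  have "\<forall>k. Ck k UNIV (pd i f)" using snoc.prems Ck_Suc_pderiv(2)[OF open_UNIV] by blast
  thus ?case using snoc.IH by simp
 qed
 thus "smooth f" unfolding smooth_def by blast
qed

lemma smooth_has_derivative:
 "smooth f ==> (f has_derivative (%h. \<Sum>i\<in>UNIV. pd i f x * h $ i)) (at x)" by (simp add: has_derivative_pderiv_dirI smooth_differentiable)

lemma smooth_continuous: "smooth f ==> continuous_on A f"
 by (intro continuous_at_imp_continuous_on ballI differentiable_imp_continuous_within smooth_differentiable)

lemma smooth_const [simp]: "smooth (%x. c)" by (simp add: smooth_iff_Ck)
lemma smooth_nth [simp]: "smooth (%x. x $ i)" by (simp add: smooth_iff_Ck)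
lemma smooth_add: "smooth f ==> smooth g ==> smooth (%x. f x + g x)" by (simp add: smooth_iff_Ck Ck_add)
lemma smooth_mult: "smooth f ==> smooth g ==> smooth (%x. f x * g x)" by (simp add: smooth_iff_Ck Ck_mult)
lemma smooth_comp: "(\<And>k. Ck1 k UNIV f) ==> smooth g ==> smooth (%x. f (g x))" unfolding smooth_iff_Ck using Ck_comp[of _ UNIV f UNIV g] by simp

lemma pderiv_dir_mult:
 "smooth f ==> smooth g ==> pd i (%x. f x * g x) x = pd i f x * g x + f x * pd i g x"
 by (rule has_derivative_pderiv_dir[where g = "%i. pd i f x * g x + f x * pd i g x"],
   rule has_derivative_eq_rhs[OF has_derivative_mult[OF smooth_has_derivative smooth_has_derivative]])
   (auto simp: sum_2 algebra_simps)

section \<open>A smooth step function\<close>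

definition flat :: "nat => real => real" where
 "flat n t = (if t <= 0 then 0 else exp (- 1 / t) / t ^ n)"

lemma flat_tendsto: "(flat n \<longlongrightarrow> 0) (at 0)"
proof -
 have "((%t::real. (inverse t) ^ n / exp (inverse t)) \<longlongrightarrow> 0) (at_right 0)"
  by (rule filterlim_compose[OF tendsto_power_div_exp_0 filterlim_inverse_at_top_right])
 moreover have "\<forall>\<^sub>F t in at_right 0. (inverse t) ^ n / exp (inverse t) = flat n t"
  by (auto simp: eventually_at_filter flat_def exp_minus divide_simps power_inverse)
 ultimately have r: "(flat n \<longlongrightarrow> 0) (at_right 0)" by (rule Lim_transform_eventually)
 have "((%t::real. 0::real) \<longlongrightarrow> 0) (at_left 0)" by simp
 moreover have "\<forall>\<^sub>F t in at_left 0. 0 = flat n t" by (auto simp: eventually_at_filter flat_def)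
 ultimately have l: "(flat n \<longlongrightarrow> 0) (at_left 0)" by (rule Lim_transform_eventually)
 show ?thesis using l r by (simp add: filterlim_split_at_real)
qed

text \<open>Keeping the power \<open>1 / t ^ n\<close> as a parameter makes the family closed under
  differentiation, also at 0, where all members are flat. Smoothness of every order is then one
  induction with n arbitrary.\<close>

lemma flat_deriv: "(flat n has_real_derivative flat (n + 2) t - real n * flat (n + 1) t) (at t)"
proof -
 consider "t < 0" | "t = 0" | "t > 0" by linarith
 thus ?thesis
 proof cases
  case 1
  have "((%t. 0) has_real_derivative 0) (at t)" by simp
  hence "(flat n has_real_derivative 0) (at t)"
   by (rule has_field_derivative_transform_within_open[of _ _ _ "{..<0}"]) (use 1 in \<open>auto simp: flat_def\<close>)
  thus ?thesis using 1 by (simp add: flat_def)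
 next
  case 2
  have "((%h. flat (n + 1) h) \<longlongrightarrow> 0) (at 0)" by (rule flat_tendsto)
  moreover have "flat (n+1) h = (flat n (0 + h) - flat n 0) / h" if "h \<noteq> 0" for h using that by (auto simp: flat_def)
  ultimately have "((%h. (flat n (0 + h) - flat n 0) / h) \<longlongrightarrow> 0) (at 0)"
   by (subst (asm) tendsto_cong[where g = "%h. (flat n (0 + h) - flat n 0) / h"])
     (auto simp: eventually_at_filter)
  thus ?thesis using 2 by (simp add: DERIV_def flat_def)
 next
  case 3
  have "((%t. exp (- 1 / t) / t ^ n) has_real_derivative
    (exp (- 1 / t) * (1 / t\<^sup>2) * t ^ n - exp (- 1 / t) * (real n * t ^ (n - 1))) / (t ^ n * t ^ n)) (at t)"
   using 3 by (auto intro!: derivative_eq_intros simp: power2_eq_square)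
  moreover have "(exp (- 1 / t) * (1 / t\<^sup>2) * t ^ n - exp (- 1 / t) * (real n * t ^ (n - 1))) / (t ^ n * t ^ n)
    = flat (n + 2) t - real n * flat (n + 1) t" using 3 by (cases n) (auto simp: flat_def divide_simps power2_eq_square algebra_simps)
  ultimately have "((%t. exp (- 1 / t) / t ^ n) has_real_derivative flat (n + 2) t - real n * flat (n + 1) t) (at t)" by simp
  thus ?thesis by (rule has_field_derivative_transform_within_open[of _ _ _ "{0<..}"]) (use 3 in \<open>auto simp: flat_def\<close>)
 qed
qed

lemma Ck1_cmult: "Ck1 k S f ==> Ck1 k S (%t. c * f t)" using Ck1_mult[of k S "%t. c" f] by simp

lemma Ck1_diff: "Ck1 k S f ==> Ck1 k S g ==> Ck1 k S (%t. f t - g t)" using Ck1_add[of k S f "%t. (-1) * g t"] Ck1_cmult[of k S g "-1"] by simp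

lemma Ck1_flat: "Ck1 k S (flat n)"
proof (induction k arbitrary: n)
 case (Suc k)
 have "Ck1 k S (%t. flat (n + 2) t - real n * flat (n + 1) t)" by (rule Ck1_diff[OF Suc Ck1_cmult[OF Suc]])
 thus ?case unfolding Ck1.simps using flat_deriv by (intro exI[of _ "%t. flat (n + 2) t - real n * flat (n + 1) t"] conjI ballI)
qed simp

lemma Ck1_continuous: "Ck1 (Suc 0) S f ==> t \<in> S ==> isCont f t" by (auto intro: DERIV_isCont)

definition hump :: "real => real" where "hump t = flat 0 t * flat 0 (1 - t)"

lemma Ck1_hump: "Ck1 k UNIV hump"
proof -
 have "Ck1 k UNIV (%t. flat 0 (1 - t))" by (rule Ck1_comp[of k UNIV "flat 0" UNIV "%t. 1 - t"]) (auto intro!: Ck1_flat Ck1_diff)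
 thus ?thesis unfolding hump_def by (intro Ck1_mult Ck1_flat)
qed

lemma hump_pos: "0 < t ==> t < 1 ==> hump t > 0"
 and hump_nonneg: "hump t >= 0"
 and hump_0: "t <= 0 ==> hump t = 0" "t >= 1 ==> hump t = 0" by (auto simp: hump_def flat_def)

text \<open>The normalised primitive of \<open>hump\<close>. Its derivative is packaged with it,
  since the curvature of the regularised cone is expressed by that derivative.\<close>

lemma exists_step:
 "\<exists>s s'::real=>real. (\<forall>t. (s has_real_derivative s' t) (at t)) \<and> (\<forall>k. Ck1 k UNIV s) \<and> (\<forall>k. Ck1 k UNIV s') \<and> (\<forall>t. s' t >= 0) \<and>
   (\<forall>t. 0 < t \<and> t < 1 \<longrightarrow> s' t > 0) \<and>
   (\<forall>t\<le>0. s t = 0 \<and> s' t = 0) \<and> (\<forall>t\<ge>1. s t = 1 \<and> s' t = 0)"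
proof -
 have "isCont hump t" for t using Ck1_continuous[OF Ck1_hump] by auto
 then obtain F where F: "\<And>t. (F has_real_derivative hump t) (at t)"
  using einterval_antiderivative[of "-\<infinity>" "\<infinity>" hump] by (auto simp: has_real_derivative_iff_has_vector_derivative)
 have c: "F a = F b" if "a <= b" "\<And>t. a < t ==> t < b ==> hump t = 0" for a b
 proof (cases "a = b")
  case False
  hence "a < b" using that by simp
  from MVT2[OF this, of F hump] F obtain z where "a < z" "z < b" "F b - F a = (b - a) * hump z" by blast
  thus ?thesis using that(2)[of z] by simp
 qed simp
 have s: "F 0 < F 1"
 proof -
  from MVT2[of 0 1 F hump] F obtain z where "0 < z" "z < 1" "F 1 - F 0 = (1 - 0) * hump z" using zero_less_one by blast
  thus ?thesis using hump_pos[of z] by simp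
 qed
 define I where "I = F 1 - F 0"
 define u where "u = (%t. (F t - F 0) / I)"
 define u' where "u' = (%t. (1 / I) * hump t)"
 have I: "I > 0" using s I_def by simp
 have d: "(u has_real_derivative u' t) (at t)" for t unfolding u_def u'_def using I by (auto intro!: derivative_eq_intros F)
 have k': "Ck1 k UNIV u'" for k unfolding u'_def by (rule Ck1_cmult[OF Ck1_hump])
 have k: "Ck1 k UNIV u" for k
 proof (cases k)
  case (Suc l)
  have "\<forall>t\<in>UNIV. (u has_real_derivative u' t) (at t)" using d by blast
  thus ?thesis using k'[of l] unfolding Suc Ck1.simps by blast
 qed simp
 have z: "u t = 0" if "t <= 0" for t unfolding u_def using c[OF that] hump_0(1) by (metis diff_self div_0 less_imp_le)
 have z': "u' t = 0" if "t <= 0" for t unfolding u'_def using that hump_0(1) by simp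
 have o: "u t = 1" if "t >= 1" for t
 proof -
  have "F 1 = F t" using c[OF that] hump_0(2) by (metis less_imp_le)
  thus ?thesis unfolding u_def I_def using s by simp
 qed
 have o': "u' t = 0" if "t >= 1" for t unfolding u'_def using that hump_0(2) by simp
 have n: "u' t >= 0" for t unfolding u'_def using I hump_nonneg by simp
 have p: "u' t > 0" if "0 < t" "t < 1" for t unfolding u'_def using I hump_pos[OF that] by simp
 show ?thesis by (rule exI[of _ u], rule exI[of _ u']) (simp add: d k k' z z' o o' n p)
qed

definition step_pair :: "(real => real) \<times> (real => real)" where
 "step_pair = (SOME (s, s'). (\<forall>t. (s has_real_derivative s' t) (at t)) \<and> (\<forall>k. Ck1 k UNIV s) \<and> (\<forall>k. Ck1 k UNIV s') \<and> (\<forall>t. s' t >= 0) \<and>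
   (\<forall>t. 0 < t \<and> t < 1 \<longrightarrow> s' t > 0) \<and>
   (\<forall>t\<le>0. s t = 0 \<and> s' t = 0) \<and> (\<forall>t\<ge>1. s t = 1 \<and> s' t = 0))"
definition "step = fst step_pair"
definition "step' = snd step_pair"

lemma step_props:
 "(\<forall>t. (step has_real_derivative step' t) (at t)) \<and> (\<forall>k. Ck1 k UNIV step) \<and> (\<forall>k. Ck1 k UNIV step') \<and> (\<forall>t. step' t >= 0) \<and>
   (\<forall>t. 0 < t \<and> t < 1 \<longrightarrow> step' t > 0) \<and>
   (\<forall>t\<le>0. step t = 0 \<and> step' t = 0) \<and> (\<forall>t\<ge>1. step t = 1 \<and> step' t = 0)"
 using someI_ex[of "%(s, s'). (\<forall>t. (s has_real_derivative s' t) (at t)) \<and> (\<forall>k. Ck1 k UNIV s) \<and> (\<forall>k. Ck1 k UNIV s') \<and> (\<forall>t. s' t >= 0) \<and>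
   (\<forall>t. 0 < t \<and> t < 1 \<longrightarrow> s' t > 0) \<and>
   (\<forall>t\<le>0. s t = 0 \<and> s' t = 0) \<and> (\<forall>t\<ge>1. s t = 1 \<and> s' t = 0)"] exists_step
 unfolding step_def step'_def step_pair_def by (auto simp: case_prod_unfold)

lemma step_deriv: "(step has_real_derivative step' t) (at t)"
 and Ck1_step: "Ck1 k UNIV step" and Ck1_step': "Ck1 k UNIV step'"
 and step'_nonneg: "step' t >= 0"
 and step'_pos: "0 < t ==> t < 1 ==> step' t > 0"
 and step_0: "t <= 0 ==> step t = 0" and step'_0: "t <= 0 ==> step' t = 0"
 and step_1: "t >= 1 ==> step t = 1" and step'_1: "t >= 1 ==> step' t = 0" using step_props by auto

lemma step_mono: "s <= t ==> step s <= step t" by (rule DERIV_nonneg_imp_nondecreasing) (use step_deriv step'_nonneg in blast)+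

lemma step_nonneg: "step t >= 0" and step_le_1: "step t <= 1"
 using step_mono[of 0 t] step_mono[of t 0] step_0 step_1 step_mono[of t 1] step_mono[of 1 t] by (smt (verit))+

section \<open>Square-integrable functions\<close>

lemma integrable_mult_L2:
 fixes f g :: "'a => real"
 assumes [measurable]: "f \<in> borel_measurable M" "g \<in> borel_measurable M"
  and i: "integrable M (%x. (f x)\<^sup>2)" "integrable M (%x. (g x)\<^sup>2)"
 shows "integrable M (%x. f x * g x)"
proof (rule lint_bound[OF lint_add_int[OF i]])
 show "AE x in M. norm (f x * g x) <= norm ((f x)\<^sup>2 + (g x)\<^sup>2)"
 proof (intro always_eventually allI)
  fix x
  have "0 <= (\<bar>f x\<bar> - \<bar>g x\<bar>)\<^sup>2" by simp
  hence "2 * (\<bar>f x\<bar> * \<bar>g x\<bar>) <= (f x)\<^sup>2 + (g x)\<^sup>2" by (simp add: power2_diff)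
  moreover have "0 <= \<bar>f x\<bar> * \<bar>g x\<bar>" by simp
  ultimately have "\<bar>f x\<bar> * \<bar>g x\<bar> <= (f x)\<^sup>2 + (g x)\<^sup>2" by linarith
  thus "norm (f x * g x) <= norm ((f x)\<^sup>2 + (g x)\<^sup>2)" by (simp add: abs_mult)
 qed
qed simp

lemma Cauchy_Schwarz_integral:
 fixes f g :: "'a => real"
 assumes [measurable]: "f \<in> borel_measurable M" "g \<in> borel_measurable M"
  and i: "integrable M (%x. (f x)\<^sup>2)" "integrable M (%x. (g x)\<^sup>2)"
 shows "\<bar>LINT x|M. f x * g x\<bar> <= sqrt (LINT x|M. (f x)\<^sup>2) * sqrt (LINT x|M. (g x)\<^sup>2)"
proof -
 note ifg = integrable_mult_L2[OF assms]
 define A B C where "A = (LINT x|M. (f x)\<^sup>2)" and "B = (LINT x|M. (g x)\<^sup>2)" and "C = (LINT x|M. f x * g x)"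
 \<comment> \<open>The square of \<open>f + t * g\<close> has a nonnegative integral for every t.
   Below, t is the minimiser \<open>- C / B\<close> or, if B vanishes, a value that would make the
   affine function of t negative.\<close>
 have q: "0 <= A + 2 * t * C + t\<^sup>2 * B" for t
 proof -
  have "0 <= (LINT x|M. (f x + t * g x)\<^sup>2)" by simp
  also have "\<dots> = (LINT x|M. (f x)\<^sup>2 + 2 * t * (f x * g x) + t\<^sup>2 * (g x)\<^sup>2)"
   by (intro Bochner_Integration.integral_cong) (auto simp: power2_eq_square algebra_simps)
  also have "\<dots> = A + 2 * t * C + t\<^sup>2 * B" using i ifg by (simp add: A_def B_def C_def)
  finally show ?thesis .
 qed
 have A: "A >= 0" and B: "B >= 0" by (auto simp: A_def B_def)
 have "C\<^sup>2 <= A * B"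
 proof (cases "B = 0")
  case True
  have "C = 0"
  proof (rule ccontr)
   assume "C \<noteq> 0"
   hence "2 * (- (A + 1) / C) * C = - 2 * (A + 1)" by simp
   thus False using q[of "- (A + 1) / C"] A True by simp
  qed
  thus ?thesis using True by simp
 next
  case False
  hence "B > 0" using B by simp
  hence "0 <= B * (A + 2 * (- C / B) * C + (- C / B)\<^sup>2 * B)" using q[of "- C / B"] by simp
  also have "\<dots> = A * B - C\<^sup>2" using \<open>B > 0\<close> by (simp add: field_simps power2_eq_square)
  finally show ?thesis by simp
 qed
 hence "\<bar>C\<bar> <= sqrt (A * B)" by (simp add: real_le_rsqrt)
 thus ?thesis by (simp add: A_def B_def C_def real_sqrt_mult)
qed

lemma L2_integrable_mult: "f \<in> L2 W ==> g \<in> L2 W ==> integrable (lebesgue_on W) (%x. f x * (g x :: real))"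
 unfolding L2_def by (auto intro!: integrable_mult_L2)

lemma L2_norm_nonneg: "L2_norm W f >= 0" unfolding L2_norm_def by simp

lemma L2_Cauchy_Schwarz:
 "f \<in> L2 W ==> g \<in> L2 W ==> \<bar>LINT x|lebesgue_on W. f x * (g x :: real)\<bar> <= L2_norm W f * L2_norm W g"
 unfolding L2_def L2_norm_def by (auto intro!: Cauchy_Schwarz_integral)

lemma L2_cmult: "f \<in> L2 W ==> (%x. c * (f x :: real)) \<in> L2 W" unfolding L2_def by (auto simp: power_mult_distrib)

lemma L2_add:
 assumes "f \<in> L2 W" "g \<in> L2 W" shows "(%x. f x + (g x :: real)) \<in> L2 W"
proof -
 have "integrable (lebesgue_on W) (%x. (f x)\<^sup>2 + 2 * (f x * g x) + (g x)\<^sup>2)"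
  using assms L2_integrable_mult[OF assms] unfolding L2_def by simp
 moreover have "(f x)\<^sup>2 + 2 * (f x * g x) + (g x)\<^sup>2 = (f x + g x)\<^sup>2" for x by (simp add: power2_eq_square algebra_simps)
 moreover have "(%x. f x + g x) \<in> borel_measurable (lebesgue_on W)" using assms unfolding L2_def by (intro borel_measurable_add) auto
 ultimately show ?thesis unfolding L2_def by simp
qed

lemma L2_diff: "f \<in> L2 W ==> g \<in> L2 W ==> (%x. f x - (g x :: real)) \<in> L2 W"
 using L2_add[of f W "%x. -1 * g x"] L2_cmult[of g W "-1"] by simp

lemma L2_norm_power2: "(L2_norm W f)\<^sup>2 = (LINT x|lebesgue_on W. (norm (f x))\<^sup>2)" unfolding L2_norm_def by simp

lemma L2_norm_triangle:
 assumes "f \<in> L2 W" "g \<in> L2 W" shows "L2_norm W (%x. f x + (g x :: real)) <= L2_norm W f + L2_norm W g"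
proof (rule power2_le_imp_le)
 have "(L2_norm W (%x. f x + g x))\<^sup>2 = (LINT x|lebesgue_on W. (f x)\<^sup>2 + 2 * (f x * g x) + (g x)\<^sup>2)"
  unfolding L2_norm_power2 by (intro Bochner_Integration.integral_cong) (auto simp: power2_eq_square algebra_simps)
 also have "\<dots> = (L2_norm W f)\<^sup>2 + 2 * (LINT x|lebesgue_on W. f x * g x) + (L2_norm W g)\<^sup>2"
  using assms L2_integrable_mult[OF assms] unfolding L2_norm_power2 L2_def by simp
 also have "\<dots> <= (L2_norm W f + L2_norm W g)\<^sup>2" using L2_Cauchy_Schwarz[OF assms] by (simp add: power2_eq_square algebra_simps)
 finally show "(L2_norm W (%x. f x + g x))\<^sup>2 <= (L2_norm W f + L2_norm W g)\<^sup>2" .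
qed (simp add: L2_norm_nonneg)

lemma LINT_lebesgue_on:
 fixes f :: "real^2 => real"
 assumes "W \<in> sets lebesgue"
 shows "(LINT x|lebesgue_on W. f x) = (LINT x|lebesgue. ind W x * f x)" using assms by (subst integral_restrict_space) auto

lemma integrable_lebesgue_on:
 fixes f :: "real^2 => real"
 assumes "W \<in> sets lebesgue"
 shows "integrable (lebesgue_on W) f \<longleftrightarrow> integrable lebesgue (%x. ind W x * f x)"
 using assms by (subst integrable_restrict_space) auto

lemma bounded_continuous_L2:
 fixes f :: "real^2 => real"
 assumes "W \<in> sets lebesgue" "bounded W" "continuous_on UNIV f"
 shows "f \<in> L2 W"
proof -
 have c: "compact (closure W)" using assms by simp
 hence "compact (f ` closure W)" using assms(3) by (meson compact_continuous_image continuous_on_subset subset_UNIV)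
 then obtain B where B: "\<And>x. x \<in> W ==> \<bar>f x\<bar> <= B"
  using compact_imp_bounded bounded_iff closure_subset by (metis (no_types, opaque_lifting) image_eqI real_norm_def subsetD)
 have [measurable]: "f \<in> borel_measurable lebesgue" by (rule measurable_completion) (simp add: borel_measurable_continuous_onI assms(3))
 have m: "f \<in> borel_measurable (lebesgue_on W)" by (rule measurable_restrict_space1) simp
 have "integrable (lebesgue_on W) (%x. (norm (f x))\<^sup>2)"
 proof (rule lint_bound[of _ "%x. B\<^sup>2"])
  show "integrable (lebesgue_on W) (%x. B\<^sup>2)"
   by (rule finite_measure.integrable_const[OF finite_measure_lebesgue_on[OF bounded_set_imp_lmeasurable[OF assms(2,1)]]])
  show "AE x in lebesgue_on W. norm ((norm (f x))\<^sup>2) <= norm (B\<^sup>2)"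
  proof (intro AE_I2)
   fix x assume "x \<in> space (lebesgue_on W)"
   hence "norm (f x) <= B" using B by (simp add: space_restrict_space)
   hence "(norm (f x))\<^sup>2 <= B\<^sup>2" by (intro power_mono) auto
   thus "norm ((norm (f x))\<^sup>2) <= norm (B\<^sup>2)" by simp
  qed
 qed (use m in measurable)
 thus ?thesis using m unfolding L2_def by auto
qed

section \<open>Integration by parts\<close>

lemma compact_support_integrable:
 fixes f :: "real^2 => real"
 assumes "continuous_on UNIV f" "compact K" "\<And>x. x \<notin> K ==> f x = 0"
 shows "integrable lborel f"
proof -
 have "integrable lborel (%x. ind K x *\<^sub>R f x)" using borel_integrable_compact[OF assms(2), of f] assms(1) continuous_on_subset
  by (auto simp: set_integrable_def)
 moreover have "(%x. ind K x *\<^sub>R f x) = f" using assms(3) by (auto simp: indicator_def fun_eq_iff)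
 ultimately show ?thesis by metis
qed

lemma pderiv_dir_outside:
 assumes "closed K" "\<And>x. x \<notin> K ==> f x = 0" "x \<notin> K"
 shows "pd i f x = 0"
proof (rule has_derivative_pderiv_dir[where g = "%_. 0"])
 have "((%x. 0) has_derivative (%h. \<Sum>i\<in>UNIV. 0 * h $ i)) (at x)" by simp
 thus "(f has_derivative (%h. \<Sum>i\<in>UNIV. 0 * h $ i)) (at x)"
  by (rule has_derivative_transform_within_open[where s = "- K"]) (use assms in auto)
qed

lemma vector2_lines:
 "(%a. vector [a, b] :: real^2) = (%a. a *\<^sub>R axis 1 1 + vector [0, b])"
 "(%b. vector [a, b] :: real^2) = (%b. b *\<^sub>R axis 2 1 + vector [a, 0])" by (simp_all add: fun_eq_iff vec_eq_iff forall_2 axis_def)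

lemma has_derivative_line:
 fixes f :: "real^2 => real"
 assumes "(f has_derivative (%h. \<Sum>i\<in>UNIV. g i * h $ i)) (at (vector [a, b]))"
 shows "((%a. f (vector [a, b])) has_real_derivative g 1) (at a)"
  and "((%b. f (vector [a, b])) has_real_derivative g 2) (at b)"
proof -
 have 1: "((%a. vector [a, b] :: real^2) has_derivative (%h. vector [h, 0])) (at a)"
  unfolding vector2_lines by (rule has_derivative_eq_rhs, (rule derivative_intros)+) (simp add: fun_eq_iff vec_eq_iff forall_2 axis_def)
 have 2: "((%b. vector [a, b] :: real^2) has_derivative (%h. vector [0, h])) (at b)"
  unfolding vector2_lines by (rule has_derivative_eq_rhs, (rule derivative_intros)+) (simp add: fun_eq_iff vec_eq_iff forall_2 axis_def)
 show "((%a. f (vector [a, b])) has_real_derivative g 1) (at a)"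
  using has_derivative_compose[OF 1 assms] unfolding has_field_derivative_def by (simp add: sum_2)
 show "((%b. f (vector [a, b])) has_real_derivative g 2) (at b)"
  using has_derivative_compose[OF 2 assms] unfolding has_field_derivative_def by (simp add: sum_2)
qed

lemma line_integral_zero:
 fixes F f :: "real => real"
 assumes "\<And>t. (F has_real_derivative f t) (at t)" "\<And>t. isCont f t" "\<And>t. \<bar>t\<bar> >= B ==> F t = 0" "\<And>t. \<bar>t\<bar> >= B ==> f t = 0"
 shows "(LINT t|lborel. f t) = 0"
proof -
 define B' where "B' = max B 0"
 have "(LINT t|lborel. f t * ind {-B'..B'} t) = F B' - F (- B')" by (rule integral_FTC_Icc_real) (use assms in \<open>auto simp: B'_def\<close>)
 moreover have "(%t. f t * ind {-B'..B'} t) = f"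
 proof
  fix t show "f t * ind {-B'..B'} t = f t" using assms(4)[of t] by (cases "\<bar>t\<bar> >= B") (auto simp: indicator_def B'_def)
 qed
 moreover have "F B' = 0" "F (-B') = 0" using assms(3) by (auto simp: B'_def)
 ultimately show ?thesis by simp
qed

lemma smooth_isCont: "smooth f ==> isCont f x" using smooth_continuous[of f UNIV] by (simp add: continuous_on_eq_continuous_at)

lemma isCont_vector2: "isCont (%a. vector [a, b] :: real^2) a" "isCont (%b. vector [a, b] :: real^2) b"
 unfolding vector2_lines by (intro continuous_intros)+

text \<open>Fubini with the inner integral along the direction of differentiation reduces this to
  the fundamental theorem of calculus on lines.\<close>

lemma integral_pderiv_zero:
 assumes f: "smooth f" and K: "compact K" "\<And>x. x \<notin> K ==> f x = 0"
 shows "(LINT x|lborel. pd i f x) = 0"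
proof -
 have out: "pd i f x = 0" if "x \<notin> K" for x i using pderiv_dir_outside[of K f x] K that compact_imp_closed by blast
 have sm: "smooth (pd i f)" using smooth_pderiv[OF f] .
 have int: "integrable lborel (pd i f)" using compact_support_integrable[OF smooth_continuous[OF sm] K(1)] out by blast
 obtain B where B: "\<And>x. x \<in> K ==> norm x < B" using compact_imp_bounded[OF K(1)] by (metis bounded_pos_less)
 have nK: "(vector [a, b] :: real^2) \<notin> K" if "\<bar>a\<bar> >= B \<or> \<bar>b\<bar> >= B" for a b
  using B[of "vector [a, b]"] that component_le_norm_cart[of "vector [a, b] :: real^2" 1] component_le_norm_cart[of "vector [a, b] :: real^2" 2]
  by auto
 have C: "isCont (pd i f) x" for x by (rule smooth_isCont[OF sm])
 show ?thesis
 proof (cases "i = 1")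
  case True
  have "(LINT a|lborel. pd 1 f (vector [a, b])) = 0" for b by (rule line_integral_zero[of "%a. f (vector [a, b])" _ B])
    (use True nK K(2) out C has_derivative_line(1)[OF smooth_has_derivative[OF f]] in
     \<open>auto intro!: isCont_o2[OF isCont_vector2(1)]\<close>)
  thus ?thesis using integral_plane(2)[OF int] True by simp
 next
  case False
  hence i: "i = 2" using exhaust_2 by blast
  have "(LINT b|lborel. pd 2 f (vector [a, b])) = 0" for a by (rule line_integral_zero[of "%b. f (vector [a, b])" _ B])
    (use i nK K(2) out C has_derivative_line(2)[OF smooth_has_derivative[OF f]] in
     \<open>auto intro!: isCont_o2[OF isCont_vector2(2)]\<close>)
  thus ?thesis using integral_plane(1)[OF int] i by simp
 qed
qed

section \<open>Mollification\<close>

text \<open>A product of one-dimensional humps rather than a radial kernel: smoothness and evenness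
  reduce to one variable. The support is a square contained in the ball of radius
  \<open>2 * e\<close>, which is the origin of the radii \<open>2 * e\<close> and
  \<open>4 * e\<close> below.\<close>

definition rho :: "real => real^2 => real" where
 "rho e x = hump ((x $ 1 / e + 1) / 2) * hump ((x $ 2 / e + 1) / 2)"

lemma hump_reflect: "hump (1 - t) = hump t" by (simp add: hump_def mult.commute)

lemma rho_nonneg: "rho e x >= 0" by (simp add: rho_def hump_nonneg)

lemma rho_minus: "rho e (- x) = rho e x"
proof -
 have "hump ((- t / e + 1) / 2) = hump ((t / e + 1) / 2)" for t :: real using hump_reflect[of "(t / e + 1) / 2"] by (simp add: field_simps)
 thus ?thesis by (simp add: rho_def)
qed

definition square :: "real => (real^2) set" where "square e = {x. \<bar>x $ 1\<bar> <= e \<and> \<bar>x $ 2\<bar> <= e}"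

lemma compact_square: "compact (square e)"
proof -
 have "closed (square e)" unfolding square_def by (intro closed_Collect_conj closed_Collect_le continuous_intros)
 moreover have "norm x <= e + e" if "x \<in> square e" for x using that norm_le_l1_cart[of x] by (auto simp: sum_2 square_def)
 hence "bounded (square e)" unfolding bounded_iff by blast
 ultimately show ?thesis by (simp add: compact_eq_bounded_closed)
qed

lemma square_norm: "x \<in> square e ==> norm x <= 2 * e" using norm_le_l1_cart[of x] by (auto simp: sum_2 square_def)

lemma rho_outside: "e > 0 ==> x \<notin> square e ==> rho e x = 0"
proof -
 assume e: "e > 0" and x: "x \<notin> square e"
 have "hump ((t / e + 1) / 2) = 0" if "\<bar>t\<bar> > e" for t
 proof -
  have "t / e >= 1 \<or> t / e <= -1" using that e by (auto simp: abs_if field_simps split: if_splits)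
  thus ?thesis
  proof
   assume "1 <= t / e" thus ?thesis by (intro hump_0(2)) simp
  next
   assume "t / e <= - 1" thus ?thesis by (intro hump_0(1)) simp
  qed
 qed
 thus ?thesis using x by (auto simp: square_def rho_def not_le)
qed

lemma smooth_cmult: "smooth f ==> smooth (%x. c * f x)" by (rule smooth_mult) simp

lemma smooth_rho: "smooth (rho e)"
proof -
 have "smooth (%x. hump ((1/2) + (1 / (2 * e)) * x $ i))" for i
  by (rule smooth_comp[OF Ck1_hump]) (intro smooth_add smooth_cmult smooth_nth smooth_const)
 hence "smooth (%x. hump ((1/2) + (1 / (2 * e)) * x $ 1) * hump ((1/2) + (1 / (2 * e)) * x $ 2))" by (intro smooth_mult)
 moreover have "(%x. hump ((1/2) + (1 / (2 * e)) * x $ 1) * hump ((1/2) + (1 / (2 * e)) * x $ 2)) = rho e"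
  by (simp add: fun_eq_iff rho_def add_divide_distrib add.commute mult.commute)
 ultimately show ?thesis by simp
qed

lemma rho_integrable: "e > 0 ==> integrable lborel (rho e)"
 by (rule compact_support_integrable[OF smooth_continuous[OF smooth_rho] compact_square[of e] rho_outside])

text \<open>A vanishing integral would make the kernel zero almost everywhere, but it is positive on
  an open square.\<close>

lemma rho_integral_pos: "e > 0 ==> (LINT x|lborel. rho e x) > 0"
proof -
 assume e: "e > 0"
 have "(LINT x|lborel. rho e x) \<noteq> 0"
 proof
  assume "(LINT x|lborel. rho e x) = 0"
  hence "AE x in lborel. rho e x = 0" using integral_nonneg_eq_0_iff_AE[OF rho_integrable[OF e]] rho_nonneg by simp
  hence "AE x in lborel. x \<notin> box (vec (-e)) (vec e :: real^2)"
  proof (rule eventually_mono)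
   fix x :: "real^2" assume elim: "rho e x = 0"
   have "rho e x > 0" if "x \<in> box (vec (-e)) (vec e)"
    using that e by (auto simp: rho_def mem_box_cart forall_2 field_simps intro!: mult_pos_pos hump_pos)
   thus "x \<notin> box (vec (-e)) (vec e)" using elim by auto
  qed
  hence "box (vec (-e)) (vec e :: real^2) \<in> null_sets lborel" by (subst (asm) AE_iff_null_sets[symmetric]) auto
  hence "negligible (box (vec (-e)) (vec e :: real^2))" by (simp add: negligible_iff_null_sets null_sets_completionI)
  moreover have "(0::real^2) \<in> box (vec (-e)) (vec e)" using e by (auto simp: mem_box_cart)
  ultimately show False using open_not_negligible[OF open_box] by blast
 qed
 moreover have "(LINT x|lborel. rho e x) >= 0" by (simp add: rho_nonneg)
 ultimately show ?thesis by simp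
qed

definition eta :: "real => real^2 => real" where
 "eta e x = 1 / (LINT x|lborel. rho e x) * rho e x"

lemma smooth_eta: "smooth (eta e)" unfolding eta_def by (rule smooth_cmult[OF smooth_rho])
lemma eta_nonneg: "e > 0 ==> eta e x >= 0" using rho_nonneg rho_integral_pos by (simp add: eta_def less_imp_le)
lemma eta_minus: "eta e (- x) = eta e x" by (simp add: eta_def rho_minus)
lemma eta_commute: "eta e (x - y) = eta e (y - x)" by (metis eta_minus minus_diff_eq)
lemma eta_outside: "e > 0 ==> x \<notin> square e ==> eta e x = 0" by (simp add: eta_def rho_outside)
lemma eta_integrable: "e > 0 ==> integrable lborel (eta e)" unfolding eta_def using rho_integrable by simp
lemma eta_integral: "e > 0 ==> (LINT x|lborel. eta e x) = 1" unfolding eta_def using rho_integral_pos[of e] by simp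
lemma eta_measurable[measurable]: "eta e \<in> borel_measurable borel" by (rule borel_measurable_continuous_onI[OF smooth_continuous[OF smooth_eta]])

lemma compact_support_bounded:
 fixes f :: "real^2 => real"
 assumes "continuous_on UNIV f" "compact K" "\<And>x. x \<notin> K ==> f x = 0"
 obtains B where "B >= 0" "\<And>x. \<bar>f x\<bar> <= B"
proof -
 have "compact (f ` K)" using assms(1,2) by (meson compact_continuous_image continuous_on_subset subset_UNIV)
 then obtain B where B: "\<And>x. x \<in> K ==> \<bar>f x\<bar> <= B" using compact_imp_bounded bounded_iff by (metis imageI real_norm_def)
 show ?thesis
 proof (rule that[of "\<bar>B\<bar>"])
  fix x show "\<bar>f x\<bar> <= \<bar>B\<bar>" by (cases "x \<in> K") (use B[of x] assms(3)[of x] in auto)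
 qed simp
qed

lemma lborel_nn_shift:
 fixes g :: "real^2 => ennreal"
 assumes [measurable]: "g \<in> borel_measurable borel"
 shows "(\<integral>\<^sup>+x. g (x - y) \<partial>lborel) = (\<integral>\<^sup>+x. g x \<partial>lborel)"
proof -
 have "(\<integral>\<^sup>+x. g x \<partial>lborel) = (\<integral>\<^sup>+x. g x \<partial>distr lborel borel ((+) (- y)))" by (simp add: lborel_distr_plus)
 also have "\<dots> = (\<integral>\<^sup>+x. g (- y + x) \<partial>lborel)" by (subst nn_integral_distr) auto
 finally show ?thesis by (simp add: add.commute)
qed

lemma eta_nn_integral: "e > 0 ==> (\<integral>\<^sup>+x. ennreal (eta e (x - y)) \<partial>lborel) = 1"
 using lborel_nn_shift[of "%x. ennreal (eta e x)" y] nn_integral_eq_integral[OF eta_integrable, of e] by (simp add: eta_nonneg eta_integral)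

text \<open>The integral is over \<open>lebesgue\<close> because weak derivatives are only Lebesgue
  measurable; \<open>conv_lborel\<close> returns to Borel functions where Tonelli is
  applied.\<close>

definition conv :: "(real^2 => real) => (real^2 => real) => real^2 => real" where
 "conv k f x = (LINT y|lebesgue. f y * k (x - y))"

lemma integrable_mult_kernel:
 assumes f: "integrable lebesgue (f :: real^2 => real)" and k: "continuous_on UNIV k" "\<And>x. \<bar>k x\<bar> <= B"
 shows "integrable lebesgue (%y. f y * k (x - y))"
proof (rule lint_bound[of _ "%y. B * f y"])
 have "continuous_on UNIV (%y. k (x - y))" by (rule continuous_on_compose2[OF k(1)]) (auto intro!: continuous_intros)
 hence "(%y. k (x - y)) \<in> borel_measurable lebesgue" by (simp add: borel_measurable_continuous_onI measurable_completion)
 thus "(%y. f y * k (x - y)) \<in> borel_measurable lebesgue" using f by auto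
 have "\<bar>f y * k (x - y)\<bar> <= \<bar>B * f y\<bar>" for y
  using mult_mono[OF k(2)[of "x - y"] order_refl[of "\<bar>f y\<bar>"]] k(2)[of 0] by (simp add: abs_mult mult.commute)
 thus "AE y in lebesgue. norm (f y * k (x - y)) <= norm (B * f y)" by simp
qed (use f in simp)

text \<open>The kernel obeys Taylor's estimate with remainder \<open>L * (norm h)^2\<close>,
  uniformly in the point. Integrating this against the absolute value of f bounds the remainder of
  the convolution, so all derivatives fall on the kernel.\<close>

lemma conv_has_derivative:
 assumes f: "integrable lebesgue f" and k: "smooth k" "compact K" "\<And>x. x \<notin> K ==> k x = 0"
 shows "(conv k f has_derivative (%h. \<Sum>i\<in>UNIV. conv (pd i k) f x * h $ i)) (at x)"
proof -
 have out: "pd i k z = 0" if "z \<notin> K" for i z using pderiv_dir_outside[of K k z] k that compact_imp_closed by blast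
 have out2: "pd j (pd i k) z = 0" if "z \<notin> K" for i j z using pderiv_dir_outside[of K "pd i k" z] out that compact_imp_closed k(2) by blast
 have sm: "smooth (pd i k)" "smooth (pd j (pd i k))" for i j using k(1) smooth_pderiv by blast+
 have "\<exists>B\<ge>0. \<forall>z. \<bar>pd j (pd i k) z\<bar> <= B" for i j
  using compact_support_bounded[OF smooth_continuous[OF sm(2)] k(2) out2] by metis
 hence "\<forall>i j. \<exists>B. B >= 0 \<and> (\<forall>z. \<bar>pd j (pd i k) z\<bar> <= B)" by blast
 moreover define BB where "BB i j = (SOME B. B >= 0 \<and> (\<forall>z. \<bar>pd j (pd i k) z\<bar> <= B))" for i j
 ultimately have "\<forall>i j. BB i j >= 0 \<and> (\<forall>z. \<bar>pd j (pd i k) z\<bar> <= BB i j)"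
  unfolding BB_def by (intro allI) (rule someI_ex, blast)
 hence BB: "\<And>i j. BB i j >= 0" "\<And>i j z. \<bar>pd j (pd i k) z\<bar> <= BB i j" by blast+
 define L where "L = (\<Sum>i\<in>UNIV. \<Sum>j\<in>UNIV. BB i j)"
 have L0: "L >= 0" unfolding L_def by (intro sum_nonneg BB)
 have lip: "\<bar>pd i k z - pd i k w\<bar> <= (\<Sum>j\<in>UNIV. BB i j) * norm (z - w)" for i z w
 proof -
  have "norm (pd i k z - pd i k w) <= (\<Sum>j\<in>UNIV. BB i j) * norm (z - w)"
  proof (rule differentiable_bound[of UNIV _ "%z h. \<Sum>j\<in>UNIV. pd j (pd i k) z * h $ j"])
   fix z :: "real^2"
   show "(pd i k has_derivative (%h. \<Sum>j\<in>UNIV. pd j (pd i k) z * h $ j)) (at z within UNIV)" using smooth_has_derivative[OF sm(1)] by simp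
   show "onorm (%h. \<Sum>j\<in>UNIV. pd j (pd i k) z * h $ j) <= (\<Sum>j\<in>UNIV. BB i j)"
   proof (rule onorm_le)
    fix h :: "real^2"
    have "norm (\<Sum>j\<in>UNIV. pd j (pd i k) z * h $ j) <= (\<Sum>j\<in>UNIV. BB i j * norm h)"
     by (rule sum_norm_le) (auto simp: abs_mult intro!: mult_mono BB component_le_norm_cart)
    thus "norm (\<Sum>j\<in>UNIV. pd j (pd i k) z * h $ j) <= (\<Sum>j\<in>UNIV. BB i j) * norm h" by (simp add: sum_distrib_right)
   qed
  qed auto
  thus ?thesis by simp
 qed
 have taylor: "\<bar>k (z + h) - k z - (\<Sum>i\<in>UNIV. pd i k z * h $ i)\<bar> <= L * (norm h)\<^sup>2" for z h
 proof -
  let ?S = "closed_segment z (z + h)"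
  have "norm (k (z + h) - k z - (\<Sum>i\<in>UNIV. pd i k z * ((z + h) - z) $ i)) <= norm ((z + h) - z) * (L * norm h)"
  proof (rule differentiable_bound_linearization[of z "z + h" ?S k "%z h. \<Sum>i\<in>UNIV. pd i k z * h $ i" z "L * norm h"])
   fix t :: real assume "t \<in> {0..1}"
   thus "z + t *\<^sub>R (z + h - z) \<in> ?S" by (auto simp: in_segment algebra_simps intro!: exI[of _ t])
  next
   fix w assume "w \<in> ?S"
   show "(k has_derivative (%h. \<Sum>i\<in>UNIV. pd i k w * h $ i)) (at w within ?S)"
    using smooth_has_derivative[OF k(1)] has_derivative_at_withinI by blast
   have wz: "norm (w - z) <= norm h" using \<open>w \<in> ?S\<close> segment_bound1[of w z "z + h"] by (simp add: norm_minus_commute)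
   have "onorm (%h'. \<Sum>i\<in>UNIV. (pd i k w - pd i k z) * h' $ i) <= L * norm h"
   proof (rule onorm_le)
    fix h' :: "real^2"
    have "norm (\<Sum>i\<in>UNIV. (pd i k w - pd i k z) * h' $ i) <= (\<Sum>i\<in>UNIV. ((\<Sum>j\<in>UNIV. BB i j) * norm h) * norm h')"
    proof (rule sum_norm_le)
     fix i :: 2
     have "\<bar>pd i k w - pd i k z\<bar> <= (\<Sum>j\<in>UNIV. BB i j) * norm h"
      using lip[of i w z] mult_left_mono[OF wz, of "\<Sum>j\<in>UNIV. BB i j"] sum_nonneg[of UNIV "BB i"] BB(1) by fastforce
     thus "norm ((pd i k w - pd i k z) * h' $ i) <= ((\<Sum>j\<in>UNIV. BB i j) * norm h) * norm h'"
      by (auto simp: abs_mult intro!: mult_mono component_le_norm_cart mult_nonneg_nonneg sum_nonneg BB)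
    qed
    thus "norm (\<Sum>i\<in>UNIV. (pd i k w - pd i k z) * h' $ i) <= L * norm h * norm h'" by (simp add: L_def sum_distrib_right)
   qed
   moreover have "(%h. \<Sum>i\<in>UNIV. pd i k w * h $ i) - (%h. \<Sum>i\<in>UNIV. pd i k z * h $ i)
     = (%h'. \<Sum>i\<in>UNIV. (pd i k w - pd i k z) * h' $ i)" by (simp add: fun_eq_iff sum_2 algebra_simps)
   ultimately show "onorm ((%h. \<Sum>i\<in>UNIV. pd i k w * h $ i) - (%h. \<Sum>i\<in>UNIV. pd i k z * h $ i)) <= L * norm h" by simp
  qed auto
  thus ?thesis by (simp add: power2_eq_square mult_ac)
 qed
 obtain B0 where B0: "\<And>x. \<bar>k x\<bar> <= B0" using compact_support_bounded[OF smooth_continuous[OF k(1)] k(2,3)] by metis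
 have "\<exists>B. \<forall>z. \<bar>pd i k z\<bar> <= B" for i using compact_support_bounded[OF smooth_continuous[OF sm(1)] k(2) out] by metis
 then obtain B1 where B1: "\<And>i z. \<bar>pd i k z\<bar> <= B1 i" by metis
 note i0 = integrable_mult_kernel[OF f smooth_continuous[OF k(1)] B0]
 note i1 = integrable_mult_kernel[OF f smooth_continuous[OF sm(1)] B1]
 define A where "A = (LINT y|lebesgue. \<bar>f y\<bar>)"
 have est: "\<bar>conv k f (x + h) - conv k f x - (\<Sum>i\<in>UNIV. conv (pd i k) f x * h $ i)\<bar> <= (A * L) * (norm h)\<^sup>2" for h
 proof -
  have "conv k f (x + h) - conv k f x - (\<Sum>i\<in>UNIV. conv (pd i k) f x * h $ i)
    = (LINT y|lebesgue. f y * k (x + h - y) - f y * k (x - y) - (f y * pd 1 k (x - y) * h $ 1 + f y * pd 2 k (x - y) * h $ 2))"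
   unfolding conv_def sum_2 using i0 i1 by simp
  also have "\<bar>\<dots>\<bar> <= (LINT y|lebesgue. \<bar>f y\<bar> * (L * (norm h)\<^sup>2))"
  proof (rule order_trans[OF integral_abs_bound integral_mono])
   show "integrable lebesgue (%y. \<bar>f y * k (x + h - y) - f y * k (x - y) - (f y * pd 1 k (x - y) * h $ 1 + f y * pd 2 k (x - y) * h $ 2)\<bar>)"
    using i0 i1 by (intro integrable_abs lint_diff_int lint_add_int integrable_mult_left)
   show "integrable lebesgue (%y. \<bar>f y\<bar> * (L * (norm h)\<^sup>2))" using f by simp
   fix y
   have "f y * k (x + h - y) - f y * k (x - y) - (f y * pd 1 k (x - y) * h $ 1 + f y * pd 2 k (x - y) * h $ 2)
    = f y * (k ((x - y) + h) - k (x - y) - (\<Sum>i\<in>UNIV. pd i k (x - y) * h $ i))" by (simp add: sum_2 algebra_simps)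
   moreover have "\<bar>f y * (k ((x - y) + h) - k (x - y) - (\<Sum>i\<in>UNIV. pd i k (x - y) * h $ i))\<bar> <= \<bar>f y\<bar> * (L * (norm h)\<^sup>2)"
    unfolding abs_mult by (rule mult_left_mono[OF taylor]) simp
   ultimately show "\<bar>f y * k (x + h - y) - f y * k (x - y) - (f y * pd 1 k (x - y) * h $ 1 + f y * pd 2 k (x - y) * h $ 2)\<bar> <= \<bar>f y\<bar> * (L * (norm h)\<^sup>2)"
    by (simp only:)
  qed
  also have "\<dots> = (A * L) * (norm h)\<^sup>2" by (simp add: A_def)
  finally show ?thesis .
 qed
 show ?thesis unfolding has_derivative_iff_norm
 proof
  show "bounded_linear (%h. \<Sum>i\<in>UNIV. conv (pd i k) f x * h $ i)"
   by (intro bounded_linear_sum bounded_linear_mult_right bounded_linear_compose[OF bounded_linear_mult_right bounded_linear_vec_nth])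
  have "((%y. (A * L) * norm (y - x)) \<longlongrightarrow> (A * L) * norm (x - x)) (at x)" by (intro tendsto_intros)
  hence lim: "((%y. (A * L) * norm (y - x)) \<longlongrightarrow> 0) (at x)" by simp
  show "((%y. norm (conv k f y - conv k f x - (\<Sum>i\<in>UNIV. conv (pd i k) f x * (y - x) $ i)) / norm (y - x)) \<longlongrightarrow> 0) (at x)"
  proof (rule tendsto_sandwich[OF _ _ tendsto_const lim])
   show "\<forall>\<^sub>F y in at x. norm (conv k f y - conv k f x - (\<Sum>i\<in>UNIV. conv (pd i k) f x * (y - x) $ i)) / norm (y - x) <= (A * L) * norm (y - x)"
    unfolding eventually_at_filter
   proof (intro always_eventually allI impI)
    fix y assume "y \<noteq> x"
    thus "norm (conv k f y - conv k f x - (\<Sum>i\<in>UNIV. conv (pd i k) f x * (y - x) $ i)) / norm (y - x) <= (A * L) * norm (y - x)"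
     using est[of "y - x"] by (simp add: divide_le_eq power2_eq_square mult.assoc)
   qed
  qed (auto simp: eventually_at_filter)
 qed
qed

section \<open>Convergence of mollifications\<close>

lemma power_sum_bound: "0 <= a ==> 0 <= b ==> (a + b) ^ p <= 2 ^ p * (a ^ p + (b::real) ^ p)"
proof -
 assume ab: "0 <= a" "0 <= b"
 have "(a + b) ^ p <= (2 * max a b) ^ p" using ab by (intro power_mono) auto
 also have "\<dots> = 2 ^ p * max a b ^ p" by (simp add: power_mult_distrib)
 also have "max a b ^ p <= a ^ p + b ^ p" using ab by (auto simp: max_def)
 finally show ?thesis by simp
qed

lemma conv_lborel:
 assumes [measurable]: "f \<in> borel_measurable borel" "k \<in> borel_measurable borel"
 shows "conv k f x = (LINT y|lborel. f y * k (x - y))" unfolding conv_def by (intro integral_completion) measurable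

text \<open>Jensen's inequality for the probability density \<open>eta e\<close>. For p = 2 it is
  the Cauchy-Schwarz inequality with one factor \<open>sqrt (eta e (x - y))\<close> on each
  side.\<close>

lemma conv_eta_pointwise:
 assumes e: "e > 0" and p: "p = 1 \<or> p = 2" and [measurable]: "f \<in> borel_measurable borel"
  and f: "integrable lborel f" "integrable lborel (%x. \<bar>f x\<bar> ^ p)"
 shows "ennreal (\<bar>conv (eta e) f x\<bar> ^ p) <= (\<integral>\<^sup>+y. ennreal (\<bar>f y\<bar> ^ p * eta e (x - y)) \<partial>lborel)"
proof -
 obtain B where B: "\<And>x. \<bar>eta e x\<bar> <= B"
  using compact_support_bounded[OF smooth_continuous[OF smooth_eta] compact_square[of e] eta_outside[OF e]] by metis
 have ik: "integrable lborel (%y. g y * eta e (x - y))" if "integrable lborel g" for g :: "real^2 => real"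
 proof -
  have "integrable lebesgue g" using that by (simp add: integrable_completion)
  from integrable_mult_kernel[OF this smooth_continuous[OF smooth_eta] B] that
  show ?thesis by (subst (asm) integrable_completion) auto
 qed
 note ip = ik[OF f(2)]
 have "\<bar>conv (eta e) f x\<bar> ^ p <= (LINT y|lborel. \<bar>f y\<bar> ^ p * eta e (x - y))"
 proof (cases "p = 1")
  case True
  have "\<bar>conv (eta e) f x\<bar> <= (LINT y|lborel. \<bar>f y * eta e (x - y)\<bar>)" by (subst conv_lborel) (auto intro: integral_abs_bound)
  thus ?thesis using True eta_nonneg[OF e] by (simp add: abs_mult)
 next
  case False
  hence p2: "p = 2" using p by simp
  define a where "a = (%y. f y * sqrt (eta e (x - y)))"
  define b where "b = (%y. sqrt (eta e (x - y)))"
  have a2: "(a y)\<^sup>2 = \<bar>f y\<bar> ^ p * eta e (x - y)" and b2: "(b y)\<^sup>2 = eta e (x - y)" and ab: "a y * b y = f y * eta e (x - y)" for y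
   using eta_nonneg[OF e] p2 by (auto simp: a_def b_def power_mult_distrib)
  have [measurable]: "a \<in> borel_measurable borel" "b \<in> borel_measurable borel" unfolding a_def b_def by measurable
  have e1: "(\<integral>\<^sup>+y. ennreal (eta e (x - y)) \<partial>lborel) = 1" using eta_nn_integral[OF e, of x] by (simp add: eta_commute[of e x])
  have ie: "integrable lborel (%y. eta e (x - y))" by (rule integrableI_nonneg) (use e1 eta_nonneg[OF e] in auto)
  have I1: "(LINT y|lborel. eta e (x - y)) = 1" using nn_integral_eq_integral[OF ie] e1 eta_nonneg[OF e] by simp
  have "\<bar>LINT y|lborel. a y * b y\<bar> <= sqrt (LINT y|lborel. (a y)\<^sup>2) * sqrt (LINT y|lborel. (b y)\<^sup>2)"
   by (rule Cauchy_Schwarz_integral) (use ip ie in \<open>auto simp: a2 b2\<close>)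
  hence "\<bar>conv (eta e) f x\<bar> <= sqrt (LINT y|lborel. \<bar>f y\<bar> ^ p * eta e (x - y))" by (simp add: a2 b2 ab I1 conv_lborel)
  moreover have "(LINT y|lborel. \<bar>f y\<bar> ^ p * eta e (x - y)) >= 0" using eta_nonneg[OF e] by (intro lint_nonneg) simp
  ultimately show ?thesis using p2 power_mono[of "\<bar>conv (eta e) f x\<bar>" _ 2] by fastforce
 qed
 thus ?thesis using nn_integral_eq_integral[OF ip] eta_nonneg[OF e] by (simp add: ennreal_leI)
qed

text \<open>Tonelli puts the outer integral on the kernel, whose mass is 1.\<close>

lemma conv_eta_contract:
 assumes e: "e > 0" and p: "p = 1 \<or> p = 2" and m[measurable]: "f \<in> borel_measurable borel"
  and f: "integrable lborel f" "integrable lborel (%x. \<bar>f x\<bar> ^ p)"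
 shows "(\<integral>\<^sup>+x. ennreal (\<bar>conv (eta e) f x\<bar> ^ p) \<partial>lborel) <= (\<integral>\<^sup>+x. ennreal (\<bar>f x\<bar> ^ p) \<partial>lborel)"
proof -
 have "(\<integral>\<^sup>+x. ennreal (\<bar>conv (eta e) f x\<bar> ^ p) \<partial>lborel) <= (\<integral>\<^sup>+x. \<integral>\<^sup>+y. ennreal (\<bar>f y\<bar> ^ p * eta e (x - y)) \<partial>lborel \<partial>lborel)"
  by (intro nn_integral_mono conv_eta_pointwise[OF e p m f])
 also have "\<dots> = (\<integral>\<^sup>+y. \<integral>\<^sup>+x. ennreal (\<bar>f y\<bar> ^ p * eta e (x - y)) \<partial>lborel \<partial>lborel)"
  by (rule lborel_pair.Fubini') measurable
 also have "\<dots> = (\<integral>\<^sup>+y. ennreal (\<bar>f y\<bar> ^ p) * (\<integral>\<^sup>+x. ennreal (eta e (x - y)) \<partial>lborel) \<partial>lborel)"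
  using eta_nonneg[OF e] by (intro nn_integral_cong) (simp add: ennreal_mult nn_integral_cmult)
 also have "\<dots> = (\<integral>\<^sup>+x. ennreal (\<bar>f x\<bar> ^ p) \<partial>lborel)" by (simp add: eta_nn_integral[OF e])
 finally show ?thesis .
qed

text \<open>The function is truncated in size and in space. The truncation is an almost everywhere
  limit of continuous functions, and clamping these to the same bound and to a slightly larger ball
  makes dominated convergence applicable.\<close>

lemma continuous_dense:
 fixes f :: "real^2 => real"
 assumes p: "p > 0" and m[measurable]: "f \<in> borel_measurable borel"
  and f: "integrable lborel (%x. \<bar>f x\<bar> ^ p)" and d: "d > 0"
 shows "\<exists>g R. continuous_on UNIV g \<and> R > 0 \<and> (\<forall>x. x \<notin> cball 0 R \<longrightarrow> g x = 0) \<and>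
  integrable lborel (%x. \<bar>f x - g x\<bar> ^ p) \<and> (LINT x|lborel. \<bar>f x - g x\<bar> ^ p) < d"
proof -
 \<comment> \<open>There are two errors, each multiplied by the \<open>2 ^ p\<close> of
   \<open>power_sum_bound\<close>.\<close>
 define d' where "d' = d / (2 * 2 ^ p)"
 have d': "d' > 0" using d by (simp add: d'_def)
 define F where "F = (%n::nat. %x. if norm x <= real n \<and> \<bar>f x\<bar> <= real n then f x else 0)"
 have Fm[measurable]: "F n \<in> borel_measurable borel" for n unfolding F_def by measurable
 have "(%n. LINT x|lborel. \<bar>f x - F n x\<bar> ^ p) \<longlonglongrightarrow> (LINT x|(lborel :: (real^2) measure). (0::real))"
 proof (rule integral_dominated_convergence[where w = "%x. \<bar>f x\<bar> ^ p"])
  show "integrable lborel (%x. \<bar>f x\<bar> ^ p)" by (rule f)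
  show "AE x in lborel. (%n. \<bar>f x - F n x\<bar> ^ p) \<longlonglongrightarrow> 0"
  proof (rule AE_I2)
   fix x
   have "\<forall>\<^sub>F n in sequentially. \<bar>f x - F n x\<bar> ^ p = 0"
    using eventually_ge_at_top[of "nat \<lceil>max (norm x) \<bar>f x\<bar>\<rceil>"]
   proof eventually_elim
    case (elim n)
    hence "max (norm x) \<bar>f x\<bar> <= real n" by linarith
    thus ?case using p by (simp add: F_def)
   qed
   thus "(%n. \<bar>f x - F n x\<bar> ^ p) \<longlonglongrightarrow> 0" by (rule tendsto_eventually)
  qed
  show "AE x in lborel. norm (\<bar>f x - F n x\<bar> ^ p) <= \<bar>f x\<bar> ^ p" for n using p by (auto simp: F_def)
 qed auto
 hence "\<forall>\<^sub>F n in sequentially. (LINT x|lborel. \<bar>f x - F n x\<bar> ^ p) < d'" using d' by (intro order_tendstoD) auto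
 then obtain n where n: "(LINT x|lborel. \<bar>f x - F n x\<bar> ^ p) < d'" "n > 0"
  by (metis (mono_tags, lifting) eventually_sequentially gt_ex le_trans less_imp_le_nat not_less_zero nat_neq_iff zero_le linorder_not_le)
 have i1: "integrable lborel (%x. \<bar>f x - F n x\<bar> ^ p)" by (rule lint_bound[OF f]) (use p in \<open>auto simp: F_def\<close>)
 have "F n \<in> borel_measurable (lebesgue_on UNIV)" using Fm[of n] by (simp add: measurable_completion lebesgue_on_UNIV_eq)
 hence "F n measurable_on UNIV" by (subst measurable_on_iff_borel_measurable) auto
 then obtain N g where N: "negligible N" "\<And>k. continuous_on UNIV (g k)" "\<And>x. x \<notin> N ==> (%k. g k x) \<longlonglongrightarrow> F n x"
  unfolding measurable_on_def by auto
 define cut where "cut = (%x::real^2. max 0 (min 1 (real n + 1 - norm x)))"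
 define G where "G = (%k x. cut x * max (- real n) (min (real n) (g k x)))"
 have cG: "continuous_on UNIV (G k)" for k unfolding G_def cut_def by (intro continuous_intros N(2))
 have [measurable]: "G k \<in> borel_measurable borel" for k using cG by (rule borel_measurable_continuous_onI)
 have G0: "G k x = 0" if "x \<notin> cball 0 (real n + 1)" for k x using that by (simp add: G_def cut_def)
 have cb: "0 <= cut x" "cut x <= 1" for x by (auto simp: cut_def)
 have Gb: "\<bar>G k x\<bar> <= real n" for k x
 proof -
  have "\<bar>G k x\<bar> <= 1 * real n" unfolding G_def abs_mult using cb[of x] by (intro mult_mono) auto
  thus ?thesis by simp
 qed
 have F0: "F n x = 0" if "x \<notin> cball 0 (real n + 1)" for x using that by (simp add: F_def)
 have Fb: "\<bar>F n x\<bar> <= real n" for x by (simp add: F_def)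
 have dom: "\<bar>F n x - G k x\<bar> ^ p <= (2 * real n) ^ p * ind (cball 0 (real n + 1)) x" for k x
 proof (cases "x \<in> cball 0 (real n + 1)")
  case True
  have "\<bar>F n x - G k x\<bar> <= 2 * real n" using Fb[of x] Gb[of k x] by linarith
  hence "\<bar>F n x - G k x\<bar> ^ p <= (2 * real n) ^ p" by (intro power_mono) auto
  thus ?thesis using True by simp
 next
  case False
  hence "F n x - G k x = 0" using F0[of x] G0[of x k] by auto
  thus ?thesis using p False by (simp add: zero_power)
 qed
 have wi: "integrable lborel (%x::real^2. (2 * real n) ^ p * ind (cball 0 (real n + 1)) x)"
  by (intro integrable_mult_right integrable_real_indicator emeasure_bounded_finite) auto
 have i2: "integrable lborel (%x. \<bar>F n x - G k x\<bar> ^ p)" for k by (rule lint_bound[OF wi]) (use dom in \<open>auto\<close>)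
 have "(%k. LINT x|lborel. \<bar>F n x - G k x\<bar> ^ p) \<longlonglongrightarrow> (LINT x|(lborel :: (real^2) measure). (0::real))"
 proof (rule integral_dominated_convergence[where w = "%x. (2 * real n) ^ p * ind (cball 0 (real n + 1)) x"])
  show "integrable lborel (%x::real^2. (2 * real n) ^ p * ind (cball 0 (real n + 1)) x)" by (rule wi)
  have "AE x in lebesgue. x \<notin> N" using N(1) by (simp add: AE_not_in negligible_iff_null_sets)
  hence "AE x in lborel. x \<notin> N" by (simp add: AE_completion_iff)
  thus "AE x in lborel. (%k. \<bar>F n x - G k x\<bar> ^ p) \<longlonglongrightarrow> 0"
  proof (rule eventually_mono)
   fix x assume "x \<notin> N"
   hence "(%k. \<bar>F n x - G k x\<bar> ^ p) \<longlonglongrightarrow> \<bar>F n x - cut x * max (- real n) (min (real n) (F n x))\<bar> ^ p"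
    unfolding G_def by (intro tendsto_intros N(3))
   moreover have "cut x * max (- real n) (min (real n) (F n x)) = F n x" using Fb[of x] by (auto simp: cut_def F_def)
   moreover have "\<bar>F n x - F n x\<bar> ^ p = 0" using p by (simp add: zero_power)
   ultimately show "(%k. \<bar>F n x - G k x\<bar> ^ p) \<longlonglongrightarrow> 0" by metis
  qed
  show "AE x in lborel. norm (\<bar>F n x - G k x\<bar> ^ p) <= (2 * real n) ^ p * ind (cball 0 (real n + 1)) x" for k using dom by simp
 qed auto
 hence "\<forall>\<^sub>F k in sequentially. (LINT x|lborel. \<bar>F n x - G k x\<bar> ^ p) < d'" using d' by (intro order_tendstoD) auto
 then obtain k where k: "(LINT x|lborel. \<bar>F n x - G k x\<bar> ^ p) < d'" by (auto simp: eventually_sequentially)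
 have pb: "\<bar>f x - G k x\<bar> ^ p <= 2 ^ p * (\<bar>f x - F n x\<bar> ^ p + \<bar>F n x - G k x\<bar> ^ p)" for x
 proof -
  have "\<bar>f x - G k x\<bar> ^ p <= (\<bar>f x - F n x\<bar> + \<bar>F n x - G k x\<bar>) ^ p" by (intro power_mono) auto
  also have "\<dots> <= 2 ^ p * (\<bar>f x - F n x\<bar> ^ p + \<bar>F n x - G k x\<bar> ^ p)" by (rule power_sum_bound) auto
  finally show ?thesis .
 qed
 have i3: "integrable lborel (%x. 2 ^ p * (\<bar>f x - F n x\<bar> ^ p + \<bar>F n x - G k x\<bar> ^ p))"
  by (intro integrable_mult_right lint_add_int i1 i2)
 have i4: "integrable lborel (%x. \<bar>f x - G k x\<bar> ^ p)" by (rule lint_bound[OF i3]) (use pb in \<open>auto\<close>)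
 have "(LINT x|lborel. \<bar>f x - G k x\<bar> ^ p) <= (LINT x|lborel. 2 ^ p * (\<bar>f x - F n x\<bar> ^ p + \<bar>F n x - G k x\<bar> ^ p))"
  by (rule integral_mono[OF i4 i3 pb])
 also have "\<dots> = 2 ^ p * ((LINT x|lborel. \<bar>f x - F n x\<bar> ^ p) + (LINT x|lborel. \<bar>F n x - G k x\<bar> ^ p))" using i1 i2 by simp
 also have "\<dots> < 2 ^ p * (d' + d')" using n k by (intro mult_strict_left_mono) auto
 also have "\<dots> = d" by (simp add: d'_def)
 finally show ?thesis using cG G0 i4 by (intro exI[of _ "G k"] exI[of _ "real n + 1"] conjI allI impI) auto
qed

lemma conv_eta_continuous_convergence:
 assumes g: "continuous_on UNIV g" "R > 0" "\<And>x. x \<notin> cball 0 R ==> g x = (0::real)" and d: "d > 0"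
 shows "\<forall>\<^sub>F e in at_right 0. \<forall>x. \<bar>conv (eta e) g x - g x\<bar> <= d * ind (cball 0 (R + 2)) x"
proof -
 have [measurable]: "g \<in> borel_measurable borel" using g(1) by (rule borel_measurable_continuous_onI)
 \<comment> \<open>x runs over the ball of radius R + 2, outside which both functions vanish, and
   the kernel reaches less than 2 further.\<close>
 have "uniformly_continuous_on (cball 0 (R + 4)) g" by (rule compact_uniformly_continuous) (use g(1) continuous_on_subset in auto)
 then obtain r where r: "r > 0" "\<And>x y. x \<in> cball 0 (R + 4) ==> y \<in> cball 0 (R + 4) ==> dist y x < r ==> dist (g y) (g x) < d"
  using d unfolding uniformly_continuous_on_def by metis
 have "\<forall>\<^sub>F e in at_right 0. e < min 1 (r / 2) \<and> e > (0::real)"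
  using r(1) by (intro eventually_conj eventually_at_right_less) (auto simp: eventually_at_right_field intro!: exI[of _ "min 1 (r/2)"])
 thus ?thesis
 proof eventually_elim
  case (elim e)
  hence e: "e > 0" "e < 1" "2 * e < r" by auto
  have ig: "integrable lebesgue g" using compact_support_integrable[OF g(1) compact_cball[of 0 R] g(3)] by (subst integrable_completion) auto
  obtain B where B: "\<And>x. \<bar>eta e x\<bar> <= B"
   using compact_support_bounded[OF smooth_continuous[OF smooth_eta] compact_square[of e] eta_outside[OF e(1)]] by metis
  show ?case
  proof
   fix x
   have e1: "(\<integral>\<^sup>+y. ennreal (eta e (x - y)) \<partial>lborel) = 1"
    using eta_nn_integral[OF e(1), of x] by (simp add: eta_commute[of e x])
   have ie: "integrable lborel (%y. eta e (x - y))" by (rule integrableI_nonneg) (use e1 eta_nonneg[OF e(1)] in auto)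
   have I1: "(LINT y|lborel. eta e (x - y)) = 1" using nn_integral_eq_integral[OF ie] e1 eta_nonneg[OF e(1)] by simp
   have i1: "integrable lborel (%y. g y * eta e (x - y))"
    using integrable_mult_kernel[OF ig smooth_continuous[OF smooth_eta] B] by (subst (asm) integrable_completion) auto
   have "conv (eta e) g x - g x = (LINT y|lborel. g y * eta e (x - y) - g x * eta e (x - y))" using i1 ie by (simp add: conv_lborel I1)
   also have "\<bar>\<dots>\<bar> <= (LINT y|lborel. (d * ind (cball 0 (R + 2)) x) * eta e (x - y))"
   proof (rule order_trans[OF integral_abs_bound integral_mono])
    show "integrable lborel (%y. \<bar>g y * eta e (x - y) - g x * eta e (x - y)\<bar>)" using i1 ie by simp
    show "integrable lborel (%y. d * ind (cball 0 (R + 2)) x * eta e (x - y))" using ie by simp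
    fix y
    have "\<bar>g y - g x\<bar> <= d * ind (cball 0 (R + 2)) x" if "x - y \<in> square e"
    proof -
     have xy: "norm (x - y) <= 2 * e" using square_norm[OF that] .
     show ?thesis
     proof (cases "x \<in> cball 0 (R + 2)")
      case True
      have "norm y <= norm x + norm (x - y)" using norm_triangle_ineq[of x "y - x"] by (simp add: norm_minus_commute)
      hence "y \<in> cball 0 (R + 4)" "x \<in> cball 0 (R + 4)" "dist y x < r" using True xy e by (auto simp: dist_norm norm_minus_commute)
      hence "dist (g y) (g x) < d" using r(2) by blast
      thus ?thesis using True by (simp add: dist_norm)
     next
      case False
      have "norm x <= norm y + norm (x - y)" using norm_triangle_ineq[of y "x - y"] by simp
      hence "y \<notin> cball 0 R" "x \<notin> cball 0 R" using False xy e by auto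
      thus ?thesis using g(3) d by simp
     qed
    qed
    hence "\<bar>g y - g x\<bar> * eta e (x - y) <= d * ind (cball 0 (R + 2)) x * eta e (x - y)"
     using eta_outside[OF e(1), of "x - y"] eta_nonneg[OF e(1), of "x - y"] by (cases "x - y \<in> square e") (auto intro: mult_right_mono)
    moreover have "g y * eta e (x - y) - g x * eta e (x - y) = (g y - g x) * eta e (x - y)" by (simp add: algebra_simps)
    ultimately show "\<bar>g y * eta e (x - y) - g x * eta e (x - y)\<bar> <= d * ind (cball 0 (R + 2)) x * eta e (x - y)"
     using eta_nonneg[OF e(1), of "x - y"] by (simp add: abs_mult)
   qed
   also have "\<dots> = d * ind (cball 0 (R + 2)) x" by (simp add: I1)
   finally show "\<bar>conv (eta e) g x - g x\<bar> <= d * ind (cball 0 (R + 2)) x" .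
  qed
 qed
qed

lemma conv_eta_measurable:
 assumes e: "e > 0" and f: "integrable lebesgue f" shows "conv (eta e) f \<in> borel_measurable borel"
proof (rule borel_measurable_continuous_onI, intro continuous_at_imp_continuous_on ballI)
 fix x show "isCont (conv (eta e) f) x" using has_derivative_continuous[OF conv_has_derivative[OF f smooth_eta compact_square eta_outside[OF e]]] .
qed

lemma conv_diff:
 assumes "integrable lebesgue f" "integrable lebesgue g" "e > 0"
 shows "conv (eta e) (%y. f y - g y) x = conv (eta e) f x - conv (eta e) g x"
proof -
 obtain B where B: "\<And>x. \<bar>eta e x\<bar> <= B"
  using compact_support_bounded[OF smooth_continuous[OF smooth_eta] compact_square[of e] eta_outside[OF assms(3)]] by metis
 have "conv (eta e) (%y. f y - g y) x = (LINT y|lebesgue. f y * eta e (x - y) - g y * eta e (x - y))" unfolding conv_def by (simp add: algebra_simps)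
 also have "\<dots> = conv (eta e) f x - conv (eta e) g x" unfolding conv_def
  by (intro lint_diff integrable_mult_kernel[OF _ smooth_continuous[OF smooth_eta] B] assms)
 finally show ?thesis .
qed

lemma conv_eta_integrable:
 assumes e: "e > 0" and p: "p = 1 \<or> p = 2" and m[measurable]: "f \<in> borel_measurable borel"
  and f: "integrable lborel f" "integrable lborel (%x. \<bar>f x\<bar> ^ p)"
 shows "integrable lborel (%x. \<bar>conv (eta e) f x\<bar> ^ p)"
  and "(LINT x|lborel. \<bar>conv (eta e) f x\<bar> ^ p) <= (LINT x|lborel. \<bar>f x\<bar> ^ p)"
proof -
 have [measurable]: "conv (eta e) f \<in> borel_measurable borel" using conv_eta_measurable[OF e] f(1) by (simp add: integrable_completion)
 have fin: "(\<integral>\<^sup>+x. ennreal (\<bar>f x\<bar> ^ p) \<partial>lborel) = ennreal (LINT x|lborel. \<bar>f x\<bar> ^ p)"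
  by (rule nn_integral_eq_integral[OF f(2)]) simp
 note c = conv_eta_contract[OF e p m f, unfolded fin]
 show i: "integrable lborel (%x. \<bar>conv (eta e) f x\<bar> ^ p)" by (rule integrableI_nonneg) (use c in \<open>auto intro: le_less_trans\<close>)
 hence "ennreal (LINT x|lborel. \<bar>conv (eta e) f x\<bar> ^ p) <= ennreal (LINT x|lborel. \<bar>f x\<bar> ^ p)"
  using c by (subst nn_integral_eq_integral[symmetric]) auto
 thus "(LINT x|lborel. \<bar>conv (eta e) f x\<bar> ^ p) <= (LINT x|lborel. \<bar>f x\<bar> ^ p)" by (subst (asm) ennreal_le_iff) auto
qed

text \<open>A density argument: for a continuous approximation g of compact support the
  mollifications converge uniformly, and mollifying \<open>f - g\<close> does not increase its norm
  by the contraction property.\<close>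

lemma conv_eta_Lp_borel:
 assumes p: "p = 1 \<or> p = 2" and m[measurable]: "f \<in> borel_measurable borel"
  and f: "integrable lborel f" "integrable lborel (%x. \<bar>f x\<bar> ^ p)"
 shows "((%e. LINT x|lborel. \<bar>conv (eta e) f x - f x\<bar> ^ p) \<longlongrightarrow> 0) (at_right 0)"
  and "e > 0 ==> integrable lborel (%x. \<bar>conv (eta e) f x - f x\<bar> ^ p)"
proof -
 have p0: "p > 0" using p by auto
 have fl: "integrable lebesgue f" using f(1) by (simp add: integrable_completion)
 have dm: "integrable lborel (%x. \<bar>conv (eta e) f x - f x\<bar> ^ p)" if e: "e > 0" for e
 proof (rule lint_bound)
  show "integrable lborel (%x. 2 ^ p * (\<bar>conv (eta e) f x\<bar> ^ p + \<bar>f x\<bar> ^ p))"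
   by (intro integrable_mult_right lint_add_int conv_eta_integrable[OF e p m f] f)
  show "(%x. \<bar>conv (eta e) f x - f x\<bar> ^ p) \<in> borel_measurable lborel" using conv_eta_measurable[OF e fl] by measurable
  have "\<bar>conv (eta e) f x - f x\<bar> ^ p <= 2 ^ p * (\<bar>conv (eta e) f x\<bar> ^ p + \<bar>f x\<bar> ^ p)" for x
   by (rule order_trans[OF power_mono power_sum_bound]) auto
  thus "AE x in lborel. norm (\<bar>conv (eta e) f x - f x\<bar> ^ p) <= norm (2 ^ p * (\<bar>conv (eta e) f x\<bar> ^ p + \<bar>f x\<bar> ^ p))"
   by simp
 qed
 thus "e > 0 ==> integrable lborel (%x. \<bar>conv (eta e) f x - f x\<bar> ^ p)" by simp
 show "((%e. LINT x|lborel. \<bar>conv (eta e) f x - f x\<bar> ^ p) \<longlongrightarrow> 0) (at_right 0)"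
 proof (rule tendstoI)
  fix d :: real assume d: "d > 0"
  \<comment> \<open>Each of the three error terms is at most \<open>4 ^ p * d1\<close>, a quarter of
    d.\<close>
  define d1 where "d1 = d / (4 * 4 ^ p)"
  have d1: "d1 > 0" using d by (simp add: d1_def)
  obtain g R where g: "continuous_on UNIV g" "R > 0" "\<And>x. x \<notin> cball 0 R ==> g x = 0"
   "integrable lborel (%x. \<bar>f x - g x\<bar> ^ p)" "(LINT x|lborel. \<bar>f x - g x\<bar> ^ p) < d1"
   using continuous_dense[OF p0 m f(2) d1] by blast
  have gm[measurable]: "g \<in> borel_measurable borel" using g(1) by (rule borel_measurable_continuous_onI)
  have gi: "integrable lborel g" by (rule compact_support_integrable[OF g(1) compact_cball g(3)])
  have gl: "integrable lebesgue g" using gi by (simp add: integrable_completion)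
  define V where "V = measure lborel (cball (0::real^2) (R + 2))"
  \<comment> \<open>At most 1, so that its p-th power is at most d2; dividing by V + 1 pays for the
    integration over a ball of measure V.\<close>
  define d2 where "d2 = min 1 (d1 / (V + 1))"
  have V0: "V >= 0" by (simp add: V_def)
  have d2: "d2 > 0" "d2 <= 1" "d2 * V <= d1"
  proof -
   show "d2 > 0" "d2 <= 1" using d1 V0 by (auto simp: d2_def)
   have "d2 * V <= d1 / (V + 1) * V" using V0 by (intro mult_right_mono) (auto simp: d2_def)
   also have "\<dots> <= d1" using d1 V0 by (simp add: field_simps)
   finally show "d2 * V <= d1" .
  qed
  have "\<forall>\<^sub>F e in at_right 0. \<forall>x. \<bar>conv (eta e) g x - g x\<bar> <= d2 * ind (cball 0 (R + 2)) x"
   by (rule conv_eta_continuous_convergence[OF g(1,2) g(3) d2(1)])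
  moreover have "\<forall>\<^sub>F e in at_right (0::real). e > 0" by (rule eventually_at_right_less)
  ultimately show "\<forall>\<^sub>F e in at_right 0. dist (LINT x|lborel. \<bar>conv (eta e) f x - f x\<bar> ^ p) 0 < d"
  proof eventually_elim
   case (elim e)
   have e: "e > 0" using elim by simp
   define a where "a = (%x. conv (eta e) (%y. f y - g y) x)"
   have fgi: "integrable lborel (%y. f y - g y)" using f(1) gi by simp
   have fgm: "(%y. f y - g y) \<in> borel_measurable borel" by measurable
   note A = conv_eta_integrable[OF e p fgm fgi g(4), folded a_def]
   have am: "conv (eta e) g \<in> borel_measurable borel" by (rule conv_eta_measurable[OF e gl])
   have b: "\<bar>conv (eta e) g x - g x\<bar> ^ p <= d2 * ind (cball 0 (R + 2)) x" for x
   proof -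
    have "\<bar>conv (eta e) g x - g x\<bar> ^ p <= (d2 * ind (cball 0 (R + 2)) x) ^ p" using elim by (intro power_mono) auto
    also have "\<dots> <= (d2 * ind (cball 0 (R + 2)) x) ^ 1" by (rule power_decreasing) (use p0 d2 in \<open>auto simp: indicator_def\<close>)
    finally show ?thesis by simp
   qed
   have wi: "integrable lborel (%x::real^2. d2 * ind (cball 0 (R + 2)) x)"
    by (intro integrable_mult_right integrable_real_indicator emeasure_bounded_finite) auto
   have "(%x. \<bar>conv (eta e) g x - g x\<bar> ^ p) \<in> borel_measurable lborel" using am by measurable
   hence bi: "integrable lborel (%x. \<bar>conv (eta e) g x - g x\<bar> ^ p)" by (rule lint_bound[OF wi]) (auto intro!: AE_I2 order_trans[OF b])
   have "(LINT x|lborel. \<bar>conv (eta e) g x - g x\<bar> ^ p) <= (LINT x::real^2|lborel. d2 * ind (cball 0 (R + 2)) x)"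
    by (rule integral_mono[OF bi wi b])
   also have "\<dots> = d2 * V" by (simp add: V_def)
   finally have B: "(LINT x|lborel. \<bar>conv (eta e) g x - g x\<bar> ^ p) <= d1" using d2 by simp
   have pt: "\<bar>conv (eta e) f x - f x\<bar> ^ p <= 2 ^ p * \<bar>a x\<bar> ^ p + 4 ^ p * \<bar>conv (eta e) g x - g x\<bar> ^ p + 4 ^ p * \<bar>f x - g x\<bar> ^ p" for x
   proof -
    have "\<bar>conv (eta e) f x - f x\<bar> <= \<bar>a x\<bar> + (\<bar>conv (eta e) g x - g x\<bar> + \<bar>f x - g x\<bar>)"
     unfolding a_def conv_diff[OF fl gl e] by linarith
    hence "\<bar>conv (eta e) f x - f x\<bar> ^ p <= (\<bar>a x\<bar> + (\<bar>conv (eta e) g x - g x\<bar> + \<bar>f x - g x\<bar>)) ^ p"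
     by (intro power_mono) auto
    also have "\<dots> <= 2 ^ p * (\<bar>a x\<bar> ^ p + (\<bar>conv (eta e) g x - g x\<bar> + \<bar>f x - g x\<bar>) ^ p)"
     by (rule power_sum_bound) auto
    also have "\<dots> <= 2 ^ p * (\<bar>a x\<bar> ^ p + 2 ^ p * (\<bar>conv (eta e) g x - g x\<bar> ^ p + \<bar>f x - g x\<bar> ^ p))"
     by (intro mult_left_mono add_left_mono power_sum_bound) auto
    also have "\<dots> = 2 ^ p * \<bar>a x\<bar> ^ p + 4 ^ p * \<bar>conv (eta e) g x - g x\<bar> ^ p + 4 ^ p * \<bar>f x - g x\<bar> ^ p"
    proof -
     have "(4::real) ^ p = 2 ^ p * 2 ^ p" by (simp flip: power_mult_distrib)
     thus ?thesis by (simp add: algebra_simps)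
    qed
    finally show ?thesis .
   qed
   have "(LINT x|lborel. \<bar>conv (eta e) f x - f x\<bar> ^ p) <= (LINT x|lborel. 2 ^ p * \<bar>a x\<bar> ^ p + 4 ^ p * \<bar>conv (eta e) g x - g x\<bar> ^ p + 4 ^ p * \<bar>f x - g x\<bar> ^ p)"
    by (rule integral_mono[OF dm[OF e] _ pt])
      (intro lint_add_int integrable_mult_right A bi g(4))
   also have "\<dots> = 2 ^ p * (LINT x|lborel. \<bar>a x\<bar> ^ p) + 4 ^ p * (LINT x|lborel. \<bar>conv (eta e) g x - g x\<bar> ^ p) + 4 ^ p * (LINT x|lborel. \<bar>f x - g x\<bar> ^ p)"
    using A(1) bi g(4) by simp
   also have "\<dots> <= 4 ^ p * d1 + 4 ^ p * d1 + 4 ^ p * d1" using A(2) B g(5) d1 by (intro add_mono mult_mono power_mono) auto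
   also have "\<dots> < d" using d by (simp add: d1_def)
   finally have "(LINT x|lborel. \<bar>conv (eta e) f x - f x\<bar> ^ p) < d" .
   moreover have "(LINT x|lborel. \<bar>conv (eta e) f x - f x\<bar> ^ p) >= 0" by simp
   ultimately show ?case by (simp add: dist_real_def)
  qed
 qed
qed

lemma AE_lborel_lebesgue: "(AE x in lborel. P x) ==> (AE x in lebesgue. P (x::real^2))" by (simp add: AE_completion)

text \<open>Tonelli was used for Borel functions, so f is replaced by a Borel representative; a
  convolution does not notice the change on a null set.\<close>

lemma conv_eta_Lp:
 assumes p: "p = 1 \<or> p = 2"
  and f: "integrable lebesgue f" "integrable lebesgue (%x. \<bar>f x\<bar> ^ p)"
 shows "((%e. LINT x|lebesgue. \<bar>conv (eta e) f x - f x\<bar> ^ p) \<longlongrightarrow> 0) (at_right 0)"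
  and "e > 0 ==> integrable lebesgue (%x. \<bar>conv (eta e) f x - f x\<bar> ^ p)"
proof -
 have fm[measurable]: "f \<in> borel_measurable lebesgue" using f(1) by simp
 obtain f' where f': "f' \<in> borel_measurable lborel" "AE x in lborel. f x = f' x" using completion_ex_borel_measurable_real[OF fm] by blast
 have f'm[measurable]: "f' \<in> borel_measurable borel" using f'(1) by simp
 have f'l[measurable]: "f' \<in> borel_measurable lebesgue" by (simp add: measurable_completion)
 have ae: "AE x in lebesgue. f x = f' x" using AE_lborel_lebesgue[OF f'(2)] .
 have "integrable lebesgue f'" using f(1) integrable_cong_AE[OF fm f'l ae] by simp
 hence i1: "integrable lborel f'" by (simp add: integrable_completion)
 have "integrable lebesgue (%x. \<bar>f' x\<bar> ^ p)" using f(2) by (rule integrable_cong_AE_imp) (use ae in auto)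
 hence i2: "integrable lborel (%x. \<bar>f' x\<bar> ^ p)" by (subst (asm) integrable_completion) auto
 have ceq: "conv k f = conv k f'" if [measurable]: "k \<in> borel_measurable borel" for k
 proof
  fix x show "conv k f x = conv k f' x" unfolding conv_def
  proof (rule integral_cong_AE)
   have [measurable]: "(%y. k (x - y)) \<in> borel_measurable lebesgue" by (intro measurable_completion) measurable
   show "(%y. f y * k (x - y)) \<in> borel_measurable lebesgue" "(%y. f' y * k (x - y)) \<in> borel_measurable lebesgue" by measurable
   show "AE y in lebesgue. f y * k (x - y) = f' y * k (x - y)" using ae by auto
  qed
 qed
 have cm: "conv (eta e) f' \<in> borel_measurable lborel" if "e > 0" for e using conv_eta_measurable[OF that] i1 by (simp add: integrable_completion)
 have m1: "(%x. \<bar>conv (eta e) f' x - f' x\<bar> ^ p) \<in> borel_measurable lborel" if "e > 0" for e using cm[OF that] by measurable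
 have m2: "(%x. \<bar>conv (eta e) f x - f x\<bar> ^ p) \<in> borel_measurable lebesgue" if "e > 0" for e
  unfolding ceq[OF eta_measurable] using measurable_completion[OF cm[OF that]] by measurable
 have ae2: "AE x in lebesgue. \<bar>conv (eta e) f' x - f' x\<bar> ^ p = \<bar>conv (eta e) f x - f x\<bar> ^ p" for e
  by (rule eventually_mono[OF ae]) (simp add: ceq[OF eta_measurable])
 have eq: "(LINT x|lebesgue. \<bar>conv (eta e) f x - f x\<bar> ^ p) = (LINT x|lborel. \<bar>conv (eta e) f' x - f' x\<bar> ^ p)" if "e > 0" for e
  unfolding integral_completion[OF m1[OF that], symmetric]
  by (rule integral_cong_AE[OF m2[OF that] measurable_completion[OF m1[OF that]]]) (rule eventually_mono[OF ae2[of e]], simp)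
 have "((%e. LINT x|lborel. \<bar>conv (eta e) f' x - f' x\<bar> ^ p) \<longlongrightarrow> 0) (at_right 0)"
  by (rule conv_eta_Lp_borel(1)[OF p f'm i1 i2])
 thus "((%e. LINT x|lebesgue. \<bar>conv (eta e) f x - f x\<bar> ^ p) \<longlongrightarrow> 0) (at_right 0)"
  by (rule Lim_transform_eventually) (auto simp: eventually_at_filter eq)
 show "integrable lebesgue (%x. \<bar>conv (eta e) f x - f x\<bar> ^ p)" if e: "e > 0"
 proof (rule integrable_cong_AE_imp[OF _ m2[OF e]])
  show "integrable lebesgue (%x. \<bar>conv (eta e) f' x - f' x\<bar> ^ p)"
   using conv_eta_Lp_borel(2)[OF p f'm i1 i2 e] m1[OF e] by (simp add: integrable_completion)
 qed (use ae2 in auto)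
qed

section \<open>Test functions and weak derivatives\<close>

lemma Ck_translate: "Ck k UNIV f ==> Ck k UNIV (%y. f (y - c))"
proof (induction k arbitrary: f)
 case (Suc k)
 then obtain g where g: "\<And>x. (f has_derivative (%h. \<Sum>i\<in>UNIV. g i x * h $ i)) (at x)" "\<And>i. Ck k UNIV (g i)" by auto
 have "((%y. f (y - c)) has_derivative (%h. \<Sum>i\<in>UNIV. g i (y - c) * h $ i)) (at y)" for y
 proof -
  have "((%y. y - c) has_derivative (%h. h)) (at y)" by (auto intro!: derivative_eq_intros)
  from has_derivative_compose[OF this g(1)] show ?thesis .
 qed
 thus ?case using Suc.IH[OF g(2)] by (auto intro!: exI[of _ "%i y. g i (y - c)"])
qed simp

lemma smooth_translate: "smooth f ==> smooth (%y. f (y - c))" by (simp add: smooth_iff_Ck Ck_translate)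

lemma pderiv_dir_translate: "smooth f ==> pd i (%y. f (y - c)) y = pd i f (y - c)"
proof (rule has_derivative_pderiv_dir[where g = "%i. pd i f (y - c)"])
 assume "smooth f"
 have "((%y. y - c) has_derivative (%h. h)) (at y)" by (auto intro!: derivative_eq_intros)
 from has_derivative_compose[OF this smooth_has_derivative[OF \<open>smooth f\<close>]]
 show "((%y. f (y - c)) has_derivative (%h. \<Sum>i\<in>UNIV. pd i f (y - c) * h $ i)) (at y)" .
qed

lemma pderiv_dir_eta_minus: "pd i (eta e) (- x) = - pd i (eta e) x"
proof -
 have "((%x::real^2. - x) has_derivative (%h. - h)) (at x)" by (auto intro!: derivative_eq_intros)
 from has_derivative_compose[OF this smooth_has_derivative[OF smooth_eta, of e "- x"]]
 have "((%x. eta e (- x)) has_derivative (%h. \<Sum>i\<in>UNIV. pd i (eta e) (- x) * (- h) $ i)) (at x)" .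
 hence "((eta e) has_derivative (%h. \<Sum>i\<in>UNIV. (- pd i (eta e) (- x)) * h $ i)) (at x)" by (simp add: eta_minus)
 from has_derivative_pderiv_dir[OF this] have "pd i (eta e) x = - pd i (eta e) (- x)" .
 thus ?thesis by simp
qed

lemma test_functionsD:
 assumes "\<phi> \<in> test_functions W"
 obtains K where "smooth \<phi>" "compact K" "K \<subseteq> interior W" "K \<subseteq> W" "\<And>x. x \<notin> K ==> \<phi> x = 0" "\<And>i x. x \<notin> K ==> pd i \<phi> x = 0"
proof -
 obtain K where K: "smooth \<phi>" "compact K" "K \<subseteq> interior W" "\<And>x. x \<notin> K ==> \<phi> x = 0"
  using assms unfolding test_functions_def by blast
 have "pd i \<phi> x = 0" if "x \<notin> K" for i x using pderiv_dir_outside[of K \<phi> x] K that compact_imp_closed by blast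
 thus ?thesis using K interior_subset that[of K] by blast
qed

lemma eta_test_function:
 assumes "e > 0" "\<And>y. y - x \<in> square e ==> y \<in> interior W"
 shows "(%y. eta e (x - y)) \<in> test_functions W"
proof -
 have eq: "(%y. eta e (x - y)) = (%y. eta e (y - x))" by (simp add: eta_commute fun_eq_iff)
 have "compact ((%z. z + x) ` square e)" by (intro compact_continuous_image compact_square continuous_intros)
 moreover have "(%z. z + x) ` square e \<subseteq> interior W" using assms(2) by auto
 moreover have "eta e (y - x) = 0" if "y \<notin> (%z. z + x) ` square e" for y
 proof -
  have "y - x \<notin> square e" using that by (metis diff_add_cancel image_eqI)
  thus ?thesis by (rule eta_outside[OF assms(1)])
 qed
 ultimately show ?thesis unfolding test_functions_def eq using smooth_translate[OF smooth_eta] by blast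
qed

section \<open>Null sets and nonnegativity almost everywhere\<close>

lemma measurable_AE_lebesgue_on:
 fixes f g :: "real^2 => real"
 assumes S: "S \<in> sets lebesgue" and f: "f \<in> borel_measurable (lebesgue_on S)" and ae: "AE x in lebesgue_on S. f x = g x"
 shows "g \<in> borel_measurable (lebesgue_on S)"
proof -
 have "AE x in lebesgue. x \<in> S \<longrightarrow> f x = g x" using ae S by (subst (asm) AE_restrict_space_iff) auto
 then obtain N where N: "N \<in> null_sets lebesgue" "{x. \<not> (x \<in> S \<longrightarrow> f x = g x)} \<subseteq> N"
  by (auto simp: eventually_ae_filter)
 have "f measurable_on S" using f S by (simp add: measurable_on_iff_borel_measurable)
 hence "g measurable_on S" by (rule measurable_on_spike[of _ _ N]) (use N in \<open>auto simp: negligible_iff_null_sets\<close>)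
 thus ?thesis using S by (simp add: measurable_on_iff_borel_measurable)
qed

lemma lebesgue_on_lborel:
 fixes f :: "real^2 => real"
 assumes "W \<in> sets lebesgue" "f \<in> borel_measurable borel" "\<And>x. x \<notin> W ==> f x = 0"
 shows "(LINT x|lebesgue_on W. f x) = (LINT x|lborel. f x)"
proof -
 have "(%x. ind W x * f x) = f" using assms(3) by (auto simp: fun_eq_iff indicator_def)
 thus ?thesis using assms by (simp add: LINT_lebesgue_on integral_completion)
qed

lemma locally_integrable_mult:
 assumes W: "W \<in> sets lebesgue" and f: "locally_integrable W f"
  and k: "continuous_on UNIV k" "compact K" "K \<subseteq> interior W" "\<And>x. x \<notin> K ==> k x = 0"
 shows "integrable (lebesgue_on W) (%x. f x * k x)"
proof -
 have i: "integrable (lebesgue_on K) f" using f k unfolding locally_integrable_def by blast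
 have Km: "K \<in> sets lebesgue" using k(2) by (simp add: compact_imp_closed)
 obtain B where B: "\<And>x. \<bar>k x\<bar> <= B" using compact_support_bounded[OF k(1,2,4)] by metis
 have m: "k \<in> borel_measurable (lebesgue_on K)"
  by (intro measurable_restrict_space1 measurable_completion) (simp add: borel_measurable_continuous_onI k(1))
 have "integrable (lebesgue_on K) (%x. f x * k x)"
 proof (rule lint_bound[of _ "%x. B * f x"])
  show "integrable (lebesgue_on K) (%x. B * f x)" using i by simp
  show "(%x. f x * k x) \<in> borel_measurable (lebesgue_on K)" using i m by (intro borel_measurable_times) auto
  have "\<bar>f x * k x\<bar> <= \<bar>B * f x\<bar>" for x
   using mult_mono[OF B[of x] order_refl[of "\<bar>f x\<bar>"]] B[of 0] by (simp add: abs_mult mult.commute)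
  thus "AE x in lebesgue_on K. norm (f x * k x) <= norm (B * f x)" by simp
 qed
 moreover have "(%x. ind K x * (f x * k x)) = (%x. ind W x * (f x * k x))" using k interior_subset by (auto simp: fun_eq_iff indicator_def)
 ultimately show ?thesis using integrable_lebesgue_on[OF Km] integrable_lebesgue_on[OF W] by simp
qed

text \<open>On a compact set the negative part of f is at most the distance of f to its nonnegative
  mollifications, which tends to 0 in L1. Countably many boxes exhaust the interior.\<close>

lemma nonneg_of_mollification:
 assumes W: "W \<in> sets lebesgue" and f: "locally_integrable W f"
  and pos: "\<And>x e. e > 0 ==> cball x (4 * e) \<subseteq> interior W ==> conv (eta e) (%y. ind W y * f y) x >= 0"
 shows "AE x in lebesgue. x \<in> interior W \<longrightarrow> f x >= 0"
proof -
 have cell: "AE x in lebesgue. x \<in> K \<longrightarrow> f x >= 0" if K: "compact K" "K \<subseteq> interior W" for K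
 proof -
  obtain d where d: "d > 0" "(\<Union>x\<in>K. cball x d) \<subseteq> interior W"
   using compact_subset_open_imp_cball_epsilon_subset[OF K(1) open_interior K(2)] by metis
  \<comment> \<open>A thickening of K on which f is still integrable; for small e the mollification
    at points of K uses only values on it.\<close>
  define K' where "K' = (\<Union>x\<in>K. cball x d)"
  have K': "compact K'" "K' \<subseteq> interior W" unfolding K'_def using compact_minkowski_sum_cball[OF K(1)] d by auto
  have Km: "K \<in> sets lebesgue" "K' \<in> sets lebesgue" using K(1) K'(1) by (auto simp: compact_imp_closed)
  define g where "g = (%x. ind K' x * f x)"
  have gi: "integrable lebesgue g" unfolding g_def using f K' Km integrable_lebesgue_on[of K' f] unfolding locally_integrable_def by blast
  have cpos: "conv (eta e) g x >= 0" if e: "e > 0" "4 * e < d" and x: "x \<in> K" for e x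
  proof -
   have c: "cball x (4 * e) \<subseteq> K'" using e x unfolding K'_def by (auto intro!: bexI[of _ x])
   have in': "y \<in> K'" if "y - x \<in> square e" for y using square_norm[OF that] e c by (auto simp: dist_norm norm_minus_commute)
   have "0 <= conv (eta e) (%y. ind W y * f y) x" by (rule pos[OF e(1)]) (use c K' in auto)
   also have "\<dots> = conv (eta e) g x" unfolding conv_def
   proof (rule lint_cong)
    fix y
    show "ind W y * f y * eta e (x - y) = g y * eta e (x - y)"
    proof (cases "y - x \<in> square e")
     case True
     hence "y \<in> K'" "y \<in> W" using in' K' interior_subset by blast+
     thus ?thesis by (simp add: g_def)
    next
     case False
     hence "eta e (x - y) = 0" using eta_outside[OF e(1)] eta_commute by metis
     thus ?thesis by simp
    qed
   qed
   finally show ?thesis .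
  qed
  define n where "n = (%x. ind K x * max 0 (- f x))"
  have n_eq: "n x = ind K x * max 0 (- g x)" for x using d(1) by (auto simp: n_def g_def indicator_def K'_def)
  have ni: "integrable lebesgue n"
  proof (rule lint_bound[OF gi])
   show "n \<in> borel_measurable lebesgue" unfolding n_eq[abs_def] using gi Km by measurable
   show "AE x in lebesgue. norm (n x) <= norm (g x)" by (auto simp: n_eq indicator_def)
  qed
  have g1: "integrable lebesgue (%x. \<bar>g x\<bar> ^ 1)" using gi by simp
  have n0: "(LINT x|lebesgue. n x) <= 0"
  proof (rule tendsto_lowerbound[OF conv_eta_Lp(1)[of 1 g, OF _ gi g1]])
   have "\<forall>\<^sub>F e in at_right 0. 4 * e < d \<and> e > (0::real)"
    using d(1) by (intro eventually_conj eventually_at_right_less) (auto simp: eventually_at_right_field intro!: exI[of _ "d / 4"])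
   thus "\<forall>\<^sub>F e in at_right 0. (LINT x|lebesgue. n x) <= (LINT x|lebesgue. \<bar>conv (eta e) g x - g x\<bar> ^ 1)"
   proof eventually_elim
    case (elim e)
    show ?case
    proof (rule integral_mono[OF ni])
     show "integrable lebesgue (%x. \<bar>conv (eta e) g x - g x\<bar> ^ 1)" by (rule conv_eta_Lp(2)) (use gi elim in auto)
     fix x show "n x <= \<bar>conv (eta e) g x - g x\<bar> ^ 1" using cpos[of e x] elim by (cases "x \<in> K") (auto simp: n_eq)
    qed
   qed
  qed auto
  have nn: "n x >= 0" for x by (simp add: n_def)
  have "(LINT x|lebesgue. n x) >= 0" by (rule lint_nonneg) (rule nn)
  hence "(LINT x|lebesgue. n x) = 0" using n0 by linarith
  hence "AE x in lebesgue. n x = 0" using integral_nonneg_eq_0_iff_AE[OF ni] nn by simp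
  thus ?thesis by (rule eventually_mono) (auto simp: n_def indicator_def max_def split: if_splits)
 qed
 obtain D where D: "countable D" "\<And>X. X \<in> D ==> X \<subseteq> interior W" "\<And>X. X \<in> D ==> \<exists>a b. X = cbox a b" "\<Union>D = interior W"
  by (rule open_countable_Union_open_cbox[OF open_interior[of W]]) blast
 have "AE x in lebesgue. x \<in> X \<longrightarrow> f x >= 0" if "X \<in> D" for X using cell[of X] D(2,3)[OF that] by auto
 hence "AE x in lebesgue. \<forall>X\<in>D. x \<in> X \<longrightarrow> f x >= 0" using D(1) by (intro AE_ball_countable[THEN iffD2] ballI)
 thus ?thesis by (rule eventually_mono) (use D(4) in blast)
qed

text \<open>The reflected and translated kernel is itself a nonnegative test function, so pairing it
  with f gives a value of the mollification.\<close>

lemma nonneg_of_test_functions: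
 assumes W: "W \<in> sets lebesgue" and f: "locally_integrable W f"
  and pos: "\<And>\<phi>. \<phi> \<in> test_functions W ==> (\<And>x. \<phi> x >= 0) ==> (LINT x|lebesgue_on W. f x * \<phi> x) >= 0"
 shows "AE x in lebesgue. x \<in> interior W \<longrightarrow> f x >= 0"
proof (rule nonneg_of_mollification[OF W f])
 fix x :: "real^2" and e :: real assume e: "e > 0" and x: "cball x (4 * e) \<subseteq> interior W"
 have t: "(%y. eta e (x - y)) \<in> test_functions W"
 proof (rule eta_test_function[OF e])
  fix y assume "y - x \<in> square e"
  from square_norm[OF this] e x show "y \<in> interior W" by (auto simp: dist_norm norm_minus_commute)
 qed
 have "0 <= (LINT y|lebesgue_on W. f y * eta e (x - y))" by (rule pos[OF t]) (rule eta_nonneg[OF e])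
 thus "conv (eta e) (%y. ind W y * f y) x >= 0" unfolding LINT_lebesgue_on[OF W] conv_def by (simp add: mult.assoc)
qed

text \<open>The difference of two candidates pairs to zero with every test function; the
  nonnegativity criterion is applied to it in both orders.\<close>

lemma has_weak_pderiv_unique:
 assumes W: "W \<in> sets lebesgue" and g: "has_weak_pderiv W i f g" "has_weak_pderiv W i f g'"
 shows "AE x in lebesgue. x \<in> interior W \<longrightarrow> g x = g' x"
proof -
 have li: "locally_integrable W g" "locally_integrable W g'" using g by (auto simp: has_weak_pderiv_def)
 have ge: "AE x in lebesgue. x \<in> interior W \<longrightarrow> g x - g' x >= 0"
  if gg: "has_weak_pderiv W i f g" "has_weak_pderiv W i f g'" for g g'
 proof (rule nonneg_of_test_functions[OF W])
  have li: "locally_integrable W g" "locally_integrable W g'" using gg by (auto simp: has_weak_pderiv_def)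
  thus "locally_integrable W (%x. g x - g' x)" by (auto simp: locally_integrable_def)
  fix \<phi> assume \<phi>: "\<phi> \<in> test_functions W"
  then obtain K where K: "smooth \<phi>" "compact K" "K \<subseteq> interior W" "\<And>x. x \<notin> K ==> \<phi> x = 0"
   by (rule test_functionsD) blast
  have "(LINT x|lebesgue_on W. (g x - g' x) * \<phi> x) = (LINT x|lebesgue_on W. g x * \<phi> x) - (LINT x|lebesgue_on W. g' x * \<phi> x)"
   unfolding left_diff_distrib by (intro lint_diff locally_integrable_mult[OF W _ smooth_continuous[OF K(1)] K(2,3,4)] li)
  also have "\<dots> = 0" using gg \<phi> by (simp add: has_weak_pderiv_def)
  finally show "0 <= (LINT x|lebesgue_on W. (g x - g' x) * \<phi> x)" by simp
 qed
 from ge[OF g] ge[OF g(2,1)] show ?thesis by eventually_elim auto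
qed

lemma has_weak_pderiv_cong_AE:
 assumes W: "W \<in> sets lebesgue" and f: "f \<in> borel_measurable (lebesgue_on W)" and ae: "AE x in lebesgue. x \<in> W \<longrightarrow> f x = f' x"
  and w: "has_weak_pderiv W i f g"
 shows "has_weak_pderiv W i f' g"
proof -
 have ae': "AE x in lebesgue_on S. f x = f' x" if "S \<subseteq> W" "S \<in> sets lebesgue" for S using ae that by (subst AE_restrict_space_iff) auto
 have li: "locally_integrable W f" using w by (simp add: has_weak_pderiv_def)
 have "locally_integrable W f'" unfolding locally_integrable_def
 proof safe
  fix K assume K: "compact K" "K \<subseteq> interior W"
  have Km: "K \<in> sets lebesgue" using K(1) by (simp add: compact_imp_closed)
  have i: "integrable (lebesgue_on K) f" using li K by (auto simp: locally_integrable_def)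
  have a: "AE x in lebesgue_on K. f x = f' x" by (rule ae') (use K Km interior_subset in auto)
  show "integrable (lebesgue_on K) f'" by (rule integrable_cong_AE_imp[OF i measurable_AE_lebesgue_on[OF Km _ a]]) (use i a in auto)
 qed
 moreover have "(LINT x|lebesgue_on W. f' x * pd i \<phi> x) = - (LINT x|lebesgue_on W. g x * \<phi> x)" if "\<phi> \<in> test_functions W" for \<phi>
 proof -
  have a: "AE x in lebesgue_on W. f x = f' x" by (rule ae') (use W in auto)
  have "smooth \<phi>" using that by (simp add: test_functions_def)
  hence m: "pd i \<phi> \<in> borel_measurable (lebesgue_on W)"
   by (intro measurable_restrict_space1 measurable_completion) (simp add: borel_measurable_continuous_onI smooth_continuous smooth_pderiv)
  have "(LINT x|lebesgue_on W. f' x * pd i \<phi> x) = (LINT x|lebesgue_on W. f x * pd i \<phi> x)"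
   by (rule integral_cong_AE) (use m f measurable_AE_lebesgue_on[OF W f a] a in \<open>auto elim: eventually_mono\<close>)
  thus ?thesis using w that by (simp add: has_weak_pderiv_def)
 qed
 ultimately show ?thesis using w by (simp add: has_weak_pderiv_def)
qed

lemma weak_pderiv_cong:
 assumes W: "W \<in> sets lebesgue" and eq: "\<And>x. x \<in> W ==> f x = f' x"
 shows "has_weak_pderiv W i f = has_weak_pderiv W i f'" "weak_pderiv W i f = weak_pderiv W i f'"
proof -
 have 1: "locally_integrable W f = locally_integrable W f'" unfolding locally_integrable_def
 proof (intro all_cong imp_cong refl)
  fix K assume "compact K \<and> K \<subseteq> interior W"
  hence "\<And>x. x \<in> K ==> f x = f' x" using eq interior_subset by blast
  thus "integrable (lebesgue_on K) f = integrable (lebesgue_on K) f'" by (intro Bochner_Integration.integrable_cong) (auto simp: space_restrict_space)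
 qed
 have 2: "(LINT x|lebesgue_on W. f x * k x) = (LINT x|lebesgue_on W. f' x * k x)" for k
  by (intro Bochner_Integration.integral_cong) (auto simp: space_restrict_space eq)
 show "has_weak_pderiv W i f = has_weak_pderiv W i f'" by (intro ext) (simp add: has_weak_pderiv_def 1 2)
 thus "weak_pderiv W i f = weak_pderiv W i f'" by (simp add: weak_pderiv_def)
qed

lemma weak_pderiv_exists: "has_weak_pderiv W i f g ==> has_weak_pderiv W i f (weak_pderiv W i f)"
 unfolding weak_pderiv_def by (rule someI[where P = "has_weak_pderiv W i f"])

text \<open>Test functions live on the interior, so a weak derivative is determined only there; the
  rest of W has to be a null set.\<close>

lemma weak_pderiv_AE:
 assumes W: "W \<in> sets lebesgue" "negligible (W - interior W)" and g: "has_weak_pderiv W i f g"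
 shows "AE x in lebesgue. x \<in> W \<longrightarrow> g x = weak_pderiv W i f x"
proof -
 have "AE x in lebesgue. x \<in> interior W \<longrightarrow> g x = weak_pderiv W i f x"
  by (rule has_weak_pderiv_unique[OF W(1) g weak_pderiv_exists[OF g]])
 moreover have "AE x in lebesgue. x \<notin> W - interior W"
  using W(2) AE_not_in[of "W - interior W" lebesgue] by (simp only: negligible_iff_null_sets)
 ultimately show ?thesis by eventually_elim auto
qed

lemma L2_cong_AE:
 fixes f g :: "real^2 => real"
 assumes W: "W \<in> sets lebesgue" and f: "f \<in> L2 W" and ae: "AE x in lebesgue. x \<in> W \<longrightarrow> f x = g x"
 shows "g \<in> L2 W"
proof -
 have a: "AE x in lebesgue_on W. f x = g x" using ae W by (subst AE_restrict_space_iff) auto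
 have m: "f \<in> borel_measurable (lebesgue_on W)" using f by (simp add: L2_def)
 note m' = measurable_AE_lebesgue_on[OF W m a]
 have "integrable (lebesgue_on W) (%x. (norm (g x))\<^sup>2)"
  by (rule integrable_cong_AE_imp[of _ "%x. (norm (f x))\<^sup>2"]) (use f m' a in \<open>auto simp: L2_def elim: eventually_mono\<close>)
 thus ?thesis using m' by (simp add: L2_def)
qed

section \<open>Smooth functions in the Sobolev spaces\<close>

lemma smooth_has_weak_pderiv:
 assumes W: "W \<in> sets lebesgue" and f: "smooth f"
 shows "has_weak_pderiv W i f (pd i f)"
proof -
 have li: "locally_integrable W g" if "smooth g" for g unfolding locally_integrable_def
 proof safe
  fix K assume K: "compact K" "K \<subseteq> interior W"
  have Km: "K \<in> sets lebesgue" using K(1) by (simp add: compact_imp_closed)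
  have "integrable lborel (%x. ind K x * g x)"
   using borel_integrable_compact[OF K(1) smooth_continuous[OF that, of K]] by (simp add: set_integrable_def)
  thus "integrable (lebesgue_on K) g" using integrable_lebesgue_on[OF Km] by (simp add: integrable_completion)
 qed
 have "(LINT x|lebesgue_on W. f x * pd i \<phi> x) = - (LINT x|lebesgue_on W. pd i f x * \<phi> x)" if "\<phi> \<in> test_functions W" for \<phi>
 proof -
  obtain K where K: "smooth \<phi>" "compact K" "K \<subseteq> interior W" "K \<subseteq> W" "\<And>x. x \<notin> K ==> \<phi> x = 0" "\<And>i x. x \<notin> K ==> pd i \<phi> x = 0"
   using \<open>\<phi> \<in> test_functions W\<close> by (rule test_functionsD) blast
  have z: "\<phi> x = 0" "pd i \<phi> x = 0" if "x \<notin> W" for x using K(4,5,6) that by blast+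
  have sm: "smooth (%x. f x * pd i \<phi> x)" "smooth (%x. pd i f x * \<phi> x)" "smooth (%x. f x * \<phi> x)"
   using f K(1) by (auto intro!: smooth_mult smooth_pderiv)
  have i1: "integrable lborel (%x. f x * pd i \<phi> x)" by (rule compact_support_integrable[OF smooth_continuous[OF sm(1)] K(2)]) (simp add: K)
  have i2: "integrable lborel (%x. pd i f x * \<phi> x)" by (rule compact_support_integrable[OF smooth_continuous[OF sm(2)] K(2)]) (simp add: K)
  have "0 = (LINT x|lborel. pd i (%x. f x * \<phi> x) x)" by (rule integral_pderiv_zero[OF sm(3) K(2), symmetric]) (simp add: K)
  also have "\<dots> = (LINT x|lborel. pd i f x * \<phi> x + f x * pd i \<phi> x)" by (simp add: pderiv_dir_mult[OF f K(1)])
  also have "\<dots> = (LINT x|lborel. pd i f x * \<phi> x) + (LINT x|lborel. f x * pd i \<phi> x)" by (rule lint_add[OF i2 i1])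
  finally have "(LINT x|lborel. f x * pd i \<phi> x) = - (LINT x|lborel. pd i f x * \<phi> x)" by simp
  moreover have "(LINT x|lebesgue_on W. f x * pd i \<phi> x) = (LINT x|lborel. f x * pd i \<phi> x)"
   by (rule lebesgue_on_lborel[OF W]) (use i1 z in auto)
  moreover have "(LINT x|lebesgue_on W. pd i f x * \<phi> x) = (LINT x|lborel. pd i f x * \<phi> x)"
   by (rule lebesgue_on_lborel[OF W]) (use i2 z in auto)
  ultimately show ?thesis by simp
 qed
 thus ?thesis using li[OF f] li[OF smooth_pderiv[OF f]] by (simp add: has_weak_pderiv_def)
qed

lemma smooth_weak_pderiv_AE:
 assumes "W \<in> sets lebesgue" "negligible (W - interior W)" "smooth f"
 shows "AE x in lebesgue. x \<in> W \<longrightarrow> pd i f x = weak_pderiv W i f x"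
 by (rule weak_pderiv_AE[OF assms(1,2) smooth_has_weak_pderiv[OF assms(1,3)]])

text \<open>The second weak derivative is taken of the representative that \<open>SOME\<close>
  picked for the first one. That choice agrees almost everywhere with any concrete g, so the weak
  derivative of g serves.\<close>

lemma weak_pderiv2_AE:
 assumes W: "W \<in> sets lebesgue" "negligible (W - interior W)"
  and g: "has_weak_pderiv W i f g" "g \<in> borel_measurable (lebesgue_on W)" and gj: "has_weak_pderiv W j g gj"
 shows "has_weak_pderiv W j (weak_pderiv W i f) gj"
  and "AE x in lebesgue. x \<in> W \<longrightarrow> gj x = weak_pderiv W j (weak_pderiv W i f) x"
proof -
 show w: "has_weak_pderiv W j (weak_pderiv W i f) gj" by (rule has_weak_pderiv_cong_AE[OF W(1) g(2) weak_pderiv_AE[OF W g(1)] gj])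
 show "AE x in lebesgue. x \<in> W \<longrightarrow> gj x = weak_pderiv W j (weak_pderiv W i f) x" by (rule weak_pderiv_AE[OF W w])
qed

lemma W12_weak_pderiv:
 assumes W: "W \<in> sets lebesgue" "negligible (W - interior W)" and f: "f \<in> W12 W"
 shows "has_weak_pderiv W i f (weak_pderiv W i f)" "weak_pderiv W i f \<in> L2 W"
proof -
 obtain g where g: "g \<in> L2 W" "has_weak_pderiv W i f g" using f by (auto simp: W12_def)
 show "has_weak_pderiv W i f (weak_pderiv W i f)" by (rule weak_pderiv_exists[OF g(2)])
 show "weak_pderiv W i f \<in> L2 W" by (rule L2_cong_AE[OF W(1) g(1) weak_pderiv_AE[OF W g(2)]])
qed

lemma smooth_W12:
 assumes W: "W \<in> sets lebesgue" "negligible (W - interior W)" "bounded W" and f: "smooth f"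
 shows "f \<in> W12 W" unfolding W12_def
 using bounded_continuous_L2[OF W(1,3) smooth_continuous] f smooth_pderiv smooth_has_weak_pderiv[OF W(1) f] by blast

lemma smooth_W22:
 assumes W: "W \<in> sets lebesgue" "negligible (W - interior W)" "bounded W" and f: "smooth f"
 shows "f \<in> W22 W"
proof -
 have L: "smooth g ==> g \<in> L2 W" for g using bounded_continuous_L2[OF W(1,3) smooth_continuous] by blast
 have "weak_pderiv W i f \<in> W12 W" for i
 proof -
  have s: "smooth (pd i f)" by (rule smooth_pderiv[OF f])
  have "weak_pderiv W i f \<in> L2 W" by (rule W12_weak_pderiv(2)[OF W(1,2) smooth_W12[OF W f]])
  moreover have "has_weak_pderiv W j (weak_pderiv W i f) (pd j (pd i f))" for j
   by (rule weak_pderiv2_AE(1)[OF W(1,2) smooth_has_weak_pderiv[OF W(1) f] _ smooth_has_weak_pderiv[OF W(1) s]])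
     (use L[OF s] in \<open>simp add: L2_def\<close>)
  ultimately show ?thesis unfolding W12_def using L[OF smooth_pderiv[OF s]] by blast
 qed
 thus ?thesis unfolding W22_def using smooth_W12[OF W f] by blast
qed

lemma smooth_weak_hessian_AE:
 assumes W: "W \<in> sets lebesgue" "negligible (W - interior W)" "bounded W" and f: "smooth f"
 shows "AE x in lebesgue. x \<in> W \<longrightarrow> weak_hessian W f x = (\<chi> i j. pd j (pd i f) x)"
proof -
 have s: "smooth (pd i f)" for i by (rule smooth_pderiv[OF f])
 have "pd i f \<in> borel_measurable (lebesgue_on W)" for i using bounded_continuous_L2[OF W(1,3) smooth_continuous[OF s]] by (simp add: L2_def)
 hence "AE x in lebesgue. x \<in> W \<longrightarrow> pd j (pd i f) x = weak_pderiv W j (weak_pderiv W i f) x" for i j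
  by (rule weak_pderiv2_AE(2)[OF W(1,2) smooth_has_weak_pderiv[OF W(1) f] _ smooth_has_weak_pderiv[OF W(1) s]])
 hence "AE x in lebesgue. \<forall>i j. x \<in> W \<longrightarrow> pd j (pd i f) x = weak_pderiv W j (weak_pderiv W i f) x"
  by (intro AE_all_countable[THEN iffD2] allI)
 thus ?thesis by (rule eventually_mono) (simp add: weak_hessian_def vec_eq_iff)
qed

text \<open>The kernel as a function of y is a test function. Differentiating it in y instead of x
  changes the sign, and this cancels the sign in the definition of the weak derivative.\<close>

lemma conv_weak_pderiv:
 assumes W: "W \<in> sets lebesgue" and w: "has_weak_pderiv W i f g"
  and e: "e > 0" "\<And>y. y - x \<in> square e ==> y \<in> interior W"
 shows "conv (pd i (eta e)) (%x. ind W x * f x) x = conv (eta e) (%x. ind W x * g x) x"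
proof -
 have t: "(%y. eta e (x - y)) \<in> test_functions W" by (rule eta_test_function[OF e])
 have p: "pd i (%y. eta e (x - y)) y = - pd i (eta e) (x - y)" for y
 proof -
  have "(%y. eta e (x - y)) = (%y. eta e (y - x))" by (simp add: eta_commute fun_eq_iff)
  hence "pd i (%y. eta e (x - y)) y = pd i (eta e) (y - x)" by (simp add: pderiv_dir_translate[OF smooth_eta])
  also have "\<dots> = - pd i (eta e) (x - y)" using pderiv_dir_eta_minus[of i e "x - y"] by simp
  finally show ?thesis .
 qed
 have "(LINT y|lebesgue_on W. f y * pd i (%y. eta e (x - y)) y) = - (LINT y|lebesgue_on W. g y * eta e (x - y))"
  using w t unfolding has_weak_pderiv_def by blast
 hence "(LINT y|lebesgue_on W. f y * pd i (eta e) (x - y)) = (LINT y|lebesgue_on W. g y * eta e (x - y))" by (simp add: p)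
 thus ?thesis unfolding conv_def LINT_lebesgue_on[OF W] by (simp add: mult.assoc)
qed

section \<open>Gradients over the truncated cone\<close>

text \<open>The second assumption makes m concave with supergradient \<open>- y t\<close>, so that y
  is nondecreasing. On n equal cells the errors telescope to
  \<open>(b - a) / n * (y b - y a)\<close>, and m never has to be differentiated.\<close>

lemma mono_derivative_integral:
 fixes m y G :: "real => real"
 assumes ab: "a <= b"
  and m: "\<And>s t. s \<in> {a..b} ==> t \<in> {a..b} ==> m s <= m t + (t - s) * y t"
  and G: "G integrable_on {a..b}" "\<And>t. t \<in> {a..b} ==> y t <= G t"
 shows "m a - m b <= integral {a..b} G"
proof -
 have mono: "y s <= y t" if "s \<in> {a..b}" "t \<in> {a..b}" "s <= t" for s t
 proof (cases "s = t")
  case False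
  have "(t - s) * y s <= (t - s) * y t" using m[OF that(1,2)] m[OF that(2,1)] by (simp add: algebra_simps)
  thus ?thesis using that False by simp
 qed simp
 have yi: "y integrable_on {a..b}" by (rule integrable_on_mono_on) (auto intro!: mono_onI mono)
 have yi': "y integrable_on {s..t}" if "a <= s" "t <= b" for s t by (rule integrable_subinterval_real[OF yi]) (use that in auto)
 have cell: "m s - m t <= integral {s..t} y + (t - s) * (y t - y s)" if "a <= s" "s <= t" "t <= b" for s t
 proof -
  have "integral {s..t} (%_. y s) <= integral {s..t} y" by (rule integral_le) (use that in \<open>auto intro!: yi' mono\<close>)
  hence "(t - s) * y s <= integral {s..t} y" using that by simp
  moreover have "m s - m t <= (t - s) * y t" using m[of s t] that by auto
  ultimately show ?thesis by (simp add: algebra_simps)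
 qed
 have part: "m a - m b <= integral {a..b} y + (b - a) / real n * (y b - y a)" if n: "n > 0" for n
 proof -
  define d where "d = (b - a) / real n"
  have d: "d >= 0" "real n * d = b - a" using ab n by (auto simp: d_def)
  have pt: "a + real k * d <= b" if "k <= n" for k
  proof -
   have "real k * d <= real n * d" using that d by (intro mult_right_mono) auto
   thus ?thesis using d by simp
  qed
  have "m a - m (a + real k * d) <= integral {a..a + real k * d} y + d * (y (a + real k * d) - y a)" if "k <= n" for k using that
  proof (induction k)
   case (Suc k)
   have e: "a + real (Suc k) * d = a + real k * d + d" by (simp add: algebra_simps)
   have 1: "m (a + real k * d) - m (a + real (Suc k) * d) <= integral {a + real k * d..a + real (Suc k) * d} y
     + d * (y (a + real (Suc k) * d) - y (a + real k * d))" using cell[of "a + real k * d" "a + real (Suc k) * d"] pt[OF Suc.prems] d e by auto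
   have "integral {a..a + real k * d} y + integral {a + real k * d..a + real (Suc k) * d} y = integral {a..a + real (Suc k) * d} y"
    by (rule Henstock_Kurzweil_Integration.integral_combine) (use d e pt[OF Suc.prems] in \<open>auto intro!: yi'\<close>)
   thus ?case using 1 Suc by (simp add: algebra_simps)
  qed simp
  from this[of n] show ?thesis using d by (simp add: d_def)
 qed
 have "((%n. integral {a..b} y + (b - a) / real n * (y b - y a)) \<longlongrightarrow> integral {a..b} y + 0 * (y b - y a)) sequentially"
  by (intro tendsto_intros lim_const_over_n)
 hence "m a - m b <= integral {a..b} y + 0 * (y b - y a)"
 proof (rule tendsto_lowerbound)
  show "\<forall>\<^sub>F n in sequentially. m a - m b <= integral {a..b} y + (b - a) / real n * (y b - y a)"
   using eventually_gt_at_top[of 0] by eventually_elim (rule part)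
 qed simp
 also have "\<dots> <= integral {a..b} G" using integral_le[OF yi G] by simp
 finally show ?thesis .
qed

lemma norm_le_sum2: "norm (x :: real^2) <= \<bar>x $ 1\<bar> + \<bar>x $ 2\<bar>" using norm_le_l1_cart[of x] by (simp add: sum_2)

lemma norm_power2: "(norm (x :: real^2))\<^sup>2 = (x $ 1)\<^sup>2 + (x $ 2)\<^sup>2"
 unfolding power2_norm_eq_inner by (simp add: inner_vec_def sum_2 power2_eq_square)

lemma inner_2: "(x :: real^2) \<bullet> y = x $ 1 * y $ 1 + x $ 2 * y $ 2" by (simp add: inner_vec_def sum_2)

text \<open>A point outside the narrow cone is turned from the axis by an angle of order \<alpha>,
  while the slope \<open>(t, q2)\<close> has only a small second component. Hence the inner product
  falls short of \<open>norm x\<close> by a fraction of order \<open>\<alpha>^2\<close>; in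
  \<open>slope_line\<close> this bounds the distance of such a minimiser from the vertex.\<close>

lemma cone_gap:
 fixes x :: "real^2"
 assumes "0 < \<alpha>" "\<alpha> <= 2" "0 <= x $ 1" "\<alpha> / 8 * x $ 1 <= \<bar>x $ 2\<bar>" "t <= 1" "\<bar>q2\<bar> <= \<alpha> / 40"
 shows "norm x * \<alpha>\<^sup>2 / 400 <= norm x - (t * x $ 1 + q2 * x $ 2)"
proof (cases "x = 0")
 case False
 define r where "r = norm x"
 have r: "r > 0" using False by (simp add: r_def)
 have r2: "r\<^sup>2 = (x $ 1)\<^sup>2 + (x $ 2)\<^sup>2" by (simp add: r_def norm_power2)
 have "(\<alpha> * x $ 1)\<^sup>2 <= (8 * \<bar>x $ 2\<bar>)\<^sup>2" using assms by (intro power_mono) auto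
 hence "(\<alpha> * r)\<^sup>2 <= 64 * (x $ 2)\<^sup>2 + (\<alpha> * x $ 2)\<^sup>2" by (simp add: power_mult_distrib r2 algebra_simps)
 also have "(\<alpha> * x $ 2)\<^sup>2 <= 4 * (x $ 2)\<^sup>2"
 proof -
  have "\<alpha>\<^sup>2 <= 2\<^sup>2" using assms by (intro power_mono) auto
  thus ?thesis by (simp add: power_mult_distrib mult_right_mono)
 qed
 finally have "(\<alpha> * r)\<^sup>2 <= 68 * (x $ 2)\<^sup>2" by simp
 also have "\<dots> <= 100 * (x $ 2)\<^sup>2" by (intro mult_right_mono) auto
 finally have "(\<alpha> * r)\<^sup>2 <= (10 * \<bar>x $ 2\<bar>)\<^sup>2" by (simp add: power_mult_distrib)
 hence x2: "\<alpha> * r <= 10 * \<bar>x $ 2\<bar>" by (rule power2_le_imp_le) simp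
 have x1r: "x $ 1 <= r" using component_le_norm_cart[of x 1] by (simp add: r_def)
 \<comment> \<open>The gain is quadratic in \<open>x $ 2\<close>, the loss through q2 is linear.
   Since \<open>\<bar>x $ 2\<bar>\<close> is at least \<open>\<alpha> * r / 10\<close>, half of the
   gain survives the loss.\<close>
 have "(r - x $ 1) * (2 * r) >= (r - x $ 1) * (r + x $ 1)" using x1r by (intro mult_left_mono) auto
 hence d: "(r - x $ 1) * (2 * r) >= (x $ 2)\<^sup>2" using r2 by (simp add: algebra_simps power2_eq_square)
 have t: "t * x $ 1 + q2 * x $ 2 <= x $ 1 + \<alpha> / 40 * \<bar>x $ 2\<bar>"
 proof -
  have "t * x $ 1 <= 1 * x $ 1" using assms by (intro mult_right_mono) auto
  moreover have "q2 * x $ 2 <= \<bar>q2\<bar> * \<bar>x $ 2\<bar>" by (metis abs_ge_self abs_mult)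
  moreover have "\<dots> <= \<alpha> / 40 * \<bar>x $ 2\<bar>" using assms by (intro mult_right_mono) auto
  ultimately show ?thesis by linarith
 qed
 have "(x $ 2)\<^sup>2 - 2 * r * (\<alpha> / 40 * \<bar>x $ 2\<bar>) = \<bar>x $ 2\<bar> * (\<bar>x $ 2\<bar> - \<alpha> * r / 20)"
  by (simp add: algebra_simps power2_eq_square flip: abs_mult)
 also have "\<dots> >= (\<alpha> * r / 10) * (\<alpha> * r / 20)" using x2 assms r by (intro mult_mono) auto
 finally have "2 * r * (r - x $ 1 - \<alpha> / 40 * \<bar>x $ 2\<bar>) >= 2 * r * (r * \<alpha>\<^sup>2 / 400)"
  using d by (simp add: algebra_simps power2_eq_square)
 hence "r - x $ 1 - \<alpha> / 40 * \<bar>x $ 2\<bar> >= r * \<alpha>\<^sup>2 / 400" using r by (simp add: mult_le_cancel_left_pos)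
 thus ?thesis using t by (simp add: r_def)
qed simp

text \<open>The slope \<open>\<alpha> / 2\<close> keeps it away from the sides of the sector, as
  \<open>\<alpha> <= tan \<alpha>\<close>. The radius 3/2 lies between 1, from where on the
  extension is \<open>norm x\<close>, and the radius 2 of the double sector.\<close>

definition trunc_cone :: "real => real => (real^2) set" where
 "trunc_cone \<alpha> \<tau> = {x. \<tau> <= x $ 1 \<and> \<bar>x $ 2\<bar> <= \<alpha> / 2 * x $ 1 \<and> norm x <= 3/2}"

lemma compact_trunc_cone: "compact (trunc_cone \<alpha> \<tau>)"
proof -
 have "closed (trunc_cone \<alpha> \<tau>)" unfolding trunc_cone_def by (intro closed_Collect_conj closed_Collect_le continuous_intros)
 moreover have "bounded (trunc_cone \<alpha> \<tau>)" unfolding trunc_cone_def bounded_iff by (intro exI[of _ "3/2"]) auto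
 ultimately show ?thesis by (simp add: compact_eq_bounded_closed)
qed

text \<open>Over dyadic l these boxes cover the narrow cone
  \<open>\<bar>x $ 2\<bar> <= \<alpha> / 8 * x $ 1\<close>, and they stay inside the cone of slope
  \<open>\<alpha> / 4\<close>.\<close>

definition dyadic_box :: "real => real => (real^2) set" where
 "dyadic_box \<alpha> l = {x. l / 2 <= x $ 1 \<and> x $ 1 <= l \<and> \<bar>x $ 2\<bar> <= \<alpha> * l / 8}"

lemma compact_dyadic_box: "compact (dyadic_box \<alpha> l)"
proof -
 have "closed (dyadic_box \<alpha> l)" unfolding dyadic_box_def by (intro closed_Collect_conj closed_Collect_le continuous_intros)
 moreover have "norm x <= \<bar>l\<bar> + \<bar>l\<bar> + \<bar>\<alpha> * l / 8\<bar>" if "x \<in> dyadic_box \<alpha> l" for x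
  using that norm_le_sum2[of x] unfolding dyadic_box_def by auto
 hence "bounded (dyadic_box \<alpha> l)" unfolding bounded_iff by blast
 ultimately show ?thesis by (simp add: compact_eq_bounded_closed)
qed

lemma gradient_at_min:
 fixes U :: "real^2 => real"
 assumes "(U has_derivative (%h. p \<bullet> h)) (at x)" "open S" "x \<in> S" "\<And>z. z \<in> S ==> U x - q \<bullet> x <= U z - q \<bullet> z"
 shows "p = q"
proof -
 have "((%z. U z - q \<bullet> z) has_derivative (%h. p \<bullet> h - q \<bullet> h)) (at x)" using assms(1) by (auto intro!: derivative_eq_intros)
 hence "(%h. p \<bullet> h - q \<bullet> h) = (%h. 0)" by (rule differential_zero_maxmin[OF assms(3,2)]) (use assms(4) in auto)
 hence "(p - q) \<bullet> (p - q) = 0" by (metis inner_diff_left)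
 thus ?thesis by simp
qed

lemma dyadic_scale_exists:
 fixes c :: real
 assumes "c / 2 ^ J < s" "s <= c" "c > 0"
 shows "\<exists>j<J. c / 2 ^ j / 2 <= s \<and> s <= c / 2 ^ j" using assms
proof (induction J)
 case (Suc J)
 show ?case
 proof (cases "c / 2 ^ J < s")
  case True thus ?thesis using Suc by (metis less_SucI)
 next
  case False thus ?thesis using Suc.prems by (intro exI[of _ J]) auto
 qed
qed auto

text \<open>Absorbs the half of x that reappears on the right-hand side.\<close>

lemma half_absorb:
 fixes x y I p w k :: real
 assumes "x - y <= I + p" "p <= (x + w) / 2 + k"
 shows "x <= 2 * y + 2 * I + w + 2 * k" using assms by (simp add: field_simps)

text \<open>For slopes \<open>q\<close> just inside the unit circle, the minimum of \<open>U x - q \<bullet> x\<close> over the truncated cone is attained neither on the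
outer arc nor, if \<open>q\<close> is nearly horizontal, far from the axis: so \<open>q\<close> is the gradient of \<open>U\<close> at a point of a dyadic box,
or the minimiser is close to the inner edge. The minimum is concave in \<open>q $ 1\<close> with slope \<open>-x $ 1\<close>.\<close>

lemma slope_line:
 fixes U :: "real^2 => real" and P :: "real^2 => real^2"
 assumes \<alpha>: "0 < \<alpha>" "\<alpha> <= 2" and \<omega>: "0 < \<omega>" "15 * \<omega> <= \<kappa>" and \<kappa>: "\<kappa> = \<alpha>\<^sup>2 / 800"
  and \<tau>: "\<tau> = 3 / 2 / 2 ^ J" "J >= 4"
  and U: "\<And>x. x \<in> trunc_cone \<alpha> \<tau> ==> (U has_derivative (%h. P x \<bullet> h)) (at x)"
  and cP: "continuous_on UNIV P"
  and lo: "\<And>x. x \<in> trunc_cone \<alpha> \<tau> ==> U x >= norm x - \<omega>" "\<And>x. x \<in> trunc_cone \<alpha> \<tau> ==> U x >= M"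
  and hi: "\<And>x. x \<in> trunc_cone \<alpha> \<tau> ==> norm x >= 6/5 ==> U x <= norm x + \<omega>"
  and q2: "\<bar>q2\<bar> <= \<alpha> / 40"
 shows "\<kappa> * M / 2 - 40 * \<omega> - 2 * \<kappa> * \<tau> <=
   2 * integral {sqrt (1 - q2\<^sup>2) - \<kappa>..sqrt (1 - q2\<^sup>2) - 15 * \<omega>}
    (%t. \<Sum>j<J. (3/2/2^j) * ind (P ` dyadic_box \<alpha> (3/2/2^j)) (vector [t, q2] :: real^2))"
proof -
 define D where "D = trunc_cone \<alpha> \<tau>"
 \<comment> \<open>\<open>(s, q2)\<close> is the point of the unit circle at height q2; a and b lie
   \<kappa> and \<open>15 * \<omega>\<close> inside it.\<close>
 define s where "s = sqrt (1 - q2\<^sup>2)"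
 define a where "a = s - \<kappa>"
 define b where "b = s - 15 * \<omega>"
 define F where "F = (%t. \<Sum>j<J. (3/2/2^j) * ind (P ` dyadic_box \<alpha> (3/2/2^j)) (vector [t, q2] :: real^2) :: real)"
 have \<tau>b: "0 < \<tau>" "\<tau> <= 1/10"
 proof -
  have "(2::real) ^ 4 <= 2 ^ J" using \<tau> by (intro power_increasing) auto
  hence "(15::real) <= 2 ^ J" by simp
  thus "0 < \<tau>" "\<tau> <= 1/10" unfolding \<tau>(1) by (simp_all add: divide_simps)
 qed
 have \<alpha>2: "\<alpha>\<^sup>2 <= 4" using \<alpha> power_mono[of \<alpha> 2 2] by simp
 have \<kappa>b: "0 < \<kappa>" "\<kappa> <= 1/200" unfolding \<kappa> using \<alpha> \<alpha>2 by auto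
 have q22: "q2\<^sup>2 <= 1/400"
 proof -
  have "\<bar>q2\<bar>\<^sup>2 <= (1/20)\<^sup>2" using q2 \<alpha> by (intro power_mono) auto
  thus ?thesis by (simp add: power2_eq_square)
 qed
 have s2: "s\<^sup>2 = 1 - q2\<^sup>2" using q22 by (simp add: s_def)
 have s: "9/10 <= s" "s <= 1"
 proof -
  show "s <= 1" by (rule power2_le_imp_le) (use s2 in auto)
  show "9/10 <= s" by (rule power2_le_imp_le) (use s2 q22 in \<open>auto simp: s_def power2_eq_square\<close>)
 qed
 have ab: "a <= b" using \<omega> by (simp add: a_def b_def)
 have tb: "t <= 1" if "t \<in> {a..b}" for t using that s \<omega> by (auto simp: b_def)
 have comp: "compact D" unfolding D_def by (rule compact_trunc_cone)
 have contU: "continuous_on D U" using U unfolding D_def by (meson continuous_at_imp_continuous_on has_derivative_continuous)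
 \<comment> \<open>On the ray of the slope \<open>(s, q2)\<close>, at a radius where U is at most
   \<open>norm x + \<omega>\<close>; it shows that the minimum for the slope b is small.\<close>
 define e :: "real^2" where "e = vector [6/5 * s, 6/5 * q2]"
 have ne: "norm e = 6/5"
 proof -
  have "(norm e)\<^sup>2 = (6/5 * s)\<^sup>2 + (6/5 * q2)\<^sup>2" by (simp only: norm_power2 e_def vector_2)
  also have "\<dots> = (6/5)\<^sup>2 * (s\<^sup>2 + q2\<^sup>2)" by (simp add: power_mult_distrib algebra_simps power2_eq_square)
  also have "\<dots> = (6/5)\<^sup>2" using s2 by simp
  finally have "(norm e)\<^sup>2 = (6/5)\<^sup>2" .
  thus ?thesis by (rule power2_eq_imp_eq) auto
 qed
 have eD: "e \<in> D"
 proof -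
  have "6/5 * \<bar>q2\<bar> <= 6/5 * (\<alpha> / 40)" using q2 by simp
  also have "\<dots> <= \<alpha> / 2 * (6/5 * s)" using s \<alpha> by (simp add: field_simps)
  finally show ?thesis using ne \<tau>b s by (simp add: D_def trunc_cone_def e_def abs_mult)
 qed
 define V where "V = (%t x. U x - t * x $ 1 - q2 * (x::real^2) $ 2)"
 have "\<exists>x\<in>D. \<forall>z\<in>D. V t x <= V t z" for t
  by (rule continuous_attains_inf[OF comp]) (use eD contU in \<open>auto simp: V_def intro!: continuous_intros\<close>)
 then obtain X where X: "\<And>t. X t \<in> D" "\<And>t z. z \<in> D ==> V t (X t) <= V t z" by metis
 define y where "y = (%t. X t $ 1)"
 define m where "m = (%t. V t (X t))"
 have y0: "y t >= 0" for t using X(1)[of t] \<tau>b by (auto simp: D_def trunc_cone_def y_def)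
 have mm: "m r <= m t + (t - r) * y t" for r t using X(2)[OF X(1)[of t], of r] by (simp add: m_def V_def y_def algebra_simps)
 have ma: "m t <= m a" if "t \<in> {a..b}" for t
 proof -
  have "(a - t) * y a <= 0" using that y0 by (intro mult_nonpos_nonneg) auto
  thus ?thesis using mm[of t a] by simp
 qed
 \<comment> \<open>To first order the norm drops at rate s, which is at least 9/10; the rate 3/4
   leaves room for the quadratic term.\<close>
 have nq: "norm (vector [t, q2] :: real^2) <= 1 - 3/4 * (s - t)" if "t \<in> {a..b}" for t
 proof (rule power2_le_imp_le)
  have st: "0 <= s - t" "s - t <= \<kappa>" using that \<omega> by (auto simp: a_def b_def)
  hence "(s - t) * (s - t) <= (s - t) * (1/200)" using \<kappa>b by (intro mult_left_mono) auto
  moreover have "(s - t) * s >= (s - t) * (9/10)" using st s by (intro mult_left_mono) auto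
  moreover have "(norm (vector [t, q2] :: real^2))\<^sup>2 = 1 - 2 * ((s - t) * s) + (s - t) * (s - t)"
   unfolding norm_power2 vector_2 using s2 by (simp add: power2_eq_square algebra_simps)
  moreover have "(1 - 3/4 * (s - t))\<^sup>2 = 1 - 3/2 * (s - t) + 9/16 * ((s - t) * (s - t))" by (simp add: power2_eq_square field_simps)
  ultimately show "(norm (vector [t, q2] :: real^2))\<^sup>2 <= (1 - 3/4 * (s - t))\<^sup>2"
  proof -
   assume h: "(s - t) * (s - t) <= (s - t) * (1/200)" "(s - t) * s >= (s - t) * (9/10)"
    "(norm (vector [t, q2] :: real^2))\<^sup>2 = 1 - 2 * ((s - t) * s) + (s - t) * (s - t)"
    "(1 - 3/4 * (s - t))\<^sup>2 = 1 - 3/2 * (s - t) + 9/16 * ((s - t) * (s - t))"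
   define A B d where "A = (s - t) * (s - t)" and "B = (s - t) * s" and "d = s - t"
   have "A >= 0" "d >= 0" using st by (auto simp: A_def d_def)
   thus ?thesis using h[folded A_def B_def, folded d_def] unfolding d_def[symmetric] by linarith
  qed
  show "0 <= 1 - 3/4 * (s - t)" using st \<kappa>b by simp
 qed
 \<comment> \<open>The three terms correspond to a minimiser whose slope is a gradient over a box,
   one outside the narrow cone, and one on the inner edge.\<close>
 have key: "y t <= F t + 400 * (m t + \<omega>) / \<alpha>\<^sup>2 + \<tau>" if t: "t \<in> {a..b}" for t
 proof -
  define x where "x = X t"
  have xD: "\<tau> <= x $ 1" "\<bar>x $ 2\<bar> <= \<alpha> / 2 * x $ 1" "norm x <= 3/2" "x \<in> D"
   using X(1)[of t] by (auto simp: x_def D_def trunc_cone_def)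
  have lox: "U x >= norm x - \<omega>" using lo(1) xD by (simp add: D_def)
  have F0: "F t >= 0" unfolding F_def by (intro sum_nonneg) auto
  have m_eq: "m t = U x - (t * x $ 1 + q2 * x $ 2)" by (simp add: m_def V_def x_def)
  have qx: "t * x $ 1 + q2 * x $ 2 = vector [t, q2] \<bullet> x" by (simp add: inner_2)
  have nn: "t * x $ 1 + q2 * x $ 2 <= norm x"
  proof -
   have "vector [t, q2] \<bullet> x <= norm (vector [t, q2] :: real^2) * norm x" by (rule norm_cauchy_schwarz)
   also have "\<dots> <= 1 * norm x"
   proof (rule mult_right_mono)
    have "s - t >= 0" using t \<omega> by (auto simp: b_def)
    thus "norm (vector [t, q2] :: real^2) <= 1" by (intro order_trans[OF nq[OF t]]) simp
   qed simp
   finally show ?thesis using qx by simp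
  qed
  hence m0: "m t + \<omega> >= 0" using m_eq lox by simp
  show ?thesis
  proof (cases "\<alpha> / 8 * x $ 1 <= \<bar>x $ 2\<bar>")
   case True
   have "norm x * \<alpha>\<^sup>2 / 400 <= norm x - (t * x $ 1 + q2 * x $ 2)" by (rule cone_gap) (use \<alpha> xD \<tau>b True tb[OF t] q2 in auto)
   hence "norm x * \<alpha>\<^sup>2 <= 400 * (m t + \<omega>)" using m_eq lox by simp
   hence "norm x <= 400 * (m t + \<omega>) / \<alpha>\<^sup>2" using \<alpha> by (simp add: divide_simps)
   moreover have "y t <= norm x" using component_le_norm_cart[of x 1] by (simp add: y_def x_def)
   ultimately show ?thesis using F0 \<tau>b by simp
  next
   case False
   have gap0: "0 <= 400 * (m t + \<omega>) / \<alpha>\<^sup>2" using m0 by simp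
   show ?thesis
   proof (cases "x $ 1 = \<tau>")
    case True thus ?thesis using F0 gap0 by (simp add: y_def x_def)
   next
    case n\<tau>: False
    have x1: "0 < x $ 1" using xD \<tau>b by simp
    have n32: "norm x < 3/2"
    proof (rule ccontr)
     assume "\<not> norm x < 3/2"
     hence n: "norm x = 3/2" using xD by simp
     \<comment> \<open>Moving x along its ray to radius 6/5 gains \<open>27/8 * \<omega>\<close>
       because the slope stays \<open>15 * \<omega>\<close> inside the circle; this exceeds the
       \<open>2 * \<omega>\<close> by which U may deviate from the norm at the two points.\<close>
     define z where "z = (4/5) *\<^sub>R x"
     have "norm x <= x $ 1 + \<alpha> / 8 * x $ 1" using norm_le_sum2[of x] False x1 by simp
     also have "\<dots> <= x $ 1 + 2 / 8 * x $ 1" using \<alpha> x1 by (intro add_left_mono mult_right_mono) auto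
     finally have "x $ 1 >= 1" using n by simp
     hence zD: "z \<in> D" "norm z = 6/5" using xD n \<tau>b by (auto simp: z_def D_def trunc_cone_def abs_mult)
     have "V t x <= V t z" using X(2)[OF zD(1)] by (simp add: x_def)
     moreover have "U z <= 6/5 + \<omega>" using hi[of z] zD by (simp add: D_def)
     ultimately have 1: "3/10 <= 2 * \<omega> + 1/5 * (t * x $ 1 + q2 * x $ 2)" using lox n by (simp add: V_def z_def algebra_simps)
     have "vector [t, q2] \<bullet> x <= norm (vector [t, q2] :: real^2) * norm x" by (rule norm_cauchy_schwarz)
     also have "\<dots> <= (1 - 3/4 * (15 * \<omega>)) * norm x"
     proof (rule mult_right_mono)
      have "15 * \<omega> <= s - t" using t by (auto simp: b_def)
      thus "norm (vector [t, q2] :: real^2) <= 1 - 3/4 * (15 * \<omega>)" by (intro order_trans[OF nq[OF t]]) simp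
     qed simp
     finally show False using 1 qx n \<omega> by (simp add: algebra_simps)
    qed
    define S where "S = {z::real^2. \<tau> < z $ 1 \<and> \<bar>z $ 2\<bar> < \<alpha> / 2 * z $ 1 \<and> norm z < 3/2}"
    have oS: "open S" unfolding S_def by (intro open_Collect_conj open_Collect_less continuous_intros)
    have xS: "x \<in> S" using xD n\<tau> n32 False x1 \<alpha> by (auto simp: S_def)
    have SD: "S \<subseteq> D" by (auto simp: S_def D_def trunc_cone_def)
    have Px: "P x = vector [t, q2]"
    proof (rule gradient_at_min[OF _ oS xS])
     show "(U has_derivative (\<bullet>) (P x)) (at x)" using U xD by (simp add: D_def)
     fix z assume "z \<in> S"
     hence "V t x <= V t z" using X(2)[of z t] SD by (auto simp: x_def)
     thus "U x - vector [t, q2] \<bullet> x <= U z - vector [t, q2] \<bullet> z" by (simp add: V_def inner_2)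
    qed
    have "x $ 1 <= 3/2" using component_le_norm_cart[of x 1] xD by simp
    then obtain j where j: "j < J" "3/2/2^j/2 <= x $ 1" "x $ 1 <= 3/2/2^j" using dyadic_scale_exists[of "3/2" J "x $ 1"] xD n\<tau> \<tau> by auto
    have "\<alpha> / 8 * x $ 1 <= \<alpha> / 8 * (3/2/2^j)" using j \<alpha> by (intro mult_left_mono) auto
    hence "x \<in> dyadic_box \<alpha> (3/2/2^j)" using j False by (auto simp: dyadic_box_def)
    hence ind: "vector [t, q2] \<in> P ` dyadic_box \<alpha> (3/2/2^j)" using Px by (metis imageI)
    have "(3/2/2^j) * ind (P ` dyadic_box \<alpha> (3/2/2^j)) (vector [t, q2] :: real^2) <= F t"
     unfolding F_def by (rule member_le_sum) (use j in auto)
    hence "3/2/2^j <= F t" using ind by simp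
    thus ?thesis using j gap0 \<tau>b by (simp add: y_def x_def)
   qed
  qed
 qed
 have meas: "F \<in> borel_measurable borel"
 proof -
  have [measurable]: "P ` dyadic_box \<alpha> l \<in> sets borel" for l
   by (intro borel_closed compact_imp_closed compact_continuous_image compact_dyadic_box continuous_on_subset[OF cP]) auto
  have [measurable]: "(%t. vector [t, q2] :: real^2) \<in> borel \<rightarrow>\<^sub>M borel"
   by (intro borel_measurable_continuous_onI continuous_at_imp_continuous_on ballI isCont_vector2)
  show ?thesis unfolding F_def by measurable
 qed
 have Fb: "\<bar>F t\<bar> <= (\<Sum>j<J. 3/2/2^j)" for t
 proof -
  have "\<bar>F t\<bar> = F t" unfolding F_def by (intro abs_of_nonneg sum_nonneg) auto
  also have "\<dots> <= (\<Sum>j<J. 3/2/2^j)" unfolding F_def by (intro sum_mono) (auto simp: indicator_def)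
  finally show ?thesis .
 qed
 have Fi: "F integrable_on {a..b}"
 proof (rule measurable_bounded_by_integrable_imp_integrable[where g = "%_. \<Sum>j<J. 3/2/2^j"])
  show "F \<in> borel_measurable (lebesgue_on {a..b})" using meas by (simp add: measurable_completion measurable_restrict_space1)
 qed (use Fb in auto)
 let ?c = "400 * (m a + \<omega>) / \<alpha>\<^sup>2 + \<tau>"
 have "m a - m b <= integral {a..b} (%t. F t + ?c)"
 proof (rule mono_derivative_integral[OF ab])
  show "m r <= m t + (t - r) * y t" for r t by (rule mm)
  show "(%t. F t + ?c) integrable_on {a..b}" by (intro integrable_add Fi) auto
  fix t assume t: "t \<in> {a..b}"
  have "400 * (m t + \<omega>) / \<alpha>\<^sup>2 <= 400 * (m a + \<omega>) / \<alpha>\<^sup>2" using ma[OF t] \<alpha> by (intro divide_right_mono) auto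
  thus "y t <= F t + ?c" using key[OF t] by simp
 qed
 also have "\<dots> = integral {a..b} F + (b - a) * ?c" using ab Fi by (subst Henstock_Kurzweil_Integration.integral_add) auto
 finally have h1: "m a - m b <= integral {a..b} F + (b - a) * ?c" .
 have h2: "(b - a) * ?c <= \<kappa> * ?c"
 proof (rule mult_right_mono)
  show "b - a <= \<kappa>" using \<omega> by (simp add: a_def b_def)
  have "norm (X a) * 0 <= 0" by simp
  have "U (X a) >= norm (X a) - \<omega>" using lo(1) X(1)[of a] by (simp add: D_def)
  moreover have "vector [a, q2] \<bullet> X a <= norm (vector [a, q2] :: real^2) * norm (X a)" by (rule norm_cauchy_schwarz)
  moreover have "\<dots> <= 1 * norm (X a)" using ab \<kappa>b by (intro mult_right_mono order_trans[OF nq[of a]]) (auto simp: a_def)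
  ultimately have "m a + \<omega> >= 0" by (simp add: m_def V_def inner_2)
  thus "0 <= ?c" using \<tau>b by simp
 qed
 \<comment> \<open>\<kappa> is chosen to make \<open>\<kappa> * 400 / \<alpha>^2\<close> equal to
   1/2, so that \<open>m a\<close> on the right can be absorbed.\<close>
 have h3: "\<kappa> * ?c = (m a + \<omega>) / 2 + \<kappa> * \<tau>" unfolding \<kappa> using \<alpha> by (simp add: field_simps)
 have up: "m a <= 2 * m b + 2 * integral {a..b} F + \<omega> + 2 * \<kappa> * \<tau>"
  unfolding mult.assoc[of 2 \<kappa> \<tau>] by (rule half_absorb[OF h1 h2[unfolded h3]])
 \<comment> \<open>The deviation of U contributes \<omega>, and the distance
   \<open>15 * \<omega>\<close> of b from the circle, taken at radius 6/5, contributes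
   \<open>18 * \<omega>\<close>.\<close>
 have mb: "m b <= 19 * \<omega>"
 proof -
  have "m b <= V b e" using X(2)[OF eD] by (simp add: m_def)
  also have "\<dots> = U e - 6/5 * (b * s + q2\<^sup>2)" by (simp add: V_def e_def field_simps power2_eq_square)
  finally have 1: "m b <= U e - 6/5 * (b * s + q2\<^sup>2)" .
  have 2: "U e <= 6/5 + \<omega>" using hi[of e] eD ne by (simp add: D_def)
  have 3: "b * s + q2\<^sup>2 = 1 - 15 * (\<omega> * s)" using s2 by (simp add: b_def algebra_simps power2_eq_square)
  have 4: "\<omega> * s <= \<omega> * 1" using s \<omega> by (intro mult_left_mono) auto
  show ?thesis using 1 2 4 unfolding 3 by (simp add: field_simps)
 qed
 \<comment> \<open>The slope at a has norm at most \<open>1 - \<kappa> / 2\<close>, so even at the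
   minimiser the fraction \<open>\<kappa> / 2\<close> of the value of U remains.\<close>
 have low: "\<kappa> * M / 2 - \<omega> <= m a"
 proof -
  define x where "x = X a"
  have xD: "x \<in> D" using X by (simp add: x_def)
  have U1: "norm x <= U x + \<omega>" "M <= U x" using lo[of x] xD by (simp_all add: D_def diff_le_eq)
  have "vector [a, q2] \<bullet> x <= norm (vector [a, q2] :: real^2) * norm x" by (rule norm_cauchy_schwarz)
  also have "\<dots> <= (1 - \<kappa> / 2) * norm x" using ab \<kappa>b by (intro mult_right_mono order_trans[OF nq[of a]]) (auto simp: a_def)
  also have "\<dots> <= (1 - \<kappa> / 2) * (U x + \<omega>)" using U1 \<kappa>b by (intro mult_left_mono) auto
  finally have "m a >= U x - (1 - \<kappa> / 2) * (U x + \<omega>)" by (simp add: m_def V_def inner_2 x_def)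
  moreover have "(1 - \<kappa> / 2) * \<omega> <= 1 * \<omega>" using \<kappa>b \<omega> by (intro mult_right_mono) auto
  moreover have "\<kappa> * M <= \<kappa> * U x" using U1 \<kappa>b by (intro mult_left_mono) auto
  ultimately show ?thesis by (simp add: algebra_simps)
 qed
 show ?thesis using up mb low unfolding F_def a_def b_def s_def by simp
qed

text \<open>The estimate on lines is integrated over \<open>\<bar>q2\<bar> <= \<alpha> / 40\<close>,
  an interval of length \<open>\<alpha> / 20\<close>; Tonelli turns the indicator functions on the
  lines into areas of gradient images.\<close>

lemma slope_area:
 fixes U :: "real^2 => real" and P :: "real^2 => real^2"
 assumes \<alpha>: "0 < \<alpha>" "\<alpha> <= 2" and \<omega>: "0 < \<omega>" "15 * \<omega> <= \<kappa>" and \<kappa>: "\<kappa> = \<alpha>\<^sup>2 / 800"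
  and \<tau>: "\<tau> = 3 / 2 / 2 ^ J" "J >= 4"
  and U: "\<And>x. x \<in> trunc_cone \<alpha> \<tau> ==> (U has_derivative (%h. P x \<bullet> h)) (at x)"
  and cP: "continuous_on UNIV P"
  and lo: "\<And>x. x \<in> trunc_cone \<alpha> \<tau> ==> U x >= norm x - \<omega>" "\<And>x. x \<in> trunc_cone \<alpha> \<tau> ==> U x >= M"
  and hi: "\<And>x. x \<in> trunc_cone \<alpha> \<tau> ==> norm x >= 6/5 ==> U x <= norm x + \<omega>"
 shows "\<alpha> / 20 * (\<kappa> * M / 2 - 40 * \<omega> - 2 * \<kappa> * \<tau>) <=
   2 * (\<Sum>j<J. (3/2/2^j) * measure lebesgue (P ` dyadic_box \<alpha> (3/2/2^j)))"
proof (cases "\<kappa> * M / 2 - 40 * \<omega> - 2 * \<kappa> * \<tau> >= 0")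
 case False
 hence "\<alpha> / 20 * (\<kappa> * M / 2 - 40 * \<omega> - 2 * \<kappa> * \<tau>) <= 0" using \<alpha> by (intro mult_nonneg_nonpos) auto
 also have "0 <= 2 * (\<Sum>j<J. (3/2/2^j) * measure lebesgue (P ` dyadic_box \<alpha> (3/2/2^j)))" by (intro mult_nonneg_nonneg sum_nonneg) auto
 finally show ?thesis .
next
 case c0: True
 define c where "c = \<kappa> * M / 2 - 40 * \<omega> - 2 * \<kappa> * \<tau>"
 define Q where "Q = (%j. P ` dyadic_box \<alpha> (3/2/2^j))"
 define F :: "real^2 => real" where "F = (%q. \<Sum>j<J. (3/2/2^j) * ind (Q j) q)"
 have cQ: "compact (Q j)" for j unfolding Q_def by (intro compact_continuous_image compact_dyadic_box continuous_on_subset[OF cP]) auto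
 have Qm[measurable]: "Q j \<in> sets borel" for j using cQ by (simp add: borel_closed compact_imp_closed)
 have iQ: "integrable lborel (indicat_real (Q j))" for j by (intro integrable_real_indicator emeasure_bounded_finite compact_imp_bounded cQ) simp
 have Fm[measurable]: "F \<in> borel_measurable borel" unfolding F_def by measurable
 have Fnn: "F q >= 0" for q unfolding F_def by (intro sum_nonneg) auto
 have vm[measurable]: "(%t. vector [t, q2] :: real^2) \<in> borel \<rightarrow>\<^sub>M borel" for q2
  by (intro borel_measurable_continuous_onI continuous_at_imp_continuous_on ballI isCont_vector2)
 have line: "ennreal c <= 2 * (\<integral>\<^sup>+t. ennreal (F (vector [t, q2])) \<partial>lborel)" if q2: "\<bar>q2\<bar> <= \<alpha> / 40" for q2
 proof -
  let ?a = "sqrt (1 - q2\<^sup>2) - \<kappa>" and ?b = "sqrt (1 - q2\<^sup>2) - 15 * \<omega>"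
  have le: "c <= 2 * integral {?a..?b} (%t. F (vector [t, q2]))"
   using slope_line[OF \<alpha> \<omega> \<kappa> \<tau> U cP lo hi q2] unfolding c_def F_def Q_def by simp
  have "F (vector [t, q2]) <= (\<Sum>j<J. 3/2/2^j)" for t unfolding F_def by (intro sum_mono) (auto simp: indicator_def)
  hence ae: "(%t. F (vector [t, q2])) absolutely_integrable_on {?a..?b}"
   by (intro measurable_bounded_by_integrable_imp_absolutely_integrable[where g = "%_. \<Sum>j<J. 3/2/2^j"])
     (auto simp: Fnn intro!: measurable_restrict_space1 measurable_completion)
  have "integral {?a..?b} (%t. F (vector [t, q2])) = (LINT t|lebesgue. ind {?a..?b} t *\<^sub>R F (vector [t, q2]))"
   using set_lebesgue_integral_eq_integral(2)[OF ae] by (simp add: set_lebesgue_integral_def)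
  also have "\<dots> = (LINT t|lborel. ind {?a..?b} t *\<^sub>R F (vector [t, q2]))" by (rule integral_completion) measurable
  finally have I: "integral {?a..?b} (%t. F (vector [t, q2])) = (LINT t|lborel. ind {?a..?b} t *\<^sub>R F (vector [t, q2]))" .
  have "integrable lborel (%t. ind {?a..?b} t *\<^sub>R F (vector [t, q2]))"
   using ae unfolding set_integrable_def by (subst (asm) integrable_completion) measurable
  hence "ennreal (LINT t|lborel. ind {?a..?b} t *\<^sub>R F (vector [t, q2])) = (\<integral>\<^sup>+t. ennreal (ind {?a..?b} t *\<^sub>R F (vector [t, q2])) \<partial>lborel)"
   by (subst nn_integral_eq_integral) (auto simp: Fnn)
  also have "\<dots> <= (\<integral>\<^sup>+t. ennreal (F (vector [t, q2])) \<partial>lborel)"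
   by (intro nn_integral_mono ennreal_leI) (auto simp: indicator_def Fnn)
  finally have "2 * ennreal (integral {?a..?b} (%t. F (vector [t, q2]))) <= 2 * (\<integral>\<^sup>+t. ennreal (F (vector [t, q2])) \<partial>lborel)"
   unfolding I by (intro mult_left_mono) auto
  moreover have "ennreal c <= ennreal (2 * integral {?a..?b} (%t. F (vector [t, q2])))" using le by (rule ennreal_leI)
  moreover have "ennreal (2 * integral {?a..?b} (%t. F (vector [t, q2]))) = 2 * ennreal (integral {?a..?b} (%t. F (vector [t, q2])))"
   by (simp add: ennreal_mult')
  ultimately show ?thesis by simp
 qed
 have "ennreal (\<alpha> / 20 * c) = (\<integral>\<^sup>+q2. ennreal c * ind {-\<alpha>/40..\<alpha>/40} q2 \<partial>lborel)"
  using \<alpha> c0 by (subst nn_integral_cmult_indicator) (auto simp: c_def mult.commute simp flip: ennreal_mult)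
 also have "\<dots> <= (\<integral>\<^sup>+q2. 2 * (\<integral>\<^sup>+t. ennreal (F (vector [t, q2])) \<partial>lborel) \<partial>lborel)"
  using line by (intro nn_integral_mono) (auto simp: indicator_def abs_le_iff)
 also have "\<dots> = 2 * (\<integral>\<^sup>+q2. (\<integral>\<^sup>+t. ennreal (F (vector [t, q2])) \<partial>lborel) \<partial>lborel)"
 proof (rule nn_integral_cmult)
  have "(%p. vector [snd p, fst p] :: real^2) \<in> borel \<Otimes>\<^sub>M borel \<rightarrow>\<^sub>M borel"
  proof -
   have "(%p. (snd p, fst p)) \<in> borel \<rightarrow>\<^sub>M (borel :: (real \<times> real) measure)"
    by (intro borel_measurable_continuous_onI continuous_intros)
   from measurable_compose[OF this measurable_vector2] show ?thesis by (simp add: borel_prod)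
  qed
  hence "(%p. ennreal (F (vector [snd p, fst p]))) \<in> borel_measurable (borel \<Otimes>\<^sub>M lborel)" by measurable
  hence "(%q2. \<integral>\<^sup>+t. ennreal (F (vector [snd (q2, t), fst (q2, t)])) \<partial>lborel) \<in> borel_measurable borel"
   by (intro lborel.borel_measurable_nn_integral) (simp add: case_prod_unfold)
  thus "(%q2. \<integral>\<^sup>+t. ennreal (F (vector [t, q2])) \<partial>lborel) \<in> borel_measurable lborel" by simp
 qed
 also have "\<dots> = 2 * (\<integral>\<^sup>+q. ennreal (F q) \<partial>lborel)" by (subst nn_integral_plane(2)) auto
 also have "(\<integral>\<^sup>+q. ennreal (F q) \<partial>lborel) = ennreal (LINT q|lborel. F q)"
 proof (rule nn_integral_eq_integral)
  show "integrable lborel F" unfolding F_def by (intro Bochner_Integration.integrable_sum integrable_mult_right iQ)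
 qed (use Fnn in auto)
 also have "(LINT q|lborel. F q) = (\<Sum>j<J. (3/2/2^j) * measure lborel (Q j))"
  unfolding F_def by (subst Bochner_Integration.integral_sum) (use iQ in auto)
 also have "\<dots> = (\<Sum>j<J. (3/2/2^j) * measure lebesgue (Q j))" by (intro sum.cong) (auto simp: measure_completion)
 finally have "ennreal (\<alpha> / 20 * c) <= ennreal (2 * (\<Sum>j<J. (3/2/2^j) * measure lebesgue (Q j)))" by (simp add: ennreal_mult')
 hence "\<alpha> / 20 * c <= 2 * (\<Sum>j<J. (3/2/2^j) * measure lebesgue (Q j))"
  by (subst (asm) ennreal_le_iff) (auto intro!: mult_nonneg_nonneg sum_nonneg)
 thus ?thesis by (simp add: c_def Q_def)
qed

section \<open>Polar coordinates\<close>

definition polar :: "real^2 => real^2" where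
 "polar p = vector [p $ 1 * cos (p $ 2), p $ 1 * sin (p $ 2)]"

definition dir :: "real => real^2" where "dir t = vector [cos t, sin t]"

lemma polar_dir: "polar (vector [r, t]) = r *\<^sub>R dir t" by (simp add: polar_def dir_def vec_eq_iff forall_2)

lemma norm_dir [simp]: "norm (dir t) = 1" by (simp add: norm_vec_def L2_set_def sum_2 dir_def)

lemma dir_nth [simp]: "dir t $ 1 = cos t" "dir t $ 2 = sin t" by (simp_all add: dir_def)

lemma polar_has_derivative:
 "(polar has_derivative (%h. vector [cos (p$2) * h$1 - p$1 * sin (p$2) * h$2, sin (p$2) * h$1 + p$1 * cos (p$2) * h$2])) (at p within S)"
proof -
 have eq: "polar = (%p. (p$1 * cos (p$2)) *\<^sub>R axis 1 1 + (p$1 * sin (p$2)) *\<^sub>R axis 2 1)"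
  by (simp add: fun_eq_iff polar_def vec_eq_iff forall_2 axis_def)
 have n: "((%p::real^2. p $ i) has_derivative (%h. h $ i)) (at p within S)" for i
  by (rule bounded_linear_imp_has_derivative[OF bounded_linear_vec_nth])
 have c: "((%p::real^2. cos (p $ 2)) has_derivative (%h. - sin (p $ 2) * h $ 2)) (at p within S)"
  by (rule has_derivative_eq_rhs[OF DERIV_compose_FDERIV[OF DERIV_cos n]]) (simp add: fun_eq_iff)
 have s: "((%p::real^2. sin (p $ 2)) has_derivative (%h. cos (p $ 2) * h $ 2)) (at p within S)"
  by (rule has_derivative_eq_rhs[OF DERIV_compose_FDERIV[OF DERIV_sin n]]) (simp add: fun_eq_iff)
 show ?thesis unfolding eq by (rule has_derivative_eq_rhs, (rule has_derivative_add has_derivative_scaleR_left has_derivative_mult n c s)+)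
    (simp add: fun_eq_iff vec_eq_iff forall_2 axis_def algebra_simps)
qed

definition polar_rect :: "real => real => real => (real^2) set" where
 "polar_rect a b c = cbox (vector [a, - c]) (vector [b, c])"

lemma polar_rect_mem: "p \<in> polar_rect a b c \<longleftrightarrow> a <= p$1 \<and> p$1 <= b \<and> - c <= p$2 \<and> p$2 <= c"
 by (auto simp: polar_rect_def mem_box_cart forall_2)

lemma polar_continuous: "continuous_on S polar" by (intro continuous_at_imp_continuous_on ballI has_derivative_continuous[OF polar_has_derivative])

lemma polar_inj:
 assumes "0 < a" "0 < c" "c < pi"
 shows "inj_on polar (polar_rect a b c)"
proof (rule inj_onI)
 fix p q assume p: "p \<in> polar_rect a b c" and q: "q \<in> polar_rect a b c" and eq: "polar p = polar q"
 have e: "p$1 * cos (p$2) = q$1 * cos (q$2)" "p$1 * sin (p$2) = q$1 * sin (q$2)" using eq by (auto simp: polar_def vec_eq_iff forall_2)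
 have pos: "p$1 > 0" "q$1 > 0" using p q assms by (auto simp: polar_rect_mem)
 have "(p$1)\<^sup>2 = (p$1 * cos (p$2))\<^sup>2 + (p$1 * sin (p$2))\<^sup>2" by (simp add: power_mult_distrib flip: distrib_left)
 also have "\<dots> = (q$1)\<^sup>2" unfolding e by (simp add: power_mult_distrib flip: distrib_left)
 finally have r: "p$1 = q$1" using pos by (simp add: power2_eq_iff)
 hence cs: "cos (p$2) = cos (q$2)" "sin (p$2) = sin (q$2)" using e pos by auto
 have ab: "\<bar>p$2\<bar> = \<bar>q$2\<bar>"
 proof (rule cos_inj_pi)
  show "cos \<bar>p$2\<bar> = cos \<bar>q$2\<bar>" using cs by simp
 qed (use p q assms in \<open>auto simp: polar_rect_mem\<close>)
 have "p$2 = q$2"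
 proof (rule ccontr)
  assume n: "p$2 \<noteq> q$2"
  hence "p$2 = - q$2" "q$2 \<noteq> 0" using ab by (auto simp: abs_if split: if_splits)
  hence "sin (q$2) = 0" using cs by simp
  moreover have "sin \<bar>q$2\<bar> > 0" using \<open>q$2 \<noteq> 0\<close> q assms by (intro sin_gt_zero) (auto simp: polar_rect_mem)
  ultimately show False by (auto simp: abs_if split: if_splits)
 qed
 thus "p = q" using r by (simp add: vec_eq_iff forall_2)
qed

lemma absolutely_integrable_continuous_compact:
 fixes f :: "'a::euclidean_space => 'b::euclidean_space"
 assumes "compact A" "continuous_on A f" shows "f absolutely_integrable_on A"
proof -
 have i: "integrable lborel (%x. ind A x *\<^sub>R f x)" using borel_integrable_compact[OF assms] by (simp add: set_integrable_def)
 thus ?thesis unfolding set_integrable_def by (subst integrable_completion) auto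
qed

lemma polar_integral:
 fixes f :: "real^2 => real"
 assumes c: "continuous_on UNIV f" and ab: "0 < a" "0 < c" "c < pi"
 shows "(LINT x|lborel. ind (polar ` polar_rect a b c) x * f x)
  = (LINT p|lborel. ind (polar_rect a b c) p * (p$1 * f (polar p)))"
proof -
 let ?R = "polar_rect a b c"
 let ?D = "%p h. vector [cos (p$2) * h$1 - p$1 * sin (p$2) * h$2, sin (p$2) * h$1 + p$1 * cos (p$2) * h$2] :: real^2"
 have cR: "compact ?R" by (simp add: polar_rect_def)
 have cI: "compact (polar ` ?R)" by (rule compact_continuous_image[OF polar_continuous cR])
 have d: "\<bar>det (matrix (?D p))\<bar> = p$1" if "p \<in> ?R" for p
 proof -
  have "det (matrix (?D p)) = p$1 * (cos (p$2) * cos (p$2)) + p$1 * (sin (p$2) * sin (p$2))" by (simp add: det_2 matrix_def axis_def)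
  hence "det (matrix (?D p)) = p$1 * (cos (p$2) * cos (p$2) + sin (p$2) * sin (p$2))" by (simp only: distrib_left)
  moreover have "cos (p$2) * cos (p$2) + sin (p$2) * sin (p$2) = 1" using sin_cos_squared_add2[of "p$2"] by (simp add: power2_eq_square)
  ultimately show ?thesis using that ab by (simp add: polar_rect_mem)
 qed
 have fcont: "continuous_on (polar ` ?R) f" using c continuous_on_subset by blast
 have hcont: "continuous_on UNIV (%p. p$1 * f (polar p))" by (intro continuous_intros continuous_on_compose2[OF c polar_continuous]) auto
 \<comment> \<open>The values are lifted to \<open>real^1\<close>, where the change of variables is
   applied; \<open>comp\<close> takes them back.\<close>
 have ai: "(%x. vec (f x) :: real^1) absolutely_integrable_on polar ` ?R"
  by (rule absolutely_integrable_continuous_compact[OF cI]) (unfold vec_def, intro continuous_on_vec_lambda fcont)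
 have ch: "integral (polar ` ?R) (%x. vec (f x) :: real^1) = integral ?R (%p. \<bar>det (matrix (?D p))\<bar> *\<^sub>R (vec (f (polar p)) :: real^1))"
  by (rule integral_change_of_variables[OF _ polar_has_derivative polar_inj[OF ab] disjI1[OF ai]])
    (simp add: polar_rect_def)
 have "integral ?R (%p. \<bar>det (matrix (?D p))\<bar> *\<^sub>R (vec (f (polar p)) :: real^1)) = integral ?R (%p. vec (p$1 * f (polar p)))"
  by (rule integral_cong) (simp add: d vec_eq_iff)
 hence v: "integral (polar ` ?R) (%x. vec (f x) :: real^1) = integral ?R (%p. vec (p$1 * f (polar p)))" using ch by simp
 have i1: "(%x. vec (f x) :: real^1) integrable_on polar ` ?R" using ai set_lebesgue_integral_eq_integral(1) by blast
 have i2: "(%p. vec (p$1 * f (polar p)) :: real^1) integrable_on ?R"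
  unfolding polar_rect_def by (rule integrable_continuous) (unfold vec_def, intro continuous_on_vec_lambda continuous_on_subset[OF hcont] subset_UNIV)
 have comp: "integral A (%x. vec (k x) :: real^1) $ 1 = integral A k" if "(%x. vec (k x) :: real^1) integrable_on A" for A and k :: "real^2 => real"
  using integral_linear[OF that bounded_linear_vec_nth[of 1]] by (simp add: o_def)
 have "integral (polar ` ?R) f = integral ?R (%p. p$1 * f (polar p))" using v comp[OF i1] comp[OF i2] by simp
 moreover have conv: "integral A k = (LINT x|lborel. ind A x * k x)" if A: "compact A" and k: "continuous_on UNIV k" for A and k :: "real^2 => real"
 proof -
  have ak: "k absolutely_integrable_on A" by (rule absolutely_integrable_continuous_compact[OF A]) (use k continuous_on_subset in blast)
  have [measurable]: "k \<in> borel_measurable borel" "A \<in> sets borel"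
   using k A by (auto simp: borel_measurable_continuous_onI compact_imp_closed)
  have "integral A k = (LINT x|lebesgue. ind A x *\<^sub>R k x)"
   using set_lebesgue_integral_eq_integral(2)[OF ak] by (simp add: set_lebesgue_integral_def)
  also have "\<dots> = (LINT x|lborel. ind A x *\<^sub>R k x)" by (rule integral_completion) measurable
  finally show ?thesis by simp
 qed
 ultimately show ?thesis using conv[OF cI c] conv[OF cR hcont] by simp
qed

section \<open>The sector\<close>

lemma tan_pos: "0 < \<alpha> ==> \<alpha> < pi / 2 ==> 0 < tan \<alpha>" by (rule tan_gt_zero) auto

text \<open>Described by linear inequalities instead of angles: for positive
  \<open>tan \<alpha>\<close> it is an intersection of two open half-planes, so openness, convexity
  and scaling are immediate, and the vertex is excluded.\<close>

definition cone :: "real => (real^2) set" where "cone \<alpha> = {x. \<bar>x $ 2\<bar> < tan \<alpha> * x $ 1}"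

lemma cone_pos: "0 < \<alpha> ==> \<alpha> < pi / 2 ==> x \<in> cone \<alpha> ==> x $ 1 > 0"
proof -
 assume a: "0 < \<alpha>" "\<alpha> < pi / 2" "x \<in> cone \<alpha>"
 hence "0 < tan \<alpha> * x $ 1" using abs_ge_zero[of "x $ 2"] by (auto simp: cone_def intro: le_less_trans)
 thus "x $ 1 > 0" using tan_pos[OF a(1,2)] by (rule zero_less_mult_pos)
qed

lemma open_cone: "open (cone \<alpha>)" unfolding cone_def by (intro open_Collect_less continuous_intros)

lemma dir_cone:
 assumes a: "0 < \<alpha>" "\<alpha> < pi / 2" and t: "\<bar>t\<bar> < \<alpha>" and r: "0 < r"
 shows "r *\<^sub>R dir t \<in> cone \<alpha>"
proof -
 have c: "cos t > 0" by (rule cos_gt_zero_pi) (use a t in auto)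
 have "tan t < tan \<alpha>" by (rule tan_monotone) (use a t in auto)
 moreover have "tan (- t) < tan \<alpha>" by (rule tan_monotone) (use a t in auto)
 ultimately have "\<bar>tan t\<bar> < tan \<alpha>" by auto
 hence "\<bar>tan t\<bar> * cos t < tan \<alpha> * cos t" using c by simp
 moreover have "\<bar>tan t\<bar> * cos t = \<bar>sin t\<bar>" using c by (simp add: tan_def abs_mult)
 ultimately show ?thesis using r by (simp add: cone_def abs_mult mult.left_commute)
qed

lemma cone_dir:
 assumes a: "0 < \<alpha>" "\<alpha> < pi / 2" and x: "x \<in> cone \<alpha>"
 obtains t where "\<bar>t\<bar> < \<alpha>" "x = norm x *\<^sub>R dir t"
proof -
 have x1: "x $ 1 > 0" by (rule cone_pos[OF a x])
 define t where "t = arctan (x $ 2 / x $ 1)"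
 have tb: "- (pi/2) < t" "t < pi/2" unfolding t_def using arctan_bounded by auto
 have tt: "tan t = x $ 2 / x $ 1" by (simp add: t_def tan_arctan)
 have b: "x $ 2 / x $ 1 < tan \<alpha>" "- tan \<alpha> < x $ 2 / x $ 1"
  using x x1 by (auto simp: cone_def divide_less_eq less_divide_eq abs_less_iff)
 have "t < \<alpha>" using tan_monotone'[of t \<alpha>] tb a b tt by auto
 moreover have "- \<alpha> < t" using tan_monotone'[of "- \<alpha>" t] tb a b tt by auto
 ultimately have ta: "\<bar>t\<bar> < \<alpha>" by auto
 have c: "cos t > 0" by (rule cos_gt_zero_pi) (use tb in auto)
 have s: "sin t = cos t * (x $ 2 / x $ 1)" using tt c by (simp add: tan_def field_simps)
 define r where "r = x $ 1 / cos t"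
 have "x = r *\<^sub>R dir t" using s c x1 by (simp add: vec_eq_iff forall_2 r_def)
 moreover have "r > 0" using c x1 by (simp add: r_def)
 ultimately have "x = norm x *\<^sub>R dir t" by (metis abs_of_pos mult.right_neutral norm_dir norm_scaleR)
 thus ?thesis using ta that by blast
qed

lemma sector_eq:
 assumes a: "0 < \<alpha>" "\<alpha> < pi / 2"
 shows "sector \<alpha> = insert 0 {x \<in> cone \<alpha>. norm x < 1}"
proof (intro equalityI subsetI)
 fix x assume "x \<in> sector \<alpha>"
 then obtain r t where x: "x = r *\<^sub>R dir t" "0 <= r" "r < 1" "- \<alpha> < t" "t < \<alpha>" unfolding sector_def dir_def by auto
 show "x \<in> insert 0 {x \<in> cone \<alpha>. norm x < 1}"
 proof (cases "r = 0")
  case False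
  thus ?thesis using x dir_cone[OF a, of t r] by auto
 qed (use x in simp)
next
 fix x assume x: "x \<in> insert 0 {x \<in> cone \<alpha>. norm x < 1}"
 show "x \<in> sector \<alpha>"
 proof (cases "x = 0")
  case True
  thus ?thesis unfolding sector_def using a by (auto intro!: exI[of _ 0])
 next
  case False
  then obtain t where "\<bar>t\<bar> < \<alpha>" "x = norm x *\<^sub>R dir t" using x cone_dir[OF a] by auto
  thus ?thesis unfolding sector_def dir_def[symmetric] using x False by (intro CollectI, rule_tac exI[of _ "norm x"], rule_tac exI[of _ t], auto)
 qed
qed

lemma cone_scale: "c > 0 ==> c *\<^sub>R x \<in> cone \<alpha> \<longleftrightarrow> x \<in> cone \<alpha>"
 by (auto simp: cone_def abs_mult mult.left_commute)

lemma double_sector_eq: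
 assumes a: "0 < \<alpha>" "\<alpha> < pi / 2"
 shows "double_sector \<alpha> = insert 0 {x \<in> cone \<alpha>. norm x < 2}" unfolding double_sector_def sector_eq[OF a]
proof (intro equalityI subsetI)
 fix x assume "x \<in> insert 0 {x \<in> cone \<alpha>. norm x < 2}"
 hence "(1/2) *\<^sub>R x \<in> insert 0 {x \<in> cone \<alpha>. norm x < 1}" by (auto simp: cone_scale)
 hence "2 *\<^sub>R ((1/2) *\<^sub>R x) \<in> (%x. 2 *\<^sub>R x) ` insert 0 {x \<in> cone \<alpha>. norm x < 1}" by blast
 thus "x \<in> (%x. 2 *\<^sub>R x) ` insert 0 {x \<in> cone \<alpha>. norm x < 1}" by simp
qed (auto simp: cone_scale)

text \<open>Points just left of the vertex are outside the cone, so the vertex is the one point that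
  is not interior.\<close>

lemma cone_ball_interior:
 assumes a: "0 < \<alpha>" "\<alpha> < pi / 2" and R: "R > 0"
 shows "interior (insert 0 {x \<in> cone \<alpha>. norm x < R}) = {x \<in> cone \<alpha>. norm x < R}"
proof
 have o: "open {x \<in> cone \<alpha>. norm x < R}"
  unfolding Collect_conj_eq using open_cone by (simp add: open_Int open_Collect_less continuous_intros)
 thus "{x \<in> cone \<alpha>. norm x < R} \<subseteq> interior (insert 0 {x \<in> cone \<alpha>. norm x < R})" by (intro interior_maximal) auto
 have "0 \<notin> interior (insert 0 {x \<in> cone \<alpha>. norm x < R})"
 proof
  assume "0 \<in> interior (insert 0 {x \<in> cone \<alpha>. norm x < R})"
  then obtain d where d: "d > 0" "ball 0 d \<subseteq> insert 0 {x \<in> cone \<alpha>. norm x < R}" using mem_interior by blast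
  have "(- d / 2) *\<^sub>R dir 0 \<in> ball 0 d" using d by simp
  hence "(- d / 2) *\<^sub>R dir 0 \<in> insert 0 {x \<in> cone \<alpha>. norm x < R}" using d by blast
  moreover have "(- d / 2) *\<^sub>R dir 0 \<noteq> 0" using d by (metis divide_eq_0_iff less_irrefl neg_equal_0_iff_equal norm_dir norm_zero scale_eq_0_iff zero_neq_one zero_neq_numeral)
  ultimately have "(- d / 2) *\<^sub>R dir 0 \<in> cone \<alpha>" by auto
  from cone_pos[OF a this] show False using d by simp
 qed
 thus "interior (insert 0 {x \<in> cone \<alpha>. norm x < R}) \<subseteq> {x \<in> cone \<alpha>. norm x < R}" using interior_subset by blast
qed

lemma sector_interior:
 assumes a: "0 < \<alpha>" "\<alpha> < pi / 2"
 shows "interior (sector \<alpha>) = {x \<in> cone \<alpha>. norm x < 1}" "interior (double_sector \<alpha>) = {x \<in> cone \<alpha>. norm x < 2}"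
 unfolding sector_eq[OF a] double_sector_eq[OF a] using cone_ball_interior[OF a] by auto

lemma sector_basics:
 assumes a: "0 < \<alpha>" "\<alpha> < pi / 2"
 shows "sector \<alpha> \<in> sets lebesgue" "double_sector \<alpha> \<in> sets lebesgue"
  "negligible (sector \<alpha> - interior (sector \<alpha>))" "negligible (double_sector \<alpha> - interior (double_sector \<alpha>))"
  "bounded (sector \<alpha>)" "bounded (double_sector \<alpha>)" "sector \<alpha> \<in> sets borel" "double_sector \<alpha> \<in> sets borel"
  "sector \<alpha> \<subseteq> double_sector \<alpha>"
proof -
 have o: "open {x \<in> cone \<alpha>. norm x < R}" for R
  unfolding Collect_conj_eq using open_cone by (simp add: open_Int open_Collect_less continuous_intros)
 have ib: "insert 0 {x \<in> cone \<alpha>. norm x < R} \<in> sets borel" for R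
 proof -
  have "{0} \<union> {x \<in> cone \<alpha>. norm x < R} \<in> sets borel" by (rule sets.Un[OF _ borel_open[OF o]]) auto
  thus ?thesis by simp
 qed
 show b: "sector \<alpha> \<in> sets borel" "double_sector \<alpha> \<in> sets borel" unfolding sector_eq[OF a] double_sector_eq[OF a] by (rule ib)+
 thus "sector \<alpha> \<in> sets lebesgue" "double_sector \<alpha> \<in> sets lebesgue" by auto
 show "negligible (sector \<alpha> - interior (sector \<alpha>))" "negligible (double_sector \<alpha> - interior (double_sector \<alpha>))"
  unfolding sector_interior[OF a] unfolding sector_eq[OF a] double_sector_eq[OF a] by (rule negligible_subset[of "{0}"]; auto)+
 show "bounded (sector \<alpha>)" "bounded (double_sector \<alpha>)" unfolding sector_eq[OF a] double_sector_eq[OF a] bounded_iff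
  by (auto intro!: exI[of _ 1] exI[of _ 2])
 show "sector \<alpha> \<subseteq> double_sector \<alpha>" unfolding sector_eq[OF a] double_sector_eq[OF a] by auto
qed

section \<open>Green's formula on the sector\<close>

lemma smooth_isCont_compose: "smooth f ==> continuous_on UNIV g ==> continuous_on UNIV (%p. f (g p))"
 by (rule continuous_on_compose2[OF smooth_continuous]) auto

lemma dir_continuous: "continuous_on UNIV dir"
proof -
 have eq: "dir = (%t. cos t *\<^sub>R axis 1 1 + sin t *\<^sub>R axis 2 1)" by (simp add: fun_eq_iff dir_def vec_eq_iff forall_2 axis_def)
 show ?thesis by (subst eq) (intro continuous_intros)
qed

lemma radial_deriv:
 assumes "smooth f"
 shows "((%r. f (r *\<^sub>R dir t)) has_real_derivative (pd 1 f (r *\<^sub>R dir t) * cos t + pd 2 f (r *\<^sub>R dir t) * sin t)) (at r)"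
proof -
 have "((%r. r *\<^sub>R dir t) has_derivative (%h. h *\<^sub>R dir t)) (at r)" by (auto intro!: derivative_eq_intros)
 from has_derivative_compose[OF this smooth_has_derivative[OF assms]]
 show ?thesis unfolding has_field_derivative_def by (rule has_derivative_eq_rhs) (simp add: fun_eq_iff sum_2 algebra_simps)
qed

lemma dir_has_derivative: "((%t. r *\<^sub>R dir t) has_derivative (%h. h *\<^sub>R vector [- r * sin t, r * cos t])) (at t)"
proof -
 have eq: "(%t. r *\<^sub>R dir t) = (%t. (r * cos t) *\<^sub>R axis 1 1 + (r * sin t) *\<^sub>R axis 2 1)"
  by (simp add: fun_eq_iff dir_def vec_eq_iff forall_2 axis_def)
 show ?thesis unfolding eq by (auto intro!: derivative_eq_intros simp: fun_eq_iff vec_eq_iff forall_2 axis_def)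
qed

lemma angular_deriv:
 assumes "smooth f"
 shows "((%t. f (r *\<^sub>R dir t)) has_real_derivative (r * (pd 2 f (r *\<^sub>R dir t) * cos t - pd 1 f (r *\<^sub>R dir t) * sin t))) (at t)"
proof -
 from has_derivative_compose[OF dir_has_derivative smooth_has_derivative[OF assms]]
 show ?thesis unfolding has_field_derivative_def by (rule has_derivative_eq_rhs) (simp add: fun_eq_iff sum_2 algebra_simps)
qed

lemma integral_rect_iterated:
 fixes h :: "real^2 => real"
 assumes "continuous_on UNIV h"
 shows "(LINT p|lborel. ind (polar_rect a b c) p * h p) = (LINT r|lborel. ind {a..b} r * (LINT t|lborel. ind {-c..c} t * h (vector [r, t])))"
  "(LINT p|lborel. ind (polar_rect a b c) p * h p) = (LINT t|lborel. ind {-c..c} t * (LINT r|lborel. ind {a..b} r * h (vector [r, t])))"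
  "integrable lborel (%p. ind (polar_rect a b c) p * h p)"
proof -
 show i: "integrable lborel (%p. ind (polar_rect a b c) p * h p)" using borel_integrable_compact[of "polar_rect a b c" h] assms continuous_on_subset
  by (auto simp: set_integrable_def polar_rect_def)
 have ind: "ind (polar_rect a b c) (vector [r, t]) = (ind {a..b} r * ind {-c..c} t :: real)" for r t by (auto simp: indicator_def polar_rect_mem)
 show "(LINT p|lborel. ind (polar_rect a b c) p * h p) = (LINT r|lborel. ind {a..b} r * (LINT t|lborel. ind {-c..c} t * h (vector [r, t])))"
  unfolding integral_plane(1)[OF i] ind by (simp add: mult.assoc)
 show "(LINT p|lborel. ind (polar_rect a b c) p * h p) = (LINT t|lborel. ind {-c..c} t * (LINT r|lborel. ind {a..b} r * h (vector [r, t])))"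
 proof -
  have "(LINT r|lborel. ind {a..b} r * ind {-c..c} t * h (vector [r, t])) = ind {-c..c} t * (LINT r|lborel. ind {a..b} r * h (vector [r, t]))" for t
  proof -
   have "(LINT r|lborel. ind {a..b} r * ind {-c..c} t * h (vector [r, t])) = (LINT r|lborel. ind {-c..c} t * (ind {a..b} r * h (vector [r, t])))"
    by (intro lint_cong) (simp only: mult_ac)
   thus ?thesis by simp
  qed
  thus ?thesis unfolding integral_plane(2)[OF i] ind by (simp only:)
 qed
qed

text \<open>The support of f is compact in the open double sector, so f vanishes near the vertex and
  on both sides, and only the arc contributes. In polar coordinates r times a partial derivative is
  a radial plus an angular derivative, and each of them is integrated exactly.\<close>

lemma sector_green:
 assumes a: "0 < \<alpha>" "\<alpha> < pi / 2" and f: "smooth f" and K: "compact K" "K \<subseteq> interior (double_sector \<alpha>)" "\<And>x. x \<notin> K ==> f x = 0"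
 shows "(LINT x|lebesgue_on (sector \<alpha>). pd i f x) = (LINT t|lborel. ind {-\<alpha>..\<alpha>} t * (f (dir t) * dir t $ i))"
proof -
 have out: "pd i f x = 0" if "x \<notin> K" for x i using pderiv_dir_outside[of K f x] K that compact_imp_closed by blast
 have Kc: "x \<in> cone \<alpha>" if "x \<in> K" for x using K(2) sector_interior[OF a] that by auto
 have "0 \<notin> K" using Kc cone_pos[OF a, of 0] by auto
 then obtain d where d: "d > 0" "ball 0 d \<inter> K = {}"
  using compact_imp_closed[OF K(1)] by (metis (no_types, opaque_lifting) Compl_iff closed_def disjoint_eq_subset_Compl inf_commute openE compl_le_swap1)
 \<comment> \<open>Radii below \<rho> carry nothing, and staying away from 0 keeps polar coordinates
   injective.\<close>
 define \<rho> where "\<rho> = min (d / 2) (1 / 2)"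
 have \<rho>: "\<rho> > 0" "\<rho> < d" "\<rho> < 1" using d by (auto simp: \<rho>_def)
 have z\<rho>: "f x = 0" if "norm x < d" for x using d(2) that by (intro K(3)) (auto simp: ball_def dist_norm)
 have api: "\<alpha> < pi" using a by simp
 have side: "f (r *\<^sub>R dir \<alpha>) = 0" "f (r *\<^sub>R dir (- \<alpha>)) = 0" if "r >= 0" for r
 proof -
  have c: "cos \<alpha> > 0" by (rule cos_gt_zero_pi) (use a in auto)
  have "r *\<^sub>R dir \<alpha> \<notin> cone \<alpha>" "r *\<^sub>R dir (- \<alpha>) \<notin> cone \<alpha>"
   using that c by (auto simp: cone_def tan_def abs_mult abs_if)
  thus "f (r *\<^sub>R dir \<alpha>) = 0" "f (r *\<^sub>R dir (- \<alpha>)) = 0" using Kc K(3) by blast+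
 qed
 have cont: "continuous_on UNIV (pd j f)" for j by (rule smooth_continuous[OF smooth_pderiv[OF f]])
 have cI: "compact (polar ` polar_rect \<rho> 1 \<alpha>)" by (rule compact_continuous_image[OF polar_continuous]) (simp add: polar_rect_def)
 have m1: "(%x. ind (sector \<alpha>) x * pd i f x) \<in> borel_measurable borel"
  by (intro borel_measurable_times borel_measurable_indicator borel_measurable_continuous_onI cont sector_basics[OF a])
 have m2: "(%x. ind (polar ` polar_rect \<rho> 1 \<alpha>) x * pd i f x) \<in> borel_measurable borel"
  by (intro borel_measurable_times borel_measurable_indicator borel_measurable_continuous_onI cont borel_closed compact_imp_closed cI)
 have "(LINT x|lebesgue_on (sector \<alpha>). pd i f x) = (LINT x|lebesgue. ind (sector \<alpha>) x * pd i f x)"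
  by (rule LINT_lebesgue_on) (rule sector_basics[OF a])
 also have "\<dots> = (LINT x|lborel. ind (sector \<alpha>) x * pd i f x)" by (rule integral_completion) (simp add: m1)
 also have "\<dots> = (LINT x|lborel. ind (polar ` polar_rect \<rho> 1 \<alpha>) x * pd i f x)"
 proof (rule integral_cong_AE)
  show "(%x. ind (sector \<alpha>) x * pd i f x) \<in> borel_measurable lborel"
   "(%x. ind (polar ` polar_rect \<rho> 1 \<alpha>) x * pd i f x) \<in> borel_measurable lborel" using m1 m2 by simp_all
  have "sphere (0::real^2) 1 \<in> null_sets lborel"
   using negligible_sphere[of "0::real^2" 1] by (simp add: negligible_iff_null_sets null_sets_completion_iff)
  hence "AE x in lborel. x \<notin> sphere (0::real^2) 1" by (rule AE_not_in)
  thus "AE x in lborel. ind (sector \<alpha>) x * pd i f x = ind (polar ` polar_rect \<rho> 1 \<alpha>) x * pd i f x"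
  proof (rule eventually_mono)
   fix x :: "real^2" assume n1: "x \<notin> sphere 0 1"
   show "ind (sector \<alpha>) x * pd i f x = ind (polar ` polar_rect \<rho> 1 \<alpha>) x * pd i f x"
   proof (cases "x \<in> K")
    case True
    have xc: "x \<in> cone \<alpha>" by (rule Kc[OF True])
    have nx: "norm x >= d" using d(2) True by (force simp: ball_def dist_norm)
    obtain t where t: "\<bar>t\<bar> < \<alpha>" "x = norm x *\<^sub>R dir t" by (rule cone_dir[OF a xc])
    have "x \<in> sector \<alpha> \<longleftrightarrow> norm x < 1" using sector_eq[OF a] xc nx d by auto
    moreover have "x \<in> polar ` polar_rect \<rho> 1 \<alpha> \<longleftrightarrow> norm x <= 1"
    proof
     assume "norm x <= 1"
     hence "vector [norm x, t] \<in> polar_rect \<rho> 1 \<alpha>" using t nx \<rho> by (auto simp: polar_rect_mem)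
     moreover have "polar (vector [norm x, t]) = x" unfolding polar_dir using t(2) by simp
     ultimately show "x \<in> polar ` polar_rect \<rho> 1 \<alpha>" by (metis imageI)
    next
     assume "x \<in> polar ` polar_rect \<rho> 1 \<alpha>"
     then obtain p where p: "p \<in> polar_rect \<rho> 1 \<alpha>" "x = polar p" by auto
     have "x = p$1 *\<^sub>R dir (p$2)" using p(2) polar_dir[of "p$1" "p$2"] by simp
     thus "norm x <= 1" using p(1) \<rho> by (simp add: polar_rect_mem)
    qed
    moreover have "norm x \<noteq> 1" using n1 by simp
    ultimately show ?thesis by (auto simp: indicator_def)
   qed (simp add: out)
  qed
 qed
 also have "\<dots> = (LINT p|lborel. ind (polar_rect \<rho> 1 \<alpha>) p * (p$1 * pd i f (polar p)))"
  by (rule polar_integral[OF cont \<rho>(1) a(1) api])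
 finally have I: "(LINT x|lebesgue_on (sector \<alpha>). pd i f x) = (LINT p|lborel. ind (polar_rect \<rho> 1 \<alpha>) p * (p$1 * pd i f (polar p)))" .
 \<comment> \<open>With \<open>n t = dir t $ i\<close>, A is the radial derivative of
   \<open>n * r * f\<close> and B the angular derivative of \<open>s * f\<close>, where s and s' are
   the first two derivatives of n. As s' is \<open>- n\<close>, the terms without derivatives of f
   cancel.\<close>
 define A where "A = (%p::real^2. dir (p$2) $ i * (f (polar p) + p$1 * (pd 1 f (polar p) * cos (p$2) + pd 2 f (polar p) * sin (p$2))))"
 define s where "s = (%t::real. if i = 1 then - sin t else cos t)"
 define s' where "s' = (%t::real. if i = 1 then - cos t else - sin t)"
 have ds: "(s has_real_derivative s' t) (at t)" for t unfolding s_def s'_def by (cases "i = 1") (auto intro!: derivative_eq_intros)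
 define B where "B = (%p::real^2. s' (p$2) * f (polar p) + s (p$2) * (p$1 * (pd 2 f (polar p) * cos (p$2) - pd 1 f (polar p) * sin (p$2))))"
 have eq: "p$1 * pd i f (polar p) = A p + B p" for p
 proof -
  have cs: "cos (p$2) * (cos (p$2) * z) + sin (p$2) * (sin (p$2) * z) = z" for z
   using sin_cos_squared_add[of "p$2"] by (simp add: power2_eq_square flip: mult.assoc distrib_right)
  have "i = 1 \<or> i = 2" using exhaust_2 by blast
  thus ?thesis
  proof
   assume "i = 1"
   hence "A p + B p = cos (p$2) * (cos (p$2) * (p$1 * pd 1 f (polar p))) + sin (p$2) * (sin (p$2) * (p$1 * pd 1 f (polar p)))"
    by (simp add: A_def B_def s_def s'_def algebra_simps)
   thus ?thesis using \<open>i = 1\<close> cs by simp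
  next
   assume "i = 2"
   hence "A p + B p = cos (p$2) * (cos (p$2) * (p$1 * pd 2 f (polar p))) + sin (p$2) * (sin (p$2) * (p$1 * pd 2 f (polar p)))"
    by (simp add: A_def B_def s_def s'_def algebra_simps)
   thus ?thesis using \<open>i = 2\<close> cs by simp
  qed
 qed
 have fp: "continuous_on UNIV (%p. f (polar p))" "continuous_on UNIV (%p. pd j f (polar p))" for j
  by (intro smooth_isCont_compose f smooth_pderiv polar_continuous)+
 have dn: "continuous_on UNIV (%p::real^2. dir (p$2) $ i)" by (intro continuous_intros continuous_on_compose2[OF dir_continuous]) auto
 have cs: "continuous_on UNIV s" "continuous_on UNIV s'" unfolding s_def s'_def by (cases "i = 1"; auto intro!: continuous_intros)+
 have cs': "continuous_on UNIV (%p::real^2. s (p$2))" "continuous_on UNIV (%p::real^2. s' (p$2))"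
  by (intro continuous_on_compose2[OF cs(1)] continuous_on_compose2[OF cs(2)] continuous_intros; simp)+
 have cA: "continuous_on UNIV A" unfolding A_def by (intro continuous_intros fp dn)
 have cB: "continuous_on UNIV B" unfolding B_def by (intro continuous_intros fp cs')
 have vc: "continuous_on UNIV (%r. vector [r, t] :: real^2)" "continuous_on UNIV (%t. vector [r, t] :: real^2)" for r t
  by (intro continuous_at_imp_continuous_on ballI isCont_vector2)+
 have "(LINT p|lborel. ind (polar_rect \<rho> 1 \<alpha>) p * (p$1 * pd i f (polar p)))
   = (LINT p|lborel. ind (polar_rect \<rho> 1 \<alpha>) p * A p + ind (polar_rect \<rho> 1 \<alpha>) p * B p)" by (simp add: eq algebra_simps)
 also have "\<dots> = (LINT p|lborel. ind (polar_rect \<rho> 1 \<alpha>) p * A p) + (LINT p|lborel. ind (polar_rect \<rho> 1 \<alpha>) p * B p)"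
  by (intro lint_add integral_rect_iterated(3) cA cB)
 also have "(LINT p|lborel. ind (polar_rect \<rho> 1 \<alpha>) p * A p) = (LINT t|lborel. ind {-\<alpha>..\<alpha>} t * (LINT r|lborel. ind {\<rho>..1} r * A (vector [r, t])))"
  by (rule integral_rect_iterated(2)[OF cA])
 also have "\<dots> = (LINT t|lborel. ind {-\<alpha>..\<alpha>} t * (f (dir t) * dir t $ i))"
 proof -
  have "(LINT r|lborel. ind {\<rho>..1} r * A (vector [r, t])) = f (dir t) * dir t $ i" for t
  proof -
   have "(LINT r|lborel. A (vector [r, t]) * ind {\<rho>..1} r) = dir t $ i * (1 * f (1 *\<^sub>R dir t)) - dir t $ i * (\<rho> * f (\<rho> *\<^sub>R dir t))"
   proof (rule integral_FTC_Icc_real)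
    show "\<rho> <= 1" using \<rho> by simp
    show "isCont (%r. A (vector [r, t])) r" for r using continuous_on_compose2[OF cA vc(1)] by (auto simp: continuous_on_eq_continuous_at)
    show "((%r. dir t $ i * (r * f (r *\<^sub>R dir t))) has_real_derivative A (vector [r, t])) (at r)" for r unfolding A_def polar_dir vector_2
     by (rule DERIV_cong, (rule derivative_intros radial_deriv[OF f])+) (simp add: algebra_simps)
   qed
   moreover have "f (\<rho> *\<^sub>R dir t) = 0" by (rule z\<rho>) (use \<rho> in simp)
   ultimately show ?thesis by (simp add: mult.commute)
  qed
  thus ?thesis by simp
 qed
 also have "(LINT p|lborel. ind (polar_rect \<rho> 1 \<alpha>) p * B p) = (LINT r|lborel. ind {\<rho>..1} r * (LINT t|lborel. ind {-\<alpha>..\<alpha>} t * B (vector [r, t])))"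
  by (rule integral_rect_iterated(1)[OF cB])
 also have "\<dots> = (LINT r::real|lborel. 0)"
 proof (rule lint_cong)
  fix r
  show "ind {\<rho>..1} r * (LINT t|lborel. ind {-\<alpha>..\<alpha>} t * B (vector [r, t])) = 0"
  proof (cases "r \<in> {\<rho>..1}")
   case True
   have "(LINT t|lborel. B (vector [r, t]) * ind {-\<alpha>..\<alpha>} t) = s \<alpha> * f (r *\<^sub>R dir \<alpha>) - s (- \<alpha>) * f (r *\<^sub>R dir (- \<alpha>))"
   proof (rule integral_FTC_Icc_real)
    show "- \<alpha> <= \<alpha>" using a by simp
    show "isCont (%t. B (vector [r, t])) t" for t using continuous_on_compose2[OF cB vc(2)] by (auto simp: continuous_on_eq_continuous_at)
    show "((%t. s t * f (r *\<^sub>R dir t)) has_real_derivative B (vector [r, t])) (at t)" for t unfolding B_def polar_dir vector_2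
     by (rule DERIV_cong, (rule derivative_intros ds angular_deriv[OF f])+) (simp add: algebra_simps)
   qed
   thus ?thesis using side[of r] True \<rho> by (simp add: mult.commute)
  qed simp
 qed
 finally show ?thesis using I by simp
qed

section \<open>The regularised cone\<close>

lemma Ck1_open_deriv:
 assumes "open S" "Ck1 (Suc k) S f"
 shows "Ck1 k S (deriv f)" "\<And>t. t \<in> S ==> (f has_real_derivative deriv f t) (at t)"
proof -
 obtain g where g: "\<And>t. t \<in> S ==> (f has_real_derivative g t) (at t)" "Ck1 k S g" using assms(2) by auto
 have e: "deriv f t = g t" if "t \<in> S" for t using g(1)[OF that] by (rule DERIV_imp_deriv)
 show "Ck1 k S (deriv f)" by (rule Ck1_cong[OF assms(1) _ g(2)]) (simp add: e)
 show "\<And>t. t \<in> S ==> (f has_real_derivative deriv f t) (at t)" using g(1) e by simp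
qed

text \<open>The derivative functions found on S and on T need not agree elsewhere, so both are
  replaced by \<open>deriv f\<close>, which depends on neither set.\<close>

lemma Ck1_Un: "open S ==> open T ==> Ck1 k S f ==> Ck1 k T f ==> Ck1 k (S \<union> T) f"
proof (induction k arbitrary: f)
 case (Suc k)
 note S = Ck1_open_deriv[OF Suc.prems(1,3)] and T = Ck1_open_deriv[OF Suc.prems(2,4)]
 have "Ck1 k (S \<union> T) (deriv f)" by (rule Suc.IH[OF Suc.prems(1,2) S(1) T(1)])
 moreover have "\<forall>t\<in>S \<union> T. (f has_real_derivative deriv f t) (at t)" using S(2) T(2) by blast
 ultimately show ?case unfolding Ck1.simps by blast
qed simp

lemma Ck1_powr: "Ck1 k {0<..} (%t. t powr a)"
proof (induction k arbitrary: a)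
 case (Suc k)
 have "\<forall>t\<in>{0<..}. ((%t. t powr a) has_real_derivative a * t powr (a - 1)) (at t)"
  by (auto intro!: derivative_eq_intros has_real_derivative_powr)
 moreover have "Ck1 k {0<..} (%t. a * t powr (a - 1))" by (rule Ck1_cmult[OF Suc])
 ultimately show ?case unfolding Ck1.simps by (rule exI[of _ "%t. a * t powr (a - 1)", OF conjI])
qed simp

text \<open>All profiles are functions of the squared radius t, so that the smooth polynomial
  \<open>sq\<close> can be inserted and the norm is avoided. The radial derivative of the
  regularised cone is \<open>chi h (r^2)\<close>: it vanishes up to radius \<open>h / 2\<close> and
  is 1 from radius h on.\<close>

definition chi :: "real => real => real" where "chi h t = step ((t / h\<^sup>2 - 1/4) * (4/3))"
definition chi' :: "real => real => real" where "chi' h t = step' ((t / h\<^sup>2 - 1/4) * (4/3)) * (4/3) / h\<^sup>2"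
definition kk :: "real => real => real" where "kk h t = chi h t / sqrt t"
definition kk' :: "real => real => real" where "kk' h t = chi' h t / sqrt t - chi h t / (2 * t * sqrt t)"

lemma chi_deriv: "h > 0 ==> (chi h has_real_derivative chi' h t) (at t)"
proof -
 assume "h > 0"
 have "((%t. (t / h\<^sup>2 - 1/4) * (4/3)) has_real_derivative (1 / h\<^sup>2) * (4/3)) (at t)"
  by (rule DERIV_cong[OF DERIV_cmult_right[OF DERIV_diff[OF DERIV_cdivide[OF DERIV_ident] DERIV_const]]]) simp
 from DERIV_chain2[OF step_deriv this] show ?thesis unfolding chi_def[abs_def] chi'_def by (simp add: mult.commute)
qed

lemma chi_small: "h > 0 ==> t <= h\<^sup>2 / 4 ==> chi h t = 0" "h > 0 ==> t <= h\<^sup>2 / 4 ==> chi' h t = 0"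
 by (simp_all add: chi_def chi'_def step_0 step'_0 field_simps)

lemma chi_large: "h > 0 ==> t >= h\<^sup>2 ==> chi h t = 1" "h > 0 ==> t >= h\<^sup>2 ==> chi' h t = 0"
 by (simp_all add: chi_def chi'_def step_1 step'_1 field_simps)

lemma chi_bounds: "0 <= chi h t" "chi h t <= 1" by (simp_all add: chi_def step_nonneg step_le_1)
lemma chi'_nonneg: "0 <= chi' h t" by (simp add: chi'_def step'_nonneg)

lemma chi_mono: "h > 0 ==> s <= t ==> chi h s <= chi h t"
 unfolding chi_def by (intro step_mono mult_right_mono diff_right_mono divide_right_mono) auto

lemma Ck1_chi: "Ck1 k UNIV (chi h)"
proof -
 have "Ck1 k UNIV (%t. step ((4 / (3 * h\<^sup>2)) * t - 1/3))"
  by (rule Ck1_comp[OF Ck1_step]) (intro Ck1_diff Ck1_cmult Ck1_id Ck1_const subset_UNIV)+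
 moreover have "(%t. step ((4 / (3 * h\<^sup>2)) * t - 1/3)) = chi h" by (simp add: fun_eq_iff chi_def algebra_simps)
 ultimately show ?thesis by simp
qed

text \<open>The square root is singular only at 0, and \<open>chi h\<close> vanishes on a whole
  neighbourhood of 0; two overlapping open half-lines cover all t.\<close>

lemma Ck1_kk: assumes h: "h > 0" shows "Ck1 k UNIV (kk h)"
proof -
 have "Ck1 k {0<..} (%t. chi h t * t powr (- 1 / 2))" by (rule Ck1_mult[OF Ck1_mono[OF Ck1_chi] Ck1_powr]) simp
 hence 1: "Ck1 k {0<..} (kk h)" by (rule Ck1_cong[rotated 2]) (auto simp: kk_def powr_minus_divide powr_half_sqrt)
 have 2: "Ck1 k {..<h\<^sup>2/4} (kk h)" by (rule Ck1_cong[of _ "%t. 0"]) (auto simp: kk_def chi_small[OF h])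
 have "Ck1 k ({0<..} \<union> {..<h\<^sup>2/4}) (kk h)" by (rule Ck1_Un[OF _ _ 1 2]) auto
 moreover have "({0<..} \<union> {..<h\<^sup>2/4} :: real set) = UNIV"
 proof -
  have "h\<^sup>2 / 4 > 0" using h by simp
  hence "x < h\<^sup>2 / 4" if "x <= 0" for x using that by linarith
  thus ?thesis by (auto simp: not_less simp del: less_divide_eq_numeral1)
 qed
 ultimately show ?thesis by simp
qed

lemma kk_deriv: assumes h: "h > 0" shows "(kk h has_real_derivative kk' h t) (at t)"
proof (cases "t > 0")
 case True
 have "((%t. chi h t / sqrt t) has_real_derivative (chi' h t * sqrt t - chi h t * (inverse (sqrt t) / 2)) / (sqrt t * sqrt t)) (at t)"
  by (rule DERIV_divide[OF chi_deriv[OF h] DERIV_real_sqrt[OF True]]) (use True in simp)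
 moreover have "(chi' h t * sqrt t - chi h t * (inverse (sqrt t) / 2)) / (sqrt t * sqrt t) = kk' h t"
  unfolding kk'_def using True by (simp add: divide_simps)
 ultimately show ?thesis unfolding kk_def[abs_def] by simp
next
 case False
 have p: "h\<^sup>2 / 4 > 0" using h by simp
 have "((%t. 0) has_real_derivative 0) (at t)" by simp
 hence "(kk h has_real_derivative 0) (at t)"
 proof (rule has_field_derivative_transform_within_open[of _ _ _ "{..<h\<^sup>2/4}"])
  show "t \<in> {..<h\<^sup>2/4}" using False p unfolding lessThan_iff by linarith
  show "0 = kk h t" if "t \<in> {..<h\<^sup>2/4}" for t using that chi_small[OF h, of t] by (simp add: kk_def)
 qed auto
 moreover have "t <= h\<^sup>2/4" using False p by linarith
 hence "kk' h t = 0" using chi_small[OF h, of t] by (simp add: kk'_def)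
 ultimately show ?thesis by simp
qed

lemma exists_primitive_kk: assumes h: "h > 0" shows "\<exists>F. \<forall>t. (F has_real_derivative kk h t) (at t)"
proof -
 have "isCont (kk h) t" for t using kk_deriv[OF h] DERIV_isCont by blast
 thus ?thesis using einterval_antiderivative[of "-\<infinity>" "\<infinity>" "kk h"] by (auto simp: has_real_derivative_iff_has_vector_derivative)
qed

definition KK :: "real => real => real" where "KK h = (SOME F. \<forall>t. (F has_real_derivative kk h t) (at t))"

lemma KK_deriv: "h > 0 ==> (KK h has_real_derivative kk h t) (at t)" using someI_ex[OF exists_primitive_kk] unfolding KK_def by blast

definition sq :: "real^2 => real" where "sq x = x$1 * x$1 + x$2 * x$2"

lemma sq_norm: "sq x = (norm x)\<^sup>2" unfolding power2_norm_eq_inner by (simp add: sq_def inner_vec_def sum_2)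

lemma smooth_sq: "smooth sq" unfolding sq_def[abs_def] by (intro smooth_add smooth_mult smooth_nth)

lemma pderiv_dir_nth: "pd i (%x. x $ j) x = (if i = j then 1 else 0)"
proof (rule has_derivative_pderiv_dir[where g = "%i. if i = j then 1 else 0"])
 show "((%x::real^2. x $ j) has_derivative (%h. \<Sum>i\<in>UNIV. (if i = j then 1 else 0) * h $ i)) (at x)"
  by (rule has_derivative_eq_rhs[OF bounded_linear_imp_has_derivative[OF bounded_linear_vec_nth]])
   (auto simp: if_distrib[of "%x. x * _"] cong: if_cong)
qed

lemma pderiv_dir_comp:
 assumes "(f has_real_derivative d) (at (g x))" "smooth g"
 shows "pd i (%x. f (g x)) x = d * pd i g x"
proof (rule has_derivative_pderiv_dir[where g = "%i. d * pd i g x"])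
 have "(f has_derivative (%h. d * h)) (at (g x))" using assms(1) by (simp add: has_field_derivative_def)
 from has_derivative_compose[OF smooth_has_derivative[OF assms(2)] this]
 show "((%x. f (g x)) has_derivative (%h. \<Sum>i\<in>UNIV. (d * pd i g x) * h $ i)) (at x)"
  by (rule has_derivative_eq_rhs) (simp add: fun_eq_iff sum_distrib_left mult.assoc)
qed

lemma pderiv_dir_add:
 "smooth f ==> smooth g ==> pd i (%x. f x + g x) x = pd i f x + pd i g x" by (rule has_derivative_pderiv_dir[where g = "%i. pd i f x + pd i g x"],
   rule has_derivative_eq_rhs[OF has_derivative_add[OF smooth_has_derivative smooth_has_derivative]])
   (auto simp: sum_2 algebra_simps)

lemma pderiv_dir_sq: "pd i sq x = 2 * x $ i"
proof -
 have "i = 1 \<or> i = 2" using exhaust_2 by blast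
 moreover have "pd i sq x = pd i (%x. x$1 * x$1) x + pd i (%x. x$2 * x$2) x"
  unfolding sq_def[abs_def] by (rule pderiv_dir_add) (intro smooth_mult smooth_nth)+
 ultimately show ?thesis by (auto simp: pderiv_dir_mult pderiv_dir_nth)
qed

text \<open>The constant is fixed by the value 1 at radius 1; the function then equals the norm from
  radius h on, for h at most 1.\<close>

definition vreg :: "real => real^2 => real" where "vreg h x = 1 + (KK h (sq x) - KK h 1) / 2"

lemma Ck1_KK: "h > 0 ==> Ck1 k UNIV (KK h)"
proof (cases k)
 case (Suc l)
 assume "h > 0"
 thus ?thesis using KK_deriv Ck1_kk[of h l] unfolding Suc Ck1.simps by blast
qed simp

lemma smooth_vreg: assumes h: "h > 0" shows "smooth (vreg h)"
proof -
 have k: "Ck1 k UNIV (%t. 1 + (1/2) * (KK h t - KK h 1))" for k by (intro Ck1_add Ck1_cmult Ck1_diff Ck1_const Ck1_KK h)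
 show ?thesis using smooth_comp[OF k smooth_sq] by (simp add: vreg_def[abs_def])
qed

lemma pderiv_vreg: assumes h: "h > 0" shows "pd i (vreg h) = (%x. kk h (sq x) * x $ i)"
proof
 fix x
 have "((%t. 1 + (KK h t - KK h 1) / 2) has_real_derivative kk h (sq x) / 2) (at (sq x))" using KK_deriv[OF h] by (auto intro!: derivative_eq_intros)
 from pderiv_dir_comp[OF this smooth_sq, of i] show "pd i (vreg h) x = kk h (sq x) * x $ i" by (simp add: vreg_def[abs_def] pderiv_dir_sq)
qed

lemma pderiv2_vreg: assumes h: "h > 0"
 shows "pd j (pd i (vreg h)) x = 2 * kk' h (sq x) * x $ j * x $ i + (if i = j then kk h (sq x) else 0)"
proof -
 have s: "smooth (%x. kk h (sq x))" by (rule smooth_comp[OF Ck1_kk[OF h] smooth_sq])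
 show ?thesis unfolding pderiv_vreg[OF h] using pderiv_dir_mult[OF s smooth_nth, of j i x] pderiv_dir_comp[OF kk_deriv[OF h] smooth_sq, of j x]
  by (simp add: pderiv_dir_sq pderiv_dir_nth eq_commute)
qed

lemma vreg_norm: assumes h: "0 < h" "h <= 1" and x: "h <= norm x" shows "vreg h x = norm x"
proof -
 have key: "KK h (r\<^sup>2) - 2 * r = KK h 1 - 2" if "r >= h" for r
 proof -
  have d: "((%r. KK h (r\<^sup>2) - 2 * r) has_real_derivative 0) (at r)" if "r >= h" for r
  proof -
   have r: "r > 0" using that h by simp
   have "h\<^sup>2 <= r\<^sup>2" using that h by (intro power_mono) auto
   hence "kk h (r\<^sup>2) = 1 / r" using chi_large[OF h(1), of "r\<^sup>2"] r by (simp add: kk_def)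
   moreover have "((%r. KK h (r\<^sup>2) - 2 * r) has_real_derivative kk h (r\<^sup>2) * (2 * r) - 2) (at r)"
    by (rule DERIV_cong, (rule derivative_intros DERIV_chain2[OF KK_deriv[OF h(1)]])+) auto
   ultimately show ?thesis using r by simp
  qed
  consider "r < 1" | "r = 1" | "r > 1" by linarith
  thus ?thesis
  proof cases
   case 1
   from MVT2[OF 1, of "%r. KK h (r\<^sup>2) - 2 * r" "%_. 0"] d that show ?thesis by force
  next
   case 3
   from MVT2[OF 3, of "%r. KK h (r\<^sup>2) - 2 * r" "%_. 0"] d h show ?thesis by force
  qed simp
 qed
 have "KK h ((norm x)\<^sup>2) - 2 * norm x = KK h 1 - 2" by (rule key[OF x])
 hence "KK h ((norm x)\<^sup>2) - KK h 1 = 2 * norm x - 2" by linarith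
 thus ?thesis by (simp add: vreg_def sq_norm field_simps)
qed

text \<open>A nondecreasing convex profile composed with the norm; the profile has derivative
  \<open>chi h (r^2)\<close>, which is nonnegative and nondecreasing for nonnegative r.\<close>

lemma convex_vreg: assumes h: "h > 0" shows "convex_on UNIV (vreg h)"
proof -
 define \<phi> where "\<phi> = (%r. 1 + (KK h (r\<^sup>2) - KK h 1) / 2)"
 have d: "(\<phi> has_real_derivative kk h (r\<^sup>2) * r) (at r)" for r
 proof -
  have "((%r. KK h (r\<^sup>2)) has_real_derivative kk h (r\<^sup>2) * (2 * r)) (at r)"
   by (rule DERIV_cong, rule DERIV_chain2[OF KK_deriv[OF h]], (rule derivative_intros)+) auto
  thus ?thesis unfolding \<phi>_def by (auto intro!: derivative_eq_intros)
 qed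
 have d_eq: "kk h (r\<^sup>2) * r = chi h (r\<^sup>2)" if "r >= 0" for r using that chi_small(1)[OF h, of 0] by (cases "r = 0") (auto simp: kk_def)
 have mono: "\<phi> r <= \<phi> s" if "0 <= r" "r <= s" for r s
 proof (rule DERIV_nonneg_imp_nondecreasing[OF that(2)])
  fix x assume "r <= x" "x <= s"
  hence "kk h (x\<^sup>2) * x >= 0" using d_eq[of x] chi_bounds that(1) by simp
  thus "\<exists>y. (\<phi> has_real_derivative y) (at x) \<and> 0 <= y" using d[of x] by blast
 qed
 have conv: "convex_on {0..} \<phi>"
 proof (rule convex_on_realI)
  show "connected ({0..} :: real set)" by simp
  show "(\<phi> has_real_derivative chi h (r\<^sup>2)) (at r)" if "r \<in> {0..}" for r using d[of r] d_eq[of r] that by simp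
  show "chi h (r\<^sup>2) <= chi h (s\<^sup>2)" if "r \<in> {0..}" "s \<in> {0..}" "r <= s" for r s
   by (rule chi_mono[OF h]) (use that in \<open>auto intro: power_mono\<close>)
 qed
 have v: "vreg h x = \<phi> (norm x)" for x by (simp add: vreg_def \<phi>_def sq_norm)
 show ?thesis
 proof (rule convex_onI)
  fix t :: real and x y :: "real^2" assume t: "0 < t" "t < 1"
  have "norm ((1 - t) *\<^sub>R x + t *\<^sub>R y) <= (1 - t) * norm x + t * norm y"
   using norm_triangle_ineq[of "(1 - t) *\<^sub>R x" "t *\<^sub>R y"] t by simp
  hence "\<phi> (norm ((1 - t) *\<^sub>R x + t *\<^sub>R y)) <= \<phi> ((1 - t) * norm x + t * norm y)" by (rule mono[OF norm_ge_zero])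
  also have "\<dots> <= (1 - t) * \<phi> (norm x) + t * \<phi> (norm y)" using convex_onD[OF conv, of t "norm x" "norm y"] t by simp
  finally show "vreg h ((1 - t) *\<^sub>R x + t *\<^sub>R y) <= (1 - t) * vreg h x + t * vreg h y" by (simp add: v)
 qed simp
qed

lemma step'_bounded: "\<exists>M>0. \<forall>t. step' t <= M"
proof -
 have c: "isCont step' t" for t using Ck1_continuous[OF Ck1_step'] by auto
 have "\<exists>M. \<forall>t. 0 <= t \<and> t <= 1 \<longrightarrow> step' t <= M" using isCont_bounded[of 0 1 step'] c by (auto simp: Ball_def)
 then obtain M where M: "\<And>t. 0 <= t ==> t <= 1 ==> step' t <= M" by blast
 have "step' t <= max M 1" for t using M[of t] step'_0[of t] step'_1[of t] by (cases "0 <= t \<and> t <= 1") (auto simp: max_def not_le)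
 thus ?thesis by (intro exI[of _ "max M 1"]) auto
qed

definition M1 :: real where "M1 = (SOME M. M > 0 \<and> (\<forall>t. step' t <= M))"
lemma M1: "M1 > 0" "step' t <= M1" using someI_ex[OF step'_bounded] unfolding M1_def by blast+

text \<open>The radial eigenvalue of the Hessian of \<open>vreg h\<close> at squared radius t; the
  tangential one is \<open>kk h t\<close>.\<close>

definition BB :: "real => real => real" where "BB h t = kk h t + 2 * t * kk' h t"

lemma BB_eq: "t > 0 ==> BB h t = 2 * chi' h t * sqrt t" by (simp add: BB_def kk_def kk'_def field_simps)

lemma BB_bounds: assumes h: "h > 0"
 shows "0 <= BB h t" "t <= h\<^sup>2 / 4 ==> BB h t = 0" "t >= h\<^sup>2 ==> BB h t = 0" "BB h t <= 3 * M1 / h"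
proof -
 have p: "h\<^sup>2 / 4 > 0" "h\<^sup>2 > 0" using h by auto
 show sm: "t <= h\<^sup>2 / 4 ==> BB h t = 0" using chi_small[OF h, of t] by (simp add: BB_def kk_def kk'_def)
 show la: "BB h t = 0" if "t >= h\<^sup>2"
 proof -
  have "t > 0" using that p by linarith
  thus ?thesis using chi_large[OF h that] BB_eq[of t h] by simp
 qed
 show "0 <= BB h t"
 proof (cases "t <= h\<^sup>2 / 4")
  case False
  hence "t > 0" using p by linarith
  thus ?thesis using BB_eq[of t h] chi'_nonneg[of h t] by simp
 qed (simp add: sm)
 show "BB h t <= 3 * M1 / h"
 proof (cases "t <= h\<^sup>2 / 4 \<or> t >= h\<^sup>2")
  case True thus ?thesis using sm la M1 h by auto
 next
  case False
  hence t: "t > 0" "t <= h\<^sup>2" using p by linarith+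
  have "sqrt t <= h" using t h real_sqrt_le_mono[of t "h\<^sup>2"] by simp
  moreover have "chi' h t <= M1 * (4/3) / h\<^sup>2" unfolding chi'_def using M1 by (intro divide_right_mono mult_right_mono) auto
  ultimately have "2 * chi' h t * sqrt t <= 2 * (M1 * (4/3) / h\<^sup>2) * h" using chi'_nonneg[of h t] M1(1) h t by (intro mult_mono) auto
  also have "\<dots> <= 3 * M1 / h" using h M1(1) by (simp add: field_simps power2_eq_square)
  finally show ?thesis using BB_eq[of t h] t by simp
 qed
qed

lemma kk_bounds: assumes h: "h > 0"
 shows "0 <= kk h t" "t <= h\<^sup>2 / 4 ==> kk h t = 0" "kk h t <= 2 / h" "t > 0 ==> kk h t <= 1 / sqrt t"
proof -
 have p: "h\<^sup>2 / 4 > 0" using h by simp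
 show sm: "t <= h\<^sup>2 / 4 ==> kk h t = 0" using chi_small[OF h, of t] by (simp add: kk_def)
 show "0 <= kk h t"
 proof (cases "t <= h\<^sup>2 / 4")
  case False
  hence "t > 0" using p by linarith
  thus ?thesis using chi_bounds[of h t] by (simp add: kk_def)
 qed (simp add: sm)
 show le: "t > 0 ==> kk h t <= 1 / sqrt t" unfolding kk_def by (intro divide_right_mono chi_bounds) auto
 show "kk h t <= 2 / h"
 proof (cases "t <= h\<^sup>2 / 4")
  case False
  hence t: "t > 0" "h\<^sup>2 / 4 <= t" using p by linarith+
  have "sqrt (h\<^sup>2 / 4) <= sqrt t" using t by simp
  hence "h / 2 <= sqrt t" using h by (simp add: real_sqrt_divide)
  hence "1 / sqrt t <= 1 / (h / 2)" using h t by (intro divide_left_mono) auto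
  thus ?thesis using le[OF t(1)] by simp
 qed (use sm h in simp)
qed

definition hess :: "(real^2 => real) => real^2 => real^2^2" where
 "hess f x = (\<chi> i j. pd j (pd i f) x)"

lemma norm_matrix2: "(norm (A :: real^2^2))\<^sup>2 = (A$1$1)\<^sup>2 + (A$1$2)\<^sup>2 + (A$2$1)\<^sup>2 + (A$2$2)\<^sup>2"
 by (simp add: norm_vec_def L2_set_def sum_2)

lemma hess_vreg: assumes h: "h > 0"
 shows "(norm (hess (vreg h) x))\<^sup>2 = (kk h (sq x))\<^sup>2 + (BB h (sq x))\<^sup>2"
  "det (hess (vreg h) x) = kk h (sq x) * BB h (sq x)"
proof -
 have s: "x$1 * x$1 + x$2 * x$2 = sq x" by (simp add: sq_def)
 define A c where "A = kk h (sq x)" and "c = kk' h (sq x)"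
 have H: "hess (vreg h) x $ 1 $ 1 = 2 * c * (x$1 * x$1) + A" "hess (vreg h) x $ 2 $ 2 = 2 * c * (x$2 * x$2) + A"
  "hess (vreg h) x $ 1 $ 2 = 2 * c * (x$1 * x$2)" "hess (vreg h) x $ 2 $ 1 = 2 * c * (x$1 * x$2)"
  by (simp_all add: hess_def pderiv2_vreg[OF h] A_def c_def)
 have B: "BB h (sq x) = A + 2 * c * (x$1 * x$1 + x$2 * x$2)" by (simp add: BB_def A_def c_def s)
 show "(norm (hess (vreg h) x))\<^sup>2 = (kk h (sq x))\<^sup>2 + (BB h (sq x))\<^sup>2" unfolding norm_matrix2 H B A_def[symmetric] by algebra
 show "det (hess (vreg h) x) = kk h (sq x) * BB h (sq x)" unfolding det_2 H B A_def[symmetric] by algebra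
qed

section \<open>Traces and gluing\<close>

lemma dir_fold: "(%\<theta>. vector [cos \<theta>, sin \<theta>]) = dir" by (simp add: fun_eq_iff dir_def)

lemma dir_curved_boundary:
 assumes a: "0 < \<alpha>" "\<alpha> < pi / 2" and t: "\<bar>t\<bar> < \<alpha>"
 shows "dir t \<in> curved_boundary \<alpha>"
proof -
 have "dir t \<in> closure (sector \<alpha>)"
 proof (rule closure_sequential[THEN iffD2], intro exI conjI allI)
  show "(1 - inverse (real (Suc n))) *\<^sub>R dir t \<in> sector \<alpha>" for n
  proof (cases "n = 0")
   case True thus ?thesis using sector_eq[OF a] by simp
  next
   case False
   hence "inverse (real (Suc n)) < 1" by (simp add: inverse_eq_divide)
   hence p: "1 - inverse (real (Suc n)) > 0" by simp
   have "inverse (real (Suc n)) > 0" by simp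
   thus ?thesis unfolding sector_eq[OF a] using dir_cone[OF a t p] p by simp
  qed
  have "(%n. (1 - inverse (real (Suc n))) *\<^sub>R dir t) \<longlonglongrightarrow> (1 - 0) *\<^sub>R dir t"
   by (intro tendsto_intros LIMSEQ_inverse_real_of_nat)
  thus "(%n. (1 - inverse (real (Suc n))) *\<^sub>R dir t) \<longlonglongrightarrow> dir t" by simp
 qed
 moreover have "dir t \<notin> interior (sector \<alpha>)" unfolding sector_interior[OF a] by simp
 ultimately show ?thesis by (simp add: curved_boundary_def frontier_def)
qed

lemma borel_curved_boundary: "curved_boundary \<alpha> \<in> sets borel"
proof -
 have "curved_boundary \<alpha> = frontier (sector \<alpha>) \<inter> sphere 0 1" by (auto simp: curved_boundary_def)
 thus ?thesis by (simp add: borel_closed)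
qed

text \<open>Brings convergence to zero on the curved boundary, measured by arc length, down to an
  interval of angles. The two endpoints form a null set and are left out of the comparison.\<close>

lemma arc_integral_le:
 fixes k :: "real^2 => real"
 assumes a: "0 < \<alpha>" "\<alpha> < pi / 2" and k: "continuous_on UNIV k" "\<And>x. k x >= 0"
 shows "(LINT t|lborel. ind {-\<alpha>..\<alpha>} t * k (dir t)) <= (LINT x:curved_boundary \<alpha>|circle_arc_length. k x)"
proof -
 define \<Gamma> where "\<Gamma> = curved_boundary \<alpha>"
 have [measurable]: "\<Gamma> \<in> sets borel" unfolding \<Gamma>_def by (rule borel_curved_boundary)
 have [measurable]: "k \<in> borel_measurable borel" "dir \<in> borel \<rightarrow>\<^sub>M borel"
  using k(1) dir_continuous by (auto intro: borel_measurable_continuous_onI)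
 have dm: "dir \<in> lebesgue_on {-pi<..pi} \<rightarrow>\<^sub>M borel" by (intro measurable_restrict_space1 measurable_completion) measurable
 have cm: "continuous_on UNIV (%t. k (dir t))" by (rule continuous_on_compose2[OF k(1) dir_continuous]) auto
 have m: "(%t. ind {-pi<..pi} t * (ind \<Gamma> (dir t) * k (dir t))) \<in> borel_measurable borel" by measurable
 have "(LINT x:curved_boundary \<alpha>|circle_arc_length. k x) = (LINT x|distr (lebesgue_on {-pi<..pi}) borel dir. ind \<Gamma> x * k x)"
  by (simp add: set_lebesgue_integral_def circle_arc_length_def dir_fold \<Gamma>_def)
 also have "\<dots> = (LINT t|lebesgue_on {-pi<..pi}. ind \<Gamma> (dir t) * k (dir t))" by (rule integral_distr[OF dm]) measurable
 also have "\<dots> = (LINT t|lebesgue. ind {-pi<..pi} t * (ind \<Gamma> (dir t) * k (dir t)))" by (subst integral_restrict_space) auto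
 also have "\<dots> = (LINT t|lborel. ind {-pi<..pi} t * (ind \<Gamma> (dir t) * k (dir t)))" by (rule integral_completion) (simp add: m)
 finally have R: "(LINT x:curved_boundary \<alpha>|circle_arc_length. k x) = (LINT t|lborel. ind {-pi<..pi} t * (ind \<Gamma> (dir t) * k (dir t)))" .
 have ib: "integrable lborel (%t. ind {-b..b} t * k (dir t))" for b
  using borel_integrable_compact[of "{-b..b}" "%t. k (dir t)"] cm continuous_on_subset by (auto simp: set_integrable_def)
 have "\<alpha> < pi" using a by simp
 show ?thesis unfolding R
 proof (rule integral_mono_AE[OF ib])
  show "integrable lborel (%t. ind {-pi<..pi} t * (ind \<Gamma> (dir t) * k (dir t)))"
   by (rule lint_bound[OF ib[of pi]]) (use m k in \<open>auto simp: indicator_def\<close>)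
  have "AE t in lborel. t \<notin> {\<alpha>, - \<alpha>}" by (rule AE_not_in) (simp add: countable_imp_null_set_lborel)
  thus "AE t in lborel. ind {-\<alpha>..\<alpha>} t * k (dir t) <= ind {-pi<..pi} t * (ind \<Gamma> (dir t) * k (dir t))"
  proof (rule eventually_mono)
   fix t assume t: "t \<notin> {\<alpha>, - \<alpha>}"
   show "ind {-\<alpha>..\<alpha>} t * k (dir t) <= ind {-pi<..pi} t * (ind \<Gamma> (dir t) * k (dir t))"
   proof (cases "t \<in> {-\<alpha>..\<alpha>}")
    case True
    hence ta: "\<bar>t\<bar> < \<alpha>" using t by auto
    have "dir t \<in> \<Gamma>" unfolding \<Gamma>_def by (rule dir_curved_boundary[OF a ta])
    moreover have "t \<in> {-pi<..pi}" using ta \<open>\<alpha> < pi\<close> by auto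
    ultimately show ?thesis using True k(2)[of "dir t"] by (simp add: indicator_def)
   next
    case False
    thus ?thesis using k(2)[of "dir t"] by (auto simp: indicator_def)
   qed
  qed
 qed
qed

lemma L2_integral_tendsto:
 fixes F :: "nat => real^2 => real"
 assumes f: "f \<in> L2 W" and F: "\<And>n. F n \<in> L2 W" and k: "k \<in> L2 W"
  and lim: "(%n. L2_norm W (%x. F n x - f x)) \<longlonglongrightarrow> 0"
 shows "(%n. LINT x|lebesgue_on W. F n x * k x) \<longlonglongrightarrow> (LINT x|lebesgue_on W. f x * k x)"
proof -
 have "(%n. (LINT x|lebesgue_on W. F n x * k x) - (LINT x|lebesgue_on W. f x * k x)) \<longlonglongrightarrow> 0"
 proof (rule Lim_null_comparison)
  show "(%n. L2_norm W (%x. F n x - f x) * L2_norm W k) \<longlonglongrightarrow> 0"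
   using tendsto_mult[OF lim tendsto_const[of "L2_norm W k"]] by simp
  have "norm ((LINT x|lebesgue_on W. F n x * k x) - (LINT x|lebesgue_on W. f x * k x)) <= L2_norm W (%x. F n x - f x) * L2_norm W k" for n
  proof -
   have "(LINT x|lebesgue_on W. F n x * k x) - (LINT x|lebesgue_on W. f x * k x) = (LINT x|lebesgue_on W. (F n x - f x) * k x)"
    unfolding left_diff_distrib by (rule lint_diff[symmetric]) (intro L2_integrable_mult F f k)+
   thus ?thesis using L2_Cauchy_Schwarz[OF L2_diff[OF F f] k] by simp
  qed
  thus "\<forall>\<^sub>F n in sequentially. norm ((LINT x|lebesgue_on W. F n x * k x) - (LINT x|lebesgue_on W. f x * k x)) <= L2_norm W (%x. F n x - f x) * L2_norm W k"
   by simp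
 qed
 thus ?thesis by (rule LIM_zero_cancel)
qed

section \<open>Gluing along the arc\<close>

definition glue :: "real => (real^2 => real) => (real^2 => real) => real^2 => real" where
 "glue \<alpha> f g x = (if x \<in> sector \<alpha> then f x else g x)"

lemma L2_iff:
 fixes f :: "real^2 => real"
 assumes "W \<in> sets lebesgue"
 shows "f \<in> L2 W \<longleftrightarrow> (%x. ind W x * f x) \<in> borel_measurable lebesgue \<and> integrable lebesgue (%x. ind W x * (f x)\<^sup>2)"
 unfolding L2_def using assms by (simp add: integrable_lebesgue_on borel_measurable_restrict_space_iff mult.commute)

lemma glue_L2:
 assumes a: "0 < \<alpha>" "\<alpha> < pi / 2" and f: "f \<in> L2 (sector \<alpha>)" and G: "G \<in> L2 (double_sector \<alpha>)"
 shows "glue \<alpha> f G \<in> L2 (double_sector \<alpha>)"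
proof -
 note sb = sector_basics[OF a]
 let ?S = "sector \<alpha>" and ?D = "double_sector \<alpha>"
 have f1: "(%x. ind ?S x * f x) \<in> borel_measurable lebesgue" and f2: "integrable lebesgue (%x. ind ?S x * (f x)\<^sup>2)"
  using f L2_iff[OF sb(1)] by auto
 have g1: "(%x. ind ?D x * G x) \<in> borel_measurable lebesgue" and g2: "integrable lebesgue (%x. ind ?D x * (G x)\<^sup>2)"
  using G L2_iff[OF sb(2)] by auto
 have Sm: "(ind (- ?S) :: _ => real) \<in> borel_measurable lebesgue" using sets.compl_sets[OF sb(1)] by (intro borel_measurable_indicator) (simp add: Compl_eq_Diff_UNIV)
 have "(%x. ind ?S x * f x + ind (- ?S) x * (ind ?D x * G x)) \<in> borel_measurable lebesgue"
  by (intro borel_measurable_add borel_measurable_times f1 g1 Sm)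
 moreover have "(%x. ind ?S x * f x + ind (- ?S) x * (ind ?D x * G x)) = (%x. ind ?D x * glue \<alpha> f G x)"
  using sb(9) by (auto simp: fun_eq_iff indicator_def glue_def)
 moreover have "integrable lebesgue (%x. ind ?S x * (f x)\<^sup>2 + ind (- ?S) x * (ind ?D x * (G x)\<^sup>2))"
 proof (rule lint_add_int[OF f2])
  show "integrable lebesgue (%x. ind (- ?S) x * (ind ?D x * (G x)\<^sup>2))"
   by (rule lint_bound[OF g2 borel_measurable_times[OF Sm borel_measurable_integrable[OF g2]]])
    (auto simp: indicator_def)
 qed
 moreover have "(%x. ind ?S x * (f x)\<^sup>2 + ind (- ?S) x * (ind ?D x * (G x)\<^sup>2)) = (%x. ind ?D x * (glue \<alpha> f G x)\<^sup>2)"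
  using sb(9) by (auto simp: fun_eq_iff indicator_def glue_def)
 ultimately show ?thesis unfolding L2_iff[OF sb(2)] by simp
qed

lemma L2_locally_integrable:
 fixes f :: "real^2 => real"
 assumes W: "W \<in> sets lebesgue" and f: "f \<in> L2 W" shows "locally_integrable W f" unfolding locally_integrable_def
proof safe
 fix K assume K: "compact K" "K \<subseteq> interior W"
 have Km: "K \<in> sets lebesgue" using K(1) by (simp add: compact_imp_closed)
 have KO: "K \<subseteq> W" using K(2) interior_subset by blast
 have f1: "(%x. ind W x * f x) \<in> borel_measurable lebesgue" and f2: "integrable lebesgue (%x. ind W x * (f x)\<^sup>2)"
  using f L2_iff[OF W] by auto
 have "integrable lborel (indicat_real K)"
  using K(1) by (intro integrable_real_indicator emeasure_bounded_finite compact_imp_bounded) (auto simp: compact_imp_closed borel_closed)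
 hence i: "integrable lebesgue (indicat_real K)" by (subst integrable_completion) auto
 have "integrable lebesgue (%x. ind K x * f x)"
 proof (rule lint_bound[OF lint_add_int[OF i f2]])
  have "(%x. ind K x * (ind W x * f x)) \<in> borel_measurable lebesgue" using Km by (intro borel_measurable_times f1) auto
  moreover have "(%x. ind K x * (ind W x * f x)) = (%x. ind K x * f x)" using KO by (auto simp: fun_eq_iff indicator_def)
  ultimately show "(%x. ind K x * f x) \<in> borel_measurable lebesgue" by simp
  have "\<bar>f x\<bar> <= 1 + (f x)\<^sup>2" for x
  proof -
   have "0 <= (\<bar>f x\<bar> - 1)\<^sup>2" by simp
   hence "2 * \<bar>f x\<bar> <= 1 + (f x)\<^sup>2" by (simp add: power2_diff)
   thus ?thesis by simp
  qed
  thus "AE x in lebesgue. norm (ind K x * f x) <= norm (indicat_real K x + ind W x * (f x)\<^sup>2)"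
   using KO by (intro AE_I2) (auto simp: indicator_def)
 qed
 thus "integrable (lebesgue_on K) f" by (simp add: integrable_lebesgue_on[OF Km])
qed

text \<open>The part outside the sector is written as the double sector minus the sector, so that
  only integrals over these two domains occur; Green's formula serves the one and the weak
  derivative of a smooth function the other.\<close>

lemma glue_integral:
 assumes a: "0 < \<alpha>" "\<alpha> < pi / 2" and f: "f \<in> L2 (sector \<alpha>)" and G: "G \<in> L2 (double_sector \<alpha>)" and k: "k \<in> L2 (double_sector \<alpha>)"
 shows "(LINT x|lebesgue_on (double_sector \<alpha>). glue \<alpha> f G x * k x)
  = (LINT x|lebesgue_on (sector \<alpha>). f x * k x) + ((LINT x|lebesgue_on (double_sector \<alpha>). G x * k x) - (LINT x|lebesgue_on (sector \<alpha>). G x * k x))"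
  "k \<in> L2 (sector \<alpha>)" "G \<in> L2 (sector \<alpha>)"
proof -
 note sb = sector_basics[OF a]
 let ?S = "sector \<alpha>" and ?D = "double_sector \<alpha>"
 have sub: "u \<in> L2 ?S" if u: "u \<in> L2 ?D" for u :: "real^2 => real"
 proof -
  have g1: "(%x. ind ?D x * u x) \<in> borel_measurable lebesgue" and g2: "integrable lebesgue (%x. ind ?D x * (u x)\<^sup>2)"
   using u L2_iff[OF sb(2)] by auto
  have Sm: "(ind ?S :: _ => real) \<in> borel_measurable lebesgue" using sb(1) by (intro borel_measurable_indicator) auto
  have "(%x. ind ?S x * (ind ?D x * u x)) \<in> borel_measurable lebesgue" by (intro borel_measurable_times Sm g1)
  moreover have "(%x. ind ?S x * (ind ?D x * u x)) = (%x. ind ?S x * u x)" using sb(9) by (auto simp: fun_eq_iff indicator_def)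
  moreover have "integrable lebesgue (%x. ind ?S x * (ind ?D x * (u x)\<^sup>2))"
   by (rule lint_bound[OF g2 borel_measurable_times[OF Sm borel_measurable_integrable[OF g2]]])
    (auto simp: indicator_def)
  moreover have "(%x. ind ?S x * (ind ?D x * (u x)\<^sup>2)) = (%x. ind ?S x * (u x)\<^sup>2)" using sb(9) by (auto simp: fun_eq_iff indicator_def)
  ultimately show ?thesis unfolding L2_iff[OF sb(1)] by simp
 qed
 show k': "k \<in> L2 ?S" and G': "G \<in> L2 ?S" using sub k G by auto
 have i1: "integrable lebesgue (%x. ind ?S x * (f x * k x))" using L2_integrable_mult[OF f k'] by (simp add: integrable_lebesgue_on[OF sb(1)])
 have i2: "integrable lebesgue (%x. ind ?D x * (G x * k x))" using L2_integrable_mult[OF G k] by (simp add: integrable_lebesgue_on[OF sb(2)])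
 have i3: "integrable lebesgue (%x. ind ?S x * (G x * k x))" using L2_integrable_mult[OF G' k'] by (simp add: integrable_lebesgue_on[OF sb(1)])
 have "(LINT x|lebesgue_on ?D. glue \<alpha> f G x * k x) = (LINT x|lebesgue. ind ?S x * (f x * k x) + (ind ?D x * (G x * k x) - ind ?S x * (G x * k x)))"
  unfolding LINT_lebesgue_on[OF sb(2)] using sb(9) by (intro Bochner_Integration.integral_cong) (auto simp: indicator_def glue_def)
 also have "\<dots> = (LINT x|lebesgue. ind ?S x * (f x * k x)) + ((LINT x|lebesgue. ind ?D x * (G x * k x)) - (LINT x|lebesgue. ind ?S x * (G x * k x)))"
  using i1 i2 i3 by simp
 finally show "(LINT x|lebesgue_on ?D. glue \<alpha> f G x * k x)
  = (LINT x|lebesgue_on ?S. f x * k x) + ((LINT x|lebesgue_on ?D. G x * k x) - (LINT x|lebesgue_on ?S. G x * k x))"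
  unfolding LINT_lebesgue_on[OF sb(1)] LINT_lebesgue_on[OF sb(2)] .
qed

text \<open>Green on the sector for the approximating functions of the trace; the arc terms of both sides cancel.\<close>

lemma glue_has_weak_pderiv:
 assumes a: "0 < \<alpha>" "\<alpha> < pi / 2" and tr: "has_trace_on (sector \<alpha>) (curved_boundary \<alpha>) f g"
  and G: "smooth G" and gG: "\<And>x. norm x = 1 ==> g x = G x"
 shows "has_weak_pderiv (double_sector \<alpha>) i (glue \<alpha> f G) (glue \<alpha> (weak_pderiv (sector \<alpha>) i f) (pd i G))"
proof -
 note sb = sector_basics[OF a]
 let ?S = "sector \<alpha>" and ?D = "double_sector \<alpha>" and ?\<Gamma> = "curved_boundary \<alpha>"
 have smL: "smooth u ==> u \<in> L2 ?S" "smooth u ==> u \<in> L2 ?D" for u using bounded_continuous_L2 smooth_continuous sb by blast+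
 have fW: "f \<in> W12 ?S" using tr by (simp add: has_trace_on_def)
 obtain F where F: "\<And>n. smooth (F n)" and F1: "(%n::nat. L2_norm ?S (%x. F n x - f x)) \<longlonglongrightarrow> 0"
  and F2: "\<And>i. (%n. L2_norm ?S (%x. pd i (F n) x - weak_pderiv ?S i f x)) \<longlonglongrightarrow> 0"
  and F3: "(%n. LINT x:?\<Gamma>|circle_arc_length. (F n x - g x)\<^sup>2) \<longlonglongrightarrow> 0" using tr unfolding has_trace_on_def by blast
 have fL: "f \<in> L2 ?S" using fW by (simp add: W12_def)
 have wL: "weak_pderiv ?S i f \<in> L2 ?S" by (rule W12_weak_pderiv(2)[OF sb(1,3) fW])
 have dG: "smooth (pd i G)" by (rule smooth_pderiv[OF G])
 have F3': "(%n. LINT x:?\<Gamma>|circle_arc_length. (F n x - G x)\<^sup>2) \<longlonglongrightarrow> 0"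
 proof -
  have "(LINT x:?\<Gamma>|circle_arc_length. (F n x - g x)\<^sup>2) = (LINT x:?\<Gamma>|circle_arc_length. (F n x - G x)\<^sup>2)" for n
   unfolding set_lebesgue_integral_def by (intro lint_cong) (auto simp: indicator_def curved_boundary_def gG)
  thus ?thesis using F3 by simp
 qed
 have arc0: "(%n. LINT t|lborel. ind {-\<alpha>..\<alpha>} t * (F n (dir t) - G (dir t))\<^sup>2) \<longlonglongrightarrow> 0"
 proof (rule tendsto_sandwich[OF _ _ tendsto_const F3'])
  show "\<forall>\<^sub>F n in sequentially. 0 <= (LINT t|lborel. ind {-\<alpha>..\<alpha>} t * (F n (dir t) - G (dir t))\<^sup>2)" by simp
  have "(LINT t|lborel. ind {-\<alpha>..\<alpha>} t * (F n (dir t) - G (dir t))\<^sup>2) <= (LINT x:?\<Gamma>|circle_arc_length. (F n x - G x)\<^sup>2)" for n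
   by (rule arc_integral_le[OF a]) (intro continuous_intros smooth_continuous F G zero_le_power2)+
  thus "\<forall>\<^sub>F n in sequentially. (LINT t|lborel. ind {-\<alpha>..\<alpha>} t * (F n (dir t) - G (dir t))\<^sup>2) <= (LINT x:?\<Gamma>|circle_arc_length. (F n x - G x)\<^sup>2)"
   by simp
 qed
 have main: "(LINT x|lebesgue_on ?D. glue \<alpha> f G x * pd i \<phi> x) = - (LINT x|lebesgue_on ?D. glue \<alpha> (weak_pderiv ?S i f) (pd i G) x * \<phi> x)"
  if phi: "\<phi> \<in> test_functions ?D" for \<phi>
 proof -
  obtain K where K: "smooth \<phi>" "compact K" "K \<subseteq> interior ?D" "\<And>x. x \<notin> K ==> \<phi> x = 0"
   using phi by (rule test_functionsD) blast
  have dphi: "smooth (pd i \<phi>)" by (rule smooth_pderiv[OF K(1)])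
  have green: "(LINT x|lebesgue_on ?S. u x * pd i \<phi> x) + (LINT x|lebesgue_on ?S. pd i u x * \<phi> x)
    = (LINT t|lborel. ind {-\<alpha>..\<alpha>} t * (u (dir t) * \<phi> (dir t) * dir t $ i))" if u: "smooth u" for u
  proof -
   have "(LINT x|lebesgue_on ?S. pd i u x * \<phi> x) + (LINT x|lebesgue_on ?S. u x * pd i \<phi> x)
     = (LINT x|lebesgue_on ?S. pd i u x * \<phi> x + u x * pd i \<phi> x)"
    by (rule lint_add[symmetric]) (intro L2_integrable_mult smL u smooth_pderiv K(1))+
   also have "\<dots> = (LINT x|lebesgue_on ?S. pd i (%x. u x * \<phi> x) x)" by (simp add: pderiv_dir_mult[OF u K(1)])
   also have "\<dots> = (LINT t|lborel. ind {-\<alpha>..\<alpha>} t * (u (dir t) * \<phi> (dir t) * dir t $ i))"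
    by (rule sector_green[OF a smooth_mult[OF u K(1)] K(2,3)]) (simp add: K(4))
   finally show ?thesis by simp
  qed
  define B where "B = (LINT t|lborel. ind {-\<alpha>..\<alpha>} t * (G (dir t) * \<phi> (dir t) * dir t $ i))"
  define b where "b = (%t. \<phi> (dir t) * dir t $ i)"
  have cb: "continuous_on UNIV b" unfolding b_def
   by (intro continuous_intros smooth_isCont_compose[OF K(1) dir_continuous] continuous_on_compose2[OF dir_continuous]) auto
  have cd: "continuous_on UNIV (%t. u (dir t))" if "smooth u" for u by (rule smooth_isCont_compose[OF that dir_continuous])
  have ic: "integrable lborel (%t. ind {-\<alpha>..\<alpha>} t * q t)" if "continuous_on UNIV q" for q :: "real => real"
   using borel_integrable_compact[of "{-\<alpha>..\<alpha>}" q] that continuous_on_subset by (auto simp: set_integrable_def)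
  have lim1: "(%n. LINT t|lborel. ind {-\<alpha>..\<alpha>} t * (F n (dir t) * \<phi> (dir t) * dir t $ i)) \<longlonglongrightarrow> B"
  proof -
   have "(%n. (LINT t|lborel. ind {-\<alpha>..\<alpha>} t * (F n (dir t) * \<phi> (dir t) * dir t $ i)) - B) \<longlonglongrightarrow> 0"
   proof (rule Lim_null_comparison)
    show "(%n. sqrt (LINT t|lborel. ind {-\<alpha>..\<alpha>} t * (F n (dir t) - G (dir t))\<^sup>2) * sqrt (LINT t|lborel. ind {-\<alpha>..\<alpha>} t * (b t)\<^sup>2)) \<longlonglongrightarrow> 0"
     using tendsto_mult[OF tendsto_real_sqrt[OF arc0] tendsto_const[of "sqrt (LINT t|lborel. ind {-\<alpha>..\<alpha>} t * (b t)\<^sup>2)"]] by simp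
    have "norm ((LINT t|lborel. ind {-\<alpha>..\<alpha>} t * (F n (dir t) * \<phi> (dir t) * dir t $ i)) - B) <= sqrt (LINT t|lborel. ind {-\<alpha>..\<alpha>} t * (F n (dir t) - G (dir t))\<^sup>2) * sqrt (LINT t|lborel. ind {-\<alpha>..\<alpha>} t * (b t)\<^sup>2)" for n
    proof -
     define p where "p = (%t. ind {-\<alpha>..\<alpha>} t * (F n (dir t) - G (dir t)))"
     define q where "q = (%t. ind {-\<alpha>..\<alpha>} t * b t)"
     have cFG: "continuous_on UNIV (%t. F n (dir t) - G (dir t))" by (intro continuous_intros cd F G)
     have pm: "p \<in> borel_measurable lborel" "q \<in> borel_measurable lborel" unfolding p_def q_def using ic[OF cFG] ic[OF cb] by auto
     have p2: "(p t)\<^sup>2 = ind {-\<alpha>..\<alpha>} t * (F n (dir t) - G (dir t))\<^sup>2" and q2: "(q t)\<^sup>2 = ind {-\<alpha>..\<alpha>} t * (b t)\<^sup>2"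
      and pq: "p t * q t = ind {-\<alpha>..\<alpha>} t * (F n (dir t) * \<phi> (dir t) * dir t $ i) - ind {-\<alpha>..\<alpha>} t * (G (dir t) * \<phi> (dir t) * dir t $ i)" for t
      by (auto simp: p_def q_def b_def indicator_def algebra_simps)
     have ip: "integrable lborel (%t. (p t)\<^sup>2)" "integrable lborel (%t. (q t)\<^sup>2)" unfolding p2 q2 by (intro ic continuous_intros cFG cb)+
     have i1: "integrable lborel (%t. ind {-\<alpha>..\<alpha>} t * (u (dir t) * \<phi> (dir t) * dir t $ i))" if "smooth u" for u
     proof -
      have "continuous_on UNIV (%t. u (dir t) * b t)" by (intro continuous_intros cd that cb)
      thus ?thesis using ic by (simp add: b_def mult.assoc)
     qed
     have "(LINT t|lborel. p t * q t) = (LINT t|lborel. ind {-\<alpha>..\<alpha>} t * (F n (dir t) * \<phi> (dir t) * dir t $ i)) - B"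
      unfolding pq B_def by (rule lint_diff[OF i1[OF F] i1[OF G]])
     moreover have "\<bar>LINT t|lborel. p t * q t\<bar> <= sqrt (LINT t|lborel. (p t)\<^sup>2) * sqrt (LINT t|lborel. (q t)\<^sup>2)"
      by (rule Cauchy_Schwarz_integral[OF pm ip])
     ultimately show ?thesis unfolding p2 q2 by simp
    qed
    thus "\<forall>\<^sub>F n in sequentially. norm ((LINT t|lborel. ind {-\<alpha>..\<alpha>} t * (F n (dir t) * \<phi> (dir t) * dir t $ i)) - B) <= sqrt (LINT t|lborel. ind {-\<alpha>..\<alpha>} t * (F n (dir t) - G (dir t))\<^sup>2) * sqrt (LINT t|lborel. ind {-\<alpha>..\<alpha>} t * (b t)\<^sup>2)"
     by simp
   qed
   thus ?thesis by (rule LIM_zero_cancel)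
  qed
  have lim2: "(%n. (LINT x|lebesgue_on ?S. F n x * pd i \<phi> x) + (LINT x|lebesgue_on ?S. pd i (F n) x * \<phi> x))
   \<longlonglongrightarrow> (LINT x|lebesgue_on ?S. f x * pd i \<phi> x) + (LINT x|lebesgue_on ?S. weak_pderiv ?S i f x * \<phi> x)"
   by (intro tendsto_add L2_integral_tendsto fL wL smL F dphi K(1) smooth_pderiv F1 F2)
  \<comment> \<open>Green's formula for \<open>F n\<close> passes to the limit. Its arc term tends
    to that of G, since by Cauchy-Schwarz the L2 convergence on the arc suffices.\<close>
  have E1: "(LINT x|lebesgue_on ?S. f x * pd i \<phi> x) + (LINT x|lebesgue_on ?S. weak_pderiv ?S i f x * \<phi> x) = B"
   using LIMSEQ_unique[OF lim2[unfolded green[OF F]] lim1] .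
  have E2: "(LINT x|lebesgue_on ?S. G x * pd i \<phi> x) + (LINT x|lebesgue_on ?S. pd i G x * \<phi> x) = B" using green[OF G] by (simp add: B_def)
  have E3: "(LINT x|lebesgue_on ?D. G x * pd i \<phi> x) = - (LINT x|lebesgue_on ?D. pd i G x * \<phi> x)"
   using smooth_has_weak_pderiv[OF sb(2) G, of i] phi unfolding has_weak_pderiv_def by blast
  show ?thesis unfolding glue_integral(1)[OF a fL smL(2)[OF G] smL(2)[OF dphi]] glue_integral(1)[OF a wL smL(2)[OF dG] smL(2)[OF K(1)]]
   using E1 E2 E3 by linarith
 qed
 show ?thesis unfolding has_weak_pderiv_def
  using main L2_locally_integrable[OF sb(2)] glue_L2[OF a fL smL(2)[OF G]] glue_L2[OF a wL smL(2)[OF dG]] by blast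
qed

section \<open>The upper bound\<close>

lemma L2_norm_AE_cong:
 fixes f g :: "real^2 => 'b::euclidean_space"
 assumes W: "W \<in> sets lebesgue" and g: "g \<in> borel_measurable (lebesgue_on W)" "f \<in> borel_measurable (lebesgue_on W)"
  and ae: "AE x in lebesgue. x \<in> W \<longrightarrow> f x = g x"
 shows "L2_norm W f = L2_norm W g"
proof -
 have a: "AE x in lebesgue_on W. f x = g x" using ae W by (subst AE_restrict_space_iff) auto
 have "(LINT x|lebesgue_on W. (norm (f x))\<^sup>2) = (LINT x|lebesgue_on W. (norm (g x))\<^sup>2)"
  by (rule integral_cong_AE) (use g a in \<open>auto elim: eventually_mono\<close>)
 thus ?thesis by (simp add: L2_norm_def)
qed

lemma measurable_matrix2:
 fixes f :: "'a => real^2^2"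
 assumes "\<And>i j. (%x. f x $ i $ j) \<in> borel_measurable M"
 shows "f \<in> borel_measurable M"
proof -
 have "(%x. f x \<bullet> b) \<in> borel_measurable M" if "b \<in> Basis" for b
 proof -
  from that obtain i j where "b = axis i (axis j 1)" by (auto simp: Basis_vec_def)
  hence "f x \<bullet> b = f x $ i $ j" for x by (simp add: inner_axis)
  thus ?thesis using assms by simp
 qed
 thus ?thesis by (subst borel_measurable_euclidean_space) blast
qed

lemma W22_weak_hessian:
 assumes W: "W \<in> sets lebesgue" "negligible (W - interior W)" and f: "f \<in> W22 W"
 shows "(%x. weak_hessian W f x $ i $ j) \<in> L2 W" "weak_hessian W f \<in> borel_measurable (lebesgue_on W)"
  "has_weak_pderiv W i f (weak_pderiv W i f)"
  "has_weak_pderiv W j (weak_pderiv W i f) (%x. weak_hessian W f x $ i $ j)"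
  "integrable (lebesgue_on W) (%x. (norm (weak_hessian W f x))\<^sup>2)"
  "L2_norm W (%x. weak_hessian W f x $ i $ j) <= L2_norm W (weak_hessian W f)"
proof -
 have w: "f \<in> W12 W" "\<And>i. weak_pderiv W i f \<in> W12 W" using f by (auto simp: W22_def)
 have eq: "(%x. weak_hessian W f x $ i $ j) = weak_pderiv W j (weak_pderiv W i f)" for i j by (simp add: fun_eq_iff weak_hessian_def)
 show "has_weak_pderiv W i f (weak_pderiv W i f)" by (rule W12_weak_pderiv(1)[OF W w(1)])
 show "has_weak_pderiv W j (weak_pderiv W i f) (%x. weak_hessian W f x $ i $ j)" unfolding eq by (rule W12_weak_pderiv(1)[OF W w(2)])
 have L: "(%x. weak_hessian W f x $ i $ j) \<in> L2 W" for i j unfolding eq by (rule W12_weak_pderiv(2)[OF W w(2)])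
 thus "(%x. weak_hessian W f x $ i $ j) \<in> L2 W" .
 show m: "weak_hessian W f \<in> borel_measurable (lebesgue_on W)" by (rule measurable_matrix2) (use L in \<open>auto simp: L2_def\<close>)
 have c: "integrable (lebesgue_on W) (%x. (weak_hessian W f x $ i $ j)\<^sup>2)" for i j using L[of i j] by (simp add: L2_def)
 show i2: "integrable (lebesgue_on W) (%x. (norm (weak_hessian W f x))\<^sup>2)" unfolding norm_matrix2 by (intro lint_add_int c)
 have le: "(weak_hessian W f x $ i $ j)\<^sup>2 <= (norm (weak_hessian W f x))\<^sup>2" for x
 proof -
  have "norm (weak_hessian W f x $ i $ j) <= norm (weak_hessian W f x $ i)" by (rule Finite_Cartesian_Product.norm_nth_le)
  also have "\<dots> <= norm (weak_hessian W f x)" by (rule Finite_Cartesian_Product.norm_nth_le)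
  finally show ?thesis using power_mono[of "\<bar>weak_hessian W f x $ i $ j\<bar>" _ 2] by simp
 qed
 show "L2_norm W (%x. weak_hessian W f x $ i $ j) <= L2_norm W (weak_hessian W f)"
  unfolding L2_norm_def by (intro real_sqrt_le_mono) (use integral_mono[OF c i2 le] in simp)
qed

lemma has_weak_pderiv_diff:
 assumes W: "W \<in> sets lebesgue" and f: "has_weak_pderiv W i f f'" and g: "has_weak_pderiv W i g g'"
 shows "has_weak_pderiv W i (%x. f x - g x) (%x. f' x - g' x)"
proof -
 have li: "locally_integrable W f" "locally_integrable W g" "locally_integrable W f'" "locally_integrable W g'"
  using f g by (auto simp: has_weak_pderiv_def)
 have "(LINT x|lebesgue_on W. (f x - g x) * pd i \<phi> x) = - (LINT x|lebesgue_on W. (f' x - g' x) * \<phi> x)" if phi: "\<phi> \<in> test_functions W" for \<phi>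
 proof -
  obtain K where K: "smooth \<phi>" "compact K" "K \<subseteq> interior W" "\<And>x. x \<notin> K ==> \<phi> x = 0" "\<And>i x. x \<notin> K ==> pd i \<phi> x = 0"
   using phi by (rule test_functionsD) blast
  have c: "continuous_on UNIV \<phi>" "continuous_on UNIV (pd i \<phi>)" using K(1) smooth_pderiv smooth_continuous by blast+
  have 1: "integrable (lebesgue_on W) (%x. u x * \<phi> x)" if "locally_integrable W u" for u
   by (rule locally_integrable_mult[OF W that c(1) K(2,3)]) (rule K(4))
  have 2: "integrable (lebesgue_on W) (%x. u x * pd i \<phi> x)" if "locally_integrable W u" for u
   by (rule locally_integrable_mult[OF W that c(2) K(2,3)]) (rule K(5))
  show ?thesis using f g phi unfolding has_weak_pderiv_def left_diff_distrib by (simp add: 1 2 li)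
 qed
 moreover have "locally_integrable W (%x. f x - g x)" "locally_integrable W (%x. f' x - g' x)" using li by (auto simp: locally_integrable_def)
 ultimately show ?thesis by (simp add: has_weak_pderiv_def)
qed

lemma W12_diff:
 assumes W: "W \<in> sets lebesgue" and f: "f \<in> W12 W" and g: "g \<in> W12 W"
 shows "(%x. f x - g x) \<in> W12 W" unfolding W12_def
proof (intro CollectI conjI allI)
 show "(%x. f x - g x) \<in> L2 W" using f g by (intro L2_diff) (auto simp: W12_def)
 fix i
 have "\<exists>f'\<in>L2 W. has_weak_pderiv W i f f'" "\<exists>g'\<in>L2 W. has_weak_pderiv W i g g'" using f g by (simp_all add: W12_def)
 then obtain f' g' where "f' \<in> L2 W" "has_weak_pderiv W i f f'" "g' \<in> L2 W" "has_weak_pderiv W i g g'" by blast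
 thus "\<exists>h\<in>L2 W. has_weak_pderiv W i (%x. f x - g x) h" using has_weak_pderiv_diff[OF W] L2_diff by blast
qed

text \<open>\<open>weak_hessian\<close> is built from chosen representatives and is therefore
  additive only almost everywhere.\<close>

lemma weak_hessian_diff:
 assumes W: "W \<in> sets lebesgue" "negligible (W - interior W)" and f: "f \<in> W22 W" and g: "g \<in> W22 W"
 shows "AE x in lebesgue. x \<in> W \<longrightarrow> weak_hessian W f x $ i $ j - weak_hessian W g x $ i $ j = weak_hessian W (%x. f x - g x) x $ i $ j"
  "(%x. f x - g x) \<in> W22 W"
proof -
 note F = W22_weak_hessian[OF W f] and G = W22_weak_hessian[OF W g]
 have w1: "has_weak_pderiv W i (%x. f x - g x) (%x. weak_pderiv W i f x - weak_pderiv W i g x)" for i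
  by (rule has_weak_pderiv_diff[OF W(1) F(3) G(3)])
 have wW: "(%x. weak_pderiv W i f x - weak_pderiv W i g x) \<in> W12 W" for i using f g by (intro W12_diff[OF W(1)]) (auto simp: W22_def)
 hence wm: "(%x. weak_pderiv W i f x - weak_pderiv W i g x) \<in> borel_measurable (lebesgue_on W)" for i by (simp add: W12_def L2_def)
 have w2: "has_weak_pderiv W j (%x. weak_pderiv W i f x - weak_pderiv W i g x) (%x. weak_hessian W f x $ i $ j - weak_hessian W g x $ i $ j)" for i j
  by (rule has_weak_pderiv_diff[OF W(1) F(4) G(4)])
 note r = weak_pderiv2_AE[OF W w1 wm w2]
 show "AE x in lebesgue. x \<in> W \<longrightarrow> weak_hessian W f x $ i $ j - weak_hessian W g x $ i $ j = weak_hessian W (%x. f x - g x) x $ i $ j"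
  using r(2)[of i j] by (simp add: weak_hessian_def)
 have "weak_pderiv W i (%x. f x - g x) \<in> W12 W" for i
 proof -
  have Wd: "(%x. f x - g x) \<in> W12 W" using f g by (intro W12_diff[OF W(1)]) (auto simp: W22_def)
  have "weak_pderiv W i (%x. f x - g x) \<in> L2 W" by (rule W12_weak_pderiv(2)[OF W Wd])
  moreover have "\<exists>h\<in>L2 W. has_weak_pderiv W j (weak_pderiv W i (%x. f x - g x)) h" for j
   by (rule bexI[where x = "%x. weak_hessian W f x $ i $ j - weak_hessian W g x $ i $ j"], rule r(1), rule L2_diff[OF F(1) G(1)])
  ultimately show ?thesis unfolding W12_def by blast
 qed
 thus "(%x. f x - g x) \<in> W22 W" unfolding W22_def using W12_diff[OF W(1), of f g] f g by (auto simp: W22_def)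
qed

section \<open>Test functions near the vertex, and the dual norm of the competitor\<close>

lemma second_derivative_bound:
 fixes p p1 p2 :: "real => real"
 assumes p: "\<And>t. (p has_real_derivative p1 t) (at t)" "\<And>t. (p1 has_real_derivative p2 t) (at t)" "\<And>t. isCont p2 t"
  and z: "p 0 = 0" "p1 0 = 0" and s: "0 <= s" "s <= h"
 shows "\<bar>p s\<bar> <= h * (LINT t|lborel. ind {0..h} t * \<bar>p2 t\<bar>)"
proof -
 define A where "A = (LINT t|lborel. ind {0..h} t * \<bar>p2 t\<bar>)"
 have iA: "integrable lborel (%t. ind {0..h} t * \<bar>p2 t\<bar>)" using borel_integrable_compact[of "{0..h}" "%t. \<bar>p2 t\<bar>"] p(3)
  by (auto simp: set_integrable_def intro!: continuous_at_imp_continuous_on continuous_intros)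
 have b: "\<bar>p1 t\<bar> <= A" if "0 <= t" "t <= h" for t
 proof -
  have "(LINT x|lborel. p2 x * ind {0..t} x) = p1 t - p1 0" by (rule integral_FTC_Icc_real) (use that p in auto)
  hence "\<bar>p1 t\<bar> = \<bar>LINT x|lborel. p2 x * ind {0..t} x\<bar>" using z by simp
  also have "\<dots> <= (LINT x|lborel. \<bar>p2 x * ind {0..t} x\<bar>)" by (rule integral_abs_bound)
  also have "\<dots> <= A" unfolding A_def
  proof (rule integral_mono[OF _ iA])
   have "integrable lborel (%x. ind {0..t} x * p2 x)" using borel_integrable_compact[of "{0..t}" p2] p(3)
    by (auto simp: set_integrable_def intro!: continuous_at_imp_continuous_on)
   thus "integrable lborel (%x. \<bar>p2 x * ind {0..t} x\<bar>)" by (simp add: mult.commute)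
   show "\<bar>p2 x * ind {0..t} x\<bar> <= ind {0..h} x * \<bar>p2 x\<bar>" for x using that by (auto simp: indicator_def)
  qed
  finally show ?thesis .
 qed
 have "A >= 0" using b[of 0] s by simp
 show ?thesis
 proof (cases "s = 0")
  case True thus ?thesis using z s \<open>A >= 0\<close> by (simp add: A_def)
 next
  case False
  then obtain x where x: "0 < x" "x < s" "p s - p 0 = (s - 0) * p1 x" using MVT2[of 0 s p p1] s p(1) by auto
  hence "\<bar>p s\<bar> = s * \<bar>p1 x\<bar>" using z s by (simp add: abs_mult)
  also have "\<dots> <= h * A" using s x b[of x] \<open>A >= 0\<close> by (intro mult_mono) auto
  finally show ?thesis by (simp add: A_def)
 qed
qed

text \<open>\<phi> vanishes in a neighbourhood of the line \<open>x $ 1 = 0\<close>, which does not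
  meet the cone. Integrating the second derivative twice along horizontal lines gives
  \<open>h^2\<close>, and Cauchy-Schwarz on the rectangle gives the third h. Here
  \<open>polar_rect 0 h h\<close> is a plain Cartesian rectangle.\<close>

lemma test_function_near_vertex:
 assumes a: "0 < \<alpha>" "\<alpha> < pi / 2" and \<phi>: "\<phi> \<in> test_functions (double_sector \<alpha>)" and h: "h > 0"
 shows "(LINT x|lborel. ind (polar_rect 0 h h) x * \<bar>\<phi> x\<bar>) <= 2 * h ^ 3 * sqrt (LINT x|lborel. (pd 1 (pd 1 \<phi>) x)\<^sup>2)"
proof -
 obtain K where K: "smooth \<phi>" "compact K" "K \<subseteq> interior (double_sector \<alpha>)" "\<And>x. x \<notin> K ==> \<phi> x = 0" "\<And>i x. x \<notin> K ==> pd i \<phi> x = 0"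
  using \<phi> by (rule test_functionsD) blast
 have s1: "smooth (pd 1 \<phi>)" "smooth (pd 1 (pd 1 \<phi>))" using K(1) smooth_pderiv by blast+
 define g where "g = pd 1 (pd 1 \<phi>)"
 have g0: "g x = 0" if "x \<notin> K" for x unfolding g_def using pderiv_dir_outside[of K "pd 1 \<phi>" x] K(2,5) that compact_imp_closed by blast
 have cg: "continuous_on UNIV g" unfolding g_def by (rule smooth_continuous[OF s1(2)])
 have zero: "(vector [0, b] :: real^2) \<notin> K" for b using K(3) sector_interior[OF a] cone_pos[OF a, of "vector [0, b]"] by auto
 have row: "(LINT t|lborel. ind {0..h} t * \<bar>\<phi> (vector [t, b])\<bar>) <= h\<^sup>2 * (LINT t|lborel. ind {0..h} t * \<bar>g (vector [t, b])\<bar>)" for b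
 proof -
  define A where "A = (LINT t|lborel. ind {0..h} t * \<bar>g (vector [t, b])\<bar>)"
  have bd: "\<bar>\<phi> (vector [t, b])\<bar> <= h * A" if "0 <= t" "t <= h" for t unfolding A_def
  proof (rule second_derivative_bound[where p = "%t. \<phi> (vector [t, b])" and ?p1.0 = "%t. pd 1 \<phi> (vector [t, b])" and ?p2.0 = "%t. g (vector [t, b])"])
   show "((%t. \<phi> (vector [t, b])) has_real_derivative pd 1 \<phi> (vector [t, b])) (at t)" for t
    by (rule has_derivative_line(1)[OF smooth_has_derivative[OF K(1)]])
   show "((%t. pd 1 \<phi> (vector [t, b])) has_real_derivative g (vector [t, b])) (at t)" for t
    unfolding g_def by (rule has_derivative_line(1)[OF smooth_has_derivative[OF s1(1)]])
   show "isCont (%t. g (vector [t, b])) t" for t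
    by (rule isCont_o2[OF isCont_vector2(1)]) (use cg in \<open>simp add: continuous_on_eq_continuous_at\<close>)
  qed (use that K(4,5) zero in auto)
  have ci: "integrable lborel (%t. ind {0..h} t * \<bar>\<phi> (vector [t, b])\<bar>)"
  proof -
   have "continuous_on {0..h} (%t. \<bar>\<phi> (vector [t, b])\<bar>)"
    by (intro continuous_intros continuous_at_imp_continuous_on ballI isCont_o2[OF isCont_vector2(1)] smooth_isCont K(1))
   thus ?thesis using borel_integrable_compact[of "{0..h}" "%t. \<bar>\<phi> (vector [t, b])\<bar>"] by (simp add: set_integrable_def)
  qed
  have iR0: "integrable lborel (indicat_real {0..h})" by (intro integrable_real_indicator emeasure_bounded_finite) auto
  have ih: "integrable lborel (%t. ind {0..h} t * (h * A))" by (rule integrable_mult_left) (rule iR0)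
  have "(LINT t|lborel. ind {0..h} t * \<bar>\<phi> (vector [t, b])\<bar>) <= (LINT t|lborel. ind {0..h} t * (h * A))"
   by (rule integral_mono[OF ci ih]) (use bd in \<open>auto simp: indicator_def\<close>)
  also have "\<dots> = h\<^sup>2 * A" using h by (simp add: power2_eq_square)
  finally show ?thesis by (simp add: A_def)
 qed
 have cabs: "continuous_on UNIV (%x. \<bar>\<phi> x\<bar>)" "continuous_on UNIV (%x. h\<^sup>2 * \<bar>g x\<bar>)"
  by (intro continuous_intros smooth_continuous K(1) cg)+
 have inner: "integrable lborel (%b. ind {-h..h} b * (LINT t|lborel. ind {0..h} t * k (vector [t, b])))"
  if k: "continuous_on UNIV k" for k :: "real^2 => real"
 proof -
  have i: "integrable lborel (%x. ind (polar_rect 0 h h) x * k x)" by (rule integral_rect_iterated(3)[OF k])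
  have [measurable]: "(%x. ind (polar_rect 0 h h) x * k x) \<in> borel_measurable borel" using borel_measurable_integrable[OF i] by simp
  have m: "(%p. vector [fst p, snd p] :: real^2) \<in> lborel \<Otimes>\<^sub>M lborel \<rightarrow>\<^sub>M borel" by (simp add: lborel_prod)
  have "integrable (lborel \<Otimes>\<^sub>M lborel) (%p. ind (polar_rect 0 h h) (vector [fst p, snd p]) * k (vector [fst p, snd p]))"
   using i by (subst (asm) lborel_plane) (subst (asm) integrable_distr_eq[OF m], auto)
  hence "integrable (lborel \<Otimes>\<^sub>M lborel) (%(t, b). ind (polar_rect 0 h h) (vector [t, b]) * k (vector [t, b]))"
   by (simp add: case_prod_unfold)
  hence "integrable lborel (%b. LINT t|lborel. ind (polar_rect 0 h h) (vector [t, b]) * k (vector [t, b]))" by (rule lborel_pair.integrable_snd)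
  moreover have "(LINT t|lborel. ind (polar_rect 0 h h) (vector [t, b]) * k (vector [t, b])) = ind {-h..h} b * (LINT t|lborel. ind {0..h} t * k (vector [t, b]))" for b
  proof -
   have "(LINT t|lborel. ind (polar_rect 0 h h) (vector [t, b]) * k (vector [t, b])) = (LINT t|lborel. ind {-h..h} b * (ind {0..h} t * k (vector [t, b])))"
    by (intro lint_cong) (auto simp: indicator_def polar_rect_mem)
   thus ?thesis by simp
  qed
  ultimately show ?thesis by simp
 qed
 have "(LINT x|lborel. ind (polar_rect 0 h h) x * \<bar>\<phi> x\<bar>) = (LINT b|lborel. ind {-h..h} b * (LINT t|lborel. ind {0..h} t * \<bar>\<phi> (vector [t, b])\<bar>))"
  by (rule integral_rect_iterated(2)[OF cabs(1)])
 also have "\<dots> <= (LINT b|lborel. ind {-h..h} b * (LINT t|lborel. ind {0..h} t * (h\<^sup>2 * \<bar>g (vector [t, b])\<bar>)))"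
 proof (rule integral_mono[OF inner[OF cabs(1)] inner[OF cabs(2)]])
  fix b
  have "(LINT t|lborel. ind {0..h} t * (h\<^sup>2 * \<bar>g (vector [t, b])\<bar>)) = (LINT t|lborel. h\<^sup>2 * (ind {0..h} t * \<bar>g (vector [t, b])\<bar>))"
   by (intro lint_cong) simp
  thus "ind {-h..h} b * (LINT t|lborel. ind {0..h} t * \<bar>\<phi> (vector [t, b])\<bar>) <= ind {-h..h} b * (LINT t|lborel. ind {0..h} t * (h\<^sup>2 * \<bar>g (vector [t, b])\<bar>))"
   using row[of b] by (intro mult_left_mono) auto
 qed
 also have "\<dots> = (LINT x|lborel. ind (polar_rect 0 h h) x * (h\<^sup>2 * \<bar>g x\<bar>))"
  by (rule integral_rect_iterated(2)[OF cabs(2), symmetric])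
 also have "\<dots> = h\<^sup>2 * (LINT x|lborel. ind (polar_rect 0 h h) x * \<bar>g x\<bar>)"
 proof -
  have "(LINT x|lborel. ind (polar_rect 0 h h) x * (h\<^sup>2 * \<bar>g x\<bar>)) = (LINT x|lborel. h\<^sup>2 * (ind (polar_rect 0 h h) x * \<bar>g x\<bar>))"
   by (intro lint_cong) simp
  thus ?thesis by simp
 qed
 also have "(LINT x|lborel. ind (polar_rect 0 h h) x * \<bar>g x\<bar>) <= sqrt (LINT x|lborel. (ind (polar_rect 0 h h) (x::real^2))\<^sup>2) * sqrt (LINT x|lborel. \<bar>g x\<bar>\<^sup>2)"
 proof -
  have R: "polar_rect 0 h h \<in> sets borel" by (simp add: polar_rect_def)
  have iR: "integrable lborel (indicat_real (polar_rect 0 h h))"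
   by (intro integrable_real_indicator emeasure_bounded_finite) (auto simp: polar_rect_def)
  have cg2: "continuous_on UNIV (%x. (g x)\<^sup>2)" by (intro continuous_intros cg)
  have ig: "integrable lborel (%x. \<bar>g x\<bar>\<^sup>2)" using compact_support_integrable[OF cg2 K(2)] g0 by simp
  have sqi: "(ind (polar_rect 0 h h) x)\<^sup>2 = (ind (polar_rect 0 h h) x :: real)" for x by (simp add: indicator_def)
  have cag: "continuous_on UNIV (%x. \<bar>g x\<bar>)" by (intro continuous_intros cg)
  have mg: "(%x. \<bar>g x\<bar>) \<in> borel_measurable lborel" using borel_measurable_continuous_onI[OF cag] by simp
  have "\<bar>LINT x|lborel. ind (polar_rect 0 h h) x * \<bar>g x\<bar>\<bar> <= sqrt (LINT x|lborel. (ind (polar_rect 0 h h) (x::real^2))\<^sup>2) * sqrt (LINT x|lborel. \<bar>g x\<bar>\<^sup>2)"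
   by (rule Cauchy_Schwarz_integral) (use iR ig mg R sqi in auto)
  thus ?thesis by linarith
 qed
 also have "sqrt (LINT x|lborel. (ind (polar_rect 0 h h) (x::real^2))\<^sup>2) <= 2 * h"
 proof -
  have "(LINT x|lborel. (ind (polar_rect 0 h h) (x::real^2))\<^sup>2) = (LINT x|lborel. ind (polar_rect 0 h h) (x::real^2) * (1::real))"
   by (intro lint_cong) (simp add: indicator_def)
  also have "\<dots> = (LINT r|lborel. ind {0..h} r * (LINT t|lborel. ind {-h..h} t * (1::real)))"
   by (rule integral_rect_iterated(1)) (intro continuous_intros)
  also have "\<dots> = 2 * h\<^sup>2" using h by (simp add: power2_eq_square)
  also have "\<dots> <= (2 * h)\<^sup>2" by (simp add: power2_eq_square)
  finally show ?thesis using h by (intro real_le_lsqrt) auto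
 qed
 finally have "(LINT x|lborel. ind (polar_rect 0 h h) x * \<bar>\<phi> x\<bar>) <= h\<^sup>2 * (2 * h * sqrt (LINT x|lborel. \<bar>g x\<bar>\<^sup>2))"
  by (simp add: mult_left_mono mult_right_mono)
 thus ?thesis by (simp add: g_def power2_eq_square power3_eq_cube mult.assoc)
qed

lemma pderiv_dir_const: "pd i (%x. c) x = 0" by (rule has_derivative_pderiv_dir[where g = "%_. 0"]) simp

lemma hess_const: "hess (%x. c) x = 0" by (simp add: hess_def vec_eq_iff pderiv_dir_const[abs_def])

lemma hess_nth: "hess f x $ i $ j = pd j (pd i f) x" by (simp add: hess_def)

lemma hess_measurable:
 assumes "smooth f" shows "hess f \<in> borel_measurable (lebesgue_on W)"
proof (rule measurable_matrix2)
 fix i j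
 have "continuous_on UNIV (pd j (pd i f))" using assms smooth_pderiv smooth_continuous by blast
 thus "(%x. hess f x $ i $ j) \<in> borel_measurable (lebesgue_on W)" unfolding hess_nth
  by (intro measurable_restrict_space1 measurable_completion) (simp add: borel_measurable_continuous_onI)
qed

lemma L2_norm_AE_zero:
 fixes f :: "real^2 => 'b::euclidean_space"
 assumes "W \<in> sets lebesgue" "AE x in lebesgue. x \<in> W \<longrightarrow> f x = 0"
 shows "L2_norm W f = 0"
proof -
 have "AE x in lebesgue_on W. (norm (f x))\<^sup>2 = 0" using assms by (subst AE_restrict_space_iff) (auto elim: eventually_mono)
 thus ?thesis unfolding L2_norm_def using integral_eq_zero_AE by fastforce
qed

lemma test_function_W22_0:
 assumes W: "W \<in> sets lebesgue" "negligible (W - interior W)" "bounded W" and \<phi>: "\<phi> \<in> test_functions W"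
 shows "\<phi> \<in> W22_0 W" "W22_0_norm W \<phi> = L2_norm W (hess \<phi>)"
proof -
 have s: "smooth \<phi>" using \<phi> by (simp add: test_functions_def)
 have z: "L2_norm W (%x. \<phi> x - \<phi> x) = 0" by (rule L2_norm_AE_zero[OF W(1)]) simp
 have "AE x in lebesgue. x \<in> W \<longrightarrow> weak_hessian W (%x. 0) x = hess (%x. 0) x"
  using smooth_weak_hessian_AE[OF W smooth_const[of 0]] by (simp add: hess_def)
 hence "AE x in lebesgue. x \<in> W \<longrightarrow> weak_hessian W (%x. \<phi> x - \<phi> x) x = 0" by (simp add: hess_const)
 hence z2: "W22_0_norm W (%x. \<phi> x - \<phi> x) = 0" unfolding W22_0_norm_def by (rule L2_norm_AE_zero[OF W(1)])
 show "\<phi> \<in> W22_0 W" unfolding W22_0_def using smooth_W22[OF W s] \<phi>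
  by (auto intro!: exI[of _ "%n. \<phi>"] simp: z[simplified] z2[simplified])
 have ae: "AE x in lebesgue. x \<in> W \<longrightarrow> weak_hessian W \<phi> x = hess \<phi> x"
  using smooth_weak_hessian_AE[OF W s] by (simp add: hess_def)
 show "W22_0_norm W \<phi> = L2_norm W (hess \<phi>)" unfolding W22_0_norm_def
  by (rule L2_norm_AE_cong[OF W(1) hess_measurable[OF s] W22_weak_hessian(2)[OF W(1,2) smooth_W22[OF W s]] ae])
qed

lemma dual_norm_ge:
 assumes W: "W \<in> sets lebesgue" "negligible (W - interior W)" "bounded W" and \<phi>: "\<phi> \<in> test_functions W"
  and le: "L2_norm W (hess \<phi>) <= 1"
 shows "ereal (LINT x|lebesgue_on W. \<phi> x * f x) <= W22_dual_norm W f"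
 unfolding W22_dual_norm_def using test_function_W22_0[OF W \<phi>] le by (intro SUP_upper) auto

lemma zero_test_function: "(%x. 0) \<in> test_functions W" unfolding test_functions_def by (auto intro!: exI[of _ "{}"])

lemma dual_norm_nonneg:
 assumes W: "W \<in> sets lebesgue" "negligible (W - interior W)" "bounded W"
 shows "0 <= W22_dual_norm W f"
proof -
 have "L2_norm W (hess (%x. 0)) <= 1" by (simp add: hess_const[abs_def] L2_norm_AE_zero[OF W(1)])
 from dual_norm_ge[OF W zero_test_function this, of f] show ?thesis by (simp add: zero_ereal_def[symmetric])
qed

definition dreg :: "real => real^2 => real" where "dreg h x = det (hess (vreg h) x)"

lemma dreg: assumes h: "h > 0"
 shows "0 <= dreg h x" "dreg h x <= 6 * M1 / h\<^sup>2" "norm x >= h ==> dreg h x = 0" "continuous_on UNIV (dreg h)"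
proof -
 have e: "dreg h x = kk h (sq x) * BB h (sq x)" for x unfolding dreg_def by (rule hess_vreg(2)[OF h])
 show "0 <= dreg h x" unfolding e by (intro mult_nonneg_nonneg kk_bounds BB_bounds h)
 have "dreg h x <= (2 / h) * (3 * M1 / h)" unfolding e using h by (intro mult_mono kk_bounds BB_bounds) auto
 thus "dreg h x <= 6 * M1 / h\<^sup>2" by (simp add: power2_eq_square)
 show "norm x >= h ==> dreg h x = 0"
 proof -
  assume "norm x >= h"
  hence "h\<^sup>2 <= sq x" unfolding sq_norm using h by (intro power_mono) auto
  thus "dreg h x = 0" unfolding e by (simp add: BB_bounds(3)[OF h])
 qed
 have "continuous_on UNIV (pd j (pd i (vreg h)))" for i j using smooth_vreg[OF h] smooth_pderiv smooth_continuous by blast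
 thus "continuous_on UNIV (dreg h)" unfolding dreg_def[abs_def] det_2 hess_nth by (intro continuous_intros)
qed

text \<open>The determinant is at most \<open>6 * M1 / h^2\<close> and lives in the ball of radius
  h, where the integral of \<phi> gains a factor \<open>2 * h^3\<close>.\<close>

lemma vertex_pairing_test:
 assumes a: "0 < \<alpha>" "\<alpha> < pi / 2" and \<phi>: "\<phi> \<in> test_functions (double_sector \<alpha>)" and h: "h > 0"
 shows "\<bar>LINT x|lebesgue_on (double_sector \<alpha>). \<phi> x * dreg h x\<bar> <= 12 * M1 * h * L2_norm (double_sector \<alpha>) (pd 1 (pd 1 \<phi>))"
proof -
 note sb = sector_basics[OF a]
 let ?D = "double_sector \<alpha>"
 obtain K where K: "smooth \<phi>" "compact K" "K \<subseteq> interior ?D" "K \<subseteq> ?D" "\<And>x. x \<notin> K ==> \<phi> x = 0" "\<And>i x. x \<notin> K ==> pd i \<phi> x = 0"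
  using \<phi> by (rule test_functionsD) blast
 have sg: "smooth (pd 1 (pd 1 \<phi>))" using K(1) smooth_pderiv by blast
 define g where "g = pd 1 (pd 1 \<phi>)"
 have g0: "g x = 0" if "x \<notin> ?D" for x unfolding g_def using pderiv_dir_outside[of K "pd 1 \<phi>" x] K(2,4,6) that compact_imp_closed by blast
 have cg: "continuous_on UNIV g" unfolding g_def by (rule smooth_continuous[OF sg])
 have \<phi>0: "\<phi> x = 0" if "x \<notin> ?D" for x using K(4,5) that by blast
 have cphi: "continuous_on UNIV \<phi>" by (rule smooth_continuous[OF K(1)])
 note cd = dreg(4)[OF h]
 have cpd: "continuous_on UNIV (%x. \<phi> x * dreg h x)" by (intro continuous_intros cphi cd)
 have "(LINT x|lebesgue_on ?D. \<phi> x * dreg h x) = (LINT x|lborel. \<phi> x * dreg h x)"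
  by (rule lebesgue_on_lborel[OF sb(2)]) (use \<phi>0 cpd in \<open>auto simp: borel_measurable_continuous_onI\<close>)
 hence "\<bar>LINT x|lebesgue_on ?D. \<phi> x * dreg h x\<bar> <= (LINT x|lborel. \<bar>\<phi> x * dreg h x\<bar>)" by (simp add: integral_abs_bound)
 also have "\<dots> <= (LINT x|lborel. 6 * M1 / h\<^sup>2 * (ind (polar_rect 0 h h) x * \<bar>\<phi> x\<bar>))"
 proof (rule integral_mono)
  show "integrable lborel (%x. \<bar>\<phi> x * dreg h x\<bar>)" using compact_support_integrable[OF cpd K(2)] K(5) by auto
  show "integrable lborel (%x. 6 * M1 / h\<^sup>2 * (ind (polar_rect 0 h h) x * \<bar>\<phi> x\<bar>))"
   by (intro integrable_mult_right integral_rect_iterated(3) continuous_intros cphi)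
  fix x
  show "\<bar>\<phi> x * dreg h x\<bar> <= 6 * M1 / h\<^sup>2 * (ind (polar_rect 0 h h) x * \<bar>\<phi> x\<bar>)"
  proof (cases "x \<in> interior ?D \<and> norm x < h")
   case True
   have "x $ 1 > 0" using True sector_interior[OF a] cone_pos[OF a] by auto
   hence "x \<in> polar_rect 0 h h" using True component_le_norm_cart[of x 1] component_le_norm_cart[of x 2] by (auto simp: polar_rect_mem)
   moreover have "\<bar>\<phi> x\<bar> * dreg h x <= \<bar>\<phi> x\<bar> * (6 * M1 / h\<^sup>2)" by (intro mult_left_mono dreg(2)[OF h]) auto
   ultimately show ?thesis using dreg(1)[OF h, of x] by (simp add: abs_mult mult.commute)
  next
   case False
   hence "\<phi> x = 0 \<or> dreg h x = 0" using K(3,5) dreg(3)[OF h, of x] by force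
   thus ?thesis using M1(1) by auto
  qed
 qed
 also have "\<dots> = 6 * M1 / h\<^sup>2 * (LINT x|lborel. ind (polar_rect 0 h h) x * \<bar>\<phi> x\<bar>)" by simp
 also have "\<dots> <= 6 * M1 / h\<^sup>2 * (2 * h ^ 3 * sqrt (LINT x|lborel. (g x)\<^sup>2))"
  unfolding g_def by (intro mult_left_mono test_function_near_vertex[OF a \<phi> h]) (use M1(1) in auto)
 also have "sqrt (LINT x|lborel. (g x)\<^sup>2) = L2_norm ?D g"
 proof -
  have cg2: "continuous_on UNIV (%x. (g x)\<^sup>2)" by (intro continuous_intros cg)
  have "(LINT x|lebesgue_on ?D. (norm (g x))\<^sup>2) = (LINT x|lborel. (g x)\<^sup>2)"
   using lebesgue_on_lborel[OF sb(2), of "%x. (g x)\<^sup>2"] cg2 g0 by (simp add: borel_measurable_continuous_onI)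
  thus ?thesis by (simp add: L2_norm_def)
 qed
 also have "6 * M1 / h\<^sup>2 * (2 * h ^ 3 * L2_norm ?D g) = 12 * M1 * h * L2_norm ?D g"
  using h by (simp add: power2_eq_square power3_eq_cube field_simps)
 finally show ?thesis by (simp add: g_def)
qed

text \<open>Approximating test functions have norm at most 1 plus an error that tends to 0, so the
  bound for test functions survives the limit.\<close>

lemma vertex_pairing:
 assumes a: "0 < \<alpha>" "\<alpha> < pi / 2" and \<phi>: "\<phi> \<in> W22_0 (double_sector \<alpha>)" "W22_0_norm (double_sector \<alpha>) \<phi> <= 1" and h: "h > 0"
 shows "(LINT x|lebesgue_on (double_sector \<alpha>). \<phi> x * dreg h x) <= 12 * M1 * h"
proof -
 note sb = sector_basics[OF a]
 let ?D = "double_sector \<alpha>"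
 obtain \<Phi> where W: "\<phi> \<in> W22 ?D" and P: "\<And>n. \<Phi> n \<in> test_functions ?D"
  and c1: "(%n::nat. L2_norm ?D (%x. \<Phi> n x - \<phi> x)) \<longlonglongrightarrow> 0"
  and c2: "(%n::nat. W22_0_norm ?D (%x. \<Phi> n x - \<phi> x)) \<longlonglongrightarrow> 0" using \<phi>(1) unfolding W22_0_def by blast
 have s: "smooth (\<Phi> n)" for n using P[of n] by (simp add: test_functions_def)
 have PW: "\<Phi> n \<in> W22 ?D" for n by (rule smooth_W22[OF sb(2,4,6) s])
 have dL: "dreg h \<in> L2 ?D" by (rule bounded_continuous_L2[OF sb(2,6) dreg(4)[OF h]])
 have lim: "(%n. LINT x|lebesgue_on ?D. \<Phi> n x * dreg h x) \<longlonglongrightarrow> (LINT x|lebesgue_on ?D. \<phi> x * dreg h x)"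
  by (rule L2_integral_tendsto[OF _ _ dL c1]) (use W PW in \<open>auto simp: W22_def W12_def\<close>)
 have bd: "(LINT x|lebesgue_on ?D. \<Phi> n x * dreg h x) <= 12 * M1 * h * (W22_0_norm ?D (%x. \<Phi> n x - \<phi> x) + 1)" for n
 proof -
  note H1 = W22_weak_hessian[OF sb(2,4) PW] and H2 = W22_weak_hessian[OF sb(2,4) W]
  note H3 = W22_weak_hessian[OF sb(2,4) weak_hessian_diff(2)[OF sb(2,4) PW W]]
  have sg: "smooth (pd 1 (pd 1 (\<Phi> n)))" using s smooth_pderiv by blast
  have m: "pd 1 (pd 1 (\<Phi> n)) \<in> borel_measurable (lebesgue_on ?D)"
   using bounded_continuous_L2[OF sb(2,6) smooth_continuous[OF sg]] by (simp add: L2_def)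
  have ae1: "AE x in lebesgue. x \<in> ?D \<longrightarrow> weak_hessian ?D (\<Phi> n) x = hess (\<Phi> n) x"
   using smooth_weak_hessian_AE[OF sb(2,4,6) s] by (simp add: hess_def)
  have ae2: "AE x in lebesgue. x \<in> ?D \<longrightarrow> weak_hessian ?D (\<Phi> n) x $ 1 $ 1 - weak_hessian ?D \<phi> x $ 1 $ 1 = weak_hessian ?D (%x. \<Phi> n x - \<phi> x) x $ 1 $ 1"
   by (rule weak_hessian_diff(1)[OF sb(2,4) PW W])
  have ae: "AE x in lebesgue. x \<in> ?D \<longrightarrow> weak_hessian ?D (%x. \<Phi> n x - \<phi> x) x $ 1 $ 1 + weak_hessian ?D \<phi> x $ 1 $ 1 = pd 1 (pd 1 (\<Phi> n)) x"
   using ae1 ae2 by eventually_elim (auto simp: hess_nth)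
  have "(%x. weak_hessian ?D (%x. \<Phi> n x - \<phi> x) x $ 1 $ 1 + weak_hessian ?D \<phi> x $ 1 $ 1) \<in> L2 ?D" by (rule L2_add[OF H3(1) H2(1)])
  hence "L2_norm ?D (pd 1 (pd 1 (\<Phi> n))) = L2_norm ?D (%x. weak_hessian ?D (%x. \<Phi> n x - \<phi> x) x $ 1 $ 1 + weak_hessian ?D \<phi> x $ 1 $ 1)"
   using L2_norm_AE_cong[OF sb(2) m _ ae] by (simp add: L2_def)
  also have "\<dots> <= L2_norm ?D (%x. weak_hessian ?D (%x. \<Phi> n x - \<phi> x) x $ 1 $ 1) + L2_norm ?D (%x. weak_hessian ?D \<phi> x $ 1 $ 1)"
   by (rule L2_norm_triangle[OF H3(1) H2(1)])
  also have "\<dots> <= W22_0_norm ?D (%x. \<Phi> n x - \<phi> x) + 1"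
   using H3(6)[of n 1 1] H2(6)[of 1 1] \<phi>(2) unfolding W22_0_norm_def by linarith
  finally have "12 * M1 * h * L2_norm ?D (pd 1 (pd 1 (\<Phi> n))) <= 12 * M1 * h * (W22_0_norm ?D (%x. \<Phi> n x - \<phi> x) + 1)"
   using M1(1) h by (intro mult_left_mono) auto
  thus ?thesis using vertex_pairing_test[OF a P[of n] h] by linarith
 qed
 have "(%n. 12 * M1 * h * (W22_0_norm ?D (%x. \<Phi> n x - \<phi> x) + 1)) \<longlonglongrightarrow> 12 * M1 * h * (0 + 1)"
  by (intro tendsto_intros c2)
 from LIMSEQ_le[OF lim this] bd show ?thesis by auto
qed

section \<open>Admissibility and energy of the competitor\<close>

lemma vreg_trace:
 assumes a: "0 < \<alpha>" "\<alpha> < pi / 2" and h: "0 < h" "h <= 1"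
 shows "boundary_conditions \<alpha> (vreg h)"
proof -
 note sb = sector_basics[OF a]
 let ?S = "sector \<alpha>" and ?\<Gamma> = "curved_boundary \<alpha>"
 have sv: "smooth (vreg h)" by (rule smooth_vreg[OF h(1)])
 have sd: "smooth (pd i (vreg h))" for i by (rule smooth_pderiv[OF sv])
 have W: "vreg h \<in> W22 ?S" by (rule smooth_W22[OF sb(1,3,5) sv])
 have arc0: "(LINT x:?\<Gamma>|circle_arc_length. (k x - g x)\<^sup>2) = 0" if "\<And>x. norm x = 1 ==> k x = g x" for k g :: "real^2 => real"
 proof -
  have "(LINT x:?\<Gamma>|circle_arc_length. (k x - g x)\<^sup>2) = (LINT x|circle_arc_length. 0)" unfolding set_lebesgue_integral_def
   by (intro lint_cong) (auto simp: indicator_def curved_boundary_def that)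
  thus ?thesis by simp
 qed
 have n1: "vreg h x = 1" if "norm x = 1" for x using vreg_norm[OF h, of x] that h by simp
 have d1: "pd i (vreg h) x = x $ i" if "norm x = 1" for x i
 proof -
  have "sq x = 1" using that by (simp add: sq_norm)
  moreover have "h\<^sup>2 <= 1" using h by (simp add: power_le_one)
  ultimately show ?thesis using chi_large(1)[OF h(1), of 1] by (simp add: pderiv_vreg[OF h(1)] kk_def)
 qed
 have L0: "L2_norm ?S (%x. u x - w x) = 0" if "AE x in lebesgue. x \<in> ?S \<longrightarrow> u x = w x" for u w :: "real^2 => real"
  by (rule L2_norm_AE_zero[OF sb(1)]) (use that in \<open>auto elim: eventually_mono\<close>)
 have ae1: "AE x in lebesgue. x \<in> ?S \<longrightarrow> pd i (vreg h) x = weak_pderiv ?S i (vreg h) x" for i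
  by (rule smooth_weak_pderiv_AE[OF sb(1,3) sv])
 have m: "pd i (vreg h) \<in> borel_measurable (lebesgue_on ?S)" for i
  using bounded_continuous_L2[OF sb(1,5) smooth_continuous[OF sd]] by (simp add: L2_def)
 have ae2: "AE x in lebesgue. x \<in> ?S \<longrightarrow> pd j (pd i (vreg h)) x = weak_pderiv ?S j (weak_pderiv ?S i (vreg h)) x" for i j
  by (rule weak_pderiv2_AE(2)[OF sb(1,3) smooth_has_weak_pderiv[OF sb(1) sv] m smooth_has_weak_pderiv[OF sb(1) sd]])
 have "has_trace_on ?S ?\<Gamma> (vreg h) (%x. 1)" unfolding has_trace_on_def
 proof (intro conjI exI[of _ "%n. vreg h"] allI)
  show "vreg h \<in> W12 ?S" using W by (simp add: W22_def)
  show "smooth (vreg h)" by (rule sv)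
  show "(%n. L2_norm ?S (%x. vreg h x - vreg h x)) \<longlonglongrightarrow> 0" using L0[of "vreg h" "vreg h"] by simp
  show "(%n. L2_norm ?S (%x. pd i (vreg h) x - weak_pderiv ?S i (vreg h) x)) \<longlonglongrightarrow> 0" for i by (simp add: L0[OF ae1])
  show "(%n. LINT x:?\<Gamma>|circle_arc_length. (vreg h x - 1)\<^sup>2) \<longlonglongrightarrow> 0" by (simp add: arc0[of "vreg h" "%x. 1"] n1)
 qed
 moreover have "has_trace_on ?S ?\<Gamma> (weak_pderiv ?S i (vreg h)) (%x. x $ i)" for i unfolding has_trace_on_def
 proof (intro conjI exI[of _ "%n. pd i (vreg h)"] allI)
  show "weak_pderiv ?S i (vreg h) \<in> W12 ?S" using W by (simp add: W22_def)
  show "smooth (pd i (vreg h))" by (rule sd)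
  show "(%n. L2_norm ?S (%x. pd i (vreg h) x - weak_pderiv ?S i (vreg h) x)) \<longlonglongrightarrow> 0" by (simp add: L0[OF ae1])
  show "(%n. L2_norm ?S (%x. pd j (pd i (vreg h)) x - weak_pderiv ?S j (weak_pderiv ?S i (vreg h)) x)) \<longlonglongrightarrow> 0" for j
   by (simp add: L0[OF ae2])
  show "(%n. LINT x:?\<Gamma>|circle_arc_length. (pd i (vreg h) x - x $ i)\<^sup>2) \<longlonglongrightarrow> 0"
   by (simp add: arc0[of "pd i (vreg h)" "%x. x $ i"] d1)
 qed
 ultimately show ?thesis unfolding boundary_conditions_def by blast
qed

lemma convex_cone_ball: "convex {x \<in> cone \<alpha>. norm x < R}"
proof -
 have e: "{x \<in> cone \<alpha>. norm x < R} = ({x. (- tan \<alpha>) * x $ 1 + 1 * x $ 2 < 0} \<inter> {x. (- tan \<alpha>) * x $ 1 + (- 1) * x $ 2 < 0}) \<inter> ball 0 R"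
  by (auto simp: cone_def abs_if)
 have c: "convex {x :: real^2. a * x $ 1 + b * x $ 2 < 0}" for a b using convex_halfspace_lt[of "vector [a, b] :: real^2" 0] by (simp add: inner_2)
 show ?thesis unfolding e by (intro convex_Int c convex_ball)
qed

lemma vreg_admissible:
 assumes a: "0 < \<alpha>" "\<alpha> < pi / 2" and h: "0 < h" "h <= 1"
 shows "vreg h \<in> admissible \<alpha>"
proof -
 note sb = sector_basics[OF a]
 have "convex (sector \<alpha>)"
 proof -
  have "convex {x \<in> cone \<alpha>. norm x < 1}" by (rule convex_cone_ball)
  moreover have "sector \<alpha> = insert 0 {x \<in> cone \<alpha>. norm x < 1}" by (rule sector_eq[OF a])
  \<comment> \<open>The vertex belongs to the sector but not to the open cone, so segments ending
    there are treated by scaling.\<close>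
  moreover have "u *\<^sub>R x \<in> sector \<alpha>" if "x \<in> sector \<alpha>" "0 <= u" "u <= 1" for u x
  proof (cases "u = 0 \<or> x = 0")
   case True thus ?thesis using sector_eq[OF a] by auto
  next
   case False
   have "norm x < 1" using that False sector_eq[OF a] by auto
   moreover have "u * norm x <= norm x" by (rule mult_left_le_one_le) (use that in auto)
   ultimately have "norm (u *\<^sub>R x) < 1" using that by simp
   thus ?thesis using that False sector_eq[OF a] cone_scale[of u x \<alpha>] by auto
  qed
  ultimately show ?thesis
  proof (intro convexI, goal_cases)
   case (1 x y u v)
   consider "x = 0" | "y = 0" | "x \<noteq> 0" "y \<noteq> 0" by blast
   thus ?case
   proof cases
    case 1
    thus ?thesis using \<open>\<And>u x. x \<in> sector \<alpha> ==> 0 <= u ==> u <= 1 ==> u *\<^sub>R x \<in> sector \<alpha>\<close>[of y v] \<open>y \<in> sector \<alpha>\<close> \<open>0 <= v\<close> \<open>0 <= u\<close> \<open>u + v = 1\<close> by simp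
   next
    case 2
    thus ?thesis using \<open>\<And>u x. x \<in> sector \<alpha> ==> 0 <= u ==> u <= 1 ==> u *\<^sub>R x \<in> sector \<alpha>\<close>[of x u] \<open>x \<in> sector \<alpha>\<close> \<open>0 <= v\<close> \<open>0 <= u\<close> \<open>u + v = 1\<close> by simp
   next
    case 3
    hence "x \<in> {x \<in> cone \<alpha>. norm x < 1}" "y \<in> {x \<in> cone \<alpha>. norm x < 1}" using 1 by auto
    hence "u *\<^sub>R x + v *\<^sub>R y \<in> {x \<in> cone \<alpha>. norm x < 1}"
     using \<open>convex {x \<in> cone \<alpha>. norm x < 1}\<close> 1 unfolding convex_def by blast
    thus ?thesis using 1 by simp
   qed
  qed
 qed
 moreover have "convex_on UNIV (vreg h)" by (rule convex_vreg[OF h(1)])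
 ultimately have "convex_on (sector \<alpha>) (vreg h)" by (meson convex_on_subset subset_UNIV)
 thus ?thesis unfolding admissible_def using smooth_W22[OF sb(1,3,5) smooth_vreg[OF h(1)]] vreg_trace[OF a h] by blast
qed

lemma polar_image_sector:
 assumes a: "0 < \<alpha>" "\<alpha> < pi / 2" and x: "x \<in> cone \<alpha>" and r: "r <= norm x" "norm x <= R"
 shows "x \<in> polar ` polar_rect r R \<alpha>"
proof -
 obtain t where t: "\<bar>t\<bar> < \<alpha>" "x = norm x *\<^sub>R dir t" using cone_dir[OF a x] by blast
 have "x = polar (vector [norm x, t])" using t(2) by (simp add: polar_dir)
 moreover have "vector [norm x, t] \<in> polar_rect r R \<alpha>" using t(1) r by (auto simp: polar_rect_mem)
 ultimately show ?thesis by blast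
qed

lemma inverse_integral:
 assumes "0 < a" "a <= b"
 shows "integrable lborel (%r. ind {a..b} r * (1 / r :: real))" "(LINT r|lborel. ind {a..b} r * (1 / r :: real)) = ln (b / a)"
proof -
 have d: "(ln has_real_derivative 1 / x) (at x)" if "a <= x" "x <= b" for x using that assms DERIV_ln_divide[of x] by simp
 have c: "isCont (%r. 1 / r :: real) x" if "a <= x" "x <= b" for x using that assms by (intro continuous_intros) auto
 have "(LINT r|lborel. (1 / r :: real) * ind {a..b} r) = ln b - ln a" by (rule integral_FTC_Icc_real[OF assms(2)]) (use d c in auto)
 thus "(LINT r|lborel. ind {a..b} r * (1 / r :: real)) = ln (b / a)" using assms by (simp add: ln_div mult.commute)
 have "set_integrable lborel {a..b} (%r. 1 / r :: real)"
  by (rule borel_integrable_atLeastAtMost') (use assms in \<open>auto intro!: continuous_intros\<close>)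
 thus "integrable lborel (%r. ind {a..b} r * (1 / r :: real))" by (simp add: set_integrable_def)
qed

lemma vreg_extension:
 assumes a: "0 < \<alpha>" "\<alpha> < pi / 2" and h: "0 < h" "h <= 1" and x: "x \<in> double_sector \<alpha>"
 shows "extension \<alpha> (vreg h) x = vreg h x"
proof (cases "x \<in> sector \<alpha>")
 case False
 hence "norm x >= 1" using x sector_eq[OF a] double_sector_eq[OF a] by auto
 thus ?thesis using vreg_norm[OF h, of x] h False by (simp add: extension_def)
qed (simp add: extension_def)

text \<open>On the double sector the extension of \<open>vreg h\<close> is \<open>vreg h\<close>
  itself, so the only determinant is that of the rounded tip.\<close>

lemma vreg_dual_norm:
 assumes a: "0 < \<alpha>" "\<alpha> < pi / 2" and h: "0 < h" "h <= 1"
 shows "W22_dual_norm (double_sector \<alpha>) (%x. det (weak_hessian (double_sector \<alpha>) (extension \<alpha> (vreg h)) x)) <= ereal (12 * M1 * h)"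
proof -
 note sb = sector_basics[OF a]
 let ?D = "double_sector \<alpha>"
 have sv: "smooth (vreg h)" by (rule smooth_vreg[OF h(1)])
 have e1: "weak_pderiv ?D i (extension \<alpha> (vreg h)) = weak_pderiv ?D i (vreg h)" for i
  by (rule weak_pderiv_cong(2)[OF sb(2)]) (rule vreg_extension[OF a h])
 have e2: "weak_hessian ?D (extension \<alpha> (vreg h)) = weak_hessian ?D (vreg h)" by (rule ext) (simp add: weak_hessian_def e1)
 have ae: "AE x in lebesgue. x \<in> ?D \<longrightarrow> weak_hessian ?D (vreg h) x = hess (vreg h) x"
  using smooth_weak_hessian_AE[OF sb(2,4,6) sv] by (simp add: hess_def)
 have W: "vreg h \<in> W22 ?D" by (rule smooth_W22[OF sb(2,4,6) sv])
 have m0: "(%x. weak_hessian ?D (vreg h) x $ i $ j) \<in> borel_measurable (lebesgue_on ?D)" for i j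
  using W22_weak_hessian(1)[OF sb(2,4) W] by (simp add: L2_def)
 have m1: "(%x. det (weak_hessian ?D (vreg h) x)) \<in> borel_measurable (lebesgue_on ?D)"
  unfolding det_2 by (intro borel_measurable_diff borel_measurable_times m0)
 have m2: "dreg h \<in> borel_measurable (lebesgue_on ?D)" using bounded_continuous_L2[OF sb(2,6) dreg(4)[OF h(1)]] by (simp add: L2_def)
 show ?thesis unfolding W22_dual_norm_def
 proof (rule SUP_least)
  fix \<phi> assume "\<phi> \<in> {\<phi> \<in> W22_0 ?D. W22_0_norm ?D \<phi> <= 1}"
  hence p: "\<phi> \<in> W22_0 ?D" "W22_0_norm ?D \<phi> <= 1" by auto
  have m3: "\<phi> \<in> borel_measurable (lebesgue_on ?D)" using p(1) by (auto simp: W22_0_def W22_def W12_def L2_def)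
  have "AE x in lebesgue_on ?D. \<phi> x * det (weak_hessian ?D (vreg h) x) = \<phi> x * dreg h x"
   using ae sb(2) by (subst AE_restrict_space_iff) (auto simp: dreg_def elim: eventually_mono)
  hence "(LINT x|lebesgue_on ?D. \<phi> x * det (weak_hessian ?D (vreg h) x)) = (LINT x|lebesgue_on ?D. \<phi> x * dreg h x)"
   by (intro integral_cong_AE borel_measurable_times m1 m2 m3)
  also have "\<dots> <= 12 * M1 * h" by (rule vertex_pairing[OF a p h(1)])
  finally show "ereal (LINT x|lebesgue_on ?D. \<phi> x * det (weak_hessian ?D (extension \<alpha> (vreg h)) x)) <= ereal (12 * M1 * h)"
   unfolding e2 by simp
 qed
qed

text \<open>The tangential eigenvalue, at most \<open>1 / r\<close>, gives the logarithm. The radial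
  one is at most \<open>3 * M1 / h\<close> and lives between the radii \<open>h / 2\<close> and h,
  so the integral of its square is bounded independently of h.\<close>

lemma vreg_hessian_norm:
 assumes a: "0 < \<alpha>" "\<alpha> < pi / 2" and h: "0 < h" "h <= 1"
 shows "(L2_norm (sector \<alpha>) (weak_hessian (sector \<alpha>) (vreg h)))\<^sup>2 <= 2 * \<alpha> * (ln (2 / h) + 9 * M1\<^sup>2)"
proof -
 note sb = sector_basics[OF a]
 let ?S = "sector \<alpha>"
 have sv: "smooth (vreg h)" by (rule smooth_vreg[OF h(1)])
 have W: "vreg h \<in> W22 ?S" by (rule smooth_W22[OF sb(1,3,5) sv])
 have ae: "AE x in lebesgue. x \<in> ?S \<longrightarrow> weak_hessian ?S (vreg h) x = hess (vreg h) x"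
  using smooth_weak_hessian_AE[OF sb(1,3,5) sv] by (simp add: hess_def)
 define g where "g x = (norm (hess (vreg h) x))\<^sup>2" for x
 have gk: "g x = (kk h (sq x))\<^sup>2 + (BB h (sq x))\<^sup>2" for x unfolding g_def by (rule hess_vreg(1)[OF h(1)])
 have "continuous_on UNIV (pd j (pd i (vreg h)))" for i j using sv smooth_pderiv smooth_continuous by blast
 hence cg: "continuous_on UNIV g" unfolding g_def norm_matrix2 hess_nth by (intro continuous_intros)
 have mg: "g \<in> borel_measurable borel" using cg by (rule borel_measurable_continuous_onI)
 have P: "compact (polar ` polar_rect (h/2) 1 \<alpha>)" by (intro compact_continuous_image polar_continuous) (simp add: polar_rect_def)
 have "(L2_norm ?S (weak_hessian ?S (vreg h)))\<^sup>2 = (L2_norm ?S (hess (vreg h)))\<^sup>2"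
  by (subst L2_norm_AE_cong[OF sb(1) hess_measurable[OF sv] W22_weak_hessian(2)[OF sb(1,3) W] ae]) simp
 also have "\<dots> = (LINT x|lebesgue_on ?S. g x)" unfolding L2_norm_power2 g_def ..
 also have "\<dots> = (LINT x|lborel. ind ?S x * g x)" by (subst lebesgue_on_lborel[OF sb(1), of "%x. ind ?S x * g x", symmetric])
   (use sb(7) mg in \<open>auto intro!: Bochner_Integration.integral_cong\<close>)
 also have "\<dots> <= (LINT x|lborel. ind (polar ` polar_rect (h/2) 1 \<alpha>) x * g x)"
 proof (rule integral_mono')
  have "integrable lebesgue (%x. ind (polar ` polar_rect (h/2) 1 \<alpha>) x *\<^sub>R g x)"
   using absolutely_integrable_continuous_compact[OF P continuous_on_subset[OF cg]] by (simp add: set_integrable_def)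
  moreover have "(%x. ind (polar ` polar_rect (h/2) 1 \<alpha>) x * g x) \<in> borel_measurable borel"
   using mg P by (intro borel_measurable_times borel_measurable_indicator) (auto simp: compact_imp_closed)
  ultimately show "integrable lborel (%x. ind (polar ` polar_rect (h/2) 1 \<alpha>) x * g x)" by (simp add: integrable_completion)
  fix x
  show "0 <= ind (polar ` polar_rect (h/2) 1 \<alpha>) x * g x" by (simp add: g_def)
  show "ind ?S x * g x <= ind (polar ` polar_rect (h/2) 1 \<alpha>) x * g x"
  proof (cases "x \<in> ?S \<and> h / 2 <= norm x")
   case True
   hence "x \<in> cone \<alpha>" "norm x <= 1" using h sector_eq[OF a] by auto
   hence "x \<in> polar ` polar_rect (h/2) 1 \<alpha>" using True by (intro polar_image_sector[OF a]) auto
   thus ?thesis using True by simp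
  next
   case False
   have "x \<notin> ?S \<or> g x = 0"
   proof (cases "x \<in> ?S")
    case True
    hence "norm x <= h / 2" using False by simp
    hence "sq x <= h\<^sup>2 / 4" unfolding sq_norm using power_mono[of "norm x" "h/2" 2] by (simp add: power_divide)
    thus ?thesis unfolding gk using BB_bounds(2)[OF h(1)] kk_bounds(2)[OF h(1)] by simp
   qed simp
   thus ?thesis by (auto simp: g_def)
  qed
 qed
 also have "\<dots> = (LINT p|lborel. ind (polar_rect (h/2) 1 \<alpha>) p * (p$1 * g (polar p)))" by (rule polar_integral[OF cg]) (use a h in auto)
 also have "\<dots> = (LINT r|lborel. ind {h/2..1} r * (LINT t|lborel. ind {-\<alpha>..\<alpha>} t * ((vector [r, t] :: real^2) $ 1 * g (polar (vector [r, t])))))"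
  by (rule integral_rect_iterated(1)) (intro continuous_intros continuous_on_compose2[OF cg] polar_continuous, auto)
 also have "\<dots> = (LINT r|lborel. ind {h/2..1} r * (2 * \<alpha> * (r * ((kk h (r\<^sup>2))\<^sup>2 + (BB h (r\<^sup>2))\<^sup>2))))"
 proof (intro lint_cong)
  fix r
  have "sq (polar (vector [r, t])) = r\<^sup>2" for t by (simp add: sq_norm polar_dir)
  thus "ind {h/2..1} r * (LINT t|lborel. ind {-\<alpha>..\<alpha>} t * ((vector [r, t] :: real^2) $ 1 * g (polar (vector [r, t]))))
   = ind {h/2..1} r * (2 * \<alpha> * (r * ((kk h (r\<^sup>2))\<^sup>2 + (BB h (r\<^sup>2))\<^sup>2)))" using a by (simp add: gk)
 qed
 also have "\<dots> <= (LINT r|lborel. 2 * \<alpha> * (ind {h/2..1} r * (1 / r) + ind {h/2..h} r * (9 * M1\<^sup>2 / h)))"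
 proof (rule integral_mono')
  show "integrable lborel (%r. 2 * \<alpha> * (ind {h/2..1} r * (1 / r) + ind {h/2..h} r * (9 * M1\<^sup>2 / h)))"
   using inverse_integral(1)[of "h/2" 1] h by auto
  fix r :: real
  show "0 <= 2 * \<alpha> * (ind {h/2..1} r * (1 / r) + ind {h/2..h} r * (9 * M1\<^sup>2 / h))" using a h by (auto simp: indicator_def)
  show "ind {h/2..1} r * (2 * \<alpha> * (r * ((kk h (r\<^sup>2))\<^sup>2 + (BB h (r\<^sup>2))\<^sup>2))) <= 2 * \<alpha> * (ind {h/2..1} r * (1 / r) + ind {h/2..h} r * (9 * M1\<^sup>2 / h))"
  proof (cases "h/2 <= r \<and> r <= 1")
   case True
   hence r: "r > 0" using h by linarith
   have "kk h (r\<^sup>2) <= 1 / r" using kk_bounds(4)[OF h(1), of "r\<^sup>2"] r by simp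
   hence "(kk h (r\<^sup>2))\<^sup>2 <= (1 / r)\<^sup>2" by (intro power_mono kk_bounds(1)[OF h(1)])
   hence 1: "r * (kk h (r\<^sup>2))\<^sup>2 <= 1 / r" using r mult_left_mono[of "(kk h (r\<^sup>2))\<^sup>2" "(1/r)\<^sup>2" r] by (simp add: power2_eq_square)
   have 2: "r * (BB h (r\<^sup>2))\<^sup>2 <= ind {h/2..h} r * (9 * M1\<^sup>2 / h)"
   proof (cases "r <= h")
    case rh: True
    have "(BB h (r\<^sup>2))\<^sup>2 <= (3 * M1 / h)\<^sup>2" by (intro power_mono BB_bounds[OF h(1)])
    hence "r * (BB h (r\<^sup>2))\<^sup>2 <= h * (3 * M1 / h)\<^sup>2" using rh r by (intro mult_mono) auto
    thus ?thesis using rh True h by (simp add: power2_eq_square)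
   next
    case False
    hence "h\<^sup>2 <= r\<^sup>2" using h by (intro power_mono) auto
    thus ?thesis using BB_bounds(3)[OF h(1), of "r\<^sup>2"] h by simp
   qed
   have "r * ((kk h (r\<^sup>2))\<^sup>2 + (BB h (r\<^sup>2))\<^sup>2) <= 1 / r + ind {h/2..h} r * (9 * M1\<^sup>2 / h)"
    using 1 2 by (simp add: distrib_left)
   hence "2 * \<alpha> * (r * ((kk h (r\<^sup>2))\<^sup>2 + (BB h (r\<^sup>2))\<^sup>2)) <= 2 * \<alpha> * (1 / r + ind {h/2..h} r * (9 * M1\<^sup>2 / h))"
    using a by (intro mult_left_mono) auto
   thus ?thesis using True by simp
  next
   case False
   thus ?thesis using h a by (auto simp: indicator_def)
  qed
 qed
 also have "\<dots> = 2 * \<alpha> * (ln (2 / h) + (h / 2) * (9 * M1\<^sup>2 / h))" using inverse_integral[of "h/2" 1] h by simp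
 also have "\<dots> <= 2 * \<alpha> * (ln (2 / h) + 9 * M1\<^sup>2)" using a h by (intro mult_left_mono add_left_mono) (auto simp: field_simps)
 finally show ?thesis .
qed

lemma energy_vreg:
 assumes a: "0 < \<alpha>" "\<alpha> < pi / 2" and h: "0 < h" "h <= 1"
 shows "energy \<alpha> h (vreg h) <= ereal (2 * \<alpha> * ln (1 / h) + (144 * M1\<^sup>2 + 4 * (1 + 9 * M1\<^sup>2)))"
proof -
 note sb = sector_basics[OF a]
 define N where "N = W22_dual_norm (double_sector \<alpha>) (%x. det (weak_hessian (double_sector \<alpha>) (extension \<alpha> (vreg h)) x))"
 have N: "0 <= N" "N <= ereal (12 * M1 * h)" unfolding N_def by (intro dual_norm_nonneg sb vreg_dual_norm a h)+
 have "N\<^sup>2 <= ereal (12 * M1 * h) * ereal (12 * M1 * h)" unfolding power2_eq_square using N M1(1) h by (intro ereal_mult_mono) auto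
 hence "N\<^sup>2 / ereal (h\<^sup>2) <= ereal (12 * M1 * h) * ereal (12 * M1 * h) / ereal (h\<^sup>2)"
  using h by (intro ereal_divide_right_mono) auto
 also have "\<dots> = ereal (144 * M1\<^sup>2)" using h by (simp add: power2_eq_square)
 finally have 1: "N\<^sup>2 / ereal (h\<^sup>2) <= ereal (144 * M1\<^sup>2)" .
 have "ln (2 / h) <= ln (1 / h) + 1" using h ln_2_less_1 by (simp add: ln_div)
 hence "2 * \<alpha> * (ln (2 / h) + 9 * M1\<^sup>2) <= 2 * \<alpha> * (ln (1 / h) + (1 + 9 * M1\<^sup>2))" using a by (intro mult_left_mono) auto
 also have "\<dots> = 2 * \<alpha> * ln (1 / h) + 2 * \<alpha> * (1 + 9 * M1\<^sup>2)" by (simp add: distrib_left)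
 also have "2 * \<alpha> * (1 + 9 * M1\<^sup>2) <= 4 * (1 + 9 * M1\<^sup>2)"
 proof -
  have "2 * \<alpha> <= 4" using a pi_less_4 by linarith
  thus ?thesis by (intro mult_right_mono) auto
 qed
 finally have "(L2_norm (sector \<alpha>) (weak_hessian (sector \<alpha>) (vreg h)))\<^sup>2 <= 2 * \<alpha> * ln (1 / h) + 4 * (1 + 9 * M1\<^sup>2)"
  using vreg_hessian_norm[OF a h] by linarith
 hence "energy \<alpha> h (vreg h) <= ereal (144 * M1\<^sup>2) + ereal (2 * \<alpha> * ln (1 / h) + 4 * (1 + 9 * M1\<^sup>2))"
  unfolding energy_def N_def[symmetric] using 1 by (intro add_mono) auto
 thus ?thesis by (simp add: algebra_simps)
qed

section \<open>The Hessian energy in polar coordinates\<close>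

text \<open>To compare slice by slice, a function that is constant along each slice and has slice
  integral l is subtracted. The difference has nonnegative slice integrals, and everything stays an
  integral over the rectangle.\<close>

lemma rect_integral_ge:
 fixes f :: "real^2 => real" and l :: "real => real"
 assumes f: "continuous_on UNIV f" and l: "continuous_on UNIV l" and ab: "a < b" "0 < c"
 shows "(\<And>t. t \<in> {-c..c} ==> l t <= (LINT r|lborel. ind {a..b} r * f (vector [r, t]))) ==>
   (LINT t|lborel. ind {-c..c} t * l t) <= (LINT p|lborel. ind (polar_rect a b c) p * f p)"
  and "(\<And>r. r \<in> {a..b} ==> l r <= (LINT t|lborel. ind {-c..c} t * f (vector [r, t]))) ==>
   (LINT r|lborel. ind {a..b} r * l r) <= (LINT p|lborel. ind (polar_rect a b c) p * f p)"
proof -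
 have nth: "continuous_on UNIV (%p::real^2. l (p $ i) / d)" for i d
  unfolding divide_inverse by (intro continuous_intros continuous_on_compose2[OF l]) auto
 have sub: "(LINT p|lborel. ind (polar_rect a b c) p * (f p - l (p $ i) / d)) =
   (LINT p|lborel. ind (polar_rect a b c) p * f p) - (LINT p|lborel. ind (polar_rect a b c) p * (l (p $ i) / d))" for i d
  using lint_diff[OF integral_rect_iterated(3)[OF f, of a b c] integral_rect_iterated(3)[OF nth[of i d], of a b c]] by (simp add: right_diff_distrib)
 have cm: "continuous_on UNIV (%p. f p - l (p $ i) / d)" for i d by (intro continuous_intros f nth)
 have line: "continuous_on UNIV (%a. vector [a, b] :: real^2)" "continuous_on UNIV (%b. vector [a, b] :: real^2)" for a b
  by (simp_all add: continuous_on_eq_continuous_within isCont_vector2)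
 have ii: "integrable lborel (%r. ind {a'..b'} r * k r)" if "continuous_on UNIV k" for a' b' :: real and k :: "real => real"
  using borel_integrable_atLeastAtMost'[OF continuous_on_subset[OF that subset_UNIV], of a' b'] by (simp add: set_integrable_def)
 {
  assume *: "\<And>t. t \<in> {-c..c} ==> l t <= (LINT r|lborel. ind {a..b} r * f (vector [r, t]))"
  have "(LINT p|lborel. ind (polar_rect a b c) p * (f p - l (p $ 2) / (b - a))) >= 0" unfolding integral_rect_iterated(2)[OF cm]
  proof (intro lint_nonneg)
   fix t
   have "(LINT r|lborel. ind {a..b} r * (f (vector [r, t]) - l t / (b - a))) = (LINT r|lborel. ind {a..b} r * f (vector [r, t])) - l t" for t
    using lint_diff[OF ii[OF continuous_on_compose2[OF f line(1)[of t]], of a b] ii[of "%_. l t / (b - a)" a b]] ab by (simp add: right_diff_distrib)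
   thus "0 <= ind {-c..c} t * (LINT r|lborel. ind {a..b} r * (f (vector [r, t]) - l ((vector [r, t] :: real^2) $ 2) / (b - a)))"
    using *[of t] by (cases "t \<in> {-c..c}") auto
  qed
  moreover have "(LINT p|lborel. ind (polar_rect a b c) p * (l (p $ 2) / (b - a))) = (LINT t|lborel. ind {-c..c} t * l t)"
   unfolding integral_rect_iterated(2)[OF nth] using ab by simp
  ultimately show "(LINT t|lborel. ind {-c..c} t * l t) <= (LINT p|lborel. ind (polar_rect a b c) p * f p)" unfolding sub by simp
 }
 {
  assume *: "\<And>r. r \<in> {a..b} ==> l r <= (LINT t|lborel. ind {-c..c} t * f (vector [r, t]))"
  have "(LINT p|lborel. ind (polar_rect a b c) p * (f p - l (p $ 1) / (2 * c))) >= 0" unfolding integral_rect_iterated(1)[OF cm]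
  proof (intro lint_nonneg)
   fix t
   have "(LINT r|lborel. ind {-c..c} r * (f (vector [t, r]) - l t / (2 * c))) = (LINT r|lborel. ind {-c..c} r * f (vector [t, r])) - l t" for t
    using lint_diff[OF ii[OF continuous_on_compose2[OF f line(2)[of t]], of "-c" c] ii[of "%_. l t / (2 * c)" "-c" c]] ab
    by (simp add: right_diff_distrib)
   thus "0 <= ind {a..b} t * (LINT r|lborel. ind {-c..c} r * (f (vector [t, r]) - l ((vector [t, r] :: real^2) $ 1) / (2 * c)))"
    using *[of t] by (cases "t \<in> {a..b}") auto
  qed
  moreover have "(LINT p|lborel. ind (polar_rect a b c) p * (l (p $ 1) / (2 * c))) = (LINT t|lborel. ind {a..b} t * l t)"
   unfolding integral_rect_iterated(1)[OF nth] using ab by simp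
  ultimately show "(LINT r|lborel. ind {a..b} r * l r) <= (LINT p|lborel. ind (polar_rect a b c) p * f p)" unfolding sub by simp
 }
qed

text \<open>A piecewise linear cut-off: its second derivative consists of four point masses of size
  \<open>1 / \<delta>\<close> at the corners, so integrating it against a second derivative leaves
  only values of the function itself.\<close>

definition trapezoid :: "real => real => real => real" where
 "trapezoid \<beta> \<delta> t = max 0 (min 1 ((\<beta> - \<bar>t\<bar>) / \<delta>))"

lemma integral_Icc_FTC:
 fixes F f :: "real => real"
 assumes "a <= b" "\<And>x. a <= x ==> x <= b ==> (F has_real_derivative f x) (at x within {a..b})"
 shows "(f has_integral (F b - F a)) {a..b}"
 using assms by (intro fundamental_theorem_of_calculus) (auto simp: has_real_derivative_iff_has_vector_derivative[symmetric])

lemma LINT_Icc: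
 fixes f :: "real => real"
 assumes "continuous_on {a..b} f"
 shows "(LINT x|lborel. ind {a..b} x * f x) = integral {a..b} f" using set_borel_integral_eq_integral(2)[OF borel_integrable_atLeastAtMost'[OF assms]]
 by (simp add: set_lebesgue_integral_def)

lemma trapezoid_bounds: "0 <= trapezoid \<beta> \<delta> t" "trapezoid \<beta> \<delta> t <= 1" "continuous_on UNIV (trapezoid \<beta> \<delta>)" if "\<delta> > 0"
 using that by (auto simp: trapezoid_def[abs_def] intro!: continuous_intros)

text \<open>On each of the three pieces the product has an explicit primitive. The terms with W'
  cancel at the inner corners and have coefficient 0 at the outer ones.\<close>

lemma trapezoid_second_derivative:
 fixes W W' W'' :: "real => real"
 assumes W: "\<And>t. (W has_real_derivative W' t) (at t)" "\<And>t. (W' has_real_derivative W'' t) (at t)" "continuous_on UNIV W''"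
  and d: "0 < \<delta>" "\<delta> <= \<beta>"
 shows "(LINT t|lborel. ind {-\<beta>..\<beta>} t * (trapezoid \<beta> \<delta> t * W'' t)) = (W (-\<beta>) + W \<beta> - W (-\<beta> + \<delta>) - W (\<beta> - \<delta>)) / \<delta>"
proof -
 have c: "continuous_on {-\<beta>..\<beta>} (%t. trapezoid \<beta> \<delta> t * W'' t)"
  by (intro continuous_intros continuous_on_subset[OF trapezoid_bounds(3)] continuous_on_subset[OF W(3)] d) auto
 have 1: "((%t. trapezoid \<beta> \<delta> t * W'' t) has_integral ((((-\<beta> + \<delta>) + \<beta>) / \<delta> * W' (-\<beta> + \<delta>) - W (-\<beta> + \<delta>) / \<delta>) - (((-\<beta>) + \<beta>) / \<delta> * W' (-\<beta>) - W (-\<beta>) / \<delta>))) {-\<beta>..-\<beta> + \<delta>}"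
 proof (rule integral_Icc_FTC[of _ _ "%t. (t + \<beta>) / \<delta> * W' t - W t / \<delta>"])
  fix x assume x: "- \<beta> <= x" "x <= -\<beta> + \<delta>"
  have e: "trapezoid \<beta> \<delta> x = (x + \<beta>) / \<delta>" using x d by (simp add: trapezoid_def field_simps)
  have "((%t. (t + \<beta>) / \<delta> * W' t - W t / \<delta>) has_real_derivative (1 / \<delta> * W' x + (x + \<beta>) / \<delta> * W'' x - W' x / \<delta>)) (at x)"
   using d by (auto intro!: derivative_eq_intros W simp: field_simps)
  hence "((%t. (t + \<beta>) / \<delta> * W' t - W t / \<delta>) has_real_derivative trapezoid \<beta> \<delta> x * W'' x) (at x)" by (simp add: e)
  thus "((%t. (t + \<beta>) / \<delta> * W' t - W t / \<delta>) has_real_derivative trapezoid \<beta> \<delta> x * W'' x) (at x within {-\<beta>..-\<beta> + \<delta>})"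
   by (rule has_field_derivative_at_within)
 qed (use d in simp)
 have 2: "((%t. trapezoid \<beta> \<delta> t * W'' t) has_integral (W' (\<beta> - \<delta>) - W' (-\<beta> + \<delta>))) {-\<beta> + \<delta>..\<beta> - \<delta>}"
 proof (rule integral_Icc_FTC)
  fix x assume x: "- \<beta> + \<delta> <= x" "x <= \<beta> - \<delta>"
  have "\<bar>x\<bar> <= \<beta> - \<delta>" using x by linarith
  hence e: "trapezoid \<beta> \<delta> x = 1" using d by (simp add: trapezoid_def field_simps)
  show "(W' has_real_derivative trapezoid \<beta> \<delta> x * W'' x) (at x within {-\<beta> + \<delta>..\<beta> - \<delta>})"
   using W(2) by (simp add: e has_field_derivative_at_within)
 qed (use d in simp)
 have 3: "((%t. trapezoid \<beta> \<delta> t * W'' t) has_integral (((\<beta> - \<beta>) / \<delta> * W' \<beta> + W \<beta> / \<delta>) - ((\<beta> - (\<beta> - \<delta>)) / \<delta> * W' (\<beta> - \<delta>) + W (\<beta> - \<delta>) / \<delta>))) {\<beta> - \<delta>..\<beta>}"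
 proof (rule integral_Icc_FTC[of _ _ "%t. (\<beta> - t) / \<delta> * W' t + W t / \<delta>"])
  fix x assume x: "\<beta> - \<delta> <= x" "x <= \<beta>"
  have e: "trapezoid \<beta> \<delta> x = (\<beta> - x) / \<delta>" using x d by (simp add: trapezoid_def field_simps)
  have "((%t. (\<beta> - t) / \<delta> * W' t + W t / \<delta>) has_real_derivative (- 1 / \<delta> * W' x + (\<beta> - x) / \<delta> * W'' x + W' x / \<delta>)) (at x)"
   using d by (auto intro!: derivative_eq_intros W simp: field_simps)
  hence "((%t. (\<beta> - t) / \<delta> * W' t + W t / \<delta>) has_real_derivative trapezoid \<beta> \<delta> x * W'' x) (at x)" by (simp add: e)
  thus "((%t. (\<beta> - t) / \<delta> * W' t + W t / \<delta>) has_real_derivative trapezoid \<beta> \<delta> x * W'' x) (at x within {\<beta> - \<delta>..\<beta>})"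
   by (rule has_field_derivative_at_within)
 qed (use d in simp)
 have "((%t. trapezoid \<beta> \<delta> t * W'' t) has_integral ((W (-\<beta>) + W \<beta> - W (-\<beta> + \<delta>) - W (\<beta> - \<delta>)) / \<delta>)) {-\<beta>..\<beta>}"
  using has_integral_combine[OF _ _ has_integral_combine[OF _ _ 1 2] 3] d by (simp add: diff_divide_distrib add_divide_distrib algebra_simps)
 thus ?thesis using LINT_Icc[OF c] by (simp add: integral_unique)
qed

lemma trapezoid_integral:
 assumes d: "0 < \<delta>" "\<delta> <= \<beta>"
 shows "(LINT t|lborel. ind {-\<beta>..\<beta>} t * trapezoid \<beta> \<delta> t) = 2 * \<beta> - \<delta>"
proof -
 have "(LINT t|lborel. ind {-\<beta>..\<beta>} t * (trapezoid \<beta> \<delta> t * 1)) = ((-\<beta>)\<^sup>2 / 2 + \<beta>\<^sup>2 / 2 - (-\<beta> + \<delta>)\<^sup>2 / 2 - (\<beta> - \<delta>)\<^sup>2 / 2) / \<delta>"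
  by (rule trapezoid_second_derivative[where W = "%t. t\<^sup>2 / 2" and W' = "%t. t"]) (use d in \<open>auto intro!: derivative_eq_intros\<close>)
 also have "\<dots> = 2 * \<beta> - \<delta>" using d by (simp add: field_simps power2_eq_square)
 finally show ?thesis by simp
qed

text \<open>With \<open>(c, s)\<close> the radial direction, this is the quadratic form in the
  tangential direction \<open>(s, - c)\<close>; the Frobenius norm bounds the form on unit
  vectors.\<close>

lemma quadratic_form_le_norm:
 fixes A :: "real^2^2"
 assumes "c\<^sup>2 + s\<^sup>2 = 1"
 shows "(A$1$1 * s\<^sup>2 - (A$1$2 + A$2$1) * (s * c) + A$2$2 * c\<^sup>2)\<^sup>2 <= (norm A)\<^sup>2"
proof -
 define X Y where "X = (vector [A$1$1 * s - A$2$1 * c, A$1$2 * s - A$2$2 * c] :: real^2)" and "Y = (vector [s, - c] :: real^2)"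
 have nY: "(norm Y)\<^sup>2 = 1" using assms by (simp add: norm_power2 Y_def)
 have "A$1$1 * s\<^sup>2 - (A$1$2 + A$2$1) * (s * c) + A$2$2 * c\<^sup>2 = X \<bullet> Y"
  by (simp add: inner_2 X_def Y_def power2_eq_square algebra_simps)
 hence "(A$1$1 * s\<^sup>2 - (A$1$2 + A$2$1) * (s * c) + A$2$2 * c\<^sup>2)\<^sup>2 <= (norm X)\<^sup>2 * (norm Y)\<^sup>2"
  by (metis Cauchy_Schwarz_ineq power2_norm_eq_inner)
 also have "\<dots> = (A$1$1 * s - A$2$1 * c)\<^sup>2 + (A$1$2 * s - A$2$2 * c)\<^sup>2" unfolding nY by (simp add: norm_power2 X_def)
 also have "\<dots> <= ((A$1$1)\<^sup>2 + (A$2$1)\<^sup>2) * (s\<^sup>2 + c\<^sup>2) + ((A$1$2)\<^sup>2 + (A$2$2)\<^sup>2) * (s\<^sup>2 + c\<^sup>2)"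
 proof -
  have "(x * s - y * c)\<^sup>2 <= (x\<^sup>2 + y\<^sup>2) * (s\<^sup>2 + c\<^sup>2)" for x y
  proof -
   have "(x\<^sup>2 + y\<^sup>2) * (s\<^sup>2 + c\<^sup>2) - (x * s - y * c)\<^sup>2 = (x * c + y * s)\<^sup>2" by (simp add: power2_eq_square algebra_simps)
   thus ?thesis using zero_le_power2[of "x * c + y * s"] by linarith
  qed
  thus ?thesis by (intro add_mono)
 qed
 also have "\<dots> = (norm A)\<^sup>2" using assms by (simp add: norm_matrix2 add.commute)
 finally show ?thesis .
qed

text \<open>With \<open>b\<close> the angular second derivative of \<open>U\<close>, integrate \<open>r * b\<^sup>2 >= g * (2 * b - 1 / r)\<close> with a trapezoidal cut-off \<open>g\<close>
in the angle; the right-hand side is linear in \<open>U\<close>.\<close>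

lemma polar_energy:
 fixes U :: "real^2 => real"
 assumes U: "smooth U" and \<rho>: "0 < \<rho>" "\<rho> < 1" and d: "0 < \<delta>" "\<delta> <= \<beta>" "\<beta> < pi" and \<omega>: "0 <= \<omega>"
  and lo: "\<And>r t. \<rho> <= r ==> r <= 1 ==> \<bar>t\<bar> <= \<beta> ==> r - \<omega> <= U (r *\<^sub>R dir t)"
  and hi: "\<And>r t. \<rho> <= r ==> r <= 1 ==> \<bar>t\<bar> <= \<beta> ==> U (r *\<^sub>R dir t) <= r + \<sigma>"
 shows "(2 * \<beta> - \<delta>) * (ln (1 / \<rho>) - 2 * (\<sigma> + 2 * \<omega>) / \<rho>) - 4 * (\<sigma> + \<omega>) / (\<delta> * \<rho>)
  <= (LINT x|lborel. ind (polar ` polar_rect \<rho> 1 \<beta>) x * (norm (hess U x))\<^sup>2)"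
proof -
 define g where "g = trapezoid \<beta> \<delta>"
 note g = trapezoid_bounds[OF d(1), of \<beta>, folded g_def]
 define b where "b r t = hess U (r *\<^sub>R dir t) $ 1 $ 1 * (sin t)\<^sup>2 - (hess U (r *\<^sub>R dir t) $ 1 $ 2 + hess U (r *\<^sub>R dir t) $ 2 $ 1) * (sin t * cos t) + hess U (r *\<^sub>R dir t) $ 2 $ 2 * (cos t)\<^sup>2" for r t
 define Wr where "Wr r t = pd 1 U (r *\<^sub>R dir t) * cos t + pd 2 U (r *\<^sub>R dir t) * sin t" for r t
 define Wt where "Wt r t = r * (pd 2 U (r *\<^sub>R dir t) * cos t - pd 1 U (r *\<^sub>R dir t) * sin t)" for r t
 \<comment> \<open>The second angular derivative: tangential curvature, minus a radial term because
   the tangent turns with the angle.\<close>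
 define Wtt where "Wtt r t = r\<^sup>2 * b r t - r * Wr r t" for r t
 have s1: "smooth (pd i U)" for i by (rule smooth_pderiv[OF U])
 have s2: "smooth (pd j (pd i U))" for i j by (rule smooth_pderiv[OF s1])
 have dr: "((%r. U (r *\<^sub>R dir t)) has_real_derivative Wr r t) (at r)" for r t unfolding Wr_def by (rule radial_deriv[OF U])
 have dt: "((%t. U (r *\<^sub>R dir t)) has_real_derivative Wt r t) (at t)" for r t unfolding Wt_def by (rule angular_deriv[OF U])
 have dtt: "((%t. Wt r t) has_real_derivative Wtt r t) (at t)" for r t
 proof -
  note a1 = angular_deriv[OF s1[of 1], of r t, folded hess_nth] and a2 = angular_deriv[OF s1[of 2], of r t, folded hess_nth]
  show ?thesis unfolding Wt_def by (rule derivative_eq_intros a1 a2 refl)+ (simp add: Wtt_def Wr_def b_def power2_eq_square algebra_simps)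
 qed
 have cp: "continuous_on UNIV (%p::real^2. p $ 1 *\<^sub>R dir (p $ 2))" by (intro continuous_intros continuous_on_compose2[OF dir_continuous]) auto
 have cU: "continuous_on UNIV (%p::real^2. pd i U (p $ 1 *\<^sub>R dir (p $ 2)))" for i by (rule smooth_isCont_compose[OF s1 cp])
 have cH: "continuous_on UNIV (%p::real^2. hess U (p $ 1 *\<^sub>R dir (p $ 2)) $ i $ j)" for i j
  unfolding hess_nth by (rule smooth_isCont_compose[OF s2 cp])
 have cb: "continuous_on UNIV (%p::real^2. b (p $ 1) (p $ 2))" unfolding b_def by (intro continuous_intros cH)
 have cWr: "continuous_on UNIV (%p::real^2. Wr (p $ 1) (p $ 2))" unfolding Wr_def by (intro continuous_intros cU)
 have cWtt: "continuous_on UNIV (%p::real^2. Wtt (p $ 1) (p $ 2))" unfolding Wtt_def by (intro continuous_intros cb cWr)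
 have cg: "continuous_on UNIV (%p::real^2. g (p $ 2))" by (rule continuous_on_compose2[OF g(3)]) (auto intro!: continuous_intros)
 have mx: "max \<rho> r \<noteq> 0" for r using \<rho> by simp
 \<comment> \<open>On the rectangle \<open>A + B\<close> is \<open>g * (2 * b - 1 / r)\<close>, with
   b split into its angular part in A and its radial part in B. The maximum with \<rho> makes both
   continuous on the whole plane.\<close>
 define A where "A p = g (p $ 2) * (2 / (max \<rho> (p $ 1))\<^sup>2 * Wtt (p $ 1) (p $ 2))" for p :: "real^2"
 define B where "B p = g (p $ 2) * ((2 * Wr (p $ 1) (p $ 2) - 1) / max \<rho> (p $ 1))" for p :: "real^2"
 have cA: "continuous_on UNIV A" unfolding A_def[abs_def] by (intro continuous_intros cg cWtt) (use \<rho> in auto)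
 have cB: "continuous_on UNIV B" unfolding B_def[abs_def] by (intro continuous_intros cg cWr) (use \<rho> in auto)
 define F where "F x = (norm (hess U x))\<^sup>2" for x
 have cF: "continuous_on UNIV F" unfolding F_def[abs_def] norm_matrix2 hess_nth by (intro continuous_intros smooth_continuous s2)
 have cFp: "continuous_on UNIV (%p. p $ 1 * F (polar p))" by (intro continuous_intros continuous_on_compose2[OF cF] polar_continuous) auto
 have line: "continuous_on UNIV (%a. vector [a, b] :: real^2)" "continuous_on UNIV (%b. vector [a, b] :: real^2)" for a b
  by (simp_all add: continuous_on_eq_continuous_within isCont_vector2)
 have pw: "A p + B p <= p $ 1 * F (polar p)" if p: "p \<in> polar_rect \<rho> 1 \<beta>" for p
 proof -
  define r t where "r = p $ 1" and "t = p $ 2"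
  have r: "r > 0" "max \<rho> r = r" using p \<rho> by (auto simp: polar_rect_mem r_def)
  have pp: "polar p = r *\<^sub>R dir t" using polar_dir[of r t] by (simp add: r_def t_def)
  have "(b r t)\<^sup>2 <= F (polar p)" unfolding F_def pp b_def by (rule quadratic_form_le_norm) simp
  hence 1: "r * (b r t)\<^sup>2 <= r * F (polar p)" using r by (intro mult_left_mono) auto
  have "A p + B p = g t * (2 * b r t - 1 / r)"
   using r by (simp add: A_def B_def r_def[symmetric] t_def[symmetric] Wtt_def power2_eq_square field_simps)
  also have "\<dots> <= r * (b r t)\<^sup>2"
  proof -
   have "0 <= (r * b r t - 1)\<^sup>2 / r" using r by simp
   also have "\<dots> = r * (b r t)\<^sup>2 - (2 * b r t - 1 / r)" using r by (simp add: power2_eq_square field_simps)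
   finally have "g t * (2 * b r t - 1 / r) <= g t * (r * (b r t)\<^sup>2)" using g(1) by (intro mult_left_mono) auto
   also have "\<dots> <= 1 * (r * (b r t)\<^sup>2)" using g(2) r by (intro mult_right_mono) auto
   finally show ?thesis by simp
  qed
  finally show ?thesis using 1 by (simp add: r_def)
 qed
 let ?R = "polar_rect \<rho> 1 \<beta>"
 have "(LINT x|lborel. ind (polar ` ?R) x * F x) = (LINT p|lborel. ind ?R p * (p$1 * F (polar p)))"
  by (rule polar_integral[OF cF]) (use \<rho> d in auto)
 also have "\<dots> >= (LINT p|lborel. ind ?R p * A p + ind ?R p * B p)"
 proof (rule integral_mono)
  show "integrable lborel (%p. ind ?R p * A p + ind ?R p * B p)" by (intro lint_add_int integral_rect_iterated(3) cA cB)
  show "integrable lborel (%p. ind ?R p * (p$1 * F (polar p)))" by (rule integral_rect_iterated(3)[OF cFp])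
  fix p :: "real^2" show "ind ?R p * A p + ind ?R p * B p <= ind ?R p * (p$1 * F (polar p))" using pw[of p] by (cases "p \<in> ?R") auto
 qed
 moreover have "(LINT p|lborel. ind ?R p * A p + ind ?R p * B p) = (LINT p|lborel. ind ?R p * A p) + (LINT p|lborel. ind ?R p * B p)"
  by (intro lint_add integral_rect_iterated(3) cA cB)
 moreover have "- (4 * (\<sigma> + \<omega>) / (\<delta> * \<rho>)) <= (LINT p|lborel. ind ?R p * A p)"
 proof -
  define l where "l r = - (4 * (\<sigma> + \<omega>) / \<delta>) / (max \<rho> r)\<^sup>2" for r
  have so: "0 <= \<sigma> + \<omega>" using lo[of 1 0] hi[of 1 0] \<rho> d by force
  have cl: "continuous_on UNIV l" unfolding l_def[abs_def] by (intro continuous_intros) (use \<rho> in auto)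
  have "(LINT r|lborel. ind {\<rho>..1} r * l r) <= (LINT p|lborel. ind ?R p * A p)"
  proof (rule rect_integral_ge(2)[OF cA cl])
   fix r assume r: "r \<in> {\<rho>..1}"
   have "continuous_on UNIV (Wtt r)" using continuous_on_compose2[OF cWtt line(2)[of r]] by simp
   note tr = trapezoid_second_derivative[OF dt dtt this d(1,2), folded g_def]
   have m: "max \<rho> r = r" using r by simp
   have "(LINT t|lborel. ind {-\<beta>..\<beta>} t * A (vector [r, t])) = (LINT t|lborel. 2 / r\<^sup>2 * (ind {-\<beta>..\<beta>} t * (g t * Wtt r t)))"
    by (intro lint_cong) (simp add: A_def m)
   also have "\<dots> = 2 / r\<^sup>2 * ((U (r *\<^sub>R dir (-\<beta>)) + U (r *\<^sub>R dir \<beta>) - U (r *\<^sub>R dir (-\<beta> + \<delta>)) - U (r *\<^sub>R dir (\<beta> - \<delta>))) / \<delta>)"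
    by (simp add: tr)
   also have "\<dots> >= 2 / r\<^sup>2 * (- (2 * (\<sigma> + \<omega>)) / \<delta>)"
   proof (intro mult_left_mono divide_right_mono)
    \<comment> \<open>The two end values are bounded below by \<open>r - \<omega>\<close> and the
      two inner ones above by \<open>r + \<sigma>\<close>; the terms in r cancel.\<close>
    show "- (2 * (\<sigma> + \<omega>)) <= U (r *\<^sub>R dir (-\<beta>)) + U (r *\<^sub>R dir \<beta>) - U (r *\<^sub>R dir (-\<beta> + \<delta>)) - U (r *\<^sub>R dir (\<beta> - \<delta>))"
     using lo[of r "-\<beta>"] lo[of r \<beta>] hi[of r "-\<beta> + \<delta>"] hi[of r "\<beta> - \<delta>"] r d by auto
   qed (use d in auto)
   finally have "2 / r\<^sup>2 * (- (2 * (\<sigma> + \<omega>)) / \<delta>) <= (LINT t|lborel. ind {-\<beta>..\<beta>} t * A (vector [r, t]))" .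
   moreover have "l r = 2 / r\<^sup>2 * (- (2 * (\<sigma> + \<omega>)) / \<delta>)" unfolding l_def m using r \<rho> d by (simp add: field_simps)
   ultimately show "l r <= (LINT t|lborel. ind {-\<beta>..\<beta>} t * A (vector [r, t]))" by simp
  qed (use \<rho> d in auto)
  moreover have "(LINT r|lborel. ind {\<rho>..1} r * l r) = - (4 * (\<sigma> + \<omega>) / \<delta>) * (1 / \<rho> - 1)"
  proof -
   have "(l has_integral (4 * (\<sigma> + \<omega>) / \<delta> / 1 - 4 * (\<sigma> + \<omega>) / \<delta> / \<rho>)) {\<rho>..1}"
   proof (rule integral_Icc_FTC[of _ _ "%r. 4 * (\<sigma> + \<omega>) / \<delta> / r"])
    fix x assume "\<rho> <= x" "x <= 1"
    hence "((%r. 4 * (\<sigma> + \<omega>) / \<delta> / r) has_real_derivative l x) (at x)"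
     using \<rho> d by (auto intro!: derivative_eq_intros simp: l_def power2_eq_square)
    thus "((%r. 4 * (\<sigma> + \<omega>) / \<delta> / r) has_real_derivative l x) (at x within {\<rho>..1})" by (rule has_field_derivative_at_within)
   qed (use \<rho> in auto)
   hence "(LINT r|lborel. ind {\<rho>..1} r * l r) = 4 * (\<sigma> + \<omega>) / \<delta> / 1 - 4 * (\<sigma> + \<omega>) / \<delta> / \<rho>"
    using LINT_Icc[OF continuous_on_subset[OF cl subset_UNIV], of \<rho> 1] by (simp add: integral_unique del: mult.commute)
   also have "\<dots> = - (4 * (\<sigma> + \<omega>) / \<delta>) * (1 / \<rho> - 1)" using \<rho> d by (simp add: field_simps)
   finally show ?thesis .
  qed
  moreover have "(4 * (\<sigma> + \<omega>) / \<delta>) * (1 / \<rho> - 1) <= (4 * (\<sigma> + \<omega>) / \<delta>) * (1 / \<rho>)" using so d by (intro mult_left_mono) auto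
  ultimately show ?thesis by simp
 qed
 moreover have "(2 * \<beta> - \<delta>) * (ln (1 / \<rho>) - 2 * (\<sigma> + 2 * \<omega>) / \<rho>) <= (LINT p|lborel. ind ?R p * B p)"
 proof -
  define k where "k = ln (1 / \<rho>) - 2 * (\<sigma> + 2 * \<omega>) / \<rho>"
  have "(LINT t|lborel. ind {-\<beta>..\<beta>} t * (g t * k)) <= (LINT p|lborel. ind ?R p * B p)"
  proof (rule rect_integral_ge(1)[OF cB])
   show "continuous_on UNIV (%t. g t * k)" by (intro continuous_intros g)
   fix t assume t: "t \<in> {-\<beta>..\<beta>}"
   have cw: "continuous_on UNIV (%r. Wr r t)" using continuous_on_compose2[OF cWr line(1)[of t]] by simp
   have cf: "continuous_on UNIV (%r. (2 * Wr r t - 1) / max \<rho> r)" by (intro continuous_intros cw) (use \<rho> in auto)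
   have "(LINT r|lborel. ind {\<rho>..1} r * B (vector [r, t])) = (LINT r|lborel. g t * (ind {\<rho>..1} r * ((2 * Wr r t - 1) / max \<rho> r)))"
    by (intro lint_cong) (simp add: B_def)
   also have "\<dots> = g t * integral {\<rho>..1} (%r. (2 * Wr r t - 1) / max \<rho> r)"
    unfolding Bochner_Integration.integral_mult_right_zero LINT_Icc[OF continuous_on_subset[OF cf subset_UNIV]] ..
   also have "\<dots> >= g t * k"
   proof (intro mult_left_mono g(1))
    \<comment> \<open>\<open>2 * U / r\<close> has the derivative
      \<open>2 * Wr / r - 2 * U / r^2\<close>; inserting the lower bound for U into the last term
      yields the logarithm and the correction in \<omega>.\<close>
    define Q where "Q r = 2 * (U (r *\<^sub>R dir t) / r) + ln r + 2 * \<omega> / r" for r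
    define q where "q r = 2 * (Wr r t / r - U (r *\<^sub>R dir t) / r\<^sup>2) + 1 / r - 2 * \<omega> / r\<^sup>2" for r
    have "(q has_integral (Q 1 - Q \<rho>)) {\<rho>..1}"
    proof (rule integral_Icc_FTC)
     fix x assume x: "\<rho> <= x" "x <= 1"
     hence "x > 0" using \<rho> by simp
     hence "(Q has_real_derivative q x) (at x)" unfolding Q_def[abs_def] q_def
      by (auto intro!: derivative_eq_intros dr simp: power2_eq_square field_simps)
     thus "(Q has_real_derivative q x) (at x within {\<rho>..1})" by (rule has_field_derivative_at_within)
    qed (use \<rho> in auto)
    moreover have "((%r. (2 * Wr r t - 1) / max \<rho> r) has_integral integral {\<rho>..1} (%r. (2 * Wr r t - 1) / max \<rho> r)) {\<rho>..1}"
     by (intro integrable_integral integrable_continuous_interval continuous_on_subset[OF cf]) auto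
    moreover have "q r <= (2 * Wr r t - 1) / max \<rho> r" if r: "r \<in> {\<rho>..1}" for r
    proof -
     have r0: "r > 0" "max \<rho> r = r" using r \<rho> by auto
     have "r - \<omega> <= U (r *\<^sub>R dir t)" using lo[of r t] r t by auto
     hence "(r - \<omega>) / r\<^sup>2 <= U (r *\<^sub>R dir t) / r\<^sup>2" by (intro divide_right_mono) auto
     moreover have "(r - \<omega>) / r\<^sup>2 = 1 / r - \<omega> / r\<^sup>2" using r0 by (simp add: power2_eq_square diff_divide_distrib)
     moreover have "(2 * Wr r t - 1) / r = 2 * (Wr r t / r) - 1 / r" by (simp add: diff_divide_distrib)
     ultimately show ?thesis using r0 by (simp add: q_def)
    qed
    ultimately have "Q 1 - Q \<rho> <= integral {\<rho>..1} (%r. (2 * Wr r t - 1) / max \<rho> r)" by (rule has_integral_le) auto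
    moreover have "k <= Q 1 - Q \<rho>"
    proof -
     have "1 - \<omega> <= U (1 *\<^sub>R dir t)" using lo[of 1 t] \<rho> t by auto
     moreover have "U (\<rho> *\<^sub>R dir t) / \<rho> <= (\<rho> + \<sigma>) / \<rho>" using hi[of \<rho> t] \<rho> t by (intro divide_right_mono) auto
     moreover have "(\<rho> + \<sigma>) / \<rho> = 1 + \<sigma> / \<rho>" using \<rho> by (simp add: add_divide_distrib)
     moreover have "2 * (\<sigma> + 2 * \<omega>) / \<rho> = 2 * (\<sigma> / \<rho>) + 4 * (\<omega> / \<rho>)" by (simp add: add_divide_distrib)
     moreover have "2 * \<omega> / \<rho> = 2 * (\<omega> / \<rho>)" by simp
     moreover have "0 <= \<omega> / \<rho>" using \<omega> \<rho> by simp
     moreover have "ln (1 / \<rho>) = - ln \<rho>" using \<rho> by (simp add: ln_div)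
     ultimately show ?thesis unfolding k_def Q_def using \<omega> by simp
    qed
    ultimately show "k <= integral {\<rho>..1} (%r. (2 * Wr r t - 1) / max \<rho> r)" by linarith
   qed
   finally show "g t * k <= (LINT r|lborel. ind {\<rho>..1} r * B (vector [r, t]))" .
  qed (use \<rho> d in auto)
  moreover have "(LINT t|lborel. ind {-\<beta>..\<beta>} t * (g t * k)) = (2 * \<beta> - \<delta>) * k"
   using trapezoid_integral[OF d(1,2)] by (simp add: g_def mult.assoc[symmetric])
  ultimately show ?thesis by (simp add: k_def)
 qed
 ultimately show ?thesis unfolding F_def by linarith
qed

section \<open>Convexity and mollification\<close>

definition quad :: "(2 => 2 => real) => real^2 => real" where
 "quad A \<xi> = A 1 1 * (\<xi> $ 1)\<^sup>2 + (A 1 2 + A 2 1) * (\<xi> $ 1 * \<xi> $ 2) + A 2 2 * (\<xi> $ 2)\<^sup>2"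

lemma smooth_line_deriv:
 assumes "smooth U"
 shows "((%s. U (x + s *\<^sub>R \<xi>)) has_real_derivative (pd 1 U (x + s *\<^sub>R \<xi>) * \<xi> $ 1 + pd 2 U (x + s *\<^sub>R \<xi>) * \<xi> $ 2)) (at s)"
proof -
 have "((%s. x + s *\<^sub>R \<xi>) has_derivative (%h. h *\<^sub>R \<xi>)) (at s)" by (auto intro!: derivative_eq_intros)
 from has_derivative_compose[OF this smooth_has_derivative[OF assms]]
 have "((%s. U (x + s *\<^sub>R \<xi>)) has_derivative (%h. \<Sum>i\<in>UNIV. pd i U (x + s *\<^sub>R \<xi>) * (h *\<^sub>R \<xi>) $ i)) (at s)" .
 thus ?thesis unfolding has_field_derivative_def by (rule has_derivative_eq_rhs) (auto simp: fun_eq_iff sum_2 algebra_simps)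
qed

lemma smooth_line_deriv2:
 assumes "smooth U"
 shows "((%s. pd 1 U (x + s *\<^sub>R \<xi>) * \<xi> $ 1 + pd 2 U (x + s *\<^sub>R \<xi>) * \<xi> $ 2) has_real_derivative
   quad (%i j. pd j (pd i U) (x + s *\<^sub>R \<xi>)) \<xi>) (at s)"
proof -
 note d = smooth_line_deriv[OF smooth_pderiv[OF assms]]
 show ?thesis by (rule derivative_eq_intros d refl)+ (simp add: quad_def power2_eq_square algebra_simps)
qed

lemma conv_pderiv:
 assumes f: "integrable lebesgue f" and k: "smooth k" "compact K" "\<And>x. x \<notin> K ==> k x = 0"
 shows "pd i (conv k f) = conv (pd i k) f" using has_derivative_pderiv_dir[OF conv_has_derivative[OF f k]] by (rule ext)

text \<open>Derivatives fall on the kernel: every iterated derivative of the convolution is again a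
  convolution with a smooth kernel supported in K.\<close>

lemma conv_smooth:
 assumes f: "integrable lebesgue f" and K: "compact K" and k: "smooth k" "\<And>x. x \<notin> K ==> k x = 0"
 shows "smooth (conv k f)"
proof -
 have "\<exists>k'. smooth k' \<and> (\<forall>x. x \<notin> K \<longrightarrow> k' x = 0) \<and> foldr pd is (conv k f) = conv k' f" for "is"
 proof (induction "is")
  case Nil
  thus ?case using k by auto
 next
  case (Cons i "is")
  then obtain k' where k': "smooth k'" "\<And>x. x \<notin> K ==> k' x = 0" "foldr pd is (conv k f) = conv k' f" by blast
  have "foldr pd (i # is) (conv k f) = conv (pd i k') f" using conv_pderiv[OF f k'(1) K k'(2)] k'(3) by simp
  moreover have "smooth (pd i k')" by (rule smooth_pderiv[OF k'(1)])
  moreover have "\<forall>x. x \<notin> K \<longrightarrow> pd i k' x = 0" using pderiv_dir_outside[of K k'] K k'(2) compact_imp_closed by blast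
  ultimately show ?case by blast
 qed
 note ex = this
 have "foldr pd is (conv k f) differentiable_on UNIV" for "is"
 proof -
  obtain k' where k': "smooth k'" "\<And>x. x \<notin> K ==> k' x = 0" "foldr pd is (conv k f) = conv k' f" using ex by blast
  have "conv k' f differentiable (at x)" for x unfolding differentiable_def using conv_has_derivative[OF f k'(1) K k'(2), of x] by blast
  thus ?thesis unfolding k'(3) by (simp add: differentiable_on_def)
 qed
 thus ?thesis by (simp add: smooth_def)
qed

lemma conv_eta_smooth:
 assumes "integrable lebesgue f" "e > 0"
 shows "smooth (conv (eta e) f)" by (rule conv_smooth[OF assms(1) compact_square smooth_eta]) (rule eta_outside[OF assms(2)])

lemma square_in_cball: "y - x \<in> square e ==> y \<in> cball x (2 * e)" using square_norm[of "y - x" e] by (simp add: dist_norm norm_minus_commute)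

text \<open>The first derivative at a point needs the support of the kernel, of radius
  \<open>2 * e\<close>, inside the domain. For the second derivative this identity is
  differentiated, so it must hold on a ball around x; hence the doubled radius.\<close>

lemma mollified_derivatives:
 assumes W: "W \<in> sets lebesgue" and f: "integrable lebesgue (%x. ind W x * f x)" "integrable lebesgue (%x. ind W x * f' x)"
  and w: "has_weak_pderiv W i f f'" and w2: "has_weak_pderiv W j f' f''" and e: "e > 0"
 shows "cball x (2 * e) \<subseteq> interior W ==> pd i (conv (eta e) (%x. ind W x * f x)) x = conv (eta e) (%x. ind W x * f' x) x"
  and "cball x (4 * e) \<subseteq> interior W ==> pd j (pd i (conv (eta e) (%x. ind W x * f x))) x = conv (eta e) (%x. ind W x * f'' x) x"
proof -
 let ?U = "conv (eta e) (%x. ind W x * f x)" and ?V = "conv (eta e) (%x. ind W x * f' x)"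
 have 1: "pd i ?U y = ?V y" if "cball y (2 * e) \<subseteq> interior W" for y
 proof -
  have "pd i ?U = conv (pd i (eta e)) (%x. ind W x * f x)" by (rule conv_pderiv[OF f(1) smooth_eta compact_square eta_outside[OF e]])
  moreover have "conv (pd i (eta e)) (%x. ind W x * f x) y = ?V y" by (rule conv_weak_pderiv[OF W w e]) (use that square_in_cball[of _ y e] in blast)
  ultimately show ?thesis by simp
 qed
 thus "cball x (2 * e) \<subseteq> interior W ==> pd i ?U x = ?V x" .
 assume x: "cball x (4 * e) \<subseteq> interior W"
 have near: "pd i ?U y = ?V y" if "y \<in> ball x (2 * e)" for y
 proof (rule 1)
  have "cball y (2 * e) \<subseteq> cball x (4 * e)" using that by (intro cball_subset_cball_iff[THEN iffD2]) (auto simp: dist_commute)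
  thus "cball y (2 * e) \<subseteq> interior W" using x by blast
 qed
 have "(?V has_derivative (%h. \<Sum>j\<in>UNIV. pd j ?V x * h $ j)) (at x)" by (rule smooth_has_derivative[OF conv_eta_smooth[OF f(2) e]])
 hence "(pd i ?U has_derivative (%h. \<Sum>j\<in>UNIV. pd j ?V x * h $ j)) (at x)"
  by (rule has_derivative_transform_within_open[of _ _ _ _ "ball x (2 * e)"]) (use e near in auto)
 hence "pd j (pd i ?U) x = pd j ?V x" by (rule has_derivative_pderiv_dir)
 also have "\<dots> = conv (eta e) (%x. ind W x * f'' x) x"
 proof -
  have "pd j ?V = conv (pd j (eta e)) (%x. ind W x * f' x)" by (rule conv_pderiv[OF f(2) smooth_eta compact_square eta_outside[OF e]])
  moreover have "conv (pd j (eta e)) (%x. ind W x * f' x) x = conv (eta e) (%x. ind W x * f'' x) x"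
   by (rule conv_weak_pderiv[OF W w2 e]) (use x e square_in_cball[of _ x e] in force)
  ultimately show ?thesis by simp
 qed
 finally show "pd j (pd i ?U) x = conv (eta e) (%x. ind W x * f'' x) x" .
qed

lemma lborel_integral_shift:
 fixes g :: "real^2 => real"
 assumes "g \<in> borel_measurable borel"
 shows "(LINT y|lborel. g (y + c)) = (LINT y|lborel. g y)" "integrable lborel g ==> integrable lborel (%y. g (y + c))"
proof -
 have "(LINT y|lborel. g y) = (LINT y|distr lborel borel ((+) c). g y)" by (simp add: lborel_distr_plus)
 also have "\<dots> = (LINT y|lborel. g (c + y))" using assms by (subst integral_distr) auto
 finally show "(LINT y|lborel. g (y + c)) = (LINT y|lborel. g y)" by (simp add: add.commute)
 assume "integrable lborel g"
 hence "integrable (distr lborel borel ((+) c)) g" by (simp add: lborel_distr_plus)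
 hence "integrable lborel (%y. g (c + y))" using assms by (subst (asm) integrable_distr_eq) auto
 thus "integrable lborel (%y. g (y + c))" by (simp add: add.commute)
qed

text \<open>The midpoint inequality for f at \<open>y + c\<close> and \<open>y - c\<close> is
  averaged over y with weight \<open>eta e (x - y)\<close>. All points involved stay in the ball of
  radius \<open>4 * e\<close>, on which the convex function is continuous and thus
  integrable.\<close>

lemma conv_midpoint_convex:
 assumes W: "W \<in> sets lebesgue" and f: "convex_on (interior W) f" and e: "e > 0"
  and x: "cball x (4 * e) \<subseteq> interior W" and c: "norm c <= e"
 shows "2 * conv (eta e) (%y. ind W y * f y) x <= conv (eta e) (%y. ind W y * f y) (x + c) + conv (eta e) (%y. ind W y * f y) (x - c)"
proof -
 let ?C = "cball x (4 * e)"
 define w where "w = (%y. ind ?C y * f y)"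
 have cf: "continuous_on ?C f" using continuous_on_subset[OF convex_on_continuous[OF open_interior f] x] .
 have wm: "w \<in> borel_measurable borel" using borel_measurable_continuous_on_indicator[OF _ cf] by (simp add: w_def)
 have wi: "integrable lborel w"
 proof -
  have "integrable lebesgue w" using absolutely_integrable_continuous_compact[OF compact_cball cf] by (simp add: set_integrable_def w_def)
  thus ?thesis using wm by (simp add: integrable_completion)
 qed
 obtain B where B: "B >= 0" "\<And>x. \<bar>eta e x\<bar> <= B"
  using compact_support_bounded[OF smooth_continuous[OF smooth_eta[of e]] compact_square[of e] eta_outside[OF e]] by blast
 have eq: "conv (eta e) (%y. ind W y * f y) (x + d) = (LINT y|lborel. w (y + d) * eta e (x - y))"
  and int: "integrable lborel (%y. w (y + d) * eta e (x - y))" if d: "norm d <= e" for d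
 proof -
  have "conv (eta e) (%y. ind W y * f y) (x + d) = conv (eta e) w (x + d)" unfolding conv_def
  proof (rule lint_cong)
   fix y
   show "ind W y * f y * eta e (x + d - y) = w y * eta e (x + d - y)"
   proof (cases "y - (x + d) \<in> square e")
    case True
    from square_in_cball[OF this] have "dist (x + d) y <= 2 * e" by simp
    moreover have "dist x (x + d) <= e" using d by (simp add: dist_norm)
    ultimately have "y \<in> ?C" using dist_triangle[of x y "x + d"] e by simp
    moreover hence "y \<in> W" using x interior_subset by blast
    ultimately show ?thesis by (simp add: w_def)
   next
    case False
    hence "eta e (x + d - y) = 0" using eta_outside[OF e] eta_commute by metis
    thus ?thesis by simp
   qed
  qed
  also have "\<dots> = (LINT y|lborel. w y * eta e (x + d - y))" by (rule conv_lborel[OF wm]) simp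
  also have "\<dots> = (LINT y|lborel. w (y + d) * eta e (x + d - (y + d)))" by (rule lborel_integral_shift(1)[symmetric]) (use wm in measurable)
  finally show "conv (eta e) (%y. ind W y * f y) (x + d) = (LINT y|lborel. w (y + d) * eta e (x - y))" by simp
  have "integrable lborel (%y. w (y + d))" by (rule lborel_integral_shift(2)[OF wm wi])
  hence "integrable lborel (%y. B * w (y + d))" by simp
  thus "integrable lborel (%y. w (y + d) * eta e (x - y))"
  proof (rule lint_bound)
   show "(%y. w (y + d) * eta e (x - y)) \<in> borel_measurable lborel" using wm by measurable
   have "\<bar>w (y + d)\<bar> * \<bar>eta e (x - y)\<bar> <= \<bar>w (y + d)\<bar> * B" for y by (intro mult_left_mono B) auto
   thus "AE y in lborel. norm (w (y + d) * eta e (x - y)) <= norm (B * w (y + d))" using B(1) by (auto simp: abs_mult mult.commute)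
  qed
 qed
 have n: "norm (0::real^2) <= e" "norm (- c) <= e" using e c by auto
 have "0 <= (LINT y|lborel. (w (y + c) * eta e (x - y) + w (y + - c) * eta e (x - y)) - 2 * (w (y + 0) * eta e (x - y)))"
 proof (rule lint_nonneg)
  fix y
  show "0 <= (w (y + c) * eta e (x - y) + w (y + - c) * eta e (x - y)) - 2 * (w (y + 0) * eta e (x - y))"
  proof (cases "y - x \<in> square e")
   case True
   from square_in_cball[OF this] have "dist x y <= 2 * e" by simp
   moreover have "dist y (y + c) <= e" "dist y (y + - c) <= e" using c by (auto simp: dist_norm)
   ultimately have in': "y \<in> ?C" "y + c \<in> ?C" "y + - c \<in> ?C" using dist_triangle[of x "y + c" y] dist_triangle[of x "y + - c" y] e by auto
   have "y + c \<in> interior W" "y + - c \<in> interior W" using in'(2,3) x by blast+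
   hence "f ((1/2) *\<^sub>R (y + c) + (1/2) *\<^sub>R (y + - c)) <= 1/2 * f (y + c) + 1/2 * f (y + - c)"
    using convex_onD[OF f, of "1/2" "y + c" "y + - c"] by auto
   moreover have "(1/2) *\<^sub>R (y + c) + (1/2) *\<^sub>R (y + - c) = y" by (simp add: scaleR_add_right scaleR_diff_right flip: scaleR_add_left)
   ultimately have "0 <= w (y + c) + w (y + - c) - 2 * w (y + 0)" using in' by (simp add: w_def)
   hence "0 <= (w (y + c) + w (y + - c) - 2 * w (y + 0)) * eta e (x - y)" using eta_nonneg[OF e] by (intro mult_nonneg_nonneg)
   thus ?thesis by (simp add: algebra_simps)
  next
   case False
   hence "eta e (x - y) = 0" using eta_outside[OF e] eta_commute by metis
   thus ?thesis by simp
  qed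
 qed
 also have "\<dots> = (LINT y|lborel. w (y + c) * eta e (x - y)) + (LINT y|lborel. w (y + - c) * eta e (x - y)) - 2 * (LINT y|lborel. w (y + 0) * eta e (x - y))"
  using int[OF c] int[OF n(2)] int[OF n(1)] by (simp only: lint_diff lint_add lint_add_int integrable_mult_right integral_mult_right_zero)
 finally show ?thesis using eq[OF c] eq[OF n(2)] eq[OF n(1)] by simp
qed

text \<open>If \<open>g2 0\<close> were negative, the derivative of the even function
  \<open>g s + g (- s)\<close> would be negative just right of 0, and the mean value theorem would
  contradict the second-difference inequality.\<close>

lemma second_difference_nonneg:
 fixes g g1 g2 :: "real => real"
 assumes g: "\<And>s. (g has_real_derivative g1 s) (at s)" "\<And>s. (g1 has_real_derivative g2 s) (at s)"
  and d: "r > 0" "\<And>s. 0 < s ==> s < r ==> 2 * g 0 <= g s + g (- s)"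
 shows "0 <= g2 0"
proof (rule ccontr)
 assume "\<not> 0 <= g2 0"
 hence neg: "g2 0 < 0" by simp
 have mi: "((%s. - s) has_real_derivative -1) (at s)" for s :: real by (auto intro!: derivative_eq_intros)
 have h1: "((%s. g s + g (- s)) has_real_derivative (g1 s - g1 (- s))) (at s)" for s
  using DERIV_add[OF g(1)[of s] DERIV_chain2[OF g(1)[of "- s"] mi[of s]]] by simp
 have h2: "((%s. g1 s - g1 (- s)) has_real_derivative (g2 s + g2 (- s))) (at s)" for s
  using DERIV_diff[OF g(2)[of s] DERIV_chain2[OF g(2)[of "- s"] mi[of s]]] by simp
 obtain q where q: "q > 0" "\<And>s. 0 < s ==> s < q ==> g1 s - g1 (- s) < 0" using DERIV_neg_dec_right[OF h2[of 0]] neg by auto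
 define s where "s = min q r / 2"
 have s: "0 < s" "s < q" "s < r" using q d by (auto simp: s_def)
 obtain z where z: "0 < z" "z < s" "(g s + g (- s)) - (g 0 + g (- 0)) = (s - 0) * (g1 z - g1 (- z))"
  using MVT2[OF s(1), of "%s. g s + g (- s)" "%s. g1 s - g1 (- s)"] h1 by blast
 have "s * (g1 z - g1 (- z)) < 0" using q(2)[of z] z s by (intro mult_pos_neg) auto
 thus False using d(2)[OF s(1,3)] z(3) by simp
qed

lemma conv_quad:
 assumes A: "\<And>i j. integrable lebesgue (A i j)" and e: "e > 0"
 shows "conv (eta e) (%y. quad (%i j. A i j y) \<xi>) x = quad (%i j. conv (eta e) (A i j) x) \<xi>"
proof -
 obtain B where B: "B >= 0" "\<And>x. \<bar>eta e x\<bar> <= B"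
  using compact_support_bounded[OF smooth_continuous[OF smooth_eta[of e]] compact_square[of e] eta_outside[OF e]] by blast
 have i: "integrable lebesgue (%y. A i j y * eta e (x - y))" for i j by (rule integrable_mult_kernel[OF A smooth_continuous[OF smooth_eta] B(2)])
 have i2: "integrable lebesgue (%y. c * (A i j y * eta e (x - y)))" for i j c using i by simp
 have "conv (eta e) (%y. quad (%i j. A i j y) \<xi>) x =
  (LINT y|lebesgue. ((\<xi>$1)\<^sup>2 * (A 1 1 y * eta e (x - y)) + (\<xi>$1 * \<xi>$2) * (A 1 2 y * eta e (x - y))) + ((\<xi>$1 * \<xi>$2) * (A 2 1 y * eta e (x - y)) + (\<xi>$2)\<^sup>2 * (A 2 2 y * eta e (x - y))))"
  unfolding conv_def quad_def by (intro lint_cong) (simp add: algebra_simps)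
 also have "\<dots> = ((\<xi>$1)\<^sup>2 * conv (eta e) (A 1 1) x + (\<xi>$1 * \<xi>$2) * conv (eta e) (A 1 2) x) + ((\<xi>$1 * \<xi>$2) * conv (eta e) (A 2 1) x + (\<xi>$2)\<^sup>2 * conv (eta e) (A 2 2) x)"
  unfolding conv_def by (simp only: lint_add lint_add_int i2 integral_mult_right_zero)
 finally show ?thesis by (simp add: quad_def algebra_simps)
qed

lemma L2_integrable:
 fixes f :: "real^2 => real"
 assumes W: "W \<in> sets lebesgue" "bounded W" and f: "f \<in> L2 W"
 shows "integrable lebesgue (%x. ind W x * f x)" "integrable lebesgue (%x. \<bar>ind W x * f x\<bar> ^ 2)"
proof -
 have "(%x. 1 :: real) \<in> L2 W" by (rule bounded_continuous_L2[OF W]) simp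
 hence "integrable (lebesgue_on W) (%x. f x * 1)" by (rule L2_integrable_mult[OF f])
 thus "integrable lebesgue (%x. ind W x * f x)" using integrable_lebesgue_on[OF W(1)] by simp
 have "(%x. \<bar>ind W x * f x\<bar> ^ 2) = (%x. ind W x * (f x)\<^sup>2)" by (auto simp: fun_eq_iff indicator_def)
 thus "integrable lebesgue (%x. \<bar>ind W x * f x\<bar> ^ 2)" using f L2_iff[OF W(1)] by simp
qed

text \<open>Mollifications of a convex function have nonnegative second differences, so their second
  derivatives, which are the mollified weak ones, are nonnegative in the direction \<xi>. The null
  set may depend on \<xi>; this is harmless because the inequality is mollified again later.\<close>

lemma convex_weak_hessian:
 assumes W: "W \<in> sets lebesgue" "bounded W" and f: "convex_on (interior W) f"
  and L: "f \<in> L2 W" "\<And>i. f' i \<in> L2 W" "\<And>i j. f'' i j \<in> L2 W"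
  and w: "\<And>i. has_weak_pderiv W i f (f' i)" "\<And>i j. has_weak_pderiv W j (f' i) (f'' i j)"
 shows "AE x in lebesgue. x \<in> interior W \<longrightarrow> 0 <= quad (%i j. f'' i j x) \<xi>"
proof (rule nonneg_of_mollification[OF W(1)])
 have "(%x. (\<xi>$1)\<^sup>2 * f'' 1 1 x + (\<xi>$1 * \<xi>$2) * f'' 1 2 x + ((\<xi>$1 * \<xi>$2) * f'' 2 1 x + (\<xi>$2)\<^sup>2 * f'' 2 2 x)) \<in> L2 W"
  by (intro L2_add L2_cmult L)
 moreover have "(%x. (\<xi>$1)\<^sup>2 * f'' 1 1 x + (\<xi>$1 * \<xi>$2) * f'' 1 2 x + ((\<xi>$1 * \<xi>$2) * f'' 2 1 x + (\<xi>$2)\<^sup>2 * f'' 2 2 x)) = (%x. quad (%i j. f'' i j x) \<xi>)"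
  by (simp add: quad_def fun_eq_iff algebra_simps)
 ultimately show "locally_integrable W (%x. quad (%i j. f'' i j x) \<xi>)" using L2_locally_integrable[OF W(1)] by simp
 fix x e assume e: "(e::real) > 0" and x: "cball x (4 * e) \<subseteq> interior W"
 define U where "U = conv (eta e) (%x. ind W x * f x)"
 note i = L2_integrable(1)[OF W]
 have U: "smooth U" unfolding U_def by (rule conv_eta_smooth[OF i[OF L(1)] e])
 have "0 <= quad (%i j. pd j (pd i U) (x + 0 *\<^sub>R \<xi>)) \<xi>"
 proof (rule second_difference_nonneg[OF smooth_line_deriv[OF U] smooth_line_deriv2[OF U]])
  show "0 < e / (norm \<xi> + 1)" using e by (intro divide_pos_pos) (auto simp: add_nonneg_pos)
  fix s assume s: "0 < s" "s < e / (norm \<xi> + 1)"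
  hence "s * (norm \<xi> + 1) < e" by (simp add: pos_less_divide_eq add_nonneg_pos)
  hence "norm (s *\<^sub>R \<xi>) <= e" using s by (simp add: distrib_left)
  from conv_midpoint_convex[OF W(1) f e x this]
  show "2 * U (x + 0 *\<^sub>R \<xi>) <= U (x + s *\<^sub>R \<xi>) + U (x + - s *\<^sub>R \<xi>)" by (simp add: U_def)
 qed
 also have "\<dots> = quad (%i j. conv (eta e) (%x. ind W x * f'' i j x) x) \<xi>"
  using mollified_derivatives(2)[OF W(1) i[OF L(1)] i[OF L(2)] w e x] by (simp add: U_def)
 also have "\<dots> = conv (eta e) (%x. quad (%i j. ind W x * f'' i j x) \<xi>) x" by (rule conv_quad[symmetric]) (use i[OF L(3)] e in auto)
 also have "(%x. quad (%i j. ind W x * f'' i j x) \<xi>) = (%y. ind W y * quad (%i j. f'' i j y) \<xi>)"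
  by (simp add: quad_def fun_eq_iff algebra_simps)
 finally show "0 <= conv (eta e) (%y. ind W y * quad (%i j. f'' i j y) \<xi>) x" .
qed

text \<open>The mollification is a weighted average over the ball of radius
  \<open>2 * e\<close>.\<close>

lemma conv_eta_bounds:
 assumes f: "integrable lebesgue f" and e: "e > 0"
 shows "(AE y in lebesgue. y \<in> cball x (2 * e) \<longrightarrow> l <= f y) ==> l <= conv (eta e) f x"
  and "(AE y in lebesgue. y \<in> cball x (2 * e) \<longrightarrow> f y <= m) ==> conv (eta e) f x <= m"
proof -
 obtain B where B: "B >= 0" "\<And>x. \<bar>eta e x\<bar> <= B"
  using compact_support_bounded[OF smooth_continuous[OF smooth_eta[of e]] compact_square[of e] eta_outside[OF e]] by blast
 have i: "integrable lebesgue (%y. f y * eta e (x - y))" by (rule integrable_mult_kernel[OF f smooth_continuous[OF smooth_eta] B(2)])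
 have ei: "integrable lebesgue (%y. eta e (x - y))" "(LINT y|lebesgue. eta e (x - y)) = 1"
 proof -
  have m: "(%y. eta e (x - y)) \<in> borel_measurable lborel" by measurable
  have "integrable lborel (%y. eta e (y + - x))" using lborel_integral_shift(2)[OF _ eta_integrable[OF e], of "-x"] by simp
  moreover have "(LINT y|lborel. eta e (y + - x)) = 1" using lborel_integral_shift(1)[of "eta e" "-x"] eta_integral[OF e] by simp
  moreover have "eta e (x - y) = eta e (y + - x)" for y using eta_commute by simp
  ultimately show "integrable lebesgue (%y. eta e (x - y))" "(LINT y|lebesgue. eta e (x - y)) = 1"
   using m by (simp_all add: integrable_completion integral_completion)
 qed
 have out: "eta e (x - y) = 0" if "y \<notin> cball x (2 * e)" for y
  using that square_in_cball[of y x e] eta_outside[OF e, of "y - x"] eta_commute[of e x y] by auto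
 {
  assume ae: "AE y in lebesgue. y \<in> cball x (2 * e) \<longrightarrow> l <= f y"
  have "l * (LINT y|lebesgue. eta e (x - y)) <= conv (eta e) f x" unfolding conv_def integral_mult_right_zero[symmetric]
  proof (rule integral_mono_AE)
   show "AE y in lebesgue. l * eta e (x - y) <= f y * eta e (x - y)"
    using ae by eventually_elim (metis eta_nonneg[OF e] mult_right_mono mult_zero_right order_refl out)
  qed (use i ei in auto)
  thus "l <= conv (eta e) f x" using ei by simp
 }
 {
  assume ae: "AE y in lebesgue. y \<in> cball x (2 * e) \<longrightarrow> f y <= m"
  have "conv (eta e) f x <= m * (LINT y|lebesgue. eta e (x - y))" unfolding conv_def integral_mult_right_zero[symmetric]
  proof (rule integral_mono_AE)
   show "AE y in lebesgue. f y * eta e (x - y) <= m * eta e (x - y)"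
    using ae by eventually_elim (metis eta_nonneg[OF e] mult_right_mono mult_zero_right order_refl out)
  qed (use i ei in auto)
  thus "conv (eta e) f x <= m" using ei by simp
 }
qed

lemma conv_eta_pointwise_limit:
 assumes f: "integrable lebesgue f" and c: "isCont f x"
 shows "((%e. conv (eta e) f x) \<longlongrightarrow> f x) (at_right 0)"
proof (rule tendstoI)
 fix d :: real assume d: "d > 0"
 obtain r where r: "r > 0" "\<And>y. dist y x < r ==> dist (f y) (f x) < d / 2" using c d unfolding continuous_at_eps_delta by (meson half_gt_zero)
 have "\<forall>\<^sub>F e in at_right 0. 2 * e < r \<and> e > (0::real)"
  using r(1) by (intro eventually_conj eventually_at_right_less) (auto simp: eventually_at_right_field intro!: exI[of _ "r / 2"])
 thus "\<forall>\<^sub>F e in at_right 0. dist (conv (eta e) f x) (f x) < d"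
 proof eventually_elim
  case (elim e)
  have b: "\<bar>f y - f x\<bar> <= d / 2" if "y \<in> cball x (2 * e)" for y using r(2)[of y] that elim by (simp add: dist_real_def dist_commute)
  have b': "f x - d / 2 <= f y" "f y <= f x + d / 2" if "y \<in> cball x (2 * e)" for y
   using abs_le_D1[OF b[OF that]] abs_le_D2[OF b[OF that]] by linarith+
  have "f x - d / 2 <= conv (eta e) f x" using b'(1) elim by (intro conv_eta_bounds(1)[OF f]) (auto intro!: AE_I2)
  moreover have "conv (eta e) f x <= f x + d / 2" using b'(2) elim by (intro conv_eta_bounds(2)[OF f]) (auto intro!: AE_I2)
  ultimately show ?case using d by (simp add: dist_real_def)
 qed
qed

lemma quad_vreg_nonneg:
 assumes h: "h > 0"
 shows "0 <= quad (%i j. pd j (pd i (vreg h)) x) \<xi>"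
proof -
 have "0 <= quad (%i j. pd j (pd i (vreg h)) (x + 0 *\<^sub>R \<xi>)) \<xi>"
 proof (rule second_difference_nonneg[OF smooth_line_deriv[OF smooth_vreg[OF h]] smooth_line_deriv2[OF smooth_vreg[OF h]]])
  show "(0::real) < 1" by simp
  fix s :: real
  have "vreg h ((1 - 1/2) *\<^sub>R (x + s *\<^sub>R \<xi>) + (1/2) *\<^sub>R (x + - s *\<^sub>R \<xi>)) <= (1 - 1/2) * vreg h (x + s *\<^sub>R \<xi>) + 1/2 * vreg h (x + - s *\<^sub>R \<xi>)"
   by (rule convex_onD[OF convex_vreg[OF h]]) auto
  moreover have "(1 - 1/2) *\<^sub>R (x + s *\<^sub>R \<xi>) + (1/2) *\<^sub>R (x + - s *\<^sub>R \<xi>) = x + 0 *\<^sub>R \<xi>"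
   by (simp add: vec_eq_iff field_simps)
  ultimately show "2 * vreg h (x + 0 *\<^sub>R \<xi>) <= vreg h (x + s *\<^sub>R \<xi>) + vreg h (x + - s *\<^sub>R \<xi>)" by simp
 qed
 thus ?thesis by simp
qed

text \<open>The two mixed entries may differ. The form controls only their sum b, through
  \<open>b^2 <= 4 * A 1 1 * A 2 2\<close>; their product is at most \<open>b^2 / 4\<close>.\<close>

lemma quad_nonneg_det:
 assumes "\<And>\<xi>. 0 <= quad A \<xi>"
 shows "0 <= A 1 1 * A 2 2 - A 1 2 * A 2 1"
proof -
 define b where "b = A 1 2 + A 2 1"
 have q: "0 <= A 1 1 * s\<^sup>2 + b * (s * t) + A 2 2 * t\<^sup>2" for s t using assms[of "vector [s, t]"] by (simp add: quad_def b_def)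
 have a: "0 <= A 1 1" "0 <= A 2 2" using q[of 1 0] q[of 0 1] by auto
 have "b\<^sup>2 <= 4 * (A 1 1 * A 2 2)"
 proof (cases "A 1 1 = 0")
  case True
  have "b = 0"
  proof (rule ccontr)
   assume "b \<noteq> 0"
   thus False using q[of "- (A 2 2 + 1) / b" 1] True by (simp add: field_simps)
  qed
  thus ?thesis using True by simp
 next
  case False
  have "A 1 1 * b\<^sup>2 + b * (b * (- 2 * A 1 1)) + A 2 2 * (- 2 * A 1 1)\<^sup>2 = A 1 1 * (4 * (A 1 1 * A 2 2) - b\<^sup>2)"
   by (simp add: power2_eq_square algebra_simps)
  hence "0 <= A 1 1 * (4 * (A 1 1 * A 2 2) - b\<^sup>2)" using q[of b "- 2 * A 1 1"] by simp
  thus ?thesis using False a by (simp add: zero_le_mult_iff)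
 qed
 moreover have "4 * (A 1 2 * A 2 1) <= b\<^sup>2" using zero_le_power2[of "A 1 2 - A 2 1"] by (simp add: b_def power2_eq_square algebra_simps)
 ultimately show ?thesis by linarith
qed

section \<open>The glued extension of an admissible function and its convexity\<close>

locale admissible_function =
 fixes \<alpha> :: real and v :: "real^2 => real"
 assumes a: "0 < \<alpha>" "\<alpha> < pi / 2" and adm: "v \<in> admissible \<alpha>"
begin

text \<open>Outside the sector \<open>vreg (1/2)\<close> is used in place of the norm: both agree
  from radius 1/2 on, hence on the rest of the double sector, while the gluing requires a function
  that is smooth on the whole plane.\<close>

definition u :: "real^2 => real" where "u = glue \<alpha> v (vreg (1/2))"
definition du :: "2 => real^2 => real" where
 "du i = glue \<alpha> (weak_pderiv (sector \<alpha>) i v) (pd i (vreg (1/2)))"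
definition ddu :: "2 => 2 => real^2 => real" where
 "ddu i j = glue \<alpha> (weak_pderiv (sector \<alpha>) j (weak_pderiv (sector \<alpha>) i v)) (pd j (pd i (vreg (1/2))))"
definition Om :: "(real^2) set" where "Om = interior (double_sector \<alpha>)"
definition U :: "real => real^2 => real" where "U e = conv (eta e) (%x. ind (double_sector \<alpha>) x * u x)"

lemmas sb = sector_basics[OF a]

lemma Om_eq: "Om = {x \<in> cone \<alpha>. norm x < 2}" unfolding Om_def by (rule sector_interior(2)[OF a])
lemma open_Om: "open Om" by (simp add: Om_def)
lemma convex_Om: "convex Om" unfolding Om_eq by (rule convex_cone_ball)

lemma v: "v \<in> W22 (sector \<alpha>)" "convex_on (sector \<alpha>) v"
 "has_trace_on (sector \<alpha>) (curved_boundary \<alpha>) v (%x. 1)"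
 "has_trace_on (sector \<alpha>) (curved_boundary \<alpha>) (weak_pderiv (sector \<alpha>) i v) (%x. x $ i)"
 using adm by (auto simp: admissible_def boundary_conditions_def)

lemma smooth_V: "smooth (vreg (1/2))" by (rule smooth_vreg) simp

lemma V_deriv: "norm x = 1 ==> x $ i = pd i (vreg (1/2)) x"
proof -
 assume "norm x = 1"
 hence "sq x = 1" by (simp add: sq_norm)
 thus ?thesis using chi_large(1)[of "1/2" 1] by (simp add: pderiv_vreg kk_def power2_eq_square)
qed

text \<open>On the unit circle \<open>norm x\<close> has value 1 and gradient x, which are exactly
  the boundary conditions. Gluing is applied once to v and once to its first derivatives, so the
  second weak derivatives have no singular part on the arc.\<close>

lemma weak_derivs: "has_weak_pderiv (double_sector \<alpha>) i u (du i)" "has_weak_pderiv (double_sector \<alpha>) j (du i) (ddu i j)"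
 unfolding u_def du_def ddu_def by (rule glue_has_weak_pderiv[OF a v(3) smooth_V]; simp add: vreg_norm)
   (rule glue_has_weak_pderiv[OF a v(4) smooth_pderiv[OF smooth_V] V_deriv])

lemma u_L2: "u \<in> L2 (double_sector \<alpha>)" "du i \<in> L2 (double_sector \<alpha>)" "ddu i j \<in> L2 (double_sector \<alpha>)"
proof -
 have s: "f \<in> L2 (double_sector \<alpha>)" if "smooth f" for f :: "real^2 => real"
  by (rule bounded_continuous_L2[OF sb(2,6) smooth_continuous[OF that]])
 have 0: "v \<in> L2 (sector \<alpha>)" using v(1) by (simp add: W22_def W12_def)
 have 1: "weak_pderiv (sector \<alpha>) i v \<in> L2 (sector \<alpha>)" for i using v(1) by (simp add: W22_def W12_def)
 have 2: "weak_pderiv (sector \<alpha>) j (weak_pderiv (sector \<alpha>) i v) \<in> L2 (sector \<alpha>)" for i j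
  using W22_weak_hessian(1)[OF sb(1,3) v(1), of i j] by (simp add: weak_hessian_def)
 show "u \<in> L2 (double_sector \<alpha>)" "du i \<in> L2 (double_sector \<alpha>)" "ddu i j \<in> L2 (double_sector \<alpha>)"
  unfolding u_def du_def ddu_def by (intro glue_L2[OF a] s 0 1 2 smooth_pderiv smooth_V)+
qed

lemmas u_int = L2_integrable[OF sb(2,6) u_L2(1)] L2_integrable[OF sb(2,6) u_L2(2)] L2_integrable[OF sb(2,6) u_L2(3)]

lemma u_inside: "x \<in> sector \<alpha> ==> u x = v x" by (simp add: u_def glue_def)

lemma u_outside: "1 <= norm x ==> u x = norm x" using sector_eq[OF a] by (auto simp: u_def glue_def vreg_norm)

lemma extension_eq: "x \<in> double_sector \<alpha> ==> extension \<alpha> v x = u x"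
proof (cases "x \<in> sector \<alpha>")
 case False
 assume "x \<in> double_sector \<alpha>"
 hence "norm x >= 1" using False sector_eq[OF a] double_sector_eq[OF a] by auto
 thus ?thesis using u_outside False by (simp add: extension_def)
qed (simp add: extension_def u_inside)

lemma extension_hessian:
 "AE x in lebesgue. x \<in> double_sector \<alpha> \<longrightarrow> ddu i j x = weak_hessian (double_sector \<alpha>) (extension \<alpha> v) x $ i $ j"
proof -
 have "has_weak_pderiv (double_sector \<alpha>) i (extension \<alpha> v) (du i)"
  using weak_pderiv_cong(1)[OF sb(2) extension_eq] weak_derivs(1) by simp
 moreover have "du i \<in> borel_measurable (lebesgue_on (double_sector \<alpha>))" using u_L2(2) by (simp add: L2_def)
 ultimately show ?thesis unfolding weak_hessian_def using weak_pderiv2_AE(2)[OF sb(2,4) _ _ weak_derivs(2)] by simp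
qed

lemma v_convex_interior: "convex_on (interior (sector \<alpha>)) v"
proof -
 have "convex (interior (sector \<alpha>))" unfolding sector_interior(1)[OF a] by (rule convex_cone_ball)
 thus ?thesis using v(2) interior_subset[of "sector \<alpha>"] unfolding convex_on_def by blast
qed

text \<open>Since the weak Hessian has no part concentrated on the arc, it is checked on the two
  sides separately; this is where convexity across the arc comes from.\<close>

lemma ddu_nonneg: "AE x in lebesgue. x \<in> double_sector \<alpha> \<longrightarrow> 0 <= quad (%i j. ddu i j x) \<xi>"
proof -
 have 1: "AE x in lebesgue. x \<in> interior (sector \<alpha>) \<longrightarrow> 0 <= quad (%i j. weak_pderiv (sector \<alpha>) j (weak_pderiv (sector \<alpha>) i v) x) \<xi>"
 proof (rule convex_weak_hessian[OF sb(1,5) v_convex_interior])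
  show "v \<in> L2 (sector \<alpha>)" "\<And>i. weak_pderiv (sector \<alpha>) i v \<in> L2 (sector \<alpha>)" using v(1) by (auto simp: W22_def W12_def)
  note w = W22_weak_hessian[OF sb(1,3) v(1)]
  show "weak_pderiv (sector \<alpha>) j (weak_pderiv (sector \<alpha>) i v) \<in> L2 (sector \<alpha>)" for i j
   using w(1)[of i j] by (simp add: weak_hessian_def)
  show "has_weak_pderiv (sector \<alpha>) i v (weak_pderiv (sector \<alpha>) i v)" for i by (rule w(3))
  show "has_weak_pderiv (sector \<alpha>) j (weak_pderiv (sector \<alpha>) i v) (weak_pderiv (sector \<alpha>) j (weak_pderiv (sector \<alpha>) i v))" for i j
   using w(4)[of j i] by (simp add: weak_hessian_def)
 qed
 have "sector \<alpha> - interior (sector \<alpha>) \<in> null_sets lebesgue" using sb(3) by (simp add: negligible_iff_null_sets)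
 from AE_not_in[OF this] 1 show ?thesis
 proof eventually_elim
  case (elim x)
  thus ?case using quad_vreg_nonneg[of "1/2" x \<xi>] by (cases "x \<in> sector \<alpha>") (auto simp: ddu_def glue_def)
 qed
qed

lemma U_smooth: "e > 0 ==> smooth (U e)" unfolding U_def by (rule conv_eta_smooth[OF u_int(1)])

lemma U_hess:
 assumes "e > 0" "cball x (4 * e) \<subseteq> Om"
 shows "pd j (pd i (U e)) x = conv (eta e) (%x. ind (double_sector \<alpha>) x * ddu i j x) x"
 unfolding U_def by (rule mollified_derivatives(2)[OF sb(2) u_int(1) u_int(3) weak_derivs]) (use assms in \<open>auto simp: Om_def\<close>)

lemma U_quad:
 assumes e: "e > 0" "cball x (4 * e) \<subseteq> Om"
 shows "0 <= quad (%i j. pd j (pd i (U e)) x) \<xi>"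
proof -
 let ?D = "double_sector \<alpha>"
 have "(%x. (\<xi>$1)\<^sup>2 * (ind ?D x * ddu 1 1 x) + (\<xi>$1 * \<xi>$2) * (ind ?D x * ddu 1 2 x) + ((\<xi>$1 * \<xi>$2) * (ind ?D x * ddu 2 1 x) + (\<xi>$2)\<^sup>2 * (ind ?D x * ddu 2 2 x))) = (%x. quad (%i j. ind ?D x * ddu i j x) \<xi>)"
  by (simp add: quad_def fun_eq_iff algebra_simps)
 moreover have "integrable lebesgue (%x. (\<xi>$1)\<^sup>2 * (ind ?D x * ddu 1 1 x) + (\<xi>$1 * \<xi>$2) * (ind ?D x * ddu 1 2 x) + ((\<xi>$1 * \<xi>$2) * (ind ?D x * ddu 2 1 x) + (\<xi>$2)\<^sup>2 * (ind ?D x * ddu 2 2 x)))"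
  by (intro lint_add_int integrable_mult_right u_int(5))
 ultimately have i: "integrable lebesgue (%x. quad (%i j. ind ?D x * ddu i j x) \<xi>)" by simp
 have "0 <= conv (eta e) (%x. quad (%i j. ind ?D x * ddu i j x) \<xi>) x"
 proof (rule conv_eta_bounds(1)[OF i e(1)])
  show "AE y in lebesgue. y \<in> cball x (2 * e) \<longrightarrow> 0 <= quad (%i j. ind ?D y * ddu i j y) \<xi>"
   using ddu_nonneg[of \<xi>] by eventually_elim (auto simp: indicator_def quad_def)
 qed
 also have "\<dots> = quad (%i j. conv (eta e) (%x. ind ?D x * ddu i j x) x) \<xi>" by (rule conv_quad) (use u_int(5) e in auto)
 finally show ?thesis using U_hess[OF e] by simp
qed

text \<open>The clearance \<open>4 * e\<close> is required along the whole segment: closer to the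
  boundary of 2S the mollification also averages the zeros of the indicator function.\<close>

lemma U_convex_segment:
 assumes e: "e > 0" "\<And>z. z \<in> closed_segment x y ==> cball z (4 * e) \<subseteq> Om" and t: "0 <= t" "t <= 1"
 shows "U e ((1 - t) *\<^sub>R x + t *\<^sub>R y) <= (1 - t) * U e x + t * U e y"
proof -
 define g where "g s = U e (x + s *\<^sub>R (y - x))" for s
 have "convex_on {0..1} g"
 proof (rule f''_ge0_imp_convex)
  fix s :: real assume s: "s \<in> {0..1}"
  show "(g has_real_derivative pd 1 (U e) (x + s *\<^sub>R (y - x)) * (y - x) $ 1 + pd 2 (U e) (x + s *\<^sub>R (y - x)) * (y - x) $ 2) (at s)"
   unfolding g_def by (rule smooth_line_deriv[OF U_smooth[OF e(1)]])
  show "((%s. pd 1 (U e) (x + s *\<^sub>R (y - x)) * (y - x) $ 1 + pd 2 (U e) (x + s *\<^sub>R (y - x)) * (y - x) $ 2) has_real_derivative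
   quad (%i j. pd j (pd i (U e)) (x + s *\<^sub>R (y - x))) (y - x)) (at s)" by (rule smooth_line_deriv2[OF U_smooth[OF e(1)]])
  have "x + s *\<^sub>R (y - x) = (1 - s) *\<^sub>R x + s *\<^sub>R y" by (simp add: algebra_simps)
  hence "x + s *\<^sub>R (y - x) \<in> closed_segment x y" using s unfolding closed_segment_def by auto
  thus "0 <= quad (%i j. pd j (pd i (U e)) (x + s *\<^sub>R (y - x))) (y - x)" by (intro U_quad e)
 qed simp
 from convex_onD[OF this t, of 0 1] show ?thesis by (simp add: g_def algebra_simps)
qed

text \<open>Radius 1 is excluded here and below, since the trace condition controls v near the arc
  only in the mean. The circle is a null set, so mollifications do not see it.\<close>

lemma u_isCont:
 assumes x: "x \<in> Om" "norm x \<noteq> 1"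
 shows "isCont (%x. ind (double_sector \<alpha>) x * u x) x"
proof (cases "norm x < 1")
 case True
 let ?I = "interior (sector \<alpha>)"
 have xi: "x \<in> ?I" using x True unfolding Om_eq sector_interior(1)[OF a] by simp
 have "continuous_on ?I v" by (rule convex_on_continuous[OF open_interior v_convex_interior])
 hence "isCont v x" using xi continuous_on_eq_continuous_at[OF open_interior] by blast
 moreover have "\<forall>\<^sub>F y in nhds x. v y = ind (double_sector \<alpha>) y * u y" using eventually_nhds_in_open[OF open_interior xi]
 proof eventually_elim
  case (elim y)
  hence "y \<in> sector \<alpha>" using interior_subset by blast
  thus ?case using u_inside sb(9) by (auto simp: indicator_def)
 qed
 ultimately show ?thesis using isCont_cong by fast
next
 case False
 let ?I = "Om \<inter> {x. 1 < norm x}"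
 have op: "open ?I" by (intro open_Int open_Om open_Collect_less continuous_intros)
 have xi: "x \<in> ?I" using x False by simp
 have "isCont norm x" by (intro continuous_intros)
 moreover have "\<forall>\<^sub>F y in nhds x. norm y = ind (double_sector \<alpha>) y * u y" using eventually_nhds_in_open[OF op xi]
 proof eventually_elim
  case (elim y)
  hence "y \<in> double_sector \<alpha>" using interior_subset unfolding Om_def by blast
  thus ?case using u_outside elim by auto
 qed
 ultimately show ?thesis using isCont_cong by fast
qed

lemma U_limit:
 assumes "x \<in> Om" "norm x \<noteq> 1"
 shows "((%e. U e x) \<longlongrightarrow> u x) (at_right 0)"
proof -
 have "x \<in> double_sector \<alpha>" using assms(1) interior_subset unfolding Om_def by blast
 thus ?thesis using conv_eta_pointwise_limit[OF u_int(1) u_isCont[OF assms]] unfolding U_def by simp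
qed

text \<open>A limit of the convexity of the mollifications, whose Hessians are nonnegative also
  across the arc.\<close>

lemma u_convex:
 assumes x: "x \<in> Om" "norm x \<noteq> 1" and y: "y \<in> Om" "norm y \<noteq> 1"
  and t: "0 <= t" "t <= 1" and z: "norm ((1 - t) *\<^sub>R x + t *\<^sub>R y) \<noteq> 1"
 shows "u ((1 - t) *\<^sub>R x + t *\<^sub>R y) <= (1 - t) * u x + t * u y"
proof -
 have seg: "closed_segment x y \<subseteq> Om" by (rule closed_segment_subset[OF x(1) y(1) convex_Om])
 obtain d where d: "d > 0" "(\<Union>z\<in>closed_segment x y. cball z d) \<subseteq> Om"
  using compact_subset_open_imp_cball_epsilon_subset[OF compact_segment open_Om seg] by blast
 have zO: "(1 - t) *\<^sub>R x + t *\<^sub>R y \<in> Om" using seg t unfolding closed_segment_def by blast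
 have "\<forall>\<^sub>F e in at_right 0. e > (0::real) \<and> 4 * e < d"
  using d(1) by (intro eventually_conj eventually_at_right_less) (auto simp: eventually_at_right_field intro!: exI[of _ "d / 4"])
 hence ev: "\<forall>\<^sub>F e in at_right 0. U e ((1 - t) *\<^sub>R x + t *\<^sub>R y) <= (1 - t) * U e x + t * U e y"
 proof eventually_elim
  case (elim e)
  have "cball z (4 * e) \<subseteq> Om" if "z \<in> closed_segment x y" for z
  proof -
   have "cball z (4 * e) \<subseteq> cball z d" using elim by auto
   thus ?thesis using d(2) that by blast
  qed
  thus ?case using elim t by (intro U_convex_segment) auto
 qed
 show ?thesis by (rule tendsto_le[OF _ _ U_limit[OF zO z] ev])
    (auto intro!: tendsto_intros U_limit x y)
qed

text \<open>On the ray through x, u equals the radius at 6/5 and at 7/5, and a convex function lies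
  above the continuation of its chord.\<close>

lemma u_ge_norm:
 assumes x: "x \<in> Om" "norm x \<noteq> 1"
 shows "norm x <= u x"
proof (cases "norm x < 1")
 case True
 define r where "r = norm x"
 have x0: "x \<noteq> 0" using x cone_pos[OF a, of x] by (auto simp: Om_eq)
 hence r: "0 < r" "r < 1" using True by (auto simp: r_def)
 define z where "z = (7/5 / r) *\<^sub>R x"
 have nz: "norm z = 7/5" using r by (simp add: z_def r_def[symmetric])
 have zO: "z \<in> Om" unfolding Om_eq using x r nz by (simp add: z_def cone_scale Om_eq)
 \<comment> \<open>Makes 6/5 the convex combination of the radii r and 7/5.\<close>
 define t where "t = (6/5 - r) / (7/5 - r)"
 have t: "0 <= t" "t < 1" using r by (auto simp: t_def)
 have "(1 - t) *\<^sub>R x + t *\<^sub>R z = ((1 - t) + t * (7/5 / r)) *\<^sub>R x" by (simp add: z_def scaleR_add_left)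
 also have "(1 - t) + t * (7/5 / r) = 6/5 / r"
 proof -
  have "(1 - t) * r + t * (7/5) = r + t * (7/5 - r)" by (simp add: algebra_simps)
  also have "\<dots> = 6/5" using r by (simp add: t_def)
  finally show ?thesis using r by (simp add: field_simps)
 qed
 finally have y: "(1 - t) *\<^sub>R x + t *\<^sub>R z = (6/5 / r) *\<^sub>R x" .
 have ny: "norm ((6/5 / r) *\<^sub>R x) = 6/5" using r by (simp add: r_def[symmetric])
 have "u ((1 - t) *\<^sub>R x + t *\<^sub>R z) <= (1 - t) * u x + t * u z"
 proof (rule u_convex[OF x zO])
  have "norm ((1 - t) *\<^sub>R x + t *\<^sub>R z) = 6/5" unfolding y by (rule ny)
  thus "norm ((1 - t) *\<^sub>R x + t *\<^sub>R z) \<noteq> 1" by simp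
 qed (use nz t in auto)
 hence "6/5 <= (1 - t) * u x + t * (7/5)" unfolding y using u_outside ny nz by simp
 moreover have "6/5 = (1 - t) * r + t * (7/5)"
 proof -
  have "(1 - t) * r + t * (7/5) = r + t * (7/5 - r)" by (simp add: algebra_simps)
  thus ?thesis using r by (simp add: t_def)
 qed
 ultimately have "(1 - t) * r <= (1 - t) * u x" by linarith
 thus ?thesis using t by (simp add: r_def)
next
 case False
 thus ?thesis using u_outside[of x] by simp
qed

end

section \<open>The value at the vertex\<close>

lemma bounded_Cauchy_Schwarz:
 fixes \<psi> F G :: "'a => real"
 assumes m: "F \<in> borel_measurable M" "G \<in> borel_measurable M" and \<psi>: "\<And>x. \<bar>\<psi> x\<bar> <= B"
  and i: "integrable M (%x. (F x)\<^sup>2)" "integrable M (%x. (G x)\<^sup>2)"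
 shows "\<bar>LINT x|M. \<psi> x * (F x * G x)\<bar> <= B * (sqrt (LINT x|M. (F x)\<^sup>2) * sqrt (LINT x|M. (G x)\<^sup>2))"
proof -
 have B: "0 <= B" using \<psi>[of undefined] by (meson abs_ge_zero order_trans)
 have ma: "(%x. \<bar>F x\<bar>) \<in> borel_measurable M" "(%x. \<bar>G x\<bar>) \<in> borel_measurable M" using m by (auto intro: borel_measurable_abs)
 have ia: "integrable M (%x. \<bar>F x\<bar>\<^sup>2)" "integrable M (%x. \<bar>G x\<bar>\<^sup>2)" using i by auto
 have "integrable M (%x. B * (\<bar>F x\<bar> * \<bar>G x\<bar>))" by (intro integrable_mult_right integrable_mult_L2 ma ia)
 hence "\<bar>LINT x|M. \<psi> x * (F x * G x)\<bar> <= (LINT x|M. B * (\<bar>F x\<bar> * \<bar>G x\<bar>))"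
 proof -
  assume iB: "integrable M (%x. B * (\<bar>F x\<bar> * \<bar>G x\<bar>))"
  have "\<bar>LINT x|M. \<psi> x * (F x * G x)\<bar> <= (LINT x|M. \<bar>\<psi> x * (F x * G x)\<bar>)" by (rule integral_abs_bound)
  also have "\<dots> <= (LINT x|M. B * (\<bar>F x\<bar> * \<bar>G x\<bar>))"
  proof (rule integral_mono'[OF iB])
   fix x show "\<bar>\<psi> x * (F x * G x)\<bar> <= B * (\<bar>F x\<bar> * \<bar>G x\<bar>)" unfolding abs_mult by (intro mult_right_mono \<psi>) auto
  qed (use B in auto)
  finally show ?thesis .
 qed
 also have "\<dots> = B * (LINT x|M. \<bar>F x\<bar> * \<bar>G x\<bar>)" by simp
 also have "\<dots> <= B * (sqrt (LINT x|M. \<bar>F x\<bar>\<^sup>2) * sqrt (LINT x|M. \<bar>G x\<bar>\<^sup>2))"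
  using Cauchy_Schwarz_integral[OF ma ia] B by (intro mult_left_mono) auto
 finally show ?thesis by simp
qed

lemma conv_eta_L2_integrable:
 assumes f: "integrable lebesgue f" "integrable lebesgue (%x. \<bar>f x\<bar> ^ 2)" and e: "e > 0"
 shows "conv (eta e) f \<in> borel_measurable lebesgue" "integrable lebesgue (%x. (conv (eta e) f x)\<^sup>2)"
  "integrable lebesgue (%x. (conv (eta e) f x - f x)\<^sup>2)"
proof -
 show m: "conv (eta e) f \<in> borel_measurable lebesgue" using conv_eta_measurable[OF e f(1)] by (intro measurable_completion) simp
 show d: "integrable lebesgue (%x. (conv (eta e) f x - f x)\<^sup>2)" using conv_eta_Lp(2)[of 2 f e] f e by simp
 have "integrable lebesgue (%x. 2 * (conv (eta e) f x - f x)\<^sup>2 + 2 * \<bar>f x\<bar> ^ 2)" using d f by simp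
 thus "integrable lebesgue (%x. (conv (eta e) f x)\<^sup>2)"
 proof (rule lint_bound)
  show "(%x. (conv (eta e) f x)\<^sup>2) \<in> borel_measurable lebesgue" using m by simp
  have "c\<^sup>2 <= 2 * (c - d)\<^sup>2 + 2 * d\<^sup>2" for c d :: real
   using zero_le_power2[of "c - 2 * d"] by (simp add: power2_eq_square algebra_simps)
  thus "AE x in lebesgue. norm ((conv (eta e) f x)\<^sup>2) <= norm (2 * (conv (eta e) f x - f x)\<^sup>2 + 2 * \<bar>f x\<bar> ^ 2)" by simp
 qed
qed

text \<open>The determinant and the squared norm of the Hessian are sums of products of two L2
  functions. As \<psi> is bounded, L2 convergence of the factors suffices: the difference of the
  products splits into three terms, each with a factor that tends to 0.\<close>

lemma conv_product_limit:
 assumes f: "integrable lebesgue f" "integrable lebesgue (%x. \<bar>f x\<bar> ^ 2)"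
  and g: "integrable lebesgue g" "integrable lebesgue (%x. \<bar>g x\<bar> ^ 2)"
  and \<psi>: "\<psi> \<in> borel_measurable lebesgue" "\<And>x. \<bar>\<psi> x\<bar> <= B"
 shows "((%e. LINT x|lebesgue. \<psi> x * (conv (eta e) f x * conv (eta e) g x)) \<longlongrightarrow> (LINT x|lebesgue. \<psi> x * (f x * g x))) (at_right 0)"
  and "e > 0 ==> integrable lebesgue (%x. \<psi> x * (conv (eta e) f x * conv (eta e) g x))"
  and "integrable lebesgue (%x. \<psi> x * (f x * g x))"
proof -
 have bi: "integrable lebesgue (%x. \<psi> x * (F x * G x))"
  if "F \<in> borel_measurable lebesgue" "G \<in> borel_measurable lebesgue" "integrable lebesgue (%x. (F x)\<^sup>2)" "integrable lebesgue (%x. (G x)\<^sup>2)" for F G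
 proof -
  have "integrable lebesgue (%x. B * (F x * G x))" by (intro integrable_mult_right integrable_mult_L2 that)
  thus ?thesis
  proof (rule lint_bound)
   show "(%x. \<psi> x * (F x * G x)) \<in> borel_measurable lebesgue" using that \<psi>(1) by simp
   have "\<bar>\<psi> x\<bar> * \<bar>F x * G x\<bar> <= \<bar>B\<bar> * \<bar>F x * G x\<bar>" for x using \<psi>(2)[of x] by (intro mult_right_mono) auto
   thus "AE x in lebesgue. norm (\<psi> x * (F x * G x)) <= norm (B * (F x * G x))" by (simp add: abs_mult)
  qed
 qed
 have f2: "integrable lebesgue (%x. (f x)\<^sup>2)" "f \<in> borel_measurable lebesgue" and g2: "integrable lebesgue (%x. (g x)\<^sup>2)" "g \<in> borel_measurable lebesgue"
  using f g by auto
 show i2: "integrable lebesgue (%x. \<psi> x * (f x * g x))" by (rule bi) (use f2 g2 in auto)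
 note cf = conv_eta_L2_integrable[OF f] and cg = conv_eta_L2_integrable[OF g]
 show i1: "integrable lebesgue (%x. \<psi> x * (conv (eta e) f x * conv (eta e) g x))" if "e > 0" for e by (rule bi) (use cf cg that in auto)
 define nf ng where "nf = sqrt (LINT x|lebesgue. (f x)\<^sup>2)" and "ng = sqrt (LINT x|lebesgue. (g x)\<^sup>2)"
 define df dg where "df e = sqrt (LINT x|lebesgue. (conv (eta e) f x - f x)\<^sup>2)" and "dg e = sqrt (LINT x|lebesgue. (conv (eta e) g x - g x)\<^sup>2)" for e
 have lim: "(df \<longlongrightarrow> 0) (at_right 0)" "(dg \<longlongrightarrow> 0) (at_right 0)"
  using tendsto_real_sqrt[OF conv_eta_Lp(1)[of 2 f]] tendsto_real_sqrt[OF conv_eta_Lp(1)[of 2 g]] f g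
  by (simp_all add: df_def[abs_def] dg_def[abs_def])
 have bound: "\<bar>(LINT x|lebesgue. \<psi> x * (conv (eta e) f x * conv (eta e) g x)) - (LINT x|lebesgue. \<psi> x * (f x * g x))\<bar> <= B * (df e * dg e) + B * (df e * ng) + B * (nf * dg e)" if e: "e > 0" for e
 proof -
  let ?F = "%x. conv (eta e) f x - f x" and ?G = "%x. conv (eta e) g x - g x"
  have m: "?F \<in> borel_measurable lebesgue" "?G \<in> borel_measurable lebesgue" using cf(1)[OF e] cg(1)[OF e] f2 g2 by auto
  have i3: "integrable lebesgue (%x. \<psi> x * (?F x * ?G x))" "integrable lebesgue (%x. \<psi> x * (?F x * g x))" "integrable lebesgue (%x. \<psi> x * (f x * ?G x))"
   by (rule bi; use m f2 g2 cf(3)[OF e] cg(3)[OF e] in simp)+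
  have "(LINT x|lebesgue. \<psi> x * (conv (eta e) f x * conv (eta e) g x)) - (LINT x|lebesgue. \<psi> x * (f x * g x))
   = (LINT x|lebesgue. \<psi> x * (conv (eta e) f x * conv (eta e) g x) - \<psi> x * (f x * g x))" by (rule lint_diff[OF i1[OF e] i2, symmetric])
  also have "\<dots> = (LINT x|lebesgue. (\<psi> x * (?F x * ?G x) + \<psi> x * (?F x * g x)) + \<psi> x * (f x * ?G x))"
   by (intro lint_cong) (simp add: algebra_simps)
  also have "\<dots> = (LINT x|lebesgue. \<psi> x * (?F x * ?G x)) + (LINT x|lebesgue. \<psi> x * (?F x * g x)) + (LINT x|lebesgue. \<psi> x * (f x * ?G x))"
   by (simp only: lint_add lint_add_int i3)
  finally show ?thesis
   using bounded_Cauchy_Schwarz[where \<psi> = \<psi>, OF m \<psi>(2) cf(3)[OF e] cg(3)[OF e]] bounded_Cauchy_Schwarz[where \<psi> = \<psi>, OF m(1) g2(2) \<psi>(2) cf(3)[OF e] g2(1)]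
    bounded_Cauchy_Schwarz[where \<psi> = \<psi>, OF f2(2) m(2) \<psi>(2) f2(1) cg(3)[OF e]] unfolding df_def dg_def nf_def ng_def by linarith
 qed
 define I where "I e = (LINT x|lebesgue. \<psi> x * (conv (eta e) f x * conv (eta e) g x))" for e
 have "((%e. B * (df e * dg e) + B * (df e * ng) + B * (nf * dg e)) \<longlongrightarrow> B * (0 * 0) + B * (0 * ng) + B * (nf * 0)) (at_right 0)"
  by (intro tendsto_intros lim)
 hence l0: "((%e. B * (df e * dg e) + B * (df e * ng) + B * (nf * dg e)) \<longlongrightarrow> 0) (at_right 0)" by simp
 have "\<forall>\<^sub>F e in at_right 0. norm (I e - (LINT x|lebesgue. \<psi> x * (f x * g x))) <= B * (df e * dg e) + B * (df e * ng) + B * (nf * dg e)"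
  using eventually_at_right_less[of "0::real"]
 proof eventually_elim
  case (elim e)
  show ?case unfolding real_norm_def I_def by (rule bound[OF elim])
 qed
 from Lim_null_comparison[OF this l0]
 have "((%e. I e - (LINT x|lebesgue. \<psi> x * (f x * g x))) \<longlongrightarrow> 0) (at_right 0)" .
 hence "(I \<longlongrightarrow> (LINT x|lebesgue. \<psi> x * (f x * g x))) (at_right 0)" by (rule Lim_null[THEN iffD2])
 thus "((%e. LINT x|lebesgue. \<psi> x * (conv (eta e) f x * conv (eta e) g x)) \<longlongrightarrow> (LINT x|lebesgue. \<psi> x * (f x * g x))) (at_right 0)"
  unfolding I_def[abs_def] .
qed

section \<open>Cut-off functions of the dyadic boxes\<close>

definition dil :: "real => real => real^2 => real^2" where "dil c d x = vector [c * x $ 1, d * x $ 2]"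

lemma dil_has_derivative:
 fixes g :: "2 => real"
 assumes "(f has_derivative (%h. \<Sum>i\<in>UNIV. g i * h $ i)) (at (dil c d x))"
 shows "((%x. f (dil c d x)) has_derivative (%h. \<Sum>i\<in>UNIV. (vector [c, d] :: real^2) $ i * g i * h $ i)) (at x)"
proof -
 have "linear (dil c d)" unfolding dil_def by (intro linearI) (simp_all add: vec_eq_iff forall_2 algebra_simps)
 hence "(dil c d has_derivative dil c d) (at x)" by (simp add: linear_conv_bounded_linear bounded_linear_imp_has_derivative)
 from has_derivative_compose[OF this assms] show ?thesis by (rule has_derivative_eq_rhs) (simp add: sum_2 dil_def fun_eq_iff algebra_simps)
qed

lemma Ck_dil: "Ck k UNIV f ==> Ck k UNIV (%x. f (dil c d x))"
proof (induction k arbitrary: f)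
 case (Suc k)
 then obtain g where g: "\<And>x. (f has_derivative (%h. \<Sum>i\<in>UNIV. g i x * h $ i)) (at x)" "\<And>i. Ck k UNIV (g i)" by auto
 have "Ck k UNIV (%x. (vector [c, d] :: real^2) $ i * g i (dil c d x))" for i by (intro Ck_mult Ck_const Suc.IH g(2))
 thus ?case using dil_has_derivative[OF g(1)] by (auto intro!: exI[of _ "%i x. (vector [c, d] :: real^2) $ i * g i (dil c d x)"])
qed simp

lemma smooth_dil: "smooth f ==> smooth (%x. f (dil c d x))" by (simp add: smooth_iff_Ck Ck_dil)

lemma pderiv_dil: "smooth f ==> pd i (%x. f (dil c d x)) = (%x. (vector [c, d] :: real^2) $ i * pd i f (dil c d x))"
 using has_derivative_pderiv_dir[OF dil_has_derivative[OF smooth_has_derivative]] by fast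

lemma pderiv_cmult: "smooth f ==> pd i (%x. c * f x) x = c * pd i f x" using pderiv_dir_mult[of "%x. c" f i x] by (simp add: pderiv_dir_const)

lemma pderiv2_dil:
 assumes "smooth f"
 shows "pd j (pd i (%x. f (dil c d x))) x = (vector [c, d] :: real^2) $ i * (vector [c, d] :: real^2) $ j * pd j (pd i f) (dil c d x)"
 unfolding pderiv_dil[OF assms] pderiv_cmult[OF smooth_dil[OF smooth_pderiv[OF assms]]] pderiv_dil[OF smooth_pderiv[OF assms]] by simp

text \<open>Equal to 1 on the dyadic box of size 1 in rescaled coordinates. The margins are such
  that \<open>\<bar>x $ 2\<bar>\<close> is at most \<open>19/40 * x $ 1\<close> on the support,
  which keeps the rescaled support inside the cone for every \<alpha>.\<close>

definition bump :: "real^2 => real" where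
 "bump x = (step (10 * x $ 1 - 4) * step (11 - 10 * x $ 1)) * (step (19/5 - 20 * x $ 2) * step (19/5 + 20 * x $ 2))"

definition bump_supp :: "(real^2) set" where "bump_supp = {x. 2/5 <= x $ 1 \<and> x $ 1 <= 11/10 \<and> \<bar>x $ 2\<bar> <= 19/100}"

lemma compact_bump_supp: "compact bump_supp"
proof -
 have "bump_supp = cbox (vector [2/5, - 19/100]) (vector [11/10, 19/100])" by (auto simp: bump_supp_def mem_box_cart forall_2 abs_le_iff)
 thus ?thesis using compact_cbox by metis
qed

lemma bump: "smooth bump" "0 <= bump x" "x \<notin> bump_supp ==> bump x = 0"
 "1/2 <= x $ 1 ==> x $ 1 <= 1 ==> \<bar>x $ 2\<bar> <= 1/8 ==> bump x = 1" "bump x <= 1"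
proof -
 have s: "smooth (%x. step (c + d * x $ i))" for c d i by (rule smooth_comp[OF Ck1_step]) (intro smooth_add smooth_cmult smooth_const smooth_nth)
 have "smooth (%x. (step (-4 + 10 * x $ 1) * step (11 + (-10) * x $ 1)) * (step (19/5 + (-20) * x $ 2) * step (19/5 + 20 * x $ 2)))"
  by (intro smooth_mult s)
 thus "smooth bump" by (simp add: bump_def[abs_def])
 show "0 <= bump x" unfolding bump_def by (intro mult_nonneg_nonneg step_nonneg)
 have "x * y <= 1" if "0 <= x" "x <= 1" "0 <= y" "y <= 1" for x y :: real using that by (simp add: mult_le_one)
 thus "bump x <= 1" unfolding bump_def by (simp add: step_nonneg step_le_1)
 show "bump x = 0" if "x \<notin> bump_supp"
 proof -
  have "10 * x $ 1 - 4 <= 0 \<or> 11 - 10 * x $ 1 <= 0 \<or> 19/5 - 20 * x $ 2 <= 0 \<or> 19/5 + 20 * x $ 2 <= 0"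
   using that by (auto simp: bump_supp_def abs_le_iff)
  thus ?thesis unfolding bump_def by (auto simp: step_0)
 qed
 show "bump x = 1" if "1/2 <= x $ 1" "x $ 1 <= 1" "\<bar>x $ 2\<bar> <= 1/8"
 proof -
  have "10 * x $ 1 - 4 >= 1" "11 - 10 * x $ 1 >= 1" "19/5 - 20 * x $ 2 >= 1" "19/5 + 20 * x $ 2 >= 1" using that by auto
  thus ?thesis by (simp add: bump_def step_1)
 qed
qed

lemma bump_pderiv2_bounded: "\<exists>B>0. \<forall>i j x. \<bar>pd j (pd i bump) x\<bar> <= B"
proof -
 have cl: "closed bump_supp" using compact_bump_supp by (rule compact_imp_closed)
 have "\<exists>B\<ge>0. \<forall>x. \<bar>pd j (pd i bump) x\<bar> <= B" for i j
 proof -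
  have 1: "pd i bump x = 0" if "x \<notin> bump_supp" for x by (rule pderiv_dir_outside[OF cl bump(3) that])
  have "pd j (pd i bump) x = 0" if "x \<notin> bump_supp" for x by (rule pderiv_dir_outside[OF cl 1 that])
  thus ?thesis using compact_support_bounded[OF smooth_continuous[OF smooth_pderiv[OF smooth_pderiv[OF bump(1)]]] compact_bump_supp] by metis
 qed
 note ex = this
 define B where "B i j = (SOME B. B >= 0 \<and> (\<forall>x. \<bar>pd j (pd i bump) x\<bar> <= B))" for i j
 have B: "B i j >= 0" "\<bar>pd j (pd i bump) x\<bar> <= B i j" for i j x using someI_ex[OF ex[of j i]] unfolding B_def by auto
 define T where "T = B 1 1 + B 1 2 + B 2 1 + B 2 2 + 1"
 have "B i j <= T" for i j using B(1)[of 1 1] B(1)[of 1 2] B(1)[of 2 1] B(1)[of 2 2] exhaust_2[of i] exhaust_2[of j] by (auto simp: T_def)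
 hence "\<bar>pd j (pd i bump) x\<bar> <= T" for i j x using B(2) order_trans by blast
 moreover have "T > 0" using B(1)[of 1 1] B(1)[of 1 2] B(1)[of 2 1] B(1)[of 2 2] by (simp add: T_def)
 ultimately show ?thesis by blast
qed

definition B0 :: real where "B0 = (SOME B. B > 0 \<and> (\<forall>i j x. \<bar>pd j (pd i bump) x\<bar> <= B))"

lemma B0: "B0 > 0" "\<bar>pd j (pd i bump) x\<bar> <= B0" using someI_ex[OF bump_pderiv2_bounded] unfolding B0_def[symmetric] by auto

definition dbump :: "real => real => real^2 => real" where
 "dbump \<alpha> l x = bump (dil (1 / l) (1 / (\<alpha> * l)) x)"
definition dbump_supp :: "real => real => (real^2) set" where
 "dbump_supp \<alpha> l = polar_rect (2/5 * l) (11/10 * l) (19/100 * (\<alpha> * l))"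

lemma x_le_tan:
 assumes "0 < x" "x < pi / 2"
 shows "x <= tan x"
proof -
 have "(tan has_real_derivative inverse ((cos y)\<^sup>2)) (at y)" if "0 <= y" "y <= x" for y
  using that assms by (intro DERIV_tan) (auto intro!: cos_gt_zero_pi less_imp_neq[symmetric])
 from MVT2[OF assms(1) this] obtain z where z: "0 < z" "z < x" "tan x - tan 0 = (x - 0) * inverse ((cos z)\<^sup>2)" by blast
 have "0 < cos z" using z assms by (intro cos_gt_zero_pi) auto
 hence "1 <= inverse ((cos z)\<^sup>2)" by (intro one_le_inverse) (auto simp: power_le_one)
 thus ?thesis using z(3) mult_left_mono[of 1 "inverse ((cos z)\<^sup>2)" x] assms by simp
qed

text \<open>Second derivatives scale at worst like \<open>1 / (\<alpha> * l)^2\<close> and the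
  support has area at most \<open>l^2\<close>, so the Hessian norm is of order
  \<open>1 / l\<close>.\<close>

lemma dbump:
 assumes "0 < \<alpha>" "\<alpha> < pi / 2" and l: "0 < l" "l <= 3/2"
 shows "smooth (dbump \<alpha> l)" "0 <= dbump \<alpha> l x" "dbump \<alpha> l x <= 1" "x \<notin> dbump_supp \<alpha> l ==> dbump \<alpha> l x = 0"
  "x \<in> dyadic_box \<alpha> l ==> dbump \<alpha> l x = 1" "dbump_supp \<alpha> l \<subseteq> {x \<in> cone \<alpha>. norm x < 2}" "dyadic_box \<alpha> l \<subseteq> dbump_supp \<alpha> l"
  "dbump \<alpha> l \<in> test_functions (double_sector \<alpha>)"
  "L2_norm (double_sector \<alpha>) (hess (dbump \<alpha> l)) <= 8 * B0 / (\<alpha>\<^sup>2 * l)"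
proof -
 note a = assms(1,2)
 have al: "0 < \<alpha> * l" using a l by simp
 have a2: "\<alpha> < 2" using a pi_less_4 by linarith
 show s: "smooth (dbump \<alpha> l)" unfolding dbump_def[abs_def] by (rule smooth_dil[OF bump(1)])
 show "0 <= dbump \<alpha> l x" "dbump \<alpha> l x <= 1" unfolding dbump_def by (rule bump)+
 have iff: "x \<in> dbump_supp \<alpha> l \<longleftrightarrow> dil (1 / l) (1 / (\<alpha> * l)) x \<in> bump_supp" for x
 proof -
  have "\<bar>1 / (\<alpha> * l) * x $ 2\<bar> <= 19/100 \<longleftrightarrow> \<bar>x $ 2\<bar> <= 19/100 * (\<alpha> * l)"
  proof -
   have "\<bar>1 / (\<alpha> * l) * x $ 2\<bar> = \<bar>x $ 2\<bar> / (\<alpha> * l)" using a l by (simp add: abs_mult)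
   thus ?thesis by (simp only: pos_divide_le_eq[OF al])
  qed
  moreover have "2/5 <= 1 / l * x $ 1 \<longleftrightarrow> 2/5 * l <= x $ 1" "1 / l * x $ 1 <= 11/10 \<longleftrightarrow> x $ 1 <= 11/10 * l"
   using l by (simp_all add: pos_divide_le_eq pos_le_divide_eq)
  ultimately show ?thesis by (simp add: dbump_supp_def polar_rect_mem bump_supp_def dil_def abs_le_iff) linarith
 qed
 show out: "x \<notin> dbump_supp \<alpha> l ==> dbump \<alpha> l x = 0" for x unfolding dbump_def iff by (rule bump(3))
 show "x \<in> dyadic_box \<alpha> l ==> dbump \<alpha> l x = 1" for x
  unfolding dbump_def using l al by (intro bump(4)) (auto simp: dyadic_box_def dil_def pos_divide_le_eq pos_le_divide_eq abs_le_iff algebra_simps)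
 show sub: "dbump_supp \<alpha> l \<subseteq> {x \<in> cone \<alpha>. norm x < 2}"
 proof
  fix x assume "x \<in> dbump_supp \<alpha> l"
  hence x: "2/5 * l <= x $ 1" "x $ 1 <= 11/10 * l" "\<bar>x $ 2\<bar> <= 19/100 * (\<alpha> * l)"
   by (auto simp: dbump_supp_def polar_rect_mem abs_le_iff)
  have x1: "0 < x $ 1" using x l by linarith
  have "\<alpha> * (2/5 * l) <= \<alpha> * x $ 1" by (rule mult_left_mono[OF x(1)]) (use a in simp)
  hence "2/5 * (\<alpha> * l) <= \<alpha> * x $ 1" by (simp only: mult.left_commute)
  hence "\<bar>x $ 2\<bar> <= 19/40 * (\<alpha> * x $ 1)" using x(3) by linarith
  also have "\<dots> < \<alpha> * x $ 1" using a x1 by simp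
  also have "\<dots> <= tan \<alpha> * x $ 1" using x_le_tan[OF a] x1 by simp
  finally have 1: "x \<in> cone \<alpha>" by (simp add: cone_def)
  have "\<alpha> * l <= 2 * l" using a2 l by simp
  hence "\<bar>x $ 2\<bar> <= 19/50 * l" using x(3) by linarith
  hence "\<bar>x $ 2\<bar> <= \<bar>19/50 * (3/2)\<bar>" using l by linarith
  hence "(x $ 2)\<^sup>2 <= (19/50 * (3/2))\<^sup>2" by (rule abs_le_square_iff[THEN iffD1])
  moreover have "(x $ 1)\<^sup>2 <= (11/10 * (3/2))\<^sup>2" using x(2) x1 l by (intro power_mono) auto
  ultimately have "(norm x)\<^sup>2 < 2\<^sup>2" unfolding norm_power2 by (simp add: power2_eq_square)
  hence "norm x < 2" by (rule power2_less_imp_less) simp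
  thus "x \<in> {x \<in> cone \<alpha>. norm x < 2}" using 1 by simp
 qed
 show "dyadic_box \<alpha> l \<subseteq> dbump_supp \<alpha> l" using l al by (auto simp: dyadic_box_def dbump_supp_def polar_rect_mem abs_le_iff)
 have cs: "compact (dbump_supp \<alpha> l)" by (simp add: dbump_supp_def polar_rect_def)
 show t: "dbump \<alpha> l \<in> test_functions (double_sector \<alpha>)"
  unfolding test_functions_def using s cs sub out sector_interior(2)[OF a] by auto
 \<comment> \<open>The factor 2 covers \<open>1 / l\<close> as well, because \<alpha> is below
   2.\<close>
 have sc: "\<bar>(vector [1 / l, 1 / (\<alpha> * l)] :: real^2) $ i\<bar> <= 2 / (\<alpha> * l)" for i
  using a a2 l exhaust_2[of i] by (auto simp: field_simps)
 have pb: "\<bar>pd j (pd i (dbump \<alpha> l)) x\<bar> <= 4 * B0 / (\<alpha> * l)\<^sup>2" for i j x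
 proof -
  have "\<bar>pd j (pd i (dbump \<alpha> l)) x\<bar> <= (2 / (\<alpha> * l)) * (2 / (\<alpha> * l)) * B0"
   unfolding dbump_def[abs_def] pderiv2_dil[OF bump(1)] abs_mult by (intro mult_mono sc B0(2)) (use al B0(1) in auto)
  thus ?thesis by (simp add: power2_eq_square)
 qed
 have z1: "pd i (dbump \<alpha> l) x = 0" if "x \<notin> dbump_supp \<alpha> l" for i x
  by (rule pderiv_dir_outside[OF compact_imp_closed[OF cs] out that])
 have z2: "pd j (pd i (dbump \<alpha> l)) x = 0" if "x \<notin> dbump_supp \<alpha> l" for i j x
  by (rule pderiv_dir_outside[OF compact_imp_closed[OF cs] z1 that])
 define c where "c = 4 * (4 * B0 / (\<alpha> * l)\<^sup>2)\<^sup>2"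
 have hb: "(norm (hess (dbump \<alpha> l) x))\<^sup>2 <= ind (dbump_supp \<alpha> l) x * c" for x
 proof (cases "x \<in> dbump_supp \<alpha> l")
  case True
  have "(pd j (pd i (dbump \<alpha> l)) x)\<^sup>2 <= (4 * B0 / (\<alpha> * l)\<^sup>2)\<^sup>2" for i j
   using power_mono[OF pb[of j i x], of 2] by simp
  from this[of 1 1] this[of 1 2] this[of 2 1] this[of 2 2]
  show ?thesis unfolding norm_matrix2 hess_nth c_def using True by simp
 qed (simp add: norm_matrix2 hess_nth z2)
 let ?n = "%x. (norm (hess (dbump \<alpha> l) x))\<^sup>2"
 have cn: "continuous_on UNIV ?n" unfolding norm_matrix2 hess_nth by (intro continuous_intros smooth_continuous smooth_pderiv s)
 have "(L2_norm (double_sector \<alpha>) (hess (dbump \<alpha> l)))\<^sup>2 = (LINT x|lborel. ?n x)" unfolding L2_norm_power2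
 proof (rule lebesgue_on_lborel[OF sector_basics(2)[OF a]])
  show "?n \<in> borel_measurable borel" by (rule borel_measurable_continuous_onI[OF cn])
  fix x assume "x \<notin> double_sector \<alpha>"
  hence "x \<notin> dbump_supp \<alpha> l" using sub double_sector_eq[OF a] by auto
  thus "?n x = 0" by (simp add: norm_matrix2 hess_nth z2)
 qed
 also have "\<dots> <= (LINT x|lborel. ind (dbump_supp \<alpha> l) x * c)"
 proof (rule integral_mono'[OF _ hb])
  show "integrable lborel (%x. ind (dbump_supp \<alpha> l) x * c)" unfolding dbump_supp_def by (rule integral_rect_iterated(3)) simp
  show "0 <= ind (dbump_supp \<alpha> l) x * c" for x by (simp add: c_def)
 qed
 also have "\<dots> = 7/10 * l * (19/50 * (\<alpha> * l)) * c" unfolding dbump_supp_def by (subst integral_rect_iterated(1)) (use l al in auto)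
 also have "\<dots> <= (l * l) * c"
 proof (rule mult_right_mono)
  have "\<alpha> * l <= 2 * l" using a2 l by simp
  hence "7/10 * l * (19/50 * (\<alpha> * l)) <= l * (19/50 * (2 * l))" using l al by (intro mult_mono) auto
  thus "7/10 * l * (19/50 * (\<alpha> * l)) <= l * l" using l by (simp add: mult.assoc)
 qed (simp add: c_def)
 also have "\<dots> = (8 * B0 / (\<alpha>\<^sup>2 * l))\<^sup>2" using a l by (simp add: c_def power2_eq_square field_simps)
 finally show "L2_norm (double_sector \<alpha>) (hess (dbump \<alpha> l)) <= 8 * B0 / (\<alpha>\<^sup>2 * l)"
  by (rule power2_le_imp_le) (use B0(1) l in auto)
qed

text \<open>The supremum in the dual norm runs over the unit ball, so \<phi> is divided by
  c.\<close>

lemma dual_norm_test: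
 assumes W: "W \<in> sets lebesgue" "negligible (W - interior W)" "bounded W" and \<phi>: "\<phi> \<in> test_functions W"
  and c: "L2_norm W (hess \<phi>) <= c" "0 < c" and N: "W22_dual_norm W f <= ereal N"
 shows "(LINT x|lebesgue_on W. \<phi> x * f x) <= c * N"
proof -
 define k where "k = 1 / c"
 have k: "0 < k" using c by (simp add: k_def)
 have s: "smooth \<phi>" using \<phi> by (simp add: test_functions_def)
 have t: "(%x. k * \<phi> x) \<in> test_functions W"
 proof -
  obtain K where K: "compact K" "K \<subseteq> interior W" "\<And>x. x \<notin> K ==> \<phi> x = 0" using \<phi> unfolding test_functions_def by blast
  have "\<forall>x. x \<notin> K \<longrightarrow> k * \<phi> x = 0" using K(3) by simp
  thus ?thesis unfolding test_functions_def using K(1,2) smooth_cmult[OF s, of k] by blast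
 qed
 have "pd i (%x. k * \<phi> x) = (%x. k * pd i \<phi> x)" for i by (rule ext) (rule pderiv_cmult[OF s])
 hence h: "hess (%x. k * \<phi> x) x = k *\<^sub>R hess \<phi> x" for x by (simp add: vec_eq_iff hess_nth pderiv_cmult[OF smooth_pderiv[OF s]])
 have "L2_norm W (hess (%x. k * \<phi> x)) = k * L2_norm W (hess \<phi>)"
  unfolding L2_norm_def h[abs_def] using k by (simp add: power_mult_distrib real_sqrt_mult)
 also have "\<dots> <= k * c" using c k by (intro mult_left_mono) auto
 finally have "L2_norm W (hess (%x. k * \<phi> x)) <= 1" using c by (simp add: k_def)
 from order_trans[OF dual_norm_ge[OF W t this, of f] N]
 have "(LINT x|lebesgue_on W. k * \<phi> x * f x) <= N" by simp
 hence "k * (LINT x|lebesgue_on W. \<phi> x * f x) <= N" by (simp add: mult.assoc)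
 thus ?thesis using c by (simp add: k_def field_simps)
qed

text \<open>The Jacobian of the gradient map is the determinant of the Hessian. The map may cover
  points several times, hence only an inequality.\<close>

lemma measure_gradient_image:
 assumes U: "smooth U" and S: "compact S" and K: "\<And>x. x \<in> S ==> 0 <= det (hess U x)"
 shows "measure lebesgue ((%x. \<chi> i. pd i U x) ` S) <= (LINT x|lebesgue. ind S x * det (hess U x))"
proof -
 have cd: "continuous_on UNIV (%x. det (hess U x))" unfolding det_2 hess_nth by (intro continuous_intros smooth_continuous smooth_pderiv U)
 have d: "((%x. \<chi> i. pd i U x) has_derivative (%h. hess U x *v h)) (at x within S)" for x
  unfolding has_derivative_componentwise_within[of "%x. \<chi> i. pd i U x"]
 proof
  fix b :: "real^2" assume "b \<in> Basis"
  then obtain i where b: "b = axis i 1" by (auto simp: Basis_vec_def)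
  have "(pd i U has_derivative (%h. \<Sum>j\<in>UNIV. pd j (pd i U) x * h $ j)) (at x within S)"
   by (rule has_derivative_at_withinI[OF smooth_has_derivative[OF smooth_pderiv[OF U]]])
  thus "((%x. (\<chi> i. pd i U x) \<bullet> b) has_derivative (%h. (hess U x *v h) \<bullet> b)) (at x within S)"
   by (simp add: b inner_axis matrix_vector_mult_def hess_def)
 qed
 have ai: "(%x. \<bar>det (hess U x)\<bar>) absolutely_integrable_on S"
  by (rule absolutely_integrable_continuous_compact[OF S]) (intro continuous_intros continuous_on_subset[OF cd] subset_UNIV)
 have m: "matrix (%h. hess U x *v h) = hess U x" for x by (rule matrix_of_matrix_vector_mul)
 have "measure lebesgue ((%x. \<chi> i. pd i U x) ` S) <= integral S (%x. \<bar>det (matrix (%h. hess U x *v h))\<bar>)"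
  by (rule measure_differentiable_image[OF _ d])
    (use S ai in \<open>auto simp: m compact_imp_closed set_lebesgue_integral_eq_integral(1)\<close>)
 also have "\<dots> = (LINT x:S|lebesgue. \<bar>det (hess U x)\<bar>)" unfolding m using set_lebesgue_integral_eq_integral(2)[OF ai] by simp
 also have "\<dots> = (LINT x|lebesgue. ind S x * det (hess U x))"
  unfolding set_lebesgue_integral_def by (intro lint_cong) (use K in \<open>auto simp: indicator_def\<close>)
 finally show ?thesis .
qed

section \<open>Gradient areas against the dual norm\<close>

context admissible_function
begin

lemma sphere_AE: "AE x in lebesgue. norm (x :: real^2) \<noteq> 1"
proof -
 have "negligible (sphere (0::real^2) 1)" by (rule negligible_sphere)
 hence "sphere (0::real^2) 1 \<in> null_sets lebesgue" by (simp add: negligible_iff_null_sets)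
 from AE_not_in[OF this] show ?thesis by (rule eventually_mono) auto
qed

lemma U_ge:
 assumes e: "e > 0" "cball x (2 * e) \<subseteq> Om" and l: "\<And>y. y \<in> Om ==> norm y \<noteq> 1 ==> y \<in> cball x (2 * e) ==> l <= u y"
 shows "l <= U e x" unfolding U_def
proof (rule conv_eta_bounds(1)[OF u_int(1) e(1)])
 have "Om \<subseteq> double_sector \<alpha>" unfolding Om_def by (rule interior_subset)
 thus "AE y in lebesgue. y \<in> cball x (2 * e) \<longrightarrow> l <= indicat_real (double_sector \<alpha>) y * u y"
  using sphere_AE by (auto elim!: eventually_mono) (use e(2) l in \<open>auto simp: subset_iff\<close>)
qed

lemma U_le:
 assumes e: "e > 0" "cball x (2 * e) \<subseteq> Om" and l: "\<And>y. y \<in> Om ==> norm y \<noteq> 1 ==> y \<in> cball x (2 * e) ==> u y <= l"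
 shows "U e x <= l" unfolding U_def
proof (rule conv_eta_bounds(2)[OF u_int(1) e(1)])
 have "Om \<subseteq> double_sector \<alpha>" unfolding Om_def by (rule interior_subset)
 thus "AE y in lebesgue. y \<in> cball x (2 * e) \<longrightarrow> indicat_real (double_sector \<alpha>) y * u y <= l"
  using sphere_AE by (auto elim!: eventually_mono) (use e(2) l in \<open>auto simp: subset_iff\<close>)
qed

lemma cball_norm: "y \<in> cball x r ==> norm x - r <= norm y \<and> norm y <= norm x + r" for x y :: "real^2"
 using norm_triangle_ineq2[of x y] norm_triangle_ineq2[of y x] by (auto simp: dist_norm norm_minus_commute)

lemma U_ge_norm: "e > 0 ==> cball x (2 * e) \<subseteq> Om ==> norm x - 2 * e <= U e x"
 by (rule U_ge) (use u_ge_norm cball_norm in \<open>force+\<close>)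

text \<open>The slope estimate is applied to \<open>U e\<close>, with
  \<open>\<omega> = 2 * e\<close>, and e tends to 0 afterwards. Cut-offs replace the indicator
  functions of the boxes, since the dual norm is tested with smooth functions.\<close>

lemma vertex_bound:
 assumes N: "W22_dual_norm (double_sector \<alpha>) (%x. det (weak_hessian (double_sector \<alpha>) (extension \<alpha> v) x)) <= ereal N"
  and M: "\<And>x. x \<in> Om ==> norm x \<noteq> 1 ==> M <= u x" and J: "J >= 4"
 shows "\<alpha> / 20 * (\<alpha>\<^sup>2 / 800 * M / 2 - 2 * (\<alpha>\<^sup>2 / 800) * (3 / 2 / 2 ^ J)) <= 2 * (real J * (8 * B0 / \<alpha>\<^sup>2 * N))"
proof -
 let ?D = "double_sector \<alpha>"
 define \<kappa> \<tau> where "\<kappa> = \<alpha>\<^sup>2 / 800" and "\<tau> = (3 / 2 / 2 ^ J :: real)"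
 define l where "l j = (3 / 2 / 2 ^ j :: real)" for j :: nat
 have a2: "\<alpha> < 2" using a pi_less_4 by linarith
 have \<kappa>: "\<kappa> > 0" using a by (simp add: \<kappa>_def)
 have \<tau>: "\<tau> > 0" by (simp add: \<tau>_def)
 have l: "0 < l j" "l j <= 3/2" for j by (simp_all add: l_def divide_le_eq)
 note db = dbump[OF a l]
 have T: "trunc_cone \<alpha> \<tau> \<subseteq> Om"
 proof
  fix x assume x: "x \<in> trunc_cone \<alpha> \<tau>"
  hence x1: "0 < x $ 1" using \<tau> by (simp add: trunc_cone_def)
  have "\<bar>x $ 2\<bar> <= \<alpha> / 2 * x $ 1" using x by (simp add: trunc_cone_def)
  also have "\<dots> < \<alpha> * x $ 1" using x1 a by simp
  also have "\<dots> <= tan \<alpha> * x $ 1" using x1 x_le_tan[OF a] by simp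
  finally show "x \<in> Om" unfolding Om_eq using x by (simp add: cone_def trunc_cone_def)
 qed
 \<comment> \<open>One compact set that contains all points at which the bounds for
   \<open>U e\<close> are used; its distance to the boundary limits e.\<close>
 define K where "K = trunc_cone \<alpha> \<tau> \<union> (\<Union>j<J. dbump_supp \<alpha> (l j))"
 have K: "compact K" "K \<subseteq> Om"
 proof -
  show "compact K" unfolding K_def by (intro compact_Un compact_trunc_cone compact_UN) (auto simp: dbump_supp_def polar_rect_def)
  show "K \<subseteq> Om" unfolding K_def using T db(6) by (auto simp: Om_eq)
 qed
 obtain d where d: "d > 0" "(\<Union>z\<in>K. cball z d) \<subseteq> Om"
  using compact_subset_open_imp_cball_epsilon_subset[OF K(1) open_Om K(2)] by blast
 define hh where "hh i j x = ind ?D x * ddu i j x" for i j x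
 have hi: "integrable lebesgue (hh i j)" "integrable lebesgue (%x. \<bar>hh i j x\<bar> ^ 2)" for i j unfolding hh_def[abs_def] by (rule u_int)+
 have \<psi>: "dbump \<alpha> (l j) \<in> borel_measurable lebesgue" "\<bar>dbump \<alpha> (l j) x\<bar> <= 1" for j x
  using smooth_continuous[OF db(1), of UNIV j] db(2,3) by (auto intro!: measurable_completion borel_measurable_continuous_onI)
 note lim = conv_product_limit[OF hi hi \<psi>]
 define I where "I e j = (LINT x|lebesgue. dbump \<alpha> (l j) x * (conv (eta e) (hh 1 1) x * conv (eta e) (hh 2 2) x)) - (LINT x|lebesgue. dbump \<alpha> (l j) x * (conv (eta e) (hh 1 2) x * conv (eta e) (hh 2 1) x))" for e j
 define I0 where "I0 j = (LINT x|lebesgue. dbump \<alpha> (l j) x * (hh 1 1 x * hh 2 2 x)) - (LINT x|lebesgue. dbump \<alpha> (l j) x * (hh 1 2 x * hh 2 1 x))" for j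
 \<comment> \<open>Besides the clearance d, the smallness conditions are
   \<open>15 * \<omega> <= \<kappa>\<close> for \<open>\<omega> = 2 * e\<close>, and that around a
   point of norm 6/5 only norms of at least 1 are averaged.\<close>
 have main: "\<alpha> / 20 * (\<kappa> * M / 2 - 40 * (2 * e) - 2 * \<kappa> * \<tau>) <= 2 * (\<Sum>j<J. l j * I e j)"
  if e: "e > 0" "4 * e < d" "30 * e <= \<kappa>" "10 * e <= 1" for e
 proof -
  have KO: "cball x (4 * e) \<subseteq> Om" "cball x (2 * e) \<subseteq> Om" if "x \<in> K" for x
  proof -
   have "cball x (4 * e) \<subseteq> cball x d" "cball x (2 * e) \<subseteq> cball x d" using e by auto
   thus "cball x (4 * e) \<subseteq> Om" "cball x (2 * e) \<subseteq> Om" using d(2) that by blast+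
  qed
  have TK: "x \<in> K" if "x \<in> trunc_cone \<alpha> \<tau>" for x using that by (simp add: K_def)
  define P where "P x = (\<chi> i. pd i (U e) x)" for x
  note sU = U_smooth[OF e(1)]
  have "\<alpha> / 20 * (\<kappa> * M / 2 - 40 * (2 * e) - 2 * \<kappa> * \<tau>) <= 2 * (\<Sum>j<J. (3/2/2^j) * measure lebesgue (P ` dyadic_box \<alpha> (3/2/2^j)))"
  proof (rule slope_area[where U = "U e"])
   show "continuous_on UNIV P" unfolding P_def by (intro continuous_on_vec_lambda smooth_continuous smooth_pderiv sU)
   fix x assume x: "x \<in> trunc_cone \<alpha> \<tau>"
   show "(U e has_derivative (%h. P x \<bullet> h)) (at x)" using smooth_has_derivative[OF sU, of x] by (simp add: P_def inner_vec_def)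
   show "norm x - 2 * e <= U e x" by (rule U_ge_norm[OF e(1) KO(2)[OF TK[OF x]]])
   show "M <= U e x" by (rule U_ge[OF e(1) KO(2)[OF TK[OF x]]]) (use M in auto)
   show "U e x <= norm x + 2 * e" if "6/5 <= norm x"
   proof (rule U_le[OF e(1) KO(2)[OF TK[OF x]]])
    fix y assume "y \<in> cball x (2 * e)"
    from cball_norm[OF this] show "u y <= norm x + 2 * e" using that e u_outside[of y] by auto
   qed
  qed (use a a2 e J in \<open>auto simp: \<kappa>_def \<tau>_def\<close>)
  also have "\<dots> <= 2 * (\<Sum>j<J. l j * I e j)"
  proof (intro mult_left_mono sum_mono)
   fix j assume j: "j \<in> {..<J}"
   have HK: "det (hess (U e) x) = conv (eta e) (hh 1 1) x * conv (eta e) (hh 2 2) x - conv (eta e) (hh 1 2) x * conv (eta e) (hh 2 1) x"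
    and Hp: "0 <= det (hess (U e) x)" if "x \<in> dbump_supp \<alpha> (l j)" for x
   proof -
    have "x \<in> K" using that j by (auto simp: K_def)
    note k = KO(1)[OF this]
    show "det (hess (U e) x) = conv (eta e) (hh 1 1) x * conv (eta e) (hh 2 2) x - conv (eta e) (hh 1 2) x * conv (eta e) (hh 2 1) x"
     unfolding det_2 hess_nth U_hess[OF e(1) k] hh_def[abs_def] by simp
    show "0 <= det (hess (U e) x)" unfolding det_2 hess_nth using quad_nonneg_det[OF U_quad[OF e(1) k]] by simp
   qed
   have "measure lebesgue (P ` dyadic_box \<alpha> (l j)) <= (LINT x|lebesgue. ind (dyadic_box \<alpha> (l j)) x * det (hess (U e) x))"
    unfolding P_def by (rule measure_gradient_image[OF sU compact_dyadic_box]) (use Hp db(7)[of j] in auto)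
   also have "\<dots> <= (LINT x|lebesgue. dbump \<alpha> (l j) x * (conv (eta e) (hh 1 1) x * conv (eta e) (hh 2 2) x) - dbump \<alpha> (l j) x * (conv (eta e) (hh 1 2) x * conv (eta e) (hh 2 1) x))"
   proof (rule integral_mono')
    show "integrable lebesgue (%x. dbump \<alpha> (l j) x * (conv (eta e) (hh 1 1) x * conv (eta e) (hh 2 2) x) - dbump \<alpha> (l j) x * (conv (eta e) (hh 1 2) x * conv (eta e) (hh 2 1) x))"
     by (intro lint_diff_int lim(2) e)
    fix x
    have eq: "dbump \<alpha> (l j) x * (conv (eta e) (hh 1 1) x * conv (eta e) (hh 2 2) x) - dbump \<alpha> (l j) x * (conv (eta e) (hh 1 2) x * conv (eta e) (hh 2 1) x) = dbump \<alpha> (l j) x * det (hess (U e) x)"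
     by (cases "x \<in> dbump_supp \<alpha> (l j)") (simp_all add: HK db(4) right_diff_distrib)
    have nn: "0 <= dbump \<alpha> (l j) x * det (hess (U e) x)"
     using Hp[of x] db(2)[of j x] db(4)[of x j] by (cases "x \<in> dbump_supp \<alpha> (l j)") auto
    thus "0 <= dbump \<alpha> (l j) x * (conv (eta e) (hh 1 1) x * conv (eta e) (hh 2 2) x) - dbump \<alpha> (l j) x * (conv (eta e) (hh 1 2) x * conv (eta e) (hh 2 1) x)"
     unfolding eq .
    show "ind (dyadic_box \<alpha> (l j)) x * det (hess (U e) x) <= dbump \<alpha> (l j) x * (conv (eta e) (hh 1 1) x * conv (eta e) (hh 2 2) x) - dbump \<alpha> (l j) x * (conv (eta e) (hh 1 2) x * conv (eta e) (hh 2 1) x)"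
     unfolding eq using nn db(5)[of x j] by (cases "x \<in> dyadic_box \<alpha> (l j)") auto
   qed
   also have "\<dots> = I e j" unfolding I_def by (intro lint_diff lim(2) e)
   finally have "l j * measure lebesgue (P ` dyadic_box \<alpha> (l j)) <= l j * I e j" using l(1)[of j] by (intro mult_left_mono) auto
   thus "3/2/2^j * measure lebesgue (P ` dyadic_box \<alpha> (3/2/2^j)) <= l j * I e j" unfolding l_def .
  qed simp
  finally show ?thesis .
 qed
 have Ilim: "((%e. I e j) \<longlongrightarrow> I0 j) (at_right 0)" for j unfolding I_def I0_def by (intro tendsto_diff lim(1))
 have small: "\<forall>\<^sub>F e in at_right 0. e < (c::real)" if "c > 0" for c
  using that by (auto simp: eventually_at_right_field intro!: exI[of _ c])
 have ev: "\<forall>\<^sub>F e in at_right 0. \<alpha> / 20 * (\<kappa> * M / 2 - 40 * (2 * e) - 2 * \<kappa> * \<tau>) <= 2 * (\<Sum>j<J. l j * I e j)"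
 proof -
  have "\<forall>\<^sub>F e in at_right 0. (e::real) > 0 \<and> e < d / 4 \<and> e < \<kappa> / 30 \<and> e < 1 / 10"
   using d \<kappa> by (intro eventually_conj eventually_at_right_less small) auto
  thus ?thesis by eventually_elim (intro main, auto)
 qed
 have "((%e. 2 * (\<Sum>j<J. l j * I e j)) \<longlongrightarrow> 2 * (\<Sum>j<J. l j * I0 j)) (at_right 0)" by (intro tendsto_intros Ilim)
 moreover have "((%e::real. \<alpha> / 20 * (\<kappa> * M / 2 - 40 * (2 * e) - 2 * \<kappa> * \<tau>)) \<longlongrightarrow> \<alpha> / 20 * (\<kappa> * M / 2 - 40 * (2 * 0) - 2 * \<kappa> * \<tau>)) (at_right 0)"
  by (intro tendsto_intros)
 ultimately have "\<alpha> / 20 * (\<kappa> * M / 2 - 40 * (2 * 0) - 2 * \<kappa> * \<tau>) <= 2 * (\<Sum>j<J. l j * I0 j)"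
  by (intro tendsto_le[OF _ _ _ ev]) auto
 also have "\<dots> <= 2 * (\<Sum>j<J. 8 * B0 / \<alpha>\<^sup>2 * N)"
 proof (intro mult_left_mono sum_mono)
  fix j
  let ?H = "%x. weak_hessian ?D (extension \<alpha> v) x"
  have hm: "(%x. ind ?D x * ddu i k x) \<in> borel_measurable lebesgue" for i k using u_int(5) by auto
  have "I0 j = (LINT x|lebesgue. dbump \<alpha> (l j) x * (hh 1 1 x * hh 2 2 x) - dbump \<alpha> (l j) x * (hh 1 2 x * hh 2 1 x))"
   unfolding I0_def by (intro lint_diff[symmetric] lim(3))
  also have "\<dots> = (LINT x|lebesgue. ind ?D x * (dbump \<alpha> (l j) x * (ddu 1 1 x * ddu 2 2 x - ddu 1 2 x * ddu 2 1 x)))"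
   by (intro lint_cong) (auto simp: hh_def indicator_def algebra_simps)
  also have "\<dots> = (LINT x|lebesgue_on ?D. dbump \<alpha> (l j) x * (ddu 1 1 x * ddu 2 2 x - ddu 1 2 x * ddu 2 1 x))"
   by (rule LINT_lebesgue_on[OF sb(2), symmetric])
  also have "\<dots> = (LINT x|lebesgue_on ?D. dbump \<alpha> (l j) x * det (?H x))"
  proof (rule integral_cong_AE)
   have dm: "ddu i k \<in> borel_measurable (lebesgue_on ?D)" for i k using u_L2(3) by (simp add: L2_def)
   have bm: "dbump \<alpha> (l j) \<in> borel_measurable (lebesgue_on ?D)" by (rule measurable_restrict_space1[OF \<psi>(1)])
   show m1: "(%x. dbump \<alpha> (l j) x * (ddu 1 1 x * ddu 2 2 x - ddu 1 2 x * ddu 2 1 x)) \<in> borel_measurable (lebesgue_on ?D)"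
    by (intro borel_measurable_times borel_measurable_diff dm bm)
   have "AE x in lebesgue. x \<in> ?D \<longrightarrow> dbump \<alpha> (l j) x * (ddu 1 1 x * ddu 2 2 x - ddu 1 2 x * ddu 2 1 x) = dbump \<alpha> (l j) x * det (?H x)"
    using extension_hessian[of 1 1] extension_hessian[of 1 2] extension_hessian[of 2 1] extension_hessian[of 2 2] by eventually_elim (simp add: det_2)
   thus ae: "AE x in lebesgue_on ?D. dbump \<alpha> (l j) x * (ddu 1 1 x * ddu 2 2 x - ddu 1 2 x * ddu 2 1 x) = dbump \<alpha> (l j) x * det (?H x)"
    using sb(2) by (subst AE_restrict_space_iff) auto
   show "(%x. dbump \<alpha> (l j) x * det (?H x)) \<in> borel_measurable (lebesgue_on ?D)" by (rule measurable_AE_lebesgue_on[OF sb(2) m1 ae])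
  qed
  also have "\<dots> <= 8 * B0 / (\<alpha>\<^sup>2 * l j) * N" by (rule dual_norm_test[OF sb(2,4,6) db(8) db(9) _ N]) (use B0(1) a l in auto)
  finally have "l j * I0 j <= l j * (8 * B0 / (\<alpha>\<^sup>2 * l j) * N)" using l(1)[of j] by (intro mult_left_mono) auto
  \<comment> \<open>The weight \<open>l j\<close> of the slope estimate cancels the
    \<open>1 / l j\<close> of the cut-off, so all scales contribute equally.\<close>
  also have "\<dots> = 8 * B0 / \<alpha>\<^sup>2 * N" using l(1)[of j] by simp
  finally show "l j * I0 j <= 8 * B0 / \<alpha>\<^sup>2 * N" .
 qed simp
 finally show ?thesis by (simp add: \<kappa>_def \<tau>_def)
qed

end

section \<open>The lower bound\<close>

lemma cone_iff:
 assumes "0 < \<alpha>" "\<alpha> < pi / 2"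
 shows "x \<in> cone \<alpha> \<longleftrightarrow> 0 < sin \<alpha> * x $ 1 - cos \<alpha> * \<bar>x $ 2\<bar>"
proof -
 have c: "0 < cos \<alpha>" using assms by (intro cos_gt_zero_pi) auto
 have "\<bar>x $ 2\<bar> < tan \<alpha> * x $ 1 \<longleftrightarrow> cos \<alpha> * \<bar>x $ 2\<bar> < cos \<alpha> * (tan \<alpha> * x $ 1)" using c by simp
 also have "cos \<alpha> * (tan \<alpha> * x $ 1) = sin \<alpha> * x $ 1" using c by (simp add: tan_def)
 finally show ?thesis by (simp add: cone_def)
qed

text \<open>The 1-Lipschitz function \<open>sin \<alpha> * x $ 1 - cos \<alpha> * \<bar>x $ 2\<bar>\<close> is the distance of \<open>x\<close> to the sides of the cone.\<close>

lemma dir_clearance: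
 assumes "0 < \<alpha>" "\<alpha> < pi / 2" "0 < \<delta>" "\<bar>t\<bar> <= \<alpha> - \<delta>" "0 < \<rho>" "\<rho> <= r"
 shows "\<rho> * sin \<delta> <= sin \<alpha> * (r *\<^sub>R dir t) $ 1 - cos \<alpha> * \<bar>(r *\<^sub>R dir t) $ 2\<bar>"
proof -
 have "\<bar>sin t\<bar> = sin \<bar>t\<bar>"
 proof (cases "t >= 0")
  case True
  thus ?thesis using assms by (simp add: sin_ge_zero)
 next
  case False
  hence "0 <= sin (- t)" using assms by (intro sin_ge_zero) auto
  thus ?thesis using False by simp
 qed
 hence "sin \<alpha> * (r *\<^sub>R dir t) $ 1 - cos \<alpha> * \<bar>(r *\<^sub>R dir t) $ 2\<bar> = r * sin (\<alpha> - \<bar>t\<bar>)"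
  using assms by (simp add: abs_mult sin_diff algebra_simps)
 moreover have "sin \<delta> <= sin (\<alpha> - \<bar>t\<bar>)" using assms by (intro sin_monotone_2pi_le) auto
 moreover have "0 <= sin \<delta>" using assms by (intro sin_ge_zero) auto
 ultimately show ?thesis using assms by (auto intro!: mult_mono)
qed

context admissible_function
begin

text \<open>x lies on a segment from p, where u is at most r0, to a point y beyond the unit circle,
  where u is the norm. The clearance of x from the sides exceeds what subtracting p can take away,
  so \<open>x - p\<close>, and with it y, stays in the cone.\<close>

lemma u_upper:
 assumes r0: "0 < r0" "r0 <= 1/4" and p: "p \<in> Om" "norm p \<noteq> 1" "u p <= r0"
  and x: "x \<in> Om" "norm x \<noteq> 1" "2 * r0 < sin \<alpha> * x $ 1 - cos \<alpha> * \<bar>x $ 2\<bar>"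
 shows "u x <= norm x + 3 * r0"
proof (cases "norm x < 1")
 case False
 thus ?thesis using u_outside[of x] r0 by simp
next
 case True
 have sc: "0 <= sin \<alpha>" "sin \<alpha> <= 1" "0 <= cos \<alpha>" "cos \<alpha> <= 1" using a by (auto intro: sin_ge_zero cos_ge_zero)
 have np: "norm p <= r0" using u_ge_norm[OF p(1,2)] p(3) by simp
 have pc: "\<bar>p $ 1\<bar> <= r0" "\<bar>p $ 2\<bar> <= r0" using component_le_norm_cart[of p] np order_trans by blast+
 define w where "w = x - p"
 have wc: "w \<in> cone \<alpha>"
 proof -
  have "sin \<alpha> * p $ 1 <= sin \<alpha> * \<bar>p $ 1\<bar>" using sc by (intro mult_left_mono) auto
  moreover have "sin \<alpha> * \<bar>p $ 1\<bar> <= 1 * r0" using sc pc(1) by (intro mult_mono) auto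
  moreover have "cos \<alpha> * \<bar>p $ 2\<bar> <= 1 * r0" using sc pc(2) by (intro mult_mono) auto
  moreover have "cos \<alpha> * \<bar>w $ 2\<bar> <= cos \<alpha> * (\<bar>x $ 2\<bar> + \<bar>p $ 2\<bar>)"
   using sc by (intro mult_left_mono) (auto simp: w_def)
  ultimately show ?thesis unfolding cone_iff[OF a] using x(3) by (simp add: w_def algebra_simps)
 qed
 hence nw: "0 < norm w" using cone_pos[OF a wc] by auto
 have nw2: "norm w <= norm x + r0" using norm_triangle_ineq4[of x p] np by (simp add: w_def)
 \<comment> \<open>Places y at distance \<open>1 + 2 * r0\<close> from p. Since p has norm at most
   r0, y lies outside the unit circle, and by \<open>r0 <= 1/4\<close> still inside radius
   2.\<close>
 define s where "s = norm w / (1 + 2 * r0)"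
 have s: "0 < s" "s < 1" using nw nw2 True r0 by (auto simp: s_def)
 define y where "y = p + (1 / s) *\<^sub>R w"
 have yn: "norm (y - p) = 1 + 2 * r0" using nw r0 by (simp add: y_def s_def)
 have yn2: "1 < norm y" "norm y <= 1 + 3 * r0" "norm y < 2"
  using norm_triangle_ineq2[of y p] norm_triangle_ineq2[of "y - p" "- p"] norm_triangle_ineq[of "y - p" p] yn np r0 by auto
 have "y = x + (1 / s - 1) *\<^sub>R w" by (simp add: y_def w_def algebra_simps)
 moreover have "0 < 1 / s - 1" using s by simp
 moreover have "x \<in> cone \<alpha>" using x(1) by (simp add: Om_eq)
 ultimately have yc: "y \<in> cone \<alpha>"
 proof -
  define k where "k = 1 / s - 1"
  have k: "0 < k" "y = x + k *\<^sub>R w" using s by (auto simp: k_def y_def w_def algebra_simps)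
  have "\<bar>y $ 2\<bar> <= \<bar>x $ 2\<bar> + k * \<bar>w $ 2\<bar>" using k abs_triangle_ineq[of "x $ 2" "k * w $ 2"] by (simp add: abs_mult)
  moreover have "\<bar>x $ 2\<bar> < tan \<alpha> * x $ 1" using x(1) by (simp add: Om_eq cone_def)
  moreover have "k * \<bar>w $ 2\<bar> <= k * (tan \<alpha> * w $ 1)" using wc k by (intro mult_left_mono) (auto simp: cone_def)
  ultimately show ?thesis using k(2) by (simp add: cone_def algebra_simps)
 qed
 have yO: "y \<in> Om" using yc yn2 by (simp add: Om_eq)
 have e: "(1 - s) *\<^sub>R p + s *\<^sub>R y = x" using s by (simp add: y_def w_def algebra_simps)
 have "u ((1 - s) *\<^sub>R p + s *\<^sub>R y) <= (1 - s) * u p + s * u y" by (rule u_convex[OF p(1,2) yO]) (use yn2 s x(2) e in auto)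
 hence "u x <= (1 - s) * u p + s * norm y" unfolding e using u_outside[of y] yn2 by simp
 also have "(1 - s) * u p <= 1 * r0"
 proof -
  have "(1 - s) * u p <= (1 - s) * r0" using s p(3) by (intro mult_left_mono) auto
  also have "\<dots> <= 1 * r0" using s r0 by (intro mult_right_mono) auto
  finally show ?thesis .
 qed
 also have "s * norm y <= norm x + 2 * r0"
 proof -
  have "s * norm y <= s * (1 + 2 * r0) + s * r0" using mult_left_mono[OF yn2(2), of s] s by (simp add: algebra_simps)
  also have "s * (1 + 2 * r0) = norm w" using r0 by (simp add: s_def)
  also have "s * r0 <= 1 * r0" using s r0 by (intro mult_right_mono) auto
  finally show ?thesis using nw2 by simp
 qed
 finally show ?thesis by simp
qed

text \<open>Angles within \<delta> of the sides are given up, because the upper bound for u needs a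
  clearance above \<open>2 * r0\<close>, and at radius \<rho> the clearance is
  \<open>\<rho> * sin \<delta>\<close>. The trapezoid costs another \<delta>, whence the factor
  \<open>2 * \<alpha> - 3 * \<delta>\<close>.\<close>

lemma hessian_lower:
 assumes r0: "0 < r0" "r0 <= 1/4" and p: "p \<in> Om" "norm p \<noteq> 1" "u p <= r0"
  and \<rho>: "0 < \<rho>" "\<rho> < 1" and \<delta>: "0 < \<delta>" "2 * \<delta> <= \<alpha>" and cl: "2 * r0 < \<rho> * sin \<delta>"
 shows "(2 * \<alpha> - 3 * \<delta>) * (ln (1 / \<rho>) - 6 * r0 / \<rho>) - 12 * r0 / (\<delta> * \<rho>) <= (L2_norm (sector \<alpha>) (weak_hessian (sector \<alpha>) v))\<^sup>2"
proof -
 let ?D = "double_sector \<alpha>" and ?S = "sector \<alpha>"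
 define \<beta> where "\<beta> = \<alpha> - \<delta>"
 define K where "K = polar ` polar_rect \<rho> 1 \<beta>"
 \<comment> \<open>Open, so that a neighbourhood of K, over which the mollification averages, still
   has the clearance.\<close>
 define G where "G = {x \<in> Om. 2 * r0 < sin \<alpha> * x $ 1 - cos \<alpha> * \<bar>x $ 2\<bar>}"
 have oG: "open G"
 proof -
  have "open {x :: real^2. 2 * r0 < sin \<alpha> * x $ 1 - cos \<alpha> * \<bar>x $ 2\<bar>}" by (intro open_Collect_less continuous_intros)
  moreover have "G = Om \<inter> {x. 2 * r0 < sin \<alpha> * x $ 1 - cos \<alpha> * \<bar>x $ 2\<bar>}" by (auto simp: G_def)
  ultimately show ?thesis using open_Om by (simp add: open_Int)
 qed
 have cK: "compact K" unfolding K_def by (intro compact_continuous_image polar_continuous) (simp add: polar_rect_def)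
 have dirG: "r *\<^sub>R dir t \<in> G" if "\<rho> <= r" "r <= 1" "\<bar>t\<bar> <= \<beta>" for r t
 proof -
  have "r *\<^sub>R dir t \<in> cone \<alpha>" using that \<rho> \<delta> by (intro dir_cone[OF a]) (auto simp: \<beta>_def)
  moreover have "norm (r *\<^sub>R dir t) < 2" using that \<rho> by simp
  moreover have "\<rho> * sin \<delta> <= sin \<alpha> * (r *\<^sub>R dir t) $ 1 - cos \<alpha> * \<bar>(r *\<^sub>R dir t) $ 2\<bar>"
   by (rule dir_clearance) (use a \<delta> \<rho> that in \<open>auto simp: \<beta>_def\<close>)
  ultimately show ?thesis unfolding G_def Om_eq using cl by auto
 qed
 have K: "\<exists>r t. \<rho> <= r \<and> r <= 1 \<and> \<bar>t\<bar> <= \<beta> \<and> x = r *\<^sub>R dir t" if xK: "x \<in> K" for x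
 proof -
  obtain q where q: "q \<in> polar_rect \<rho> 1 \<beta>" "x = polar q" using xK unfolding K_def by blast
  have "x = q $ 1 *\<^sub>R dir (q $ 2)" using q(2) polar_dir[of "q $ 1" "q $ 2"] by simp
  thus ?thesis using q(1) by (intro exI[of _ "q $ 1"] exI[of _ "q $ 2"]) (auto simp: polar_rect_mem)
 qed
 have KG: "K \<subseteq> G" using K dirG by blast
 have Kn: "norm x <= 1" "x \<in> cone \<alpha>" if "x \<in> K" for x
 proof -
  show "norm x <= 1" using K[OF that] \<rho> by auto
  show "x \<in> cone \<alpha>" using KG that by (auto simp: G_def Om_eq)
 qed
 obtain d where d: "d > 0" "(\<Union>z\<in>K. cball z d) \<subseteq> G" using compact_subset_open_imp_cball_epsilon_subset[OF cK oG KG] by blast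
 define hh where "hh i j x = ind ?D x * ddu i j x" for i j x
 have hi: "integrable lebesgue (hh i j)" "integrable lebesgue (%x. \<bar>hh i j x\<bar> ^ 2)" for i j unfolding hh_def[abs_def] by (rule u_int)+
 have \<psi>: "indicat_real K \<in> borel_measurable lebesgue" "\<bar>indicat_real K x\<bar> <= 1" for x
  using cK by (auto intro!: borel_measurable_indicator simp: compact_imp_closed indicator_def)
 note lim = conv_product_limit[OF hi hi \<psi>]
 define I where "I e i j = (LINT x|lebesgue. ind K x * (conv (eta e) (hh i j) x * conv (eta e) (hh i j) x))" for e i j
 define I0 where "I0 i j = (LINT x|lebesgue. ind K x * (hh i j x * hh i j x))" for i j
 define E where "E r w = (2 * \<beta> - \<delta>) * (ln (1 / \<rho>) - 2 * (3 * r0 + w + 2 * w) / \<rho>) - 4 * (3 * r0 + w + w) / (\<delta> * \<rho>)" for r w :: real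
 have main: "E 0 (2 * e) <= I e 1 1 + I e 1 2 + I e 2 1 + I e 2 2" if e: "e > 0" "4 * e < d" for e
 proof -
  have KO: "cball x (4 * e) \<subseteq> G" "cball x (2 * e) \<subseteq> G" "cball x (4 * e) \<subseteq> Om" "cball x (2 * e) \<subseteq> Om" if "x \<in> K" for x
  proof -
   have "cball x (4 * e) \<subseteq> cball x d" "cball x (2 * e) \<subseteq> cball x d" using e by auto
   thus "cball x (4 * e) \<subseteq> G" "cball x (2 * e) \<subseteq> G" using d(2) that by blast+
   thus "cball x (4 * e) \<subseteq> Om" "cball x (2 * e) \<subseteq> Om" by (auto simp: G_def)
  qed
  have inK: "r *\<^sub>R dir t \<in> K" if "\<rho> <= r" "r <= 1" "\<bar>t\<bar> <= \<beta>" for r t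
  proof -
   have "r *\<^sub>R dir t = polar (vector [r, t])" by (simp add: polar_dir)
   moreover have "vector [r, t] \<in> polar_rect \<rho> 1 \<beta>" using that by (auto simp: polar_rect_mem)
   ultimately show ?thesis unfolding K_def by blast
  qed
  note sU = U_smooth[OF e(1)]
  have "E 0 (2 * e) <= (LINT x|lborel. ind K x * (norm (hess (U e) x))\<^sup>2)" unfolding E_def K_def
  proof (rule polar_energy[OF sU \<rho> \<delta>(1)])
   show "\<delta> <= \<beta>" "\<beta> < pi" using \<delta> a by (auto simp: \<beta>_def)
   fix r t assume rt: "\<rho> <= r" "r <= 1" "\<bar>t\<bar> <= \<beta>"
   have n: "norm (r *\<^sub>R dir t) = r" using rt \<rho> by simp
   note x = inK[OF rt]
   show "r - 2 * e <= U e (r *\<^sub>R dir t)" using U_ge_norm[OF e(1) KO(4)[OF x]] n by simp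
   show "U e (r *\<^sub>R dir t) <= r + (3 * r0 + 2 * e)"
   proof (rule U_le[OF e(1) KO(4)[OF x]])
    fix y assume y: "y \<in> Om" "norm y \<noteq> 1" "y \<in> cball (r *\<^sub>R dir t) (2 * e)"
    hence "y \<in> G" using KO(2)[OF x] by blast
    hence "u y <= norm y + 3 * r0" using y by (intro u_upper[OF r0 p]) (auto simp: G_def)
    thus "u y <= r + (3 * r0 + 2 * e)" using cball_norm[OF y(3)] n by simp
   qed
  qed (use e in simp)
  also have "\<dots> = (LINT x|lebesgue. ind K x * (norm (hess (U e) x))\<^sup>2)"
  proof (rule integral_completion[symmetric])
   have "continuous_on UNIV (%x. (norm (hess (U e) x))\<^sup>2)"
    unfolding norm_matrix2 hess_nth by (intro continuous_intros smooth_continuous smooth_pderiv sU)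
   hence "(%x. (norm (hess (U e) x))\<^sup>2) \<in> borel_measurable borel" by (rule borel_measurable_continuous_onI)
   moreover have "indicat_real K \<in> borel_measurable borel" using cK by (simp add: borel_measurable_indicator compact_imp_closed)
   ultimately show "(%x. ind K x * (norm (hess (U e) x))\<^sup>2) \<in> borel_measurable lborel" using borel_measurable_times by auto
  qed
  also have "\<dots> = (LINT x|lebesgue. ind K x * (conv (eta e) (hh 1 1) x * conv (eta e) (hh 1 1) x) + ind K x * (conv (eta e) (hh 1 2) x * conv (eta e) (hh 1 2) x)
    + ind K x * (conv (eta e) (hh 2 1) x * conv (eta e) (hh 2 1) x) + ind K x * (conv (eta e) (hh 2 2) x * conv (eta e) (hh 2 2) x))"
  proof (intro lint_cong)
   fix x
   show "ind K x * (norm (hess (U e) x))\<^sup>2 = ind K x * (conv (eta e) (hh 1 1) x * conv (eta e) (hh 1 1) x) + ind K x * (conv (eta e) (hh 1 2) x * conv (eta e) (hh 1 2) x)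
    + ind K x * (conv (eta e) (hh 2 1) x * conv (eta e) (hh 2 1) x) + ind K x * (conv (eta e) (hh 2 2) x * conv (eta e) (hh 2 2) x)"
   proof (cases "x \<in> K")
    case True
    have "hess (U e) x $ i $ j = conv (eta e) (hh i j) x" for i j unfolding hess_nth U_hess[OF e(1) KO(3)[OF True]] hh_def[abs_def] ..
    thus ?thesis using True unfolding norm_matrix2 by (simp add: power2_eq_square)
   qed simp
  qed
  also have "\<dots> = I e 1 1 + I e 1 2 + I e 2 1 + I e 2 2" unfolding I_def by (simp only: lint_add lint_add_int lim(2)[OF e(1)])
  finally show ?thesis .
 qed
 have Ilim: "((%e. I e i j) \<longlongrightarrow> I0 i j) (at_right 0)" for i j unfolding I_def I0_def by (rule lim(1))
 have ev: "\<forall>\<^sub>F e in at_right 0. E 0 (2 * e) <= I e 1 1 + I e 1 2 + I e 2 1 + I e 2 2"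
 proof -
  have "\<forall>\<^sub>F e in at_right 0. (e::real) > 0 \<and> e < d / 4"
   using d by (intro eventually_conj eventually_at_right_less) (auto simp: eventually_at_right_field intro!: exI[of _ "d / 4"])
  thus ?thesis by eventually_elim (intro main, auto)
 qed
 have "((%e. E 0 (2 * e)) \<longlongrightarrow> E 0 (2 * 0)) (at_right 0)" unfolding E_def divide_inverse by (intro tendsto_intros)
 moreover have "((%e. I e 1 1 + I e 1 2 + I e 2 1 + I e 2 2) \<longlongrightarrow> I0 1 1 + I0 1 2 + I0 2 1 + I0 2 2) (at_right 0)"
  by (intro tendsto_intros Ilim)
 ultimately have "E 0 (2 * 0) <= I0 1 1 + I0 1 2 + I0 2 1 + I0 2 2" by (intro tendsto_le[OF _ _ _ ev]) auto
 also have "\<dots> = (LINT x|lebesgue. ind K x * (hh 1 1 x * hh 1 1 x) + ind K x * (hh 1 2 x * hh 1 2 x)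
    + ind K x * (hh 2 1 x * hh 2 1 x) + ind K x * (hh 2 2 x * hh 2 2 x))" unfolding I0_def by (simp only: lint_add lint_add_int lim(3))
 also have "\<dots> <= (LINT x|lebesgue. ind ?S x * (norm (weak_hessian ?S v x))\<^sup>2)"
 proof (rule integral_mono_AE)
  show "integrable lebesgue (%x. ind K x * (hh 1 1 x * hh 1 1 x) + ind K x * (hh 1 2 x * hh 1 2 x)
    + ind K x * (hh 2 1 x * hh 2 1 x) + ind K x * (hh 2 2 x * hh 2 2 x))" by (intro lint_add_int lim(3))
  show "integrable lebesgue (%x. ind ?S x * (norm (weak_hessian ?S v x))\<^sup>2)"
   by (rule iffD1[OF integrable_lebesgue_on[OF sb(1)] W22_weak_hessian(5)[OF sb(1,3) v(1)]])
  \<comment> \<open>K reaches the unit circle, whose points are not in the sector; they form a null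
    set.\<close>
  show "AE x in lebesgue. ind K x * (hh 1 1 x * hh 1 1 x) + ind K x * (hh 1 2 x * hh 1 2 x)
    + ind K x * (hh 2 1 x * hh 2 1 x) + ind K x * (hh 2 2 x * hh 2 2 x) <= ind ?S x * (norm (weak_hessian ?S v x))\<^sup>2" using sphere_AE
  proof eventually_elim
   case (elim x)
   show ?case
   proof (cases "x \<in> K")
    case True
    hence "norm x < 1" using Kn(1)[OF True] elim by simp
    hence xS: "x \<in> ?S" using Kn(2)[OF True] sector_eq[OF a] by simp
    hence "x \<in> ?D" using sb(9) by blast
    hence "hh i j x = weak_hessian ?S v x $ i $ j" for i j using xS by (simp add: hh_def ddu_def glue_def weak_hessian_def)
    thus ?thesis using True xS unfolding norm_matrix2 by (simp add: power2_eq_square)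
   qed simp
  qed
 qed
 also have "\<dots> = (L2_norm ?S (weak_hessian ?S v))\<^sup>2" unfolding L2_norm_power2 by (rule LINT_lebesgue_on[OF sb(1), symmetric])
 finally show ?thesis by (simp add: E_def \<beta>_def algebra_simps)
qed

end

section \<open>Choice of the scales and conclusion\<close>

lemma half_le_sin:
 fixes x :: real
 assumes "0 < x" "x <= 1"
 shows "x / 2 <= sin x"
proof -
 obtain z where z: "0 < z" "z < x" "sin x - sin 0 = (x - 0) * cos z" using MVT2[OF assms(1), of sin cos] DERIV_sin by blast
 have "cos (pi / 3) <= cos z" using z assms pi_gt3 by (intro cos_monotone_0_pi_le) auto
 hence "1/2 <= cos z" by (simp add: cos_60)
 thus ?thesis using z(3) mult_left_mono[of "1/2" "cos z" x] assms by simp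
qed

text \<open>The constants of \<open>small_value\<close>:
  \<open>7168000 = 2 * 7 * 8 * 2 * 32000\<close> arises after multiplication by
  \<open>32000 * \<alpha>^2\<close>, and 8 comes from the inner edge of the truncated cone.\<close>

definition A0 :: real where "A0 = 8 + 7168000 * B0"

lemma A0: "A0 >= 8" using B0(1) by (simp add: A0_def)

context admissible_function
begin

lemma energy_nonneg: "h > 0 ==> 0 <= energy \<alpha> h v" unfolding energy_def
 by (intro add_nonneg_nonneg) (auto simp: divide_ereal_def power2_eq_square intro!: ereal_0_le_mult dual_norm_nonneg sb)

lemma energy_ge:
 shows "h > 0 ==> ereal ((L2_norm (sector \<alpha>) (weak_hessian (sector \<alpha>) v))\<^sup>2) <= energy \<alpha> h v"
  and "h > 0 ==> 0 <= c ==> ereal c <= W22_dual_norm (double_sector \<alpha>) (%x. det (weak_hessian (double_sector \<alpha>) (extension \<alpha> v) x)) ==> ereal (c\<^sup>2 / h\<^sup>2) <= energy \<alpha> h v"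
proof -
 let ?N = "W22_dual_norm (double_sector \<alpha>) (%x. det (weak_hessian (double_sector \<alpha>) (extension \<alpha> v) x))"
 assume h: "h > 0"
 have N: "0 <= ?N" by (rule dual_norm_nonneg[OF sb(2,4,6)])
 hence "0 <= ?N\<^sup>2 / ereal (h\<^sup>2)" using h by (auto simp: divide_ereal_def power2_eq_square intro!: ereal_0_le_mult)
 from add_right_mono[OF this]
 show "ereal ((L2_norm (sector \<alpha>) (weak_hessian (sector \<alpha>) v))\<^sup>2) <= energy \<alpha> h v" unfolding energy_def by (metis add_0)
 assume c: "0 <= c" "ereal c <= ?N"
 have "ereal c * ereal c <= ?N * ?N" using c N by (intro ereal_mult_mono) auto
 hence "ereal c * ereal c / ereal (h\<^sup>2) <= ?N\<^sup>2 / ereal (h\<^sup>2)"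
  unfolding power2_eq_square[of ?N] using h by (intro ereal_divide_right_mono) auto
 hence "ereal (c\<^sup>2 / h\<^sup>2) <= ?N\<^sup>2 / ereal (h\<^sup>2)" using h by (simp add: power2_eq_square)
 from add_mono[OF this, of 0 "ereal ((L2_norm (sector \<alpha>) (weak_hessian (sector \<alpha>) v))\<^sup>2)"]
 show "ereal (c\<^sup>2 / h\<^sup>2) <= energy \<alpha> h v" unfolding energy_def by simp
qed

text \<open>If u exceeded \<open>M = 2 * A0 * L ^ 7 * h\<close> everywhere off the unit circle,
  \<open>vertex_bound\<close> would bound M by half of itself.\<close>

lemma small_value:
 assumes h: "h = exp (- L)" and L: "L >= 3" and \<alpha>: "1 <= \<alpha> * L"
  and N: "W22_dual_norm (double_sector \<alpha>) (%x. det (weak_hessian (double_sector \<alpha>) (extension \<alpha> v) x)) <= ereal (2 * h * L)"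
 shows "\<exists>p. p \<in> Om \<and> norm p \<noteq> 1 \<and> u p <= 2 * A0 * L ^ 7 * h"
proof (rule ccontr)
 assume no: "\<not> ?thesis"
 define M where "M = 2 * A0 * L ^ 7 * h"
 define J where "J = nat \<lceil>2 * L\<rceil> + 4"
 have h0: "h > 0" by (simp add: h)
 have M: "M <= u x" if "x \<in> Om" "norm x \<noteq> 1" for x using no that unfolding M_def by force
 have "\<alpha> / 20 * (\<alpha>\<^sup>2 / 800 * M / 2 - 2 * (\<alpha>\<^sup>2 / 800) * (3 / 2 / 2 ^ J)) <= 2 * (real J * (8 * B0 / \<alpha>\<^sup>2 * (2 * h * L)))"
  by (rule vertex_bound[OF N M]) (simp_all add: J_def)
 moreover have J: "real J <= 7 * L" using L by (simp add: J_def) linarith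
 \<comment> \<open>About \<open>2 * L\<close> halvings suffice, since \<open>ln 2\<close> is at
   least 1/2; the inner edge is then at most of the order of h.\<close>
 moreover have "3 / 2 / 2 ^ J <= 2 * h"
 proof -
  have "2 * L <= real J" using L by (simp add: J_def) linarith
  have "exp L <= exp (real J * ln 2)"
  proof -
   have "1/2 <= ln (2::real)" using ln_le_minus_one[of "1/2"] by (simp add: ln_div)
   hence "real J * (1/2) <= real J * ln 2" by (intro mult_left_mono) auto
   thus ?thesis using \<open>2 * L <= real J\<close> by simp
  qed
  also have "\<dots> = 2 ^ J" by (simp add: exp_of_nat_mult)
  finally have "1 / 2 ^ J <= 1 / exp L" by (intro divide_left_mono) auto
  hence "1 / 2 ^ J <= h" by (simp add: h exp_minus divide_inverse)
  moreover have "3 / 2 / 2 ^ J = 3 / 2 * (1 / 2 ^ J :: real)" by simp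
  ultimately show ?thesis using h0 by linarith
 qed
 ultimately have *: "\<alpha> / 20 * (\<alpha>\<^sup>2 / 800 * M / 2 - 2 * (\<alpha>\<^sup>2 / 800) * (2 * h)) <= 2 * (7 * L * (8 * B0 / \<alpha>\<^sup>2 * (2 * h * L)))"
 proof -
  assume 1: "\<alpha> / 20 * (\<alpha>\<^sup>2 / 800 * M / 2 - 2 * (\<alpha>\<^sup>2 / 800) * (3 / 2 / 2 ^ J)) <= 2 * (real J * (8 * B0 / \<alpha>\<^sup>2 * (2 * h * L)))"
   and 2: "real J <= 7 * L" and 3: "3 / 2 / 2 ^ J <= 2 * h"
  have "2 * (\<alpha>\<^sup>2 / 800) * (3 / 2 / 2 ^ J) <= 2 * (\<alpha>\<^sup>2 / 800) * (2 * h)" by (rule mult_left_mono[OF 3]) simp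
  hence "\<alpha> / 20 * (\<alpha>\<^sup>2 / 800 * M / 2 - 2 * (\<alpha>\<^sup>2 / 800) * (2 * h)) <= \<alpha> / 20 * (\<alpha>\<^sup>2 / 800 * M / 2 - 2 * (\<alpha>\<^sup>2 / 800) * (3 / 2 / 2 ^ J))"
   using a by (intro mult_left_mono) auto
  moreover have "2 * (real J * (8 * B0 / \<alpha>\<^sup>2 * (2 * h * L))) <= 2 * (7 * L * (8 * B0 / \<alpha>\<^sup>2 * (2 * h * L)))"
   using 2 B0(1) h0 L by (intro mult_left_mono mult_right_mono) auto
  ultimately show ?thesis using 1 by linarith
 qed
 define K where "K = \<alpha> ^ 5"
 have K: "K > 0" using a by (simp add: K_def)
 have "\<alpha> / 20 * (\<alpha>\<^sup>2 / 800 * M / 2 - 2 * (\<alpha>\<^sup>2 / 800) * (2 * h)) * (32000 * \<alpha>\<^sup>2) = K * (M - 8 * h)"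
  by (simp add: K_def power2_eq_square eval_nat_numeral algebra_simps)
 moreover have "2 * (7 * L * (8 * B0 / \<alpha>\<^sup>2 * (2 * h * L))) * (32000 * \<alpha>\<^sup>2) = 7168000 * B0 * h * L\<^sup>2"
  using a by (simp add: power2_eq_square)
 ultimately have 1: "K * (M - 8 * h) <= 7168000 * B0 * h * L\<^sup>2" using mult_right_mono[OF *, of "32000 * \<alpha>\<^sup>2"] by simp
 \<comment> \<open>Here \<open>1 / \<alpha>^5\<close> is traded for \<open>L^5\<close>: three powers
   come from the left-hand side of \<open>vertex_bound\<close> and two from the cut-offs.\<close>
 have "1 <= (\<alpha> * L) ^ 5" using \<alpha> by (rule one_le_power)
 hence "1 <= K * L ^ 5" by (simp add: K_def power_mult_distrib)
 hence "7168000 * B0 * h * L\<^sup>2 * 1 <= 7168000 * B0 * h * L\<^sup>2 * (K * L ^ 5)" using B0(1) h0 by (intro mult_left_mono) auto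
 also have "\<dots> = K * (7168000 * B0 * h * L ^ 7)" by (simp add: power_add[symmetric] eval_nat_numeral algebra_simps)
 finally have "K * (M - 8 * h) <= K * (7168000 * B0 * h * L ^ 7)" using 1 by simp
 hence "M - 8 * h <= 7168000 * B0 * h * L ^ 7" using K by simp
 moreover have "8 * h * 1 <= 8 * h * L ^ 7" using h0 L by (intro mult_left_mono one_le_power) auto
 ultimately have "M <= A0 * (L ^ 7 * h)" by (simp add: A0_def algebra_simps)
 moreover have "0 < A0 * (L ^ 7 * h)" using A0 h0 L by simp
 moreover have "M = 2 * (A0 * (L ^ 7 * h))" by (simp add: M_def)
 ultimately show False by linarith
qed

text \<open>Either the energy already exceeds \<open>2 * \<alpha> * L\<close>, or the dual norm is
  at most \<open>2 * h * L\<close>, for otherwise its term alone would contribute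
  \<open>4 * L^2\<close>.\<close>

lemma energy_lower:
 assumes h: "h = exp (- L)" and L: "L >= 3" and small: "16 * A0 * L ^ 8 * h < 1" and \<alpha>: "16 <= \<alpha> * L"
 shows "ereal (2 * \<alpha> * L - (4 * ln (16 * A0) + 41) * ln L) <= energy \<alpha> h v"
proof (cases "ereal (2 * \<alpha> * L) <= energy \<alpha> h v")
 case True
 have "0 <= ln L" "0 <= ln (16 * A0)" using L A0 by (auto intro!: ln_ge_zero)
 hence "2 * \<alpha> * L - (4 * ln (16 * A0) + 41) * ln L <= 2 * \<alpha> * L" by simp
 thus ?thesis using True order_trans ereal_less_eq(3) by blast
next
 case False
 have h0: "h > 0" by (simp add: h)
 have a2: "\<alpha> < 2" using a pi_less_4 by linarith
 have N: "W22_dual_norm (double_sector \<alpha>) (%x. det (weak_hessian (double_sector \<alpha>) (extension \<alpha> v) x)) <= ereal (2 * h * L)"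
 proof (rule ccontr)
  assume "\<not> ?thesis"
  hence "ereal ((2 * h * L)\<^sup>2 / h\<^sup>2) <= energy \<alpha> h v" using h0 L by (intro energy_ge(2)) auto
  moreover have "(2 * h * L)\<^sup>2 / h\<^sup>2 = 4 * L * L" using h0 by (simp add: power2_eq_square)
  moreover have "2 * \<alpha> * L <= 4 * L * L" using a2 L by (intro mult_right_mono) auto
  ultimately show False using False by (metis ereal_less_eq(3) order_trans)
 qed
 define r0 where "r0 = 2 * A0 * L ^ 7 * h"
 obtain p where p: "p \<in> Om" "norm p \<noteq> 1" "u p <= r0" using small_value[OF h L _ N] \<alpha> unfolding r0_def by auto
 \<comment> \<open>Makes \<open>r0 / \<rho>\<close> equal to \<open>1 / (8 * L)\<close>, so that the
   errors of \<open>hessian_lower\<close> stay bounded, at the price of one more power of L inside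
   the logarithm.\<close>
 define \<rho> where "\<rho> = 8 * r0 * L"
 have \<rho>e: "\<rho> = 16 * A0 * L ^ 8 * h" by (simp add: \<rho>_def r0_def eval_nat_numeral)
 have r0: "0 < r0" using A0 L h0 by (simp add: r0_def)
 have \<rho>: "0 < \<rho>" "\<rho> < 1" using r0 L small unfolding \<rho>e[symmetric] by (auto simp: \<rho>_def)
 have "8 * r0 * 1 <= 8 * r0 * L" using r0 L by (intro mult_left_mono) auto
 hence r04: "r0 <= 1/4" using \<rho>(2) by (simp add: \<rho>_def)
 \<comment> \<open>The lost angle costs \<open>3 * \<delta> * X\<close>, at most 3, while
   \<open>12 * r0 / (\<delta> * \<rho>)\<close> is still only 3/2.\<close>
 define \<delta> where "\<delta> = 1 / L"
 have \<delta>: "0 < \<delta>" "\<delta> <= 1" "2 * \<delta> <= \<alpha>" using L \<alpha> by (auto simp: \<delta>_def field_simps)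
 have cl: "2 * r0 < \<rho> * sin \<delta>"
 proof -
  have "\<rho> * (\<delta> / 2) <= \<rho> * sin \<delta>" using half_le_sin[OF \<delta>(1,2)] \<rho> by (intro mult_left_mono) auto
  moreover have "\<rho> * (\<delta> / 2) = 4 * r0" using L by (simp add: \<rho>_def \<delta>_def)
  ultimately show ?thesis using r0 by simp
 qed
 define X where "X = ln (1 / \<rho>) - 6 * r0 / \<rho>"
 have 1: "(2 * \<alpha> - 3 * \<delta>) * X - 12 * r0 / (\<delta> * \<rho>) <= (L2_norm (sector \<alpha>) (weak_hessian (sector \<alpha>) v))\<^sup>2"
  unfolding X_def by (rule hessian_lower[OF r0 r04 p \<rho> \<delta>(1,3) cl])
 have 2: "12 * r0 / (\<delta> * \<rho>) = 3/2" using r0 L by (simp add: \<rho>_def \<delta>_def)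
 have 3: "6 * r0 / \<rho> = 3 / (4 * L)" using r0 L by (simp add: \<rho>_def)
 have "ln \<rho> = ln (16 * A0) + ln (L ^ 8) + ln h" unfolding \<rho>e using A0 L h0 by (simp add: ln_mult)
 moreover have "ln (L ^ 8) = 8 * ln L" using L by (simp add: ln_realpow)
 moreover have "ln h = - L" by (simp add: h)
 ultimately have lr: "ln (1 / \<rho>) = L - ln (16 * A0) - 8 * ln L" using \<rho> by (simp add: ln_div)
 have lnA: "0 <= ln (16 * A0)" using A0 by (intro ln_ge_zero) simp
 have lnL: "1 <= ln L"
 proof -
  have "exp 1 <= L" using exp_le L by simp
  thus ?thesis using L by (subst ln_ge_iff) auto
 qed
 have L4: "0 <= 3 / (4 * L)" "3 / (4 * L) <= 1" using L by (auto simp: divide_le_eq)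
 have X: "X = L - ln (16 * A0) - 8 * ln L - 3 / (4 * L)" by (simp add: X_def lr 3)
 define q where "q = 3 / (4 * L)"
 have "X <= L" using X lnA lnL L4(1) unfolding q_def[symmetric] by linarith
 hence "3 * \<delta> * X <= 3 * \<delta> * L" using \<delta> by (intro mult_left_mono) auto
 also have "\<dots> = 3" using L by (simp add: \<delta>_def)
 finally have 4: "3 * \<delta> * X <= 3" .
 have "2 * \<alpha> * (ln (16 * A0) + 8 * ln L + 3 / (4 * L)) <= 4 * (ln (16 * A0) + 8 * ln L + 3 / (4 * L))"
  using a2 lnA lnL L4 by (intro mult_right_mono) auto
 hence 5: "2 * \<alpha> * L - 4 * (ln (16 * A0) + 8 * ln L + 1) <= 2 * \<alpha> * X" unfolding X using L4 by (simp add: algebra_simps)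
 have "ln (16 * A0) * 1 <= ln (16 * A0) * ln L" using lnA lnL by (intro mult_left_mono) auto
 \<comment> \<open>32 is 4 times the exponent 8 of L in \<rho>; the remaining 9 cover the constants
   4, 3 and 3/2, as \<open>ln L\<close> is at least 1.\<close>
 hence "4 * (ln (16 * A0) + 8 * ln L + 1) + 3 + 3/2 <= (4 * ln (16 * A0) + 41) * ln L" using lnL by (simp add: algebra_simps)
 moreover have "(2 * \<alpha> - 3 * \<delta>) * X = 2 * \<alpha> * X - 3 * \<delta> * X" by (simp add: algebra_simps)
 ultimately have "2 * \<alpha> * L - (4 * ln (16 * A0) + 41) * ln L <= (L2_norm (sector \<alpha>) (weak_hessian (sector \<alpha>) v))\<^sup>2"
  using 1 4 5 unfolding 2 by linarith
 hence "ereal (2 * \<alpha> * L - (4 * ln (16 * A0) + 41) * ln L) <= ereal ((L2_norm (sector \<alpha>) (weak_hessian (sector \<alpha>) v))\<^sup>2)" by simp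
 thus ?thesis using energy_ge(1)[OF h0] by (rule order_trans)
qed

end

theorem theorem1:
  "\<exists>h0 C::real. 0 < h0 \<and> 0 < C \<and>
     (\<forall>\<alpha> h. 0 < 2 * \<alpha> \<and> 2 * \<alpha> < pi \<and> 0 < h \<and> h < h0 \<longrightarrow>
        ereal (2 * \<alpha> * ln (1 / h) - C * ln (ln (1 / h))) \<le> (INF v\<in>admissible \<alpha>. energy \<alpha> h v) \<and>
        (INF v\<in>admissible \<alpha>. energy \<alpha> h v) \<le> ereal (2 * \<alpha> * ln (1 / h) + C))"
proof -
 define C1 where "C1 = 4 * ln (16 * A0) + 41"
 define C2 where "C2 = 144 * M1\<^sup>2 + 4 * (1 + 9 * M1\<^sup>2)"
 have C1: "C1 >= 41" using A0 by (simp add: C1_def ln_ge_zero)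
 have C2: "C2 > 0" by (simp add: C2_def add_nonneg_pos)
 \<comment> \<open>Ensures that \<rho> is below 1 for all small h, with a threshold independent of
   \<alpha>.\<close>
 have "((%L::real. 16 * A0 * (L ^ 8 / exp L)) \<longlongrightarrow> 16 * A0 * 0) at_top" by (intro tendsto_intros tendsto_power_div_exp_0)
 hence "\<forall>\<^sub>F L in at_top. 16 * A0 * (L ^ 8 / exp L) < 1" by (rule order_tendstoD) simp
 then obtain L0 where L0: "\<And>L. L >= L0 ==> 16 * A0 * (L ^ 8 / exp L) < 1" unfolding eventually_at_top_linorder by blast
 define h0 where "h0 = exp (- max 3 L0)"
 show ?thesis
 proof (rule exI[of _ h0], rule exI[of _ "C1 + C2"], intro conjI allI impI)
  show "0 < h0" by (simp add: h0_def)
  show "0 < C1 + C2" using C1 C2 by simp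
  fix \<alpha> h :: real
  assume *: "0 < 2 * \<alpha> \<and> 2 * \<alpha> < pi \<and> 0 < h \<and> h < h0"
  hence a: "0 < \<alpha>" "\<alpha> < pi / 2" and h: "0 < h" "h < h0" by auto
  define L where "L = ln (1 / h)"
  have hL: "h = exp (- L)" using h by (simp add: L_def ln_div)
  have "- L < - max 3 L0" using h(2) unfolding hL h0_def by simp
  hence L: "L >= 3" "L >= L0" by auto
  have small: "16 * A0 * L ^ 8 * h < 1" using L0[OF L(2)] by (simp add: hL exp_minus divide_inverse mult.assoc)
  have lnL: "1 <= ln L"
  proof -
   have "exp 1 <= L" using exp_le L by simp
   thus ?thesis using L by (subst ln_ge_iff) auto
  qed
  have "h0 <= 1" by (simp add: h0_def)
  hence h1: "h <= 1" using h by simp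
  have "ereal (2 * \<alpha> * L - (C1 + C2) * ln L) <= energy \<alpha> h v" if v: "v \<in> admissible \<alpha>" for v
  proof -
   interpret admissible_function \<alpha> v by unfold_locales (use a v in auto)
   show ?thesis
   proof (cases "16 <= \<alpha> * L")
    case True
    have "ereal (2 * \<alpha> * L - C1 * ln L) <= energy \<alpha> h v" unfolding C1_def by (rule energy_lower[OF hL L(1) small True])
    moreover have "2 * \<alpha> * L - (C1 + C2) * ln L <= 2 * \<alpha> * L - C1 * ln L" using C2 lnL by (simp add: distrib_right)
    ultimately show ?thesis by (meson ereal_less_eq(3) order_trans)
   next
    case False
    \<comment> \<open>In this case \<open>2 * \<alpha> * L\<close> is below 32.\<close>
    have "41 * 1 <= (C1 + C2) * ln L" using C1 C2 lnL by (intro mult_mono) auto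
    hence "2 * \<alpha> * L - (C1 + C2) * ln L <= 0" using False by simp
    hence "ereal (2 * \<alpha> * L - (C1 + C2) * ln L) <= 0" by (simp add: zero_ereal_def)
    thus ?thesis using energy_nonneg[OF h(1)] by (rule order_trans)
   qed
  qed
  thus "ereal (2 * \<alpha> * ln (1 / h) - (C1 + C2) * ln (ln (1 / h))) <= (INF v\<in>admissible \<alpha>. energy \<alpha> h v)"
   unfolding L_def[symmetric] by (rule INF_greatest)
  have "(INF v\<in>admissible \<alpha>. energy \<alpha> h v) <= energy \<alpha> h (vreg h)" by (rule INF_lower[OF vreg_admissible[OF a h(1) h1]])
  also have "\<dots> <= ereal (2 * \<alpha> * ln (1 / h) + C2)" unfolding C2_def by (rule energy_vreg[OF a h(1) h1])
  also have "\<dots> <= ereal (2 * \<alpha> * ln (1 / h) + (C1 + C2))" using C1 by simp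
  finally show "(INF v\<in>admissible \<alpha>. energy \<alpha> h v) <= ereal (2 * \<alpha> * ln (1 / h) + (C1 + C2))" .
 qed
qed

end
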